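(* Let $\mathbf C$ be a category and $W$ a class of arrows of $\mathbf C$ satisfying the conditions CF1, CF2, CF3 for a calculus of fractions together with the 2-out-of-3 property, and let $\mathbb D$ be a weakly globular double category. Then composition with $\mathcal J_{\mathbf C}:H\mathbf C\to\mathbf C\{W\}$, i.e. the assignment sending a strict double functor $L:\mathbf C\{W\}\to\mathbb D$ to $L\mathcal J_{\mathbf C}$ with $W$-friendly structure $(\mathbb{C}\mathrm{omp}(L)\circ\Phi, L\varphi)$, induces an equivalence of categories $$\mathrm{Hom}_{\mathsf{WGDbl}_h}(\mathbf C\{W\},\mathbb D)\simeq\mathrm{Hom}_{\mathsf{WGDbl}_h,W}(H\mathbf C,\mathbb D),$$ where the left-hand side is the category of strict double functors and horizontal transformations and the right-hand side is the category of $W$-friendly functors and $W$-friendly horizontal transformations.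
   Context: **Double categories.** A double category $\mathbb X$ is an internal category in $\mathsf{Cat}$: categories $\mathbb X_0$ (objects and vertical arrows) and $\mathbb X_1$ (horizontal arrows as objects, double cells as arrows; vertical composition is written $\cdot$), functors $d_0,d_1:\mathbb X_1\to\mathbb X_0$ (horizontal domain, codomain), $s$ (horizontal identities) and $m$ (horizontal composition, written $\circ$). Write $\mathrm{Id}_A=s(A)$, $\mathrm{id}_v=s(v)$, $1_A$ for vertical identity arrows, $1_f$ for vertical identity cells; $h\mathbb X$ and $v\mathbb X$ are the categories of horizontal, resp. vertical, arrows. $\mathbb X$ is weakly globular if the quotient functor $\gamma:\mathbb X_0\to\mathbb X_0^d$ onto the discrete category of path components is an equivalence and induces equivalences $\mathbb X_1\times_{\mathbb X_0}\overset{n}{\cdots}\times_{\mathbb X_0}\mathbb X_1\simeq\mathbb X_1\times_{\mathbb X_0^d}\overset{n}{\cdots}\times_{\mathbb X_0^d}\mathbb X_1$ for $n\ge 2$. Strict double functors preserve all structure strictly. A horizontal transformation $a:G\Rightarrow K:\mathbb X\to\mathbb Y$ of strict functors has horizontal arrows $a_X:GX\to KX$ and, for each vertical $v$ from $X$ to $Y$, a double cell $a_v$ (top $a_X$, bottom $a_Y$, left $Gv$, right $Kv$), with $a_{v_1\cdot v_2}=a_{v_1}\cdot a_{v_2}$ (and identities preserved) and $a_{v'}\circ G\zeta=K\zeta\circ a_v$ for each double cell $\zeta$ with left side $v$ and right side $v'$. $H\mathbf C$ (resp. $V\mathbf C$) is the double category with the arrows of $\mathbf C$ as horizontal (resp.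 vertical) arrows and everything else identities. **Conditions on $W$.** CF1: $W$ contains all isomorphisms and is closed under composition. CF2: for $f:C\to B$ and $w:A\to B$ in $W$ there are $\bar f:D\to A$ and $\bar w:D\to C$ with $\bar w\in W$ and $w\bar f=f\bar w$. CF3: if $w\in W$ and $wf=wg$, there is $\tilde w\in W$ with $f\tilde w=g\tilde w$. 2-out-of-3: if $gf=h$ and two of $f,g,h$ are in $W$, so is the third. **The double category $\mathbf C\{W\}$.** Objects: arrows $(w)=(w:A\to B)$ in $W$. Horizontal arrows from $(w:A\to B)$ to $(w':A'\to B')$: arrows $f:A\to A'$ of $\mathbf C$, composed as in $\mathbf C$. Vertical arrows from $(w_1:A_1\to B)$ to $(w_2:A_2\to B)$ (same codomain $B$): equivalence classes $[u_1,C,u_2]$ of pairs $u_1:C\to A_1$, $u_2:C\to A_2$ with $w_1u_1=w_2u_2\in W$, where $(u_1,C,u_2)\sim(v_1,D,v_2)$ if there are $r_1:E\to C$, $r_2:E\to D$ with $u_ir_1=v_ir_2$ ($i=1,2$) and $w_1u_1r_1\in W$. Double cells with top $f_1:(w_1)\to(w_1')$, bottom $f_2:(w_2)\to(w_2')$, left side $[u_1,C,u_2]$ and right side $[u_1',C',u_2']$: equivalence classes of arrows $\varphi:C\to C'$, for representatives $(u_1,C,u_2)$, $(u'_1,C',u_2')$ of the sides, with $f_iu_i=u_i'\varphi$ ($i=1,2$); $\varphi$ and $\psi:D\to D'$ (with representatives $(v_1,D,v_2)$, $(v_1',D',v_2')$) are equivalent if there are $r:E\to C$, $s:E\to D$,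 $r':E'\to C'$, $s':E'\to D'$, $\chi:E\to E'$ with $\varphi r=r'\chi$, $\psi s=s'\chi$, $u_ir=v_is$, $u'_ir'=v'_is'$ ($i=1,2$), $w_1u_1r\in W$, $w_1'u_1'r'\in W$. Vertical composites: $[v_1,D,v_2]\cdot[u_1,C,u_2]=[u_1\bar v_1,E,v_2\bar u_2]$ for any $\bar v_1:E\to C$, $\bar u_2:E\to D$ with $u_2\bar v_1=v_1\bar u_2$ and $w_2u_2\bar v_1\in W$; a vertical composite of cells $\varphi:C\to C'$ and $\psi:D\to D'$ is represented, for such composites $E,E'$ of the left and right sides, by any $\xi:\bar E\to E'$ for which there is $r:\bar E\to E$ in $W$ with $\bar v_1'\xi=\varphi\bar v_1r$ and $\bar u_2'\xi=\psi\bar u_2r$. Horizontal composite of cells $\varphi:C\to C'$ and $\psi:D\to D'$ with $[u_1',C',u_2']=[v_1,D,v_2]$: choose $r,s$ with $u_i'r=v_is$ and $w_1'u_1'r\in W$, and $\bar r\in W$, $\bar\varphi$ with $\varphi\bar r=r\bar\varphi$; the composite is represented by $\psi s\bar\varphi$ with left side $(u_1\bar r,u_2\bar r)$. These are independent of choices and make $\mathbf C\{W\}$ a weakly globular double category. The strict functor $\mathcal J_{\mathbf C}:H\mathbf C\to\mathbf C\{W\}$ sends $A$ to $(1_A)$ and $f:A\to B$ to the horizontal arrow $f:(1_A)\to(1_B)$. **The double category of companions $\mathbb{C}\mathrm{omp}(\mathbb D)$.** It has the objects and horizontal arrows of $\mathbb D$. A vertical arrow $\theta$ from $A$ to $B$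 is a quadruple $(h_\theta,v_\theta,\psi_\theta,\chi_\theta)$ with $h_\theta:A\to B$ horizontal, $v_\theta$ vertical from $A$ to $B$, and double cells $\psi_\theta$ (top $\mathrm{Id}_A$, left $1_A$, right $v_\theta$, bottom $h_\theta$) and $\chi_\theta$ (top $h_\theta$, left $v_\theta$, right $1_B$, bottom $\mathrm{Id}_B$) with $\chi_\theta\circ\psi_\theta=1_{h_\theta}$ and $\chi_\theta\cdot\psi_\theta=\mathrm{id}_{v_\theta}$; composition is $\theta'\cdot\theta=(h_{\theta'}h_\theta,\ v_{\theta'}\cdot v_\theta,\ (\psi_{\theta'}\circ1_{h_\theta})\cdot\psi_\theta,\ \chi_{\theta'}\cdot(1_{h_{\theta'}}\circ\chi_\theta))$, with the evident identities. A double cell with top $f$, bottom $g$, left $\theta$, right $\theta'$ is a double cell $\Theta$ of $\mathbb D$ with top $f$, bottom $g$, left $v_\theta$, right $v_{\theta'}$ such that $h_{\theta'}f=gh_\theta$, $\chi_{\theta'}\circ\Theta=1_g\circ\chi_\theta$ and $\Theta\circ\psi_\theta=\psi_{\theta'}\circ1_f$. The functor $h_-:v\,\mathbb{C}\mathrm{omp}(\mathbb D)\to h\mathbb D$ is the identity on objects and sends $\theta$ to $h_\theta$. A strict functor $L:\mathbb X\to\mathbb D$ induces $\mathbb{C}\mathrm{omp}(L)$. **$W$-friendly functors and transformations.** $\nabla W$ is the category with the arrows in $W$ as objects, and an arrow $(v,w'):w\to w'$, for $w:A\to B$ and $w':A'\to B$, is an arrow $v:A\to A'$ of $\mathbf C$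 with $w'v=w$; $D_0:\nabla W\to\mathbf C$ sends $w$ to its domain and $(v,w')$ to $v$. A $W$-friendly structure on a strict functor $G:H\mathbf C\to\mathbb D$ is a pair $(\Gamma,\gamma)$ of a strict double functor $\Gamma:V\nabla W\to\mathbb{C}\mathrm{omp}(\mathbb D)$ and an invertible natural transformation $\gamma:h_-\circ v\Gamma\Rightarrow hG\circ D_0:\nabla W\to h\mathbb D$; a $W$-friendly functor is a functor with such a structure. A $W$-friendly horizontal transformation $(G,\Gamma,\gamma)\Rightarrow(L,\Lambda,\lambda)$ is a pair of horizontal transformations $a:G\Rightarrow L$, $\alpha:\Gamma\Rightarrow\Lambda$ with $\lambda_w\circ\alpha_w=a_{D_0w}\circ\gamma_w$ for all $w\in W$. **Structure on $\mathcal J_{\mathbf C}$.** $\Phi:V\nabla W\to\mathbb{C}\mathrm{omp}(\mathbf C\{W\})$ sends $w$ to $(w)$ and an arrow $(u,w):wu\to w$ (with $u:A_1\to A_2$) to the companion pair consisting of the horizontal arrow $u:(wu)\to(w)$ and the vertical arrow $[1_{A_1},A_1,u]$ from $(wu)$ to $(w)$, with binding cells $\psi$ represented by $1_{A_1}:A_1\to A_1$ (left representative $(1_{A_1},A_1,1_{A_1})$, right representative $(1_{A_1},A_1,u)$) and $\chi$ represented by $u:A_1\to A_2$ (left $(1_{A_1},A_1,u)$, right $(1_{A_2},A_2,1_{A_2})$). The natural transformation $\varphi$ has components the horizontal isomorphisms $\varphi_w=1_A:(w)\to(1_A)$ for $w:A\to B$. A functor $L:\mathbf C\{W\}\to\mathbb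 D$ then yields the $W$-friendly functor $(L\mathcal J_{\mathbf C},\mathbb{C}\mathrm{omp}(L)\circ\Phi,(L(\varphi_w))_w)$; a horizontal transformation $b:L\Rightarrow L'$ is sent to $(b\mathcal J_{\mathbf C},\beta)$ with $\beta_w=b_{(w)}$. *)

theory Defs
  imports "HOL-Library.FuncSet"
begin

section \<open>Categories, functors, equivalences\<close>

record ('o, 'a) cat =
  Obj :: "'o set"
  Arr :: "'a set"
  Dom :: "'a \<Rightarrow> 'o"
  Cod :: "'a \<Rightarrow> 'o"
  Ide :: "'o \<Rightarrow> 'a"
  Cmp :: "'a \<Rightarrow> 'a \<Rightarrow> 'a"

text \<open>\<open>Cmp C g f\<close> is \<open>g\<close> after \<open>f\<close>. Values of operations outside the carriers are irrelevant.\<close>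

locale category =
  fixes C :: "('o, 'a) cat"
  assumes Dom_closed: "f \<in> Arr C \<Longrightarrow> Dom C f \<in> Obj C"
    and Cod_closed: "f \<in> Arr C \<Longrightarrow> Cod C f \<in> Obj C"
    and Ide_closed: "A \<in> Obj C \<Longrightarrow> Ide C A \<in> Arr C"
    and Dom_Ide: "A \<in> Obj C \<Longrightarrow> Dom C (Ide C A) = A"
    and Cod_Ide: "A \<in> Obj C \<Longrightarrow> Cod C (Ide C A) = A"
    and Cmp_closed: "\<lbrakk>f \<in> Arr C; g \<in> Arr C; Cod C f = Dom C g\<rbrakk> \<Longrightarrow> Cmp C g f \<in> Arr C"
    and Dom_Cmp: "\<lbrakk>f \<in> Arr C; g \<in> Arr C; Cod C f = Dom C g\<rbrakk> \<Longrightarrow> Dom C (Cmp C g f) = Dom C f"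
    and Cod_Cmp: "\<lbrakk>f \<in> Arr C; g \<in> Arr C; Cod C f = Dom C g\<rbrakk> \<Longrightarrow> Cod C (Cmp C g f) = Cod C g"
    and Cmp_Ide_right: "f \<in> Arr C \<Longrightarrow> Cmp C f (Ide C (Dom C f)) = f"
    and Cmp_Ide_left: "f \<in> Arr C \<Longrightarrow> Cmp C (Ide C (Cod C f)) f = f"
    and Cmp_assoc: "\<lbrakk>f \<in> Arr C; g \<in> Arr C; h \<in> Arr C; Cod C f = Dom C g; Cod C g = Dom C h\<rbrakk>
      \<Longrightarrow> Cmp C h (Cmp C g f) = Cmp C (Cmp C h g) f"

definition iso_arr :: "('o, 'a) cat \<Rightarrow> 'a \<Rightarrow> bool" where
  "iso_arr C f \<longleftrightarrow> f \<in> Arr C \<and> (\<exists>g\<in>Arr C. Dom C g = Cod C f \<and> Cod C g = Dom C f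
     \<and> Cmp C g f = Ide C (Dom C f) \<and> Cmp C f g = Ide C (Cod C f))"

record ('o, 'a, 'p, 'b) ftr =
  omap :: "'o \<Rightarrow> 'p"
  amap :: "'a \<Rightarrow> 'b"

locale cat_functor = A: category A + B: category B
  for A :: "('o, 'a) cat" and B :: "('p, 'b) cat" +
  fixes F :: "('o, 'a, 'p, 'b) ftr"
  assumes omap_closed: "x \<in> Obj A \<Longrightarrow> omap F x \<in> Obj B"
    and amap_closed: "f \<in> Arr A \<Longrightarrow> amap F f \<in> Arr B"
    and Dom_amap: "f \<in> Arr A \<Longrightarrow> Dom B (amap F f) = omap F (Dom A f)"
    and Cod_amap: "f \<in> Arr A \<Longrightarrow> Cod B (amap F f) = omap F (Cod A f)"
    and amap_Ide: "x \<in> Obj A \<Longrightarrow> amap F (Ide A x) = Ide B (omap F x)"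
    and amap_Cmp: "\<lbrakk>f \<in> Arr A; g \<in> Arr A; Cod A f = Dom A g\<rbrakk>
      \<Longrightarrow> amap F (Cmp A g f) = Cmp B (amap F g) (amap F f)"

definition ftr_id :: "('o, 'a, 'o, 'a) ftr" where
  "ftr_id = \<lparr>omap = (\<lambda>x. x), amap = (\<lambda>f. f)\<rparr>"

definition ftr_comp :: "('p, 'b, 'q, 'c) ftr \<Rightarrow> ('o, 'a, 'p, 'b) ftr \<Rightarrow> ('o, 'a, 'q, 'c) ftr" where
  "ftr_comp G F = \<lparr>omap = (\<lambda>x. omap G (omap F x)), amap = (\<lambda>f. amap G (amap F f))\<rparr>"

text \<open>Setting a map to \<open>undefined\<close> outside the carriers of its source makes equality of functors
  (and of transformations) into the usual extensional equality; see \<open>dbl_functors\<close> below.\<close>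

definition ftr_restrict :: "('o, 'a) cat \<Rightarrow> ('o, 'a, 'p, 'b) ftr \<Rightarrow> ('o, 'a, 'p, 'b) ftr" where
  "ftr_restrict A F = \<lparr>omap = restrict (omap F) (Obj A), amap = restrict (amap F) (Arr A)\<rparr>"

definition ftr_extensional :: "('o, 'a) cat \<Rightarrow> ('o, 'a, 'p, 'b) ftr \<Rightarrow> bool" where
  "ftr_extensional A F \<longleftrightarrow> omap F \<in> extensional (Obj A) \<and> amap F \<in> extensional (Arr A)"

locale nat_iso = F: cat_functor A B F + G: cat_functor A B G
  for A :: "('o, 'a) cat" and B :: "('p, 'b) cat" and F G :: "('o, 'a, 'p, 'b) ftr" +
  fixes \<eta> :: "'o \<Rightarrow> 'b"
  assumes iso_component: "x \<in> Obj A \<Longrightarrow> iso_arr B (\<eta> x)"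
    and Dom_component: "x \<in> Obj A \<Longrightarrow> Dom B (\<eta> x) = omap F x"
    and Cod_component: "x \<in> Obj A \<Longrightarrow> Cod B (\<eta> x) = omap G x"
    and naturality: "f \<in> Arr A
      \<Longrightarrow> Cmp B (\<eta> (Cod A f)) (amap F f) = Cmp B (amap G f) (\<eta> (Dom A f))"

definition cat_equivalence :: "('o, 'a) cat \<Rightarrow> ('p, 'b) cat \<Rightarrow> ('o, 'a, 'p, 'b) ftr \<Rightarrow> bool" where
  "cat_equivalence A B F \<longleftrightarrow> cat_functor A B F \<and>
     (\<exists>G \<eta> \<epsilon>. cat_functor B A G \<and> nat_iso A A ftr_id (ftr_comp G F) \<eta>
        \<and> nat_iso B B (ftr_comp F G) ftr_id \<epsilon>)"

definition discrete_cat :: "'x set \<Rightarrow> ('x, 'x) cat" where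
  "discrete_cat S = \<lparr>Obj = S, Arr = S, Dom = (\<lambda>x. x), Cod = (\<lambda>x. x), Ide = (\<lambda>x. x),
     Cmp = (\<lambda>y x. x)\<rparr>"

definition pullback ::
  "('o, 'a) cat \<Rightarrow> ('p, 'b) cat \<Rightarrow> ('o, 'a, 'q, 'c) ftr \<Rightarrow> ('p, 'b, 'q, 'c) ftr \<Rightarrow> ('o \<times> 'p, 'a \<times> 'b) cat"
  where
  "pullback A B F G =
    \<lparr>Obj = {(x, y). x \<in> Obj A \<and> y \<in> Obj B \<and> omap F x = omap G y},
     Arr = {(f, g). f \<in> Arr A \<and> g \<in> Arr B \<and> amap F f = amap G g},
     Dom = map_prod (Dom A) (Dom B),
     Cod = map_prod (Cod A) (Cod B),
     Ide = map_prod (Ide A) (Ide B),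
     Cmp = (\<lambda>(f', g') (f, g). (Cmp A f' f, Cmp B g' g))\<rparr>"

text \<open>The iterated fibre product \<open>A \<times> \<dots> \<times> A\<close> (\<open>n\<close> factors) along \<open>T\<close> and \<open>S\<close>, as a category of
  lists in diagrammatic order: \<open>T\<close> of each entry equals \<open>S\<close> of the next one.\<close>

definition fibre_power ::
  "nat \<Rightarrow> ('o, 'a) cat \<Rightarrow> ('o, 'a, 'q, 'c) ftr \<Rightarrow> ('o, 'a, 'q, 'c) ftr \<Rightarrow> ('o list, 'a list) cat" where
  "fibre_power n A S T =
    \<lparr>Obj = {xs. length xs = n \<and> set xs \<subseteq> Obj A \<and> (\<forall>i. Suc i < n \<longrightarrow> omap T (xs ! i) = omap S (xs ! Suc i))},
     Arr = {fs. length fs = n \<and> set fs \<subseteq> Arr A \<and> (\<forall>i. Suc i < n \<longrightarrow> amap T (fs ! i) = amap S (fs ! Suc i))},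
     Dom = map (Dom A),
     Cod = map (Cod A),
     Ide = map (Ide A),
     Cmp = map2 (Cmp A)\<rparr>"

definition path_component :: "('o, 'a) cat \<Rightarrow> 'o \<Rightarrow> 'o set" where
  "path_component A x = ((\<lambda>f. (Dom A f, Cod A f)) ` Arr A \<union> (\<lambda>f. (Cod A f, Dom A f)) ` Arr A)\<^sup>* `` {x}"

definition components_cat :: "('o, 'a) cat \<Rightarrow> ('o set, 'o set) cat" where
  "components_cat A = discrete_cat (path_component A ` Obj A)"

definition components_quotient :: "('o, 'a) cat \<Rightarrow> ('o, 'a, 'o set, 'o set) ftr" where
  "components_quotient A = \<lparr>omap = path_component A, amap = (\<lambda>f. path_component A (Dom A f))\<rparr>"

section \<open>Double categories\<close>

text \<open>An internal category in \<open>Cat\<close>: \<open>cat0\<close> consists of objects and vertical arrows, \<open>cat1\<close> of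
  horizontal arrows and double cells (a cell going from its top to its bottom).\<close>

record ('o, 'v, 'h, 'c) dblcat =
  cat0 :: "('o, 'v) cat"
  cat1 :: "('h, 'c) cat"
  d0 :: "('h, 'c, 'o, 'v) ftr"
  d1 :: "('h, 'c, 'o, 'v) ftr"
  hid :: "('o, 'v, 'h, 'c) ftr"
  hcmp :: "('h \<times> 'h, 'c \<times> 'c, 'h, 'c) ftr"

text \<open>Horizontal composition \<open>g\<close> after \<open>f\<close> of horizontal arrows and of cells.\<close>

abbreviation hcomp :: "('o, 'v, 'h, 'c) dblcat \<Rightarrow> 'h \<Rightarrow> 'h \<Rightarrow> 'h" where
  "hcomp X g f \<equiv> omap (hcmp X) (g, f)"

abbreviation ccomp :: "('o, 'v, 'h, 'c) dblcat \<Rightarrow> 'c \<Rightarrow> 'c \<Rightarrow> 'c" where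
  "ccomp X \<beta> \<alpha> \<equiv> amap (hcmp X) (\<beta>, \<alpha>)"

locale double_category =
  fixes X :: "('o, 'v, 'h, 'c) dblcat"
  assumes d0_functor: "cat_functor (cat1 X) (cat0 X) (d0 X)"
    and d1_functor: "cat_functor (cat1 X) (cat0 X) (d1 X)"
    and hid_functor: "cat_functor (cat0 X) (cat1 X) (hid X)"
    and hcmp_functor: "cat_functor (pullback (cat1 X) (cat1 X) (d0 X) (d1 X)) (cat1 X) (hcmp X)"
    and d0_hid: "A \<in> Obj (cat0 X) \<Longrightarrow> omap (d0 X) (omap (hid X) A) = A"
    and d1_hid: "A \<in> Obj (cat0 X) \<Longrightarrow> omap (d1 X) (omap (hid X) A) = A"
    and d0_hid_v: "v \<in> Arr (cat0 X) \<Longrightarrow> amap (d0 X) (amap (hid X) v) = v"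
    and d1_hid_v: "v \<in> Arr (cat0 X) \<Longrightarrow> amap (d1 X) (amap (hid X) v) = v"
    and d0_hcomp: "\<lbrakk>f \<in> Obj (cat1 X); g \<in> Obj (cat1 X); omap (d0 X) g = omap (d1 X) f\<rbrakk>
      \<Longrightarrow> omap (d0 X) (hcomp X g f) = omap (d0 X) f"
    and d1_hcomp: "\<lbrakk>f \<in> Obj (cat1 X); g \<in> Obj (cat1 X); omap (d0 X) g = omap (d1 X) f\<rbrakk>
      \<Longrightarrow> omap (d1 X) (hcomp X g f) = omap (d1 X) g"
    and d0_ccomp: "\<lbrakk>\<alpha> \<in> Arr (cat1 X); \<beta> \<in> Arr (cat1 X); amap (d0 X) \<beta> = amap (d1 X) \<alpha>\<rbrakk>
      \<Longrightarrow> amap (d0 X) (ccomp X \<beta> \<alpha>) = amap (d0 X) \<alpha>"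
    and d1_ccomp: "\<lbrakk>\<alpha> \<in> Arr (cat1 X); \<beta> \<in> Arr (cat1 X); amap (d0 X) \<beta> = amap (d1 X) \<alpha>\<rbrakk>
      \<Longrightarrow> amap (d1 X) (ccomp X \<beta> \<alpha>) = amap (d1 X) \<beta>"
    and hcomp_hid_right: "f \<in> Obj (cat1 X) \<Longrightarrow> hcomp X f (omap (hid X) (omap (d0 X) f)) = f"
    and hcomp_hid_left: "f \<in> Obj (cat1 X) \<Longrightarrow> hcomp X (omap (hid X) (omap (d1 X) f)) f = f"
    and ccomp_hid_right: "\<alpha> \<in> Arr (cat1 X) \<Longrightarrow> ccomp X \<alpha> (amap (hid X) (amap (d0 X) \<alpha>)) = \<alpha>"
    and ccomp_hid_left: "\<alpha> \<in> Arr (cat1 X) \<Longrightarrow> ccomp X (amap (hid X) (amap (d1 X) \<alpha>)) \<alpha> = \<alpha>"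
    and hcomp_assoc: "\<lbrakk>f \<in> Obj (cat1 X); g \<in> Obj (cat1 X); h \<in> Obj (cat1 X);
        omap (d0 X) g = omap (d1 X) f; omap (d0 X) h = omap (d1 X) g\<rbrakk>
      \<Longrightarrow> hcomp X h (hcomp X g f) = hcomp X (hcomp X h g) f"
    and ccomp_assoc: "\<lbrakk>\<alpha> \<in> Arr (cat1 X); \<beta> \<in> Arr (cat1 X); \<zeta> \<in> Arr (cat1 X);
        amap (d0 X) \<beta> = amap (d1 X) \<alpha>; amap (d0 X) \<zeta> = amap (d1 X) \<beta>\<rbrakk>
      \<Longrightarrow> ccomp X \<zeta> (ccomp X \<beta> \<alpha>) = ccomp X (ccomp X \<zeta> \<beta>) \<alpha>"

definition weakly_globular :: "('o, 'v, 'h, 'c) dblcat \<Rightarrow> bool" where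
  "weakly_globular X \<longleftrightarrow> double_category X
     \<and> cat_equivalence (cat0 X) (components_cat (cat0 X)) (components_quotient (cat0 X))
     \<and> (\<forall>n\<ge>2. cat_equivalence
          (fibre_power n (cat1 X) (d0 X) (d1 X))
          (fibre_power n (cat1 X) (ftr_comp (components_quotient (cat0 X)) (d0 X))
                                  (ftr_comp (components_quotient (cat0 X)) (d1 X)))
          ftr_id)"

definition hor_cat :: "('o, 'v, 'h, 'c) dblcat \<Rightarrow> ('o, 'h) cat" where
  "hor_cat X = \<lparr>Obj = Obj (cat0 X), Arr = Obj (cat1 X), Dom = omap (d0 X), Cod = omap (d1 X),
     Ide = omap (hid X), Cmp = hcomp X\<rparr>"

definition H_dbl :: "('o, 'a) cat \<Rightarrow> ('o, 'o, 'a, 'a) dblcat" where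
  "H_dbl C = \<lparr>cat0 = discrete_cat (Obj C), cat1 = discrete_cat (Arr C),
     d0 = \<lparr>omap = Dom C, amap = Dom C\<rparr>,
     d1 = \<lparr>omap = Cod C, amap = Cod C\<rparr>,
     hid = \<lparr>omap = Ide C, amap = Ide C\<rparr>,
     hcmp = \<lparr>omap = (\<lambda>(g, f). Cmp C g f), amap = (\<lambda>(g, f). Cmp C g f)\<rparr>\<rparr>"

definition V_dbl :: "('o, 'a) cat \<Rightarrow> ('o, 'a, 'o, 'a) dblcat" where
  "V_dbl C = \<lparr>cat0 = C, cat1 = C, d0 = ftr_id, d1 = ftr_id, hid = ftr_id,
     hcmp = \<lparr>omap = fst, amap = fst\<rparr>\<rparr>"

section \<open>Strict double functors and horizontal transformations\<close>

record ('o, 'v, 'h, 'c, 'p, 'w, 'k, 'e) dblftr =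
  ftr0 :: "('o, 'v, 'p, 'w) ftr"
  ftr1 :: "('h, 'c, 'k, 'e) ftr"

locale strict_double_functor = X: double_category X + Y: double_category Y
  for X :: "('o, 'v, 'h, 'c) dblcat" and Y :: "('p, 'w, 'k, 'e) dblcat" +
  fixes F :: "('o, 'v, 'h, 'c, 'p, 'w, 'k, 'e) dblftr"
  assumes ftr0_functor: "cat_functor (cat0 X) (cat0 Y) (ftr0 F)"
    and ftr1_functor: "cat_functor (cat1 X) (cat1 Y) (ftr1 F)"
    and preserves_d0: "f \<in> Obj (cat1 X) \<Longrightarrow> omap (d0 Y) (omap (ftr1 F) f) = omap (ftr0 F) (omap (d0 X) f)"
    and preserves_d1: "f \<in> Obj (cat1 X) \<Longrightarrow> omap (d1 Y) (omap (ftr1 F) f) = omap (ftr0 F) (omap (d1 X) f)"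
    and preserves_d0_cell: "\<alpha> \<in> Arr (cat1 X) \<Longrightarrow> amap (d0 Y) (amap (ftr1 F) \<alpha>) = amap (ftr0 F) (amap (d0 X) \<alpha>)"
    and preserves_d1_cell: "\<alpha> \<in> Arr (cat1 X) \<Longrightarrow> amap (d1 Y) (amap (ftr1 F) \<alpha>) = amap (ftr0 F) (amap (d1 X) \<alpha>)"
    and preserves_hid: "A \<in> Obj (cat0 X) \<Longrightarrow> omap (ftr1 F) (omap (hid X) A) = omap (hid Y) (omap (ftr0 F) A)"
    and preserves_hid_cell: "v \<in> Arr (cat0 X) \<Longrightarrow> amap (ftr1 F) (amap (hid X) v) = amap (hid Y) (amap (ftr0 F) v)"
    and preserves_hcomp: "\<lbrakk>f \<in> Obj (cat1 X); g \<in> Obj (cat1 X); omap (d0 X) g = omap (d1 X) f\<rbrakk>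
      \<Longrightarrow> omap (ftr1 F) (hcomp X g f) = hcomp Y (omap (ftr1 F) g) (omap (ftr1 F) f)"
    and preserves_ccomp: "\<lbrakk>\<alpha> \<in> Arr (cat1 X); \<beta> \<in> Arr (cat1 X); amap (d0 X) \<beta> = amap (d1 X) \<alpha>\<rbrakk>
      \<Longrightarrow> amap (ftr1 F) (ccomp X \<beta> \<alpha>) = ccomp Y (amap (ftr1 F) \<beta>) (amap (ftr1 F) \<alpha>)"

definition dblftr_restrict ::
  "('o, 'v, 'h, 'c) dblcat \<Rightarrow> ('o, 'v, 'h, 'c, 'p, 'w, 'k, 'e) dblftr \<Rightarrow> ('o, 'v, 'h, 'c, 'p, 'w, 'k, 'e) dblftr"
  where
  "dblftr_restrict X F = \<lparr>ftr0 = ftr_restrict (cat0 X) (ftr0 F), ftr1 = ftr_restrict (cat1 X) (ftr1 F)\<rparr>"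

text \<open>\<open>X\<close> is the source of \<open>F\<close>; it is needed to keep composites extensional.\<close>

definition dblftr_comp ::
  "('o, 'v, 'h, 'c) dblcat \<Rightarrow> ('p, 'w, 'k, 'e, 'q, 'x, 'l, 'g) dblftr
   \<Rightarrow> ('o, 'v, 'h, 'c, 'p, 'w, 'k, 'e) dblftr \<Rightarrow> ('o, 'v, 'h, 'c, 'q, 'x, 'l, 'g) dblftr" where
  "dblftr_comp X G F =
     dblftr_restrict X \<lparr>ftr0 = ftr_comp (ftr0 G) (ftr0 F), ftr1 = ftr_comp (ftr1 G) (ftr1 F)\<rparr>"

definition dbl_functors ::
  "('o, 'v, 'h, 'c) dblcat \<Rightarrow> ('p, 'w, 'k, 'e) dblcat \<Rightarrow> ('o, 'v, 'h, 'c, 'p, 'w, 'k, 'e) dblftr set" where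
  "dbl_functors X Y = {F. strict_double_functor X Y F
     \<and> ftr_extensional (cat0 X) (ftr0 F) \<and> ftr_extensional (cat1 X) (ftr1 F)}"

text \<open>The components of a horizontal transformation are stored as a pair of maps from \<open>cat0 X\<close> to
  \<open>cat1 Y\<close>: the horizontal arrows \<open>omap a A\<close> and the cells \<open>amap a v\<close>.\<close>

locale horizontal_transformation = G: strict_double_functor X Y G + K: strict_double_functor X Y K
  for X :: "('o, 'v, 'h, 'c) dblcat" and Y :: "('p, 'w, 'k, 'e) dblcat"
    and G K :: "('o, 'v, 'h, 'c, 'p, 'w, 'k, 'e) dblftr" +
  fixes a :: "('o, 'v, 'k, 'e) ftr"
  assumes component: "A \<in> Obj (cat0 X) \<Longrightarrow> omap a A \<in> Obj (cat1 Y)"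
    and component_d0: "A \<in> Obj (cat0 X) \<Longrightarrow> omap (d0 Y) (omap a A) = omap (ftr0 G) A"
    and component_d1: "A \<in> Obj (cat0 X) \<Longrightarrow> omap (d1 Y) (omap a A) = omap (ftr0 K) A"
    and cell: "v \<in> Arr (cat0 X) \<Longrightarrow> amap a v \<in> Arr (cat1 Y)"
    and cell_top: "v \<in> Arr (cat0 X) \<Longrightarrow> Dom (cat1 Y) (amap a v) = omap a (Dom (cat0 X) v)"
    and cell_bottom: "v \<in> Arr (cat0 X) \<Longrightarrow> Cod (cat1 Y) (amap a v) = omap a (Cod (cat0 X) v)"
    and cell_left: "v \<in> Arr (cat0 X) \<Longrightarrow> amap (d0 Y) (amap a v) = amap (ftr0 G) v"
    and cell_right: "v \<in> Arr (cat0 X) \<Longrightarrow> amap (d1 Y) (amap a v) = amap (ftr0 K) v"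
    and cell_Ide: "A \<in> Obj (cat0 X) \<Longrightarrow> amap a (Ide (cat0 X) A) = Ide (cat1 Y) (omap a A)"
    and cell_Cmp: "\<lbrakk>v \<in> Arr (cat0 X); v' \<in> Arr (cat0 X); Cod (cat0 X) v = Dom (cat0 X) v'\<rbrakk>
      \<Longrightarrow> amap a (Cmp (cat0 X) v' v) = Cmp (cat1 Y) (amap a v') (amap a v)"
    and cell_naturality: "\<zeta> \<in> Arr (cat1 X)
      \<Longrightarrow> ccomp Y (amap a (amap (d1 X) \<zeta>)) (amap (ftr1 G) \<zeta>)
        = ccomp Y (amap (ftr1 K) \<zeta>) (amap a (amap (d0 X) \<zeta>))"

definition htrans ::
  "('o, 'v, 'h, 'c) dblcat \<Rightarrow> ('p, 'w, 'k, 'e) dblcat \<Rightarrow> ('o, 'v, 'h, 'c, 'p, 'w, 'k, 'e) dblftr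
   \<Rightarrow> ('o, 'v, 'h, 'c, 'p, 'w, 'k, 'e) dblftr \<Rightarrow> ('o, 'v, 'k, 'e) ftr set" where
  "htrans X Y G K = {a. horizontal_transformation X Y G K a \<and> ftr_extensional (cat0 X) a}"

definition htrans_id ::
  "('o, 'v, 'h, 'c) dblcat \<Rightarrow> ('p, 'w, 'k, 'e) dblcat \<Rightarrow> ('o, 'v, 'h, 'c, 'p, 'w, 'k, 'e) dblftr
   \<Rightarrow> ('o, 'v, 'k, 'e) ftr" where
  "htrans_id X Y G = ftr_restrict (cat0 X) (ftr_comp (hid Y) (ftr0 G))"

definition htrans_comp ::
  "('o, 'v, 'h, 'c) dblcat \<Rightarrow> ('p, 'w, 'k, 'e) dblcat \<Rightarrow> ('o, 'v, 'k, 'e) ftr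
   \<Rightarrow> ('o, 'v, 'k, 'e) ftr \<Rightarrow> ('o, 'v, 'k, 'e) ftr" where
  "htrans_comp X Y b a = ftr_restrict (cat0 X)
     \<lparr>omap = (\<lambda>A. hcomp Y (omap b A) (omap a A)), amap = (\<lambda>v. ccomp Y (amap b v) (amap a v))\<rparr>"

definition htrans_whisker ::
  "('o, 'v, 'h, 'c) dblcat \<Rightarrow> ('p, 'w, 'k, 'e) ftr \<Rightarrow> ('o, 'v, 'l, 'g, 'p, 'w, 'm, 'j) dblftr
   \<Rightarrow> ('o, 'v, 'k, 'e) ftr" where
  "htrans_whisker X b F = ftr_restrict (cat0 X) (ftr_comp b (ftr0 F))"

definition Hom_h ::
  "('o, 'v, 'h, 'c) dblcat \<Rightarrow> ('p, 'w, 'k, 'e) dblcat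
   \<Rightarrow> (('o, 'v, 'h, 'c, 'p, 'w, 'k, 'e) dblftr,
       ('o, 'v, 'h, 'c, 'p, 'w, 'k, 'e) dblftr \<times> ('o, 'v, 'k, 'e) ftr
         \<times> ('o, 'v, 'h, 'c, 'p, 'w, 'k, 'e) dblftr) cat" where
  "Hom_h X Y =
    \<lparr>Obj = dbl_functors X Y,
     Arr = {(G, a, K). G \<in> dbl_functors X Y \<and> K \<in> dbl_functors X Y \<and> a \<in> htrans X Y G K},
     Dom = (\<lambda>(G, a, K). G),
     Cod = (\<lambda>(G, a, K). K),
     Ide = (\<lambda>G. (G, htrans_id X Y G, G)),
     Cmp = (\<lambda>(K, b, L) (G, a, K'). (G, htrans_comp X Y b a, L))\<rparr>"

section \<open>The double category of companions\<close>

datatype ('v, 'h, 'c) companion =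
  Companion (comp_h: 'h) (comp_v: 'v) (comp_psi: 'c) (comp_chi: 'c)

definition is_companion :: "('o, 'v, 'h, 'c) dblcat \<Rightarrow> ('v, 'h, 'c) companion \<Rightarrow> bool" where
  "is_companion D \<theta> \<longleftrightarrow>
    (let h = comp_h \<theta>; v = comp_v \<theta>; \<psi> = comp_psi \<theta>; \<chi> = comp_chi \<theta>;
         A = Dom (cat0 D) v; B = Cod (cat0 D) v in
      h \<in> Obj (cat1 D) \<and> v \<in> Arr (cat0 D) \<and> omap (d0 D) h = A \<and> omap (d1 D) h = B
      \<and> \<psi> \<in> Arr (cat1 D) \<and> Dom (cat1 D) \<psi> = omap (hid D) A \<and> Cod (cat1 D) \<psi> = h
      \<and> amap (d0 D) \<psi> = Ide (cat0 D) A \<and> amap (d1 D) \<psi> = v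
      \<and> \<chi> \<in> Arr (cat1 D) \<and> Dom (cat1 D) \<chi> = h \<and> Cod (cat1 D) \<chi> = omap (hid D) B
      \<and> amap (d0 D) \<chi> = v \<and> amap (d1 D) \<chi> = Ide (cat0 D) B
      \<and> ccomp D \<chi> \<psi> = Ide (cat1 D) h
      \<and> Cmp (cat1 D) \<chi> \<psi> = amap (hid D) v)"

definition companion_id :: "('o, 'v, 'h, 'c) dblcat \<Rightarrow> 'o \<Rightarrow> ('v, 'h, 'c) companion" where
  "companion_id D A = Companion (omap (hid D) A) (Ide (cat0 D) A)
     (Ide (cat1 D) (omap (hid D) A)) (Ide (cat1 D) (omap (hid D) A))"

definition companion_comp ::
  "('o, 'v, 'h, 'c) dblcat \<Rightarrow> ('v, 'h, 'c) companion \<Rightarrow> ('v, 'h, 'c) companion \<Rightarrow> ('v, 'h, 'c) companion" where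
  "companion_comp D \<theta>' \<theta> = Companion
     (hcomp D (comp_h \<theta>') (comp_h \<theta>))
     (Cmp (cat0 D) (comp_v \<theta>') (comp_v \<theta>))
     (Cmp (cat1 D) (ccomp D (comp_psi \<theta>') (Ide (cat1 D) (comp_h \<theta>))) (comp_psi \<theta>))
     (Cmp (cat1 D) (comp_chi \<theta>') (ccomp D (Ide (cat1 D) (comp_h \<theta>')) (comp_chi \<theta>)))"

text \<open>A cell of the companion double category is a triple: left companion, underlying cell, right
  companion.\<close>

definition is_companion_cell ::
  "('o, 'v, 'h, 'c) dblcat \<Rightarrow> ('v, 'h, 'c) companion \<times> 'c \<times> ('v, 'h, 'c) companion \<Rightarrow> bool" where
  "is_companion_cell D = (\<lambda>(\<theta>, \<Theta>, \<theta>').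
     let f = Dom (cat1 D) \<Theta>; g = Cod (cat1 D) \<Theta> in
      is_companion D \<theta> \<and> is_companion D \<theta>' \<and> \<Theta> \<in> Arr (cat1 D)
      \<and> amap (d0 D) \<Theta> = comp_v \<theta> \<and> amap (d1 D) \<Theta> = comp_v \<theta>'
      \<and> hcomp D (comp_h \<theta>') f = hcomp D g (comp_h \<theta>)
      \<and> ccomp D (comp_chi \<theta>') \<Theta> = ccomp D (Ide (cat1 D) g) (comp_chi \<theta>)
      \<and> ccomp D \<Theta> (comp_psi \<theta>) = ccomp D (comp_psi \<theta>') (Ide (cat1 D) f))"

definition Companions ::
  "('o, 'v, 'h, 'c) dblcat
   \<Rightarrow> ('o, ('v, 'h, 'c) companion, 'h, ('v, 'h, 'c) companion \<times> 'c \<times> ('v, 'h, 'c) companion) dblcat" where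
  "Companions D =
    \<lparr>cat0 =
       \<lparr>Obj = Obj (cat0 D),
        Arr = Collect (is_companion D),
        Dom = (\<lambda>\<theta>. Dom (cat0 D) (comp_v \<theta>)),
        Cod = (\<lambda>\<theta>. Cod (cat0 D) (comp_v \<theta>)),
        Ide = companion_id D,
        Cmp = companion_comp D\<rparr>,
     cat1 =
       \<lparr>Obj = Obj (cat1 D),
        Arr = Collect (is_companion_cell D),
        Dom = (\<lambda>(\<theta>, \<Theta>, \<theta>'). Dom (cat1 D) \<Theta>),
        Cod = (\<lambda>(\<theta>, \<Theta>, \<theta>'). Cod (cat1 D) \<Theta>),
        Ide = (\<lambda>f. (companion_id D (omap (d0 D) f), Ide (cat1 D) f, companion_id D (omap (d1 D) f))),
        Cmp = (\<lambda>(\<rho>, P, \<rho>') (\<theta>, \<Theta>, \<theta>').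
          (companion_comp D \<rho> \<theta>, Cmp (cat1 D) P \<Theta>, companion_comp D \<rho>' \<theta>'))\<rparr>,
     d0 = \<lparr>omap = omap (d0 D), amap = (\<lambda>(\<theta>, \<Theta>, \<theta>'). \<theta>)\<rparr>,
     d1 = \<lparr>omap = omap (d1 D), amap = (\<lambda>(\<theta>, \<Theta>, \<theta>'). \<theta>')\<rparr>,
     hid = \<lparr>omap = omap (hid D), amap = (\<lambda>\<theta>. (\<theta>, amap (hid D) (comp_v \<theta>), \<theta>))\<rparr>,
     hcmp = \<lparr>omap = omap (hcmp D),
       amap = (\<lambda>((\<rho>, P, \<rho>'), (\<theta>, \<Theta>, \<theta>')). (\<theta>, ccomp D P \<Theta>, \<rho>'))\<rparr>\<rparr>"

definition h_minus :: "('o, ('v, 'h, 'c) companion, 'o, 'h) ftr" where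
  "h_minus = \<lparr>omap = (\<lambda>A. A), amap = comp_h\<rparr>"

definition map_companion_ftr ::
  "('o, 'v, 'h, 'c, 'p, 'w, 'k, 'e) dblftr \<Rightarrow> ('v, 'h, 'c) companion \<Rightarrow> ('w, 'k, 'e) companion" where
  "map_companion_ftr L = map_companion (amap (ftr0 L)) (omap (ftr1 L)) (amap (ftr1 L))"

definition Companions_ftr ::
  "('o, 'v, 'h, 'c, 'p, 'w, 'k, 'e) dblftr
   \<Rightarrow> ('o, ('v, 'h, 'c) companion, 'h, ('v, 'h, 'c) companion \<times> 'c \<times> ('v, 'h, 'c) companion,
       'p, ('w, 'k, 'e) companion, 'k, ('w, 'k, 'e) companion \<times> 'e \<times> ('w, 'k, 'e) companion) dblftr" where
  "Companions_ftr L =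
    \<lparr>ftr0 = \<lparr>omap = omap (ftr0 L), amap = map_companion_ftr L\<rparr>,
     ftr1 = \<lparr>omap = omap (ftr1 L),
       amap = (\<lambda>(\<theta>, \<Theta>, \<theta>'). (map_companion_ftr L \<theta>, amap (ftr1 L) \<Theta>, map_companion_ftr L \<theta>'))\<rparr>\<rparr>"

text \<open>The horizontal transformation from \<open>Companions_ftr L\<close> to \<open>Companions_ftr L'\<close> induced by
  \<open>b : L \<Rightarrow> L'\<close>.\<close>

definition Companions_htrans ::
  "('o, 'v, 'h, 'c, 'p, 'w, 'k, 'e) dblftr \<Rightarrow> ('o, 'v, 'k, 'e) ftr
   \<Rightarrow> ('o, 'v, 'h, 'c, 'p, 'w, 'k, 'e) dblftr
   \<Rightarrow> ('o, ('v, 'h, 'c) companion, 'k, ('w, 'k, 'e) companion \<times> 'e \<times> ('w, 'k, 'e) companion) ftr" where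
  "Companions_htrans L b L' =
    \<lparr>omap = omap b,
     amap = (\<lambda>\<theta>. (map_companion_ftr L \<theta>, amap b (comp_v \<theta>), map_companion_ftr L' \<theta>))\<rparr>"

section \<open>Conditions on the class \<open>W\<close>\<close>

locale calculus_of_fractions = category C
  for C :: "('o, 'a) cat" +
  fixes W :: "'a set"
  assumes W_arrows: "W \<subseteq> Arr C"
    and CF1_iso: "iso_arr C f \<Longrightarrow> f \<in> W"
    and CF1_comp: "\<lbrakk>w \<in> W; w' \<in> W; Cod C w = Dom C w'\<rbrakk> \<Longrightarrow> Cmp C w' w \<in> W"
    and CF2: "\<lbrakk>f \<in> Arr C; w \<in> W; Cod C f = Cod C w\<rbrakk>
      \<Longrightarrow> \<exists>f'\<in>Arr C. \<exists>w'\<in>W. Dom C f' = Dom C w' \<and> Cod C f' = Dom C w \<and> Cod C w' = Dom C f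
            \<and> Cmp C w f' = Cmp C f w'"
    and CF3: "\<lbrakk>w \<in> W; f \<in> Arr C; g \<in> Arr C; Dom C f = Dom C g; Cod C f = Dom C w; Cod C g = Dom C w;
        Cmp C w f = Cmp C w g\<rbrakk>
      \<Longrightarrow> \<exists>w'\<in>W. Cod C w' = Dom C f \<and> Cmp C f w' = Cmp C g w'"

definition two_out_of_three :: "('o, 'a) cat \<Rightarrow> 'a set \<Rightarrow> bool" where
  "two_out_of_three C W \<longleftrightarrow> (\<forall>f\<in>Arr C. \<forall>g\<in>Arr C. Cod C f = Dom C g \<longrightarrow>
     (f \<in> W \<and> g \<in> W \<longrightarrow> Cmp C g f \<in> W)
     \<and> (f \<in> W \<and> Cmp C g f \<in> W \<longrightarrow> g \<in> W)
     \<and> (g \<in> W \<and> Cmp C g f \<in> W \<longrightarrow> f \<in> W))"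

section \<open>The double category of fractions\<close>

text \<open>A span \<open>(u\<^sub>1, C, u\<^sub>2)\<close> is encoded as the pair \<open>(u\<^sub>1, u\<^sub>2)\<close>, since \<open>C\<close> is the common domain.\<close>

definition spans :: "('o, 'a) cat \<Rightarrow> 'a set \<Rightarrow> 'a \<Rightarrow> 'a \<Rightarrow> ('a \<times> 'a) set" where
  "spans C W w1 w2 = {(u1, u2). u1 \<in> Arr C \<and> u2 \<in> Arr C \<and> Dom C u1 = Dom C u2
     \<and> Cod C u1 = Dom C w1 \<and> Cod C u2 = Dom C w2
     \<and> Cmp C w1 u1 = Cmp C w2 u2 \<and> Cmp C w1 u1 \<in> W}"

definition span_rel :: "('o, 'a) cat \<Rightarrow> 'a set \<Rightarrow> 'a \<Rightarrow> 'a \<Rightarrow> (('a \<times> 'a) \<times> ('a \<times> 'a)) set" where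
  "span_rel C W w1 w2 = {((u1, u2), (v1, v2)).
     (u1, u2) \<in> spans C W w1 w2 \<and> (v1, v2) \<in> spans C W w1 w2
     \<and> (\<exists>r1\<in>Arr C. \<exists>r2\<in>Arr C. Dom C r1 = Dom C r2 \<and> Cod C r1 = Dom C u1 \<and> Cod C r2 = Dom C v1
          \<and> Cmp C u1 r1 = Cmp C v1 r2 \<and> Cmp C u2 r1 = Cmp C v2 r2
          \<and> Cmp C w1 (Cmp C u1 r1) \<in> W)}"

datatype 'a frac_vert = Vert (v_from: 'a) (v_to: 'a) (v_class: "('a \<times> 'a) set")

datatype 'a frac_hor = Hor (h_from: 'a) (h_to: 'a) (h_arr: 'a)

text \<open>A representative of a cell is \<open>((u\<^sub>1, u\<^sub>2), \<phi>, (u\<^sub>1', u\<^sub>2'))\<close>; the spans are part of it because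
  the same arrow can represent cells with respect to different spans.\<close>

type_synonym 'a cell_rep = "('a \<times> 'a) \<times> 'a \<times> ('a \<times> 'a)"

datatype 'a frac_cell = Cell (c_top: "'a frac_hor") (c_bot: "'a frac_hor")
  (c_left: "'a frac_vert") (c_right: "'a frac_vert") (c_class: "'a cell_rep set")

definition frac_vert :: "('o, 'a) cat \<Rightarrow> 'a set \<Rightarrow> 'a \<Rightarrow> 'a \<Rightarrow> 'a \<times> 'a \<Rightarrow> 'a frac_vert" where
  "frac_vert C W w1 w2 u = Vert w1 w2 (span_rel C W w1 w2 `` {u})"

definition frac_verts :: "('o, 'a) cat \<Rightarrow> 'a set \<Rightarrow> 'a frac_vert set" where
  "frac_verts C W = {frac_vert C W w1 w2 u | w1 w2 u.
     w1 \<in> W \<and> w2 \<in> W \<and> Cod C w1 = Cod C w2 \<and> u \<in> spans C W w1 w2}"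

definition frac_hors :: "('o, 'a) cat \<Rightarrow> 'a set \<Rightarrow> 'a frac_hor set" where
  "frac_hors C W = {Hor w w' f | w w' f.
     w \<in> W \<and> w' \<in> W \<and> f \<in> Arr C \<and> Dom C f = Dom C w \<and> Cod C f = Dom C w'}"

definition cell_reps ::
  "('o, 'a) cat \<Rightarrow> 'a frac_hor \<Rightarrow> 'a frac_hor \<Rightarrow> 'a frac_vert \<Rightarrow> 'a frac_vert \<Rightarrow> 'a cell_rep set" where
  "cell_reps C f1 f2 S S' = {((u1, u2), \<phi>, (u1', u2')).
     (u1, u2) \<in> v_class S \<and> (u1', u2') \<in> v_class S'
     \<and> \<phi> \<in> Arr C \<and> Dom C \<phi> = Dom C u1 \<and> Cod C \<phi> = Dom C u1'
     \<and> Cmp C (h_arr f1) u1 = Cmp C u1' \<phi> \<and> Cmp C (h_arr f2) u2 = Cmp C u2' \<phi>}"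

definition cell_rel ::
  "('o, 'a) cat \<Rightarrow> 'a set \<Rightarrow> 'a frac_hor \<Rightarrow> 'a frac_hor \<Rightarrow> 'a frac_vert \<Rightarrow> 'a frac_vert
   \<Rightarrow> ('a cell_rep \<times> 'a cell_rep) set" where
  "cell_rel C W f1 f2 S S' = {(((u1, u2), \<phi>, (u1', u2')), ((v1, v2), \<psi>, (v1', v2'))).
     ((u1, u2), \<phi>, (u1', u2')) \<in> cell_reps C f1 f2 S S'
     \<and> ((v1, v2), \<psi>, (v1', v2')) \<in> cell_reps C f1 f2 S S'
     \<and> (\<exists>r\<in>Arr C. \<exists>s\<in>Arr C. \<exists>r'\<in>Arr C. \<exists>s'\<in>Arr C. \<exists>\<chi>\<in>Arr C.
          Dom C s = Dom C r \<and> Cod C r = Dom C u1 \<and> Cod C s = Dom C v1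
          \<and> Dom C s' = Dom C r' \<and> Cod C r' = Dom C u1' \<and> Cod C s' = Dom C v1'
          \<and> Dom C \<chi> = Dom C r \<and> Cod C \<chi> = Dom C r'
          \<and> Cmp C \<phi> r = Cmp C r' \<chi> \<and> Cmp C \<psi> s = Cmp C s' \<chi>
          \<and> Cmp C u1 r = Cmp C v1 s \<and> Cmp C u2 r = Cmp C v2 s
          \<and> Cmp C u1' r' = Cmp C v1' s' \<and> Cmp C u2' r' = Cmp C v2' s'
          \<and> Cmp C (v_from S) (Cmp C u1 r) \<in> W \<and> Cmp C (v_from S') (Cmp C u1' r') \<in> W)}"

definition frac_cell ::
  "('o, 'a) cat \<Rightarrow> 'a set \<Rightarrow> 'a frac_hor \<Rightarrow> 'a frac_hor \<Rightarrow> 'a frac_vert \<Rightarrow> 'a frac_vert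
   \<Rightarrow> 'a cell_rep \<Rightarrow> 'a frac_cell" where
  "frac_cell C W f1 f2 S S' x = Cell f1 f2 S S' (cell_rel C W f1 f2 S S' `` {x})"

definition frac_cells :: "('o, 'a) cat \<Rightarrow> 'a set \<Rightarrow> 'a frac_cell set" where
  "frac_cells C W = {frac_cell C W f1 f2 S S' x | f1 f2 S S' x.
     f1 \<in> frac_hors C W \<and> f2 \<in> frac_hors C W \<and> S \<in> frac_verts C W \<and> S' \<in> frac_verts C W
     \<and> v_from S = h_from f1 \<and> v_to S = h_from f2 \<and> v_from S' = h_to f1 \<and> v_to S' = h_to f2
     \<and> x \<in> cell_reps C f1 f2 S S'}"

text \<open>The composites of classes below are the unions of the classes obtained from all admissible
  choices; as the composites do not depend on the choices, these unions are single classes.\<close>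

definition vert_squares :: "('o, 'a) cat \<Rightarrow> 'a set \<Rightarrow> 'a \<Rightarrow> 'a \<Rightarrow> 'a \<Rightarrow> ('a \<times> 'a) set" where
  "vert_squares C W w2 u2 v1 = {(v1', u2').
     v1' \<in> Arr C \<and> u2' \<in> Arr C \<and> Dom C v1' = Dom C u2' \<and> Cod C v1' = Dom C u2 \<and> Cod C u2' = Dom C v1
     \<and> Cmp C u2 v1' = Cmp C v1 u2' \<and> Cmp C w2 (Cmp C u2 v1') \<in> W}"

definition frac_vert_id :: "('o, 'a) cat \<Rightarrow> 'a set \<Rightarrow> 'a \<Rightarrow> 'a frac_vert" where
  "frac_vert_id C W w = frac_vert C W w w (Ide C (Dom C w), Ide C (Dom C w))"

definition frac_vert_comp :: "('o, 'a) cat \<Rightarrow> 'a set \<Rightarrow> 'a frac_vert \<Rightarrow> 'a frac_vert \<Rightarrow> 'a frac_vert" where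
  "frac_vert_comp C W T S = Vert (v_from S) (v_to T)
     (\<Union> {span_rel C W (v_from S) (v_to T) `` {(Cmp C u1 v1', Cmp C v2 u2')} | u1 u2 v1 v2 v1' u2'.
        (u1, u2) \<in> v_class S \<and> (v1, v2) \<in> v_class T \<and> (v1', u2') \<in> vert_squares C W (v_to S) u2 v1})"

definition frac_hor_id :: "('o, 'a) cat \<Rightarrow> 'a \<Rightarrow> 'a frac_hor" where
  "frac_hor_id C w = Hor w w (Ide C (Dom C w))"

definition frac_hor_comp :: "('o, 'a) cat \<Rightarrow> 'a frac_hor \<Rightarrow> 'a frac_hor \<Rightarrow> 'a frac_hor" where
  "frac_hor_comp C g f = Hor (h_from f) (h_to g) (Cmp C (h_arr g) (h_arr f))"

definition frac_cell_vid :: "('o, 'a) cat \<Rightarrow> 'a set \<Rightarrow> 'a frac_hor \<Rightarrow> 'a frac_cell" where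
  "frac_cell_vid C W f =
    (let i = Ide C (Dom C (h_from f)); j = Ide C (Dom C (h_to f)) in
     frac_cell C W f f (frac_vert_id C W (h_from f)) (frac_vert_id C W (h_to f)) ((i, i), h_arr f, (j, j)))"

definition frac_cell_hid :: "('o, 'a) cat \<Rightarrow> 'a set \<Rightarrow> 'a frac_vert \<Rightarrow> 'a frac_cell" where
  "frac_cell_hid C W S =
    (let f1 = frac_hor_id C (v_from S); f2 = frac_hor_id C (v_to S) in
     Cell f1 f2 S S (\<Union>u\<in>v_class S. cell_rel C W f1 f2 S S `` {(u, Ide C (Dom C (fst u)), u)}))"

text \<open>In both composites of cells the second cell comes first among the arguments. In the vertical
  one, \<open>(a, b)\<close> and \<open>(a', b')\<close> are the completing squares used to compose the left and the right
  sides, and \<open>\<xi>\<close> represents the composite with respect to the left span precomposed with \<open>r\<close>.\<close>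

definition frac_cell_vcomp :: "('o, 'a) cat \<Rightarrow> 'a set \<Rightarrow> 'a frac_cell \<Rightarrow> 'a frac_cell \<Rightarrow> 'a frac_cell" where
  "frac_cell_vcomp C W \<beta> \<alpha> =
    (let S = frac_vert_comp C W (c_left \<beta>) (c_left \<alpha>);
         S' = frac_vert_comp C W (c_right \<beta>) (c_right \<alpha>) in
     Cell (c_top \<alpha>) (c_bot \<beta>) S S'
      (\<Union> {cell_rel C W (c_top \<alpha>) (c_bot \<beta>) S S' ``
              {((Cmp C (Cmp C u1 a) r, Cmp C (Cmp C v2 b) r), \<xi>, (Cmp C u1' a', Cmp C v2' b'))} |
            u1 u2 \<phi> u1' u2' v1 v2 \<psi> v1' v2' a b a' b' r \<xi>.
          ((u1, u2), \<phi>, (u1', u2')) \<in> c_class \<alpha> \<and> ((v1, v2), \<psi>, (v1', v2')) \<in> c_class \<beta>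
          \<and> (a, b) \<in> vert_squares C W (v_to (c_left \<alpha>)) u2 v1
          \<and> (a', b') \<in> vert_squares C W (v_to (c_right \<alpha>)) u2' v1'
          \<and> r \<in> W \<and> Cod C r = Dom C a
          \<and> \<xi> \<in> Arr C \<and> Dom C \<xi> = Dom C r \<and> Cod C \<xi> = Dom C a'
          \<and> Cmp C a' \<xi> = Cmp C (Cmp C \<phi> a) r \<and> Cmp C b' \<xi> = Cmp C (Cmp C \<psi> b) r}))"

definition frac_cell_hcomp :: "('o, 'a) cat \<Rightarrow> 'a set \<Rightarrow> 'a frac_cell \<Rightarrow> 'a frac_cell \<Rightarrow> 'a frac_cell" where
  "frac_cell_hcomp C W \<beta> \<alpha> =
    (let f1 = frac_hor_comp C (c_top \<beta>) (c_top \<alpha>);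
         f2 = frac_hor_comp C (c_bot \<beta>) (c_bot \<alpha>) in
     Cell f1 f2 (c_left \<alpha>) (c_right \<beta>)
      (\<Union> {cell_rel C W f1 f2 (c_left \<alpha>) (c_right \<beta>) ``
              {((Cmp C u1 q, Cmp C u2 q), Cmp C \<psi> (Cmp C s \<phi>'), (v1', v2'))} |
            u1 u2 \<phi> u1' u2' v1 v2 \<psi> v1' v2' r s q \<phi>'.
          ((u1, u2), \<phi>, (u1', u2')) \<in> c_class \<alpha> \<and> ((v1, v2), \<psi>, (v1', v2')) \<in> c_class \<beta>
          \<and> r \<in> Arr C \<and> s \<in> Arr C \<and> Dom C r = Dom C s \<and> Cod C r = Dom C u1' \<and> Cod C s = Dom C v1
          \<and> Cmp C u1' r = Cmp C v1 s \<and> Cmp C u2' r = Cmp C v2 s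
          \<and> Cmp C (v_from (c_right \<alpha>)) (Cmp C u1' r) \<in> W
          \<and> q \<in> W \<and> \<phi>' \<in> Arr C \<and> Dom C q = Dom C \<phi>' \<and> Cod C q = Dom C \<phi> \<and> Cod C \<phi>' = Dom C r
          \<and> Cmp C \<phi> q = Cmp C r \<phi>'}))"

definition Frac :: "('o, 'a) cat \<Rightarrow> 'a set \<Rightarrow> ('a, 'a frac_vert, 'a frac_hor, 'a frac_cell) dblcat" where
  "Frac C W =
    \<lparr>cat0 =
       \<lparr>Obj = W, Arr = frac_verts C W, Dom = v_from, Cod = v_to,
        Ide = frac_vert_id C W, Cmp = frac_vert_comp C W\<rparr>,
     cat1 =
       \<lparr>Obj = frac_hors C W, Arr = frac_cells C W, Dom = c_top, Cod = c_bot,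
        Ide = frac_cell_vid C W, Cmp = frac_cell_vcomp C W\<rparr>,
     d0 = \<lparr>omap = h_from, amap = c_left\<rparr>,
     d1 = \<lparr>omap = h_to, amap = c_right\<rparr>,
     hid = \<lparr>omap = frac_hor_id C, amap = frac_cell_hid C W\<rparr>,
     hcmp = \<lparr>omap = (\<lambda>(g, f). frac_hor_comp C g f), amap = (\<lambda>(\<beta>, \<alpha>). frac_cell_hcomp C W \<beta> \<alpha>)\<rparr>\<rparr>"

definition J_ftr ::
  "('o, 'a) cat \<Rightarrow> 'a set \<Rightarrow> ('o, 'o, 'a, 'a, 'a, 'a frac_vert, 'a frac_hor, 'a frac_cell) dblftr" where
  "J_ftr C W =
    (let j = (\<lambda>f. Hor (Ide C (Dom C f)) (Ide C (Cod C f)) f) in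
     \<lparr>ftr0 = \<lparr>omap = Ide C, amap = (\<lambda>A. frac_vert_id C W (Ide C A))\<rparr>,
      ftr1 = \<lparr>omap = j, amap = (\<lambda>f. frac_cell_vid C W (j f))\<rparr>\<rparr>)"

section \<open>\<open>W\<close>-friendly functors and transformations\<close>

text \<open>An arrow \<open>(v, w') : w \<rightarrow> w'\<close> determines its domain \<open>w = w' v\<close>.\<close>

definition Nabla :: "('o, 'a) cat \<Rightarrow> 'a set \<Rightarrow> ('a, 'a \<times> 'a) cat" where
  "Nabla C W =
    \<lparr>Obj = W,
     Arr = {(v, w'). v \<in> Arr C \<and> w' \<in> W \<and> Cod C v = Dom C w' \<and> Cmp C w' v \<in> W},
     Dom = (\<lambda>(v, w'). Cmp C w' v),
     Cod = (\<lambda>(v, w'). w'),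
     Ide = (\<lambda>w. (Ide C (Dom C w), w)),
     Cmp = (\<lambda>(v', w'') (v, w'). (Cmp C v' v, w''))\<rparr>"

definition D0_ftr :: "('o, 'a) cat \<Rightarrow> ('a, 'a \<times> 'a, 'o, 'a) ftr" where
  "D0_ftr C = \<lparr>omap = Dom C, amap = fst\<rparr>"

definition hor_ftr :: "('o, 'v, 'h, 'c, 'p, 'w, 'k, 'e) dblftr \<Rightarrow> ('o, 'h, 'p, 'k) ftr" where
  "hor_ftr G = \<lparr>omap = omap (ftr0 G), amap = omap (ftr1 G)\<rparr>"

type_synonym ('o, 'a, 'p, 'v, 'h, 'c) friendly =
  "('o, 'o, 'a, 'a, 'p, 'v, 'h, 'c) dblftr
   \<times> ('a, 'a \<times> 'a, 'a, 'a \<times> 'a, 'p, ('v, 'h, 'c) companion, 'h,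
      ('v, 'h, 'c) companion \<times> 'c \<times> ('v, 'h, 'c) companion) dblftr
   \<times> ('a \<Rightarrow> 'h)"

type_synonym ('o, 'a, 'v, 'h, 'c) friendly_htrans =
  "('o, 'o, 'h, 'c) ftr
   \<times> ('a, 'a \<times> 'a, 'h, ('v, 'h, 'c) companion \<times> 'c \<times> ('v, 'h, 'c) companion) ftr"

text \<open>As \<open>cat1 (H_dbl C)\<close> has the arrows of \<open>C\<close> as objects, \<open>hor_ftr G\<close> is defined on \<open>C\<close>.\<close>

definition friendly_functors ::
  "('o, 'a) cat \<Rightarrow> 'a set \<Rightarrow> ('p, 'v, 'h, 'c) dblcat \<Rightarrow> ('o, 'a, 'p, 'v, 'h, 'c) friendly set" where
  "friendly_functors C W D = {(G, \<Gamma>, \<gamma>).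
     G \<in> dbl_functors (H_dbl C) D
     \<and> \<Gamma> \<in> dbl_functors (V_dbl (Nabla C W)) (Companions D)
     \<and> \<gamma> \<in> extensional W
     \<and> nat_iso (Nabla C W) (hor_cat D) (ftr_comp h_minus (ftr0 \<Gamma>)) (ftr_comp (hor_ftr G) (D0_ftr C)) \<gamma>}"

definition friendly_htrans ::
  "('o, 'a) cat \<Rightarrow> 'a set \<Rightarrow> ('p, 'v, 'h, 'c) dblcat \<Rightarrow> ('o, 'a, 'p, 'v, 'h, 'c) friendly
   \<Rightarrow> ('o, 'a, 'p, 'v, 'h, 'c) friendly \<Rightarrow> ('o, 'a, 'v, 'h, 'c) friendly_htrans set" where
  "friendly_htrans C W D = (\<lambda>(G, \<Gamma>, \<gamma>) (L, \<Lambda>, \<mu>). {(a, \<alpha>).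
     a \<in> htrans (H_dbl C) D G L
     \<and> \<alpha> \<in> htrans (V_dbl (Nabla C W)) (Companions D) \<Gamma> \<Lambda>
     \<and> (\<forall>w\<in>W. hcomp D (\<mu> w) (omap \<alpha> w) = hcomp D (omap a (Dom C w)) (\<gamma> w))})"

definition Hom_hW ::
  "('o, 'a) cat \<Rightarrow> 'a set \<Rightarrow> ('p, 'v, 'h, 'c) dblcat
   \<Rightarrow> (('o, 'a, 'p, 'v, 'h, 'c) friendly,
       ('o, 'a, 'p, 'v, 'h, 'c) friendly \<times> ('o, 'a, 'v, 'h, 'c) friendly_htrans
         \<times> ('o, 'a, 'p, 'v, 'h, 'c) friendly) cat" where
  "Hom_hW C W D =
    \<lparr>Obj = friendly_functors C W D,
     Arr = {(P, t, Q). P \<in> friendly_functors C W D \<and> Q \<in> friendly_functors C W D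
              \<and> t \<in> friendly_htrans C W D P Q},
     Dom = (\<lambda>(P, t, Q). P),
     Cod = (\<lambda>(P, t, Q). Q),
     Ide = (\<lambda>(G, \<Gamma>, \<gamma>). ((G, \<Gamma>, \<gamma>),
       (htrans_id (H_dbl C) D G, htrans_id (V_dbl (Nabla C W)) (Companions D) \<Gamma>), (G, \<Gamma>, \<gamma>))),
     Cmp = (\<lambda>(P', (b, \<beta>), Q) (P, (a, \<alpha>), Q').
       (P, (htrans_comp (H_dbl C) D b a, htrans_comp (V_dbl (Nabla C W)) (Companions D) \<beta> \<alpha>), Q))\<rparr>"

section \<open>The comparison functor\<close>

definition Phi_companion ::
  "('o, 'a) cat \<Rightarrow> 'a set \<Rightarrow> 'a \<times> 'a \<Rightarrow> ('a frac_vert, 'a frac_hor, 'a frac_cell) companion" where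
  "Phi_companion C W = (\<lambda>(u, w).
     let wu = Cmp C w u; i = Ide C (Dom C u); j = Ide C (Cod C u);
         h = Hor wu w u; v = frac_vert C W wu w (i, u) in
     Companion h v
       (frac_cell C W (frac_hor_id C wu) h (frac_vert_id C W wu) v ((i, i), i, (i, u)))
       (frac_cell C W h (frac_hor_id C w) v (frac_vert_id C W w) ((i, u), u, (j, j))))"

definition Phi_ftr ::
  "('o, 'a) cat \<Rightarrow> 'a set
   \<Rightarrow> ('a, 'a \<times> 'a, 'a, 'a \<times> 'a, 'a, ('a frac_vert, 'a frac_hor, 'a frac_cell) companion, 'a frac_hor,
       ('a frac_vert, 'a frac_hor, 'a frac_cell) companion \<times> 'a frac_cell
         \<times> ('a frac_vert, 'a frac_hor, 'a frac_cell) companion) dblftr" where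
  "Phi_ftr C W =
    (let F = \<lparr>omap = (\<lambda>w. w), amap = Phi_companion C W\<rparr> in
     \<lparr>ftr0 = F, ftr1 = ftr_comp (hid (Companions (Frac C W))) F\<rparr>)"

definition varphi :: "('o, 'a) cat \<Rightarrow> 'a \<Rightarrow> 'a frac_hor" where
  "varphi C w = Hor w (Ide C (Dom C w)) (Ide C (Dom C w))"

definition friendly_of ::
  "('o, 'a) cat \<Rightarrow> 'a set \<Rightarrow> ('a, 'a frac_vert, 'a frac_hor, 'a frac_cell, 'p, 'v, 'h, 'c) dblftr
   \<Rightarrow> ('o, 'a, 'p, 'v, 'h, 'c) friendly" where
  "friendly_of C W L =
    (dblftr_comp (H_dbl C) L (J_ftr C W),
     dblftr_comp (V_dbl (Nabla C W)) (Companions_ftr L) (Phi_ftr C W),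
     \<lambda>w\<in>W. omap (ftr1 L) (varphi C w))"

definition friendly_htrans_of ::
  "('o, 'a) cat \<Rightarrow> 'a set \<Rightarrow> ('a, 'a frac_vert, 'a frac_hor, 'a frac_cell, 'p, 'v, 'h, 'c) dblftr
   \<Rightarrow> ('a, 'a frac_vert, 'h, 'c) ftr \<Rightarrow> ('a, 'a frac_vert, 'a frac_hor, 'a frac_cell, 'p, 'v, 'h, 'c) dblftr
   \<Rightarrow> ('o, 'a, 'v, 'h, 'c) friendly_htrans" where
  "friendly_htrans_of C W L b L' =
    (htrans_whisker (H_dbl C) b (J_ftr C W),
     htrans_whisker (V_dbl (Nabla C W)) (Companions_htrans L b L') (Phi_ftr C W))"

definition comparison ::
  "('o, 'a) cat \<Rightarrow> 'a set
   \<Rightarrow> (('a, 'a frac_vert, 'a frac_hor, 'a frac_cell, 'p, 'v, 'h, 'c) dblftr,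
       ('a, 'a frac_vert, 'a frac_hor, 'a frac_cell, 'p, 'v, 'h, 'c) dblftr \<times> ('a, 'a frac_vert, 'h, 'c) ftr
         \<times> ('a, 'a frac_vert, 'a frac_hor, 'a frac_cell, 'p, 'v, 'h, 'c) dblftr,
       ('o, 'a, 'p, 'v, 'h, 'c) friendly,
       ('o, 'a, 'p, 'v, 'h, 'c) friendly \<times> ('o, 'a, 'v, 'h, 'c) friendly_htrans
         \<times> ('o, 'a, 'p, 'v, 'h, 'c) friendly) ftr" where
  "comparison C W =
    \<lparr>omap = friendly_of C W,
     amap = (\<lambda>(L, b, L'). (friendly_of C W L, friendly_htrans_of C W L b L', friendly_of C W L'))\<rparr>"

end

theory Submission
  imports Defs
begin

text \<open>By CF2, CF3 and the 2-out-of-3 property, vertical arrows and cells of \<open>C{W}\<close> are determined by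
  their boundaries, so all of its axioms are equations between boundaries. In a weakly globular \<open>D\<close>
  all vertical arrows are invertible, hence so are the binding cells of companions, and a cell of
  \<open>Comp(D)\<close> is a commutative square of horizontal arrows. Every vertical arrow of \<open>C{W}\<close> is a quotient
  \<open>[1, u\<^sub>2] \<cdot> [1, u\<^sub>1]\<^sup>-\<^sup>1\<close> of companions, and every cell is likewise a quotient of two companion cells.
  A \<open>W\<close>-friendly structure provides images of the companions, and these quotients extend it uniquely:
  this gives full faithfulness, and sending \<open>f : (w) \<rightarrow> (w')\<close> to \<open>\<gamma>(w')\<^sup>-\<^sup>1 G(f) \<gamma>(w)\<close> gives essential surjectivity.\<close>

section \<open>Isomorphisms and equivalences of categories\<close>

text \<open>Everything in \<open>Frac C W\<close> is compared by refining domains. The 2-out-of-3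
  property puts both legs of a span into \<open>W\<close>; CF2 then aligns any two legs with a
  common codomain, and CF3 equalises arrows that agree after an arrow of \<open>W\<close>. Hence an
  equivalence class consists of all representatives with the given boundary. This also tames the
  composites, which are unions over all choices: one explicit choice already yields the whole union.
  All that remains of a cell is whether a representative exists. The obstacle in mapping to
  \<open>D\<close> is that a cell is reached only through a representative. A representative
  restricts the top and the bottom horizontal arrow to one and the same arrow, so the cell is a
  quotient of two companion cells with a common top. A refinement multiplies both of them by the
  same invertible cell, which cancels; hence the quotient is well defined. The lift of a friendly
  functor reproduces \<open>\<Gamma>\<close> on the nose. The isomorphism of friendly functors is
  therefore an identity on the \<open>Nabla W\<close> part and moves only \<open>G\<close>, with
  components \<open>\<gamma> (Ide C x)\<close>.\<close>

definition inv_arr :: "('o, 'a) cat \<Rightarrow> 'a \<Rightarrow> 'a" where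
  "inv_arr C f = (SOME g. g \<in> Arr C \<and> Dom C g = Cod C f \<and> Cod C g = Dom C f
     \<and> Cmp C g f = Ide C (Dom C f) \<and> Cmp C f g = Ide C (Cod C f))"

context category
begin

lemmas cat_simps = Dom_closed Cod_closed Ide_closed Dom_Ide Cod_Ide Cmp_closed Dom_Cmp Cod_Cmp
  Cmp_Ide_right Cmp_Ide_left

lemma Cmp_Ide_right': "\<lbrakk>f \<in> Arr C; Dom C f = x\<rbrakk> \<Longrightarrow> Cmp C f (Ide C x) = f"
  using Cmp_Ide_right by blast

lemma Cmp_Ide_left': "\<lbrakk>f \<in> Arr C; Cod C f = x\<rbrakk> \<Longrightarrow> Cmp C (Ide C x) f = f"
  using Cmp_Ide_left by blast

lemma inv_arr:
  assumes "iso_arr C f"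
  shows "f \<in> Arr C" "inv_arr C f \<in> Arr C" "Dom C (inv_arr C f) = Cod C f"
    "Cod C (inv_arr C f) = Dom C f" "Cmp C (inv_arr C f) f = Ide C (Dom C f)"
    "Cmp C f (inv_arr C f) = Ide C (Cod C f)"
proof -
  show "f \<in> Arr C" using assms by (simp add: iso_arr_def)
  have "\<exists>g. g \<in> Arr C \<and> Dom C g = Cod C f \<and> Cod C g = Dom C f
     \<and> Cmp C g f = Ide C (Dom C f) \<and> Cmp C f g = Ide C (Cod C f)"
    using assms unfolding iso_arr_def by blast
  from someI_ex[OF this]
  show "inv_arr C f \<in> Arr C" "Dom C (inv_arr C f) = Cod C f"
    "Cod C (inv_arr C f) = Dom C f" "Cmp C (inv_arr C f) f = Ide C (Dom C f)"
    "Cmp C f (inv_arr C f) = Ide C (Cod C f)"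
    unfolding inv_arr_def by blast+
qed

lemma iso_arrI:
  assumes "f \<in> Arr C" "g \<in> Arr C" "Dom C g = Cod C f" "Cod C g = Dom C f"
    "Cmp C g f = Ide C (Dom C f)" "Cmp C f g = Ide C (Cod C f)"
  shows "iso_arr C f"
  using assms unfolding iso_arr_def by blast

lemma iso_inv_arr: "iso_arr C f \<Longrightarrow> iso_arr C (inv_arr C f)"
  by (rule iso_arrI[where g = f]) (simp_all add: inv_arr)

lemma iso_Ide: "x \<in> Obj C \<Longrightarrow> iso_arr C (Ide C x)"
  by (rule iso_arrI[where g = "Ide C x"]) (simp_all add: cat_simps Cmp_Ide_right')

lemma iso_cancel_right:
  assumes e: "iso_arr C e" and f: "f \<in> Arr C" "Dom C f = Cod C e"
    and g: "g \<in> Arr C" "Dom C g = Cod C e" and eq: "Cmp C f e = Cmp C g e"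
  shows "f = g"
proof -
  have "Cmp C (Cmp C f e) (inv_arr C e) = Cmp C (Cmp C g e) (inv_arr C e)" using eq by simp
  then show ?thesis
    using f g by (simp add: Cmp_assoc[symmetric] inv_arr[OF e] Cmp_Ide_right')
qed

lemma iso_cancel_left:
  assumes e: "iso_arr C e" and f: "f \<in> Arr C" "Cod C f = Dom C e"
    and g: "g \<in> Arr C" "Cod C g = Dom C e" and eq: "Cmp C e f = Cmp C e g"
  shows "f = g"
proof -
  have "Cmp C (inv_arr C e) (Cmp C e f) = Cmp C (inv_arr C e) (Cmp C e g)" using eq by simp
  then show ?thesis
    using f g by (simp add: Cmp_assoc inv_arr[OF e] Cmp_Ide_left')
qed

text \<open>As \<open>f\<close> is already known to be invertible, one of the two inverse equations
  suffices.\<close>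

lemma inv_arr_eqI:
  assumes "iso_arr C f" "g \<in> Arr C" "Dom C g = Cod C f" "Cod C g = Dom C f"
    "Cmp C g f = Ide C (Dom C f)"
  shows "inv_arr C f = g"
  by (rule iso_cancel_right[OF assms(1)]) (simp_all add: inv_arr[OF assms(1)] assms)

lemma inv_arr_Ide: "x \<in> Obj C \<Longrightarrow> inv_arr C (Ide C x) = Ide C x"
  by (rule inv_arr_eqI) (simp_all add: iso_Ide cat_simps Cmp_Ide_right')

lemma Cmp_inv_cancel:
  assumes "iso_arr C e" "f \<in> Arr C" "Dom C f = Cod C e"
  shows "Cmp C (Cmp C f e) (inv_arr C e) = f"
  using assms by (simp add: Cmp_assoc[symmetric] inv_arr Cmp_Ide_right')

lemma Cmp_inv_cancel':
  assumes "iso_arr C e" "f \<in> Arr C" "Dom C f = Dom C e"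
  shows "Cmp C (Cmp C f (inv_arr C e)) e = f"
  using assms by (simp add: Cmp_assoc[symmetric] inv_arr Cmp_Ide_right')

lemma iso_Cmp:
  assumes "iso_arr C f" "iso_arr C g" "Cod C f = Dom C g"
  shows "iso_arr C (Cmp C g f)"
proof (rule iso_arrI[where g = "Cmp C (inv_arr C f) (inv_arr C g)"])
  have "Cmp C (Cmp C (inv_arr C f) (inv_arr C g)) (Cmp C g f)
      = Cmp C (Cmp C (Cmp C (inv_arr C f) (inv_arr C g)) g) f"
    using assms by (simp add: inv_arr cat_simps Cmp_assoc)
  then show "Cmp C (Cmp C (inv_arr C f) (inv_arr C g)) (Cmp C g f) = Ide C (Dom C (Cmp C g f))"
    using assms by (simp add: Cmp_inv_cancel' inv_arr cat_simps)
  have "Cmp C (Cmp C g f) (Cmp C (inv_arr C f) (inv_arr C g))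
      = Cmp C (Cmp C (Cmp C g f) (inv_arr C f)) (inv_arr C g)"
    using assms by (simp add: inv_arr cat_simps Cmp_assoc)
  then show "Cmp C (Cmp C g f) (Cmp C (inv_arr C f) (inv_arr C g)) = Ide C (Cod C (Cmp C g f))"
    using assms by (simp add: Cmp_inv_cancel inv_arr cat_simps)
qed (use assms in \<open>simp_all add: inv_arr cat_simps\<close>)

end

section \<open>Functors on inverses, and a criterion for equivalences of categories\<close>

context cat_functor
begin

lemmas ftr_simps = omap_closed amap_closed Dom_amap Cod_amap amap_Ide

lemma amap_iso:
  assumes "iso_arr A f"
  shows "iso_arr B (amap F f)"
proof (rule B.iso_arrI[where g = "amap F (inv_arr A f)"])
  note i = A.inv_arr[OF assms]
  show "Cmp B (amap F (inv_arr A f)) (amap F f) = Ide B (Dom B (amap F f))"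
    using i by (simp add: amap_Cmp[symmetric] ftr_simps A.cat_simps)
  show "Cmp B (amap F f) (amap F (inv_arr A f)) = Ide B (Cod B (amap F f))"
    using i by (simp add: amap_Cmp[symmetric] ftr_simps A.cat_simps)
qed (use A.inv_arr[OF assms] in \<open>simp_all add: ftr_simps\<close>)

lemma amap_inv:
  assumes "iso_arr A f"
  shows "amap F (inv_arr A f) = inv_arr B (amap F f)"
  by (rule B.inv_arr_eqI[symmetric])
    (use amap_iso[OF assms] A.inv_arr[OF assms] in
      \<open>simp_all add: ftr_simps amap_Cmp[symmetric] A.cat_simps\<close>)

text \<open>The pseudo-inverse picks a preimage up to isomorphism for every object, and lifts every
  arrow after conjugation with the chosen isomorphisms. Its functor laws and the naturality of the
  unit are reflected along \<open>F\<close> by faithfulness.\<close>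

lemma equivalenceI:
  assumes faithful: "\<And>f g. \<lbrakk>f \<in> Arr A; g \<in> Arr A; Dom A f = Dom A g; Cod A f = Cod A g;
      amap F f = amap F g\<rbrakk> \<Longrightarrow> f = g"
    and full: "\<And>x y g. \<lbrakk>x \<in> Obj A; y \<in> Obj A; g \<in> Arr B; Dom B g = omap F x; Cod B g = omap F y\<rbrakk>
      \<Longrightarrow> \<exists>f\<in>Arr A. Dom A f = x \<and> Cod A f = y \<and> amap F f = g"
    and surj: "\<And>y. y \<in> Obj B \<Longrightarrow> \<exists>x\<in>Obj A. \<exists>e. iso_arr B e \<and> Dom B e = omap F x \<and> Cod B e = y"
  shows "cat_equivalence A B F"
proof -
  obtain g0 e where g0: "\<And>y. y \<in> Obj B \<Longrightarrow> g0 y \<in> Obj A"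
    and e: "\<And>y. y \<in> Obj B \<Longrightarrow> iso_arr B (e y)"
      "\<And>y. y \<in> Obj B \<Longrightarrow> Dom B (e y) = omap F (g0 y)" "\<And>y. y \<in> Obj B \<Longrightarrow> Cod B (e y) = y"
    using surj by metis
  note ei = B.inv_arr[OF e(1)]
  \<comment> \<open>Conjugation with the chosen isomorphisms makes \<open>t g\<close> an arrow
    between images of \<open>F\<close>, which is what fullness can lift.\<close>
  define t where "t = (\<lambda>g. Cmp B (inv_arr B (e (Cod B g))) (Cmp B g (e (Dom B g))))"
  have t: "t g \<in> Arr B" "Dom B (t g) = omap F (g0 (Dom B g))" "Cod B (t g) = omap F (g0 (Cod B g))"
    if "g \<in> Arr B" for g
    using that by (simp_all add: t_def ei e B.cat_simps)
  have "\<forall>g. \<exists>f. g \<in> Arr B \<longrightarrow> f \<in> Arr A \<and> Dom A f = g0 (Dom B g) \<and> Cod A f = g0 (Cod B g) \<and> amap F f = t g"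
    using full[OF g0 g0 t(1)] t by (metis B.Dom_closed B.Cod_closed)
  then obtain g1 where g1: "\<And>g. g \<in> Arr B \<Longrightarrow> g1 g \<in> Arr A" "\<And>g. g \<in> Arr B \<Longrightarrow> Dom A (g1 g) = g0 (Dom B g)"
    "\<And>g. g \<in> Arr B \<Longrightarrow> Cod A (g1 g) = g0 (Cod B g)" "\<And>g. g \<in> Arr B \<Longrightarrow> amap F (g1 g) = t g"
    by metis
  have et: "Cmp B (e (Cod B g)) (t g) = Cmp B g (e (Dom B g))" if "g \<in> Arr B" for g
    using that by (simp add: t_def ei e B.cat_simps B.Cmp_assoc B.Cmp_Ide_left')
  \<comment> \<open>The naturality square with \<open>e\<close> characterises \<open>t g\<close>,
    because \<open>e\<close> is invertible. Preservation of identities and composites is checked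
    through this property instead of by expanding inverses.\<close>
  have t_unique: "h = t g" if "g \<in> Arr B" "h \<in> Arr B" "Cod B h = omap F (g0 (Cod B g))"
    "Cmp B (e (Cod B g)) h = Cmp B g (e (Dom B g))" for g h
    by (rule B.iso_cancel_left[OF e(1)[of "Cod B g"]]) (use that et t e B.cat_simps in auto)
  define G where "G = \<lparr>omap = g0, amap = g1\<rparr>"
  have G: "cat_functor B A G"
  proof
    fix x assume "x \<in> Obj B"
    then show "amap G (Ide B x) = Ide A (omap G x)"
      by (auto intro!: faithful t_unique[symmetric]
          simp: G_def g1 g0 A.cat_simps B.cat_simps ftr_simps e ei B.Cmp_Ide_left' B.Cmp_Ide_right')
  next
    fix f g assume fg: "f \<in> Arr B" "g \<in> Arr B" "Cod B f = Dom B g"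
    have "Cmp B (t g) (t f) = t (Cmp B g f)"
    proof (rule t_unique)
      have "Cmp B (e (Cod B g)) (Cmp B (t g) (t f)) = Cmp B (Cmp B g (e (Dom B g))) (t f)"
        using fg by (simp add: B.Cmp_assoc B.cat_simps t e ei et)
      also have "\<dots> = Cmp B g (Cmp B (e (Cod B f)) (t f))"
        using fg by (simp add: B.Cmp_assoc B.cat_simps t e ei)
      also have "\<dots> = Cmp B (Cmp B g f) (e (Dom B f))"
        unfolding et[OF fg(1)] using fg by (simp add: B.Cmp_assoc B.cat_simps e ei)
      finally show "Cmp B (e (Cod B (Cmp B g f))) (Cmp B (t g) (t f)) = Cmp B (Cmp B g f) (e (Dom B (Cmp B g f)))"
        using fg by (simp add: B.cat_simps)
    qed (use fg in \<open>simp_all add: B.cat_simps t\<close>)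
    then show "amap G (Cmp B g f) = Cmp A (amap G g) (amap G f)"
      using fg by (auto intro!: faithful simp: G_def g1 A.cat_simps B.cat_simps amap_Cmp)
  qed (use g0 g1 B.cat_simps in \<open>auto simp: G_def\<close>)
  interpret G: cat_functor B A G by (rule G)
  have GF: "cat_functor A A (ftr_comp G F)" "cat_functor B B (ftr_comp F G)"
    by (unfold_locales; simp add: ftr_comp_def ftr_simps G.ftr_simps amap_Cmp G.amap_Cmp)+
  have I: "cat_functor A A ftr_id" "cat_functor B B ftr_id"
    by (unfold_locales; simp add: ftr_id_def A.cat_simps B.cat_simps)+
  have eps: "nat_iso B B (ftr_comp F G) ftr_id e"
    by (intro nat_iso.intro GF I nat_iso_axioms.intro)
      (simp_all add: e ftr_comp_def ftr_id_def G_def g1 et)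
  have "\<forall>x. \<exists>f. x \<in> Obj A \<longrightarrow> f \<in> Arr A \<and> Dom A f = x \<and> Cod A f = g0 (omap F x)
      \<and> amap F f = inv_arr B (e (omap F x))"
    using full[OF _ g0 ei(2)] ei e by (metis omap_closed)
  then obtain n where n: "\<And>x. x \<in> Obj A \<Longrightarrow> n x \<in> Arr A" "\<And>x. x \<in> Obj A \<Longrightarrow> Dom A (n x) = x"
    "\<And>x. x \<in> Obj A \<Longrightarrow> Cod A (n x) = g0 (omap F x)"
    "\<And>x. x \<in> Obj A \<Longrightarrow> amap F (n x) = inv_arr B (e (omap F x))" by metis
  \<comment> \<open>A lift of \<open>e\<close> in the direction opposite to \<open>n\<close>: it is
    the witness that the unit component \<open>n x\<close> is invertible.\<close>
  have "\<forall>x. \<exists>f. x \<in> Obj A \<longrightarrow> f \<in> Arr A \<and> Dom A f = g0 (omap F x) \<and> Cod A f = x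
      \<and> amap F f = e (omap F x)"
    using full[OF g0 _ ei(1)] ei e by (metis omap_closed)
  then obtain m where m: "\<And>x. x \<in> Obj A \<Longrightarrow> m x \<in> Arr A" "\<And>x. x \<in> Obj A \<Longrightarrow> Dom A (m x) = g0 (omap F x)"
    "\<And>x. x \<in> Obj A \<Longrightarrow> Cod A (m x) = x"
    "\<And>x. x \<in> Obj A \<Longrightarrow> amap F (m x) = e (omap F x)" by metis
  have eta: "nat_iso A A ftr_id (ftr_comp G F) n"
  proof (intro nat_iso.intro GF I nat_iso_axioms.intro)
    fix x assume x: "x \<in> Obj A"
    show "iso_arr A (n x)"
      by (rule A.iso_arrI[where g = "m x"])
        (use x in \<open>auto intro!: faithful simp: n m g0 A.cat_simps amap_Cmp ftr_simps ei e\<close>)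
  next
    fix f assume f: "f \<in> Arr A"
    have "Cmp B (inv_arr B (e (Cod B (amap F f)))) (amap F f)
        = Cmp B (t (amap F f)) (inv_arr B (e (Dom B (amap F f))))"
      using f by (simp add: t_def ei e B.cat_simps ftr_simps A.cat_simps B.Cmp_assoc B.Cmp_inv_cancel del: Dom_amap Cod_amap)
    then show "Cmp A (n (Cod A f)) (amap ftr_id f) = Cmp A (amap (ftr_comp G F) f) (n (Dom A f))"
      using f by (auto intro!: faithful simp: ftr_id_def ftr_comp_def G_def n g1 A.cat_simps ftr_simps amap_Cmp)
  qed (simp_all add: n ftr_id_def ftr_comp_def G_def)
  show ?thesis
    unfolding cat_equivalence_def using cat_functor_axioms G eta eps by blast
qed

end

section \<open>Restricted and composite functors, discrete categories, pullbacks\<close>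

lemma ftr_restrict_functor:
  assumes "cat_functor A B F"
  shows "cat_functor A B (ftr_restrict A F)"
proof -
  interpret cat_functor A B F by fact
  show ?thesis
    by unfold_locales (simp_all add: ftr_restrict_def ftr_simps A.cat_simps amap_Cmp)
qed

lemma ftr_comp_functor:
  assumes "cat_functor A B F" "cat_functor B E G"
  shows "cat_functor A E (ftr_comp G F)"
proof -
  interpret F: cat_functor A B F by fact
  interpret G: cat_functor B E G by fact
  show ?thesis
    by unfold_locales (simp_all add: ftr_comp_def F.ftr_simps G.ftr_simps F.amap_Cmp G.amap_Cmp)
qed

lemma discrete_category: "category (discrete_cat S)"
  by unfold_locales (simp_all add: discrete_cat_def)

text \<open>A functor to a discrete category sends \<open>f\<close> to an identity. Naturality of
  the unit \<open>n\<close> at \<open>f\<close> therefore reads \<open>n (Cod f)\<close> after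
  \<open>f\<close> equals \<open>n (Dom f)\<close>, which writes \<open>f\<close> as a composite of
  isomorphisms.\<close>

lemma equivalence_discrete_iso:
  assumes "cat_equivalence A (discrete_cat S) F" "f \<in> Arr A"
  shows "iso_arr A f"
proof -
  obtain G n where F: "cat_functor A (discrete_cat S) F" and G: "cat_functor (discrete_cat S) A G"
    and n: "nat_iso A A ftr_id (ftr_comp G F) n"
    using assms(1) unfolding cat_equivalence_def by blast
  interpret F: cat_functor A "discrete_cat S" F by (rule F)
  interpret G: cat_functor "discrete_cat S" A G by (rule G)
  interpret n: nat_iso A A ftr_id "ftr_comp G F" n by (rule n)
  have iso: "iso_arr A (n x)" if "x \<in> Obj A" for x using n.iso_component that .
  have "amap F f = Ide (discrete_cat S) (omap F (Dom A f))"
    using F.Dom_amap[OF assms(2)] by (simp add: discrete_cat_def)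
  then have "amap G (amap F f) = Ide A (omap G (omap F (Dom A f)))"
    using F.A.Dom_closed[OF assms(2)] by (simp add: G.amap_Ide F.omap_closed)
  then have "Cmp A (n (Cod A f)) f = n (Dom A f)"
    using n.naturality[OF assms(2)] assms(2) n.Cod_component iso[THEN F.A.inv_arr(1)]
    by (simp add: ftr_id_def ftr_comp_def F.A.cat_simps F.A.Cmp_Ide_left')
  then have "f = Cmp A (inv_arr A (n (Cod A f))) (n (Dom A f))"
    using assms(2) F.A.inv_arr[OF iso] n.Dom_component n.Cod_component
    by (metis F.A.Cmp_Ide_left F.A.Cmp_assoc F.A.Cod_closed ftr.select_convs(1) ftr_id_def)
  moreover have "iso_arr A (Cmp A (inv_arr A (n (Cod A f))) (n (Dom A f)))"
  proof (rule F.A.iso_Cmp)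
    show "Cod A (n (Dom A f)) = Dom A (inv_arr A (n (Cod A f)))"
      using assms(2) F.A.inv_arr[OF iso] \<open>Cmp A (n (Cod A f)) f = n (Dom A f)\<close>
      by (metis F.A.Cod_Cmp F.A.Cod_closed ftr.select_convs(1) ftr_id_def n.Dom_component)
  qed (use assms(2) iso F.A.iso_inv_arr F.A.cat_simps in auto)
  ultimately show ?thesis by simp
qed

lemma pullback_category:
  assumes "cat_functor A Q F" "cat_functor B Q G"
  shows "category (pullback A B F G)"
proof -
  interpret F: cat_functor A Q F by fact
  interpret G: cat_functor B Q G by fact
  show ?thesis
    by unfold_locales
      (auto simp: pullback_def F.A.cat_simps G.A.cat_simps F.A.Cmp_assoc G.A.Cmp_assoc F.ftr_simps G.ftr_simps
        F.amap_Cmp G.amap_Cmp simp flip: F.Dom_amap F.Cod_amap G.Dom_amap G.Cod_amap)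
qed

section \<open>Double categories and companions\<close>

context double_category
begin

sublocale D0: cat_functor "cat1 X" "cat0 X" "d0 X" by (rule d0_functor)
sublocale D1: cat_functor "cat1 X" "cat0 X" "d1 X" by (rule d1_functor)
sublocale HI: cat_functor "cat0 X" "cat1 X" "hid X" by (rule hid_functor)
sublocale HC: cat_functor "pullback (cat1 X) (cat1 X) (d0 X) (d1 X)" "cat1 X" "hcmp X"
  by (rule hcmp_functor)

lemma hcomp_closed:
  "\<lbrakk>f \<in> Obj (cat1 X); g \<in> Obj (cat1 X); omap (d0 X) g = omap (d1 X) f\<rbrakk> \<Longrightarrow> hcomp X g f \<in> Obj (cat1 X)"
  by (rule HC.omap_closed) (simp add: pullback_def)

lemma ccomp_closed:
  "\<lbrakk>\<alpha> \<in> Arr (cat1 X); \<beta> \<in> Arr (cat1 X); amap (d0 X) \<beta> = amap (d1 X) \<alpha>\<rbrakk> \<Longrightarrow> ccomp X \<beta> \<alpha> \<in> Arr (cat1 X)"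
  by (rule HC.amap_closed) (simp add: pullback_def)

lemma Dom_ccomp:
  "\<lbrakk>\<alpha> \<in> Arr (cat1 X); \<beta> \<in> Arr (cat1 X); amap (d0 X) \<beta> = amap (d1 X) \<alpha>\<rbrakk>
    \<Longrightarrow> Dom (cat1 X) (ccomp X \<beta> \<alpha>) = hcomp X (Dom (cat1 X) \<beta>) (Dom (cat1 X) \<alpha>)"
  using HC.Dom_amap[of "(\<beta>, \<alpha>)"] by (simp add: pullback_def)

lemma Cod_ccomp:
  "\<lbrakk>\<alpha> \<in> Arr (cat1 X); \<beta> \<in> Arr (cat1 X); amap (d0 X) \<beta> = amap (d1 X) \<alpha>\<rbrakk>
    \<Longrightarrow> Cod (cat1 X) (ccomp X \<beta> \<alpha>) = hcomp X (Cod (cat1 X) \<beta>) (Cod (cat1 X) \<alpha>)"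
  using HC.Cod_amap[of "(\<beta>, \<alpha>)"] by (simp add: pullback_def)

lemma ccomp_Ide:
  "\<lbrakk>f \<in> Obj (cat1 X); g \<in> Obj (cat1 X); omap (d0 X) g = omap (d1 X) f\<rbrakk>
    \<Longrightarrow> ccomp X (Ide (cat1 X) g) (Ide (cat1 X) f) = Ide (cat1 X) (hcomp X g f)"
  using HC.amap_Ide[of "(g, f)"] by (simp add: pullback_def)

text \<open>The middle-four law is functoriality of \<open>hcmp\<close> on composable pairs in the
  pullback.\<close>

lemma interchange:
  "\<lbrakk>\<alpha> \<in> Arr (cat1 X); \<alpha>' \<in> Arr (cat1 X); \<beta> \<in> Arr (cat1 X); \<beta>' \<in> Arr (cat1 X);
    Cod (cat1 X) \<alpha> = Dom (cat1 X) \<alpha>'; Cod (cat1 X) \<beta> = Dom (cat1 X) \<beta>';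
    amap (d0 X) \<beta> = amap (d1 X) \<alpha>; amap (d0 X) \<beta>' = amap (d1 X) \<alpha>'\<rbrakk>
    \<Longrightarrow> ccomp X (Cmp (cat1 X) \<beta>' \<beta>) (Cmp (cat1 X) \<alpha>' \<alpha>)
      = Cmp (cat1 X) (ccomp X \<beta>' \<alpha>') (ccomp X \<beta> \<alpha>)"
  using HC.amap_Cmp[of "(\<beta>, \<alpha>)" "(\<beta>', \<alpha>')"] by (simp add: pullback_def)

lemma ccomp_hid_right': "\<lbrakk>\<alpha> \<in> Arr (cat1 X); amap (d0 X) \<alpha> = v\<rbrakk> \<Longrightarrow> ccomp X \<alpha> (amap (hid X) v) = \<alpha>"
  using ccomp_hid_right by blast

lemma ccomp_hid_left': "\<lbrakk>\<alpha> \<in> Arr (cat1 X); amap (d1 X) \<alpha> = v\<rbrakk> \<Longrightarrow> ccomp X (amap (hid X) v) \<alpha> = \<alpha>"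
  using ccomp_hid_left by blast

lemma hcomp_hid_right': "\<lbrakk>f \<in> Obj (cat1 X); omap (d0 X) f = A\<rbrakk> \<Longrightarrow> hcomp X f (omap (hid X) A) = f"
  using hcomp_hid_right by blast

lemma hcomp_hid_left': "\<lbrakk>f \<in> Obj (cat1 X); omap (d1 X) f = A\<rbrakk> \<Longrightarrow> hcomp X (omap (hid X) A) f = f"
  using hcomp_hid_left by blast

lemma ccomp_Ide_hid_right:
  "\<lbrakk>\<alpha> \<in> Arr (cat1 X); amap (d0 X) \<alpha> = Ide (cat0 X) A; A \<in> Obj (cat0 X)\<rbrakk>
    \<Longrightarrow> ccomp X \<alpha> (Ide (cat1 X) (omap (hid X) A)) = \<alpha>"
  by (simp add: HI.amap_Ide[symmetric] ccomp_hid_right')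

lemma ccomp_Ide_hid_left:
  "\<lbrakk>\<alpha> \<in> Arr (cat1 X); amap (d1 X) \<alpha> = Ide (cat0 X) A; A \<in> Obj (cat0 X)\<rbrakk>
    \<Longrightarrow> ccomp X (Ide (cat1 X) (omap (hid X) A)) \<alpha> = \<alpha>"
  by (simp add: HI.amap_Ide[symmetric] ccomp_hid_left')

lemmas dbl_simps = D0.A.cat_simps D0.B.cat_simps D0.ftr_simps D1.ftr_simps HI.ftr_simps
  D0.amap_Cmp D1.amap_Cmp
  hcomp_closed ccomp_closed Dom_ccomp Cod_ccomp d0_hid d1_hid d0_hid_v d1_hid_v d0_hcomp d1_hcomp
  d0_ccomp d1_ccomp hcomp_hid_right' hcomp_hid_left' ccomp_hid_right' ccomp_hid_left'
  ccomp_Ide_hid_right ccomp_Ide_hid_left ccomp_Ide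
  D0.A.Cmp_Ide_left' D0.A.Cmp_Ide_right' D0.B.Cmp_Ide_left' D0.B.Cmp_Ide_right'

lemma hor_category: "category (hor_cat X)"
  by unfold_locales (simp_all add: hor_cat_def dbl_simps hcomp_assoc)

section \<open>Companion pairs and their composition\<close>

lemma companionD:
  assumes "is_companion X \<theta>"
  shows "comp_h \<theta> \<in> Obj (cat1 X)" "comp_v \<theta> \<in> Arr (cat0 X)"
    "omap (d0 X) (comp_h \<theta>) = Dom (cat0 X) (comp_v \<theta>)"
    "omap (d1 X) (comp_h \<theta>) = Cod (cat0 X) (comp_v \<theta>)"
    "comp_psi \<theta> \<in> Arr (cat1 X)"
    "Dom (cat1 X) (comp_psi \<theta>) = omap (hid X) (Dom (cat0 X) (comp_v \<theta>))"
    "Cod (cat1 X) (comp_psi \<theta>) = comp_h \<theta>"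
    "amap (d0 X) (comp_psi \<theta>) = Ide (cat0 X) (Dom (cat0 X) (comp_v \<theta>))"
    "amap (d1 X) (comp_psi \<theta>) = comp_v \<theta>"
    "comp_chi \<theta> \<in> Arr (cat1 X)"
    "Dom (cat1 X) (comp_chi \<theta>) = comp_h \<theta>"
    "Cod (cat1 X) (comp_chi \<theta>) = omap (hid X) (Cod (cat0 X) (comp_v \<theta>))"
    "amap (d0 X) (comp_chi \<theta>) = comp_v \<theta>"
    "amap (d1 X) (comp_chi \<theta>) = Ide (cat0 X) (Cod (cat0 X) (comp_v \<theta>))"
    "ccomp X (comp_chi \<theta>) (comp_psi \<theta>) = Ide (cat1 X) (comp_h \<theta>)"
    "Cmp (cat1 X) (comp_chi \<theta>) (comp_psi \<theta>) = amap (hid X) (comp_v \<theta>)"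
  using assms by (auto simp: is_companion_def Let_def)

lemma companion_id: "A \<in> Obj (cat0 X) \<Longrightarrow> is_companion X (companion_id X A)"
  by (simp add: is_companion_def companion_id_def dbl_simps)

text \<open>Both binding equations reduce to those of the factors. Vertically, the two middle cells
  change places, so that the pairs belonging to one companion become adjacent. Horizontally,
  interchange splits the pasting into two factors, each of which collapses to an identity.\<close>

lemma companion_comp:
  assumes t: "is_companion X \<theta>" and s: "is_companion X \<sigma>"
    and ts: "Cod (cat0 X) (comp_v \<theta>) = Dom (cat0 X) (comp_v \<sigma>)"
  shows "is_companion X (companion_comp X \<sigma> \<theta>)"
proof -
  note T = companionD[OF t] and S = companionD[OF s]
  let ?h = "comp_h \<theta>" and ?k = "comp_h \<sigma>" and ?P = "comp_psi \<theta>" and ?Q = "comp_psi \<sigma>"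
    and ?R = "comp_chi \<theta>" and ?S = "comp_chi \<sigma>" and ?v = "comp_v \<theta>" and ?w = "comp_v \<sigma>"
  let ?I = "Ide (cat1 X)"
  let ?B = "Dom (cat0 X) ?w"
  \<comment> \<open>The two middle cells overlap only in a horizontal identity, so interchange lets
    them slide past each other.\<close>
  have qr: "Cmp (cat1 X) (ccomp X (?I ?k) ?R) (ccomp X ?Q (?I ?h)) = Cmp (cat1 X) ?Q ?R"
  proof -
    have "Cmp (cat1 X) (ccomp X (?I ?k) ?R) (ccomp X ?Q (?I ?h))
        = ccomp X (Cmp (cat1 X) (?I ?k) ?Q) (Cmp (cat1 X) ?R (?I ?h))"
      by (rule interchange[symmetric]) (simp_all add: S T dbl_simps ts)
    also have "\<dots> = ccomp X (Cmp (cat1 X) ?Q (?I (omap (hid X) ?B))) (Cmp (cat1 X) (?I (omap (hid X) ?B)) ?R)"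
      by (simp add: S T dbl_simps ts)
    also have "\<dots> = Cmp (cat1 X) (ccomp X ?Q (?I (omap (hid X) ?B))) (ccomp X (?I (omap (hid X) ?B)) ?R)"
      by (rule interchange) (simp_all add: S T dbl_simps ts)
    finally show ?thesis by (simp add: S T dbl_simps ts)
  qed
  have "Cmp (cat1 X) (Cmp (cat1 X) ?S (ccomp X (?I ?k) ?R)) (Cmp (cat1 X) (ccomp X ?Q (?I ?h)) ?P)
      = Cmp (cat1 X) (Cmp (cat1 X) ?S (Cmp (cat1 X) (ccomp X (?I ?k) ?R) (ccomp X ?Q (?I ?h)))) ?P"
    by (simp add: S T dbl_simps ts D0.A.Cmp_assoc)
  also have "\<dots> = Cmp (cat1 X) (Cmp (cat1 X) ?S ?Q) (Cmp (cat1 X) ?R ?P)"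
    unfolding qr by (simp add: S(1-15) T(1-15) dbl_simps ts D0.A.Cmp_assoc)
  also have "\<dots> = amap (hid X) (Cmp (cat0 X) ?w ?v)"
    by (simp add: S T dbl_simps ts HI.amap_Cmp)
  finally have 1: "Cmp (cat1 X) (Cmp (cat1 X) ?S (ccomp X (?I ?k) ?R)) (Cmp (cat1 X) (ccomp X ?Q (?I ?h)) ?P)
      = amap (hid X) (Cmp (cat0 X) ?w ?v)" .
  have "ccomp X (Cmp (cat1 X) ?S (ccomp X (?I ?k) ?R)) (Cmp (cat1 X) (ccomp X ?Q (?I ?h)) ?P)
      = Cmp (cat1 X) (ccomp X ?S (ccomp X ?Q (?I ?h))) (ccomp X (ccomp X (?I ?k) ?R) ?P)"
    by (rule interchange) (simp_all add: S T dbl_simps ts)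
  also have "ccomp X ?S (ccomp X ?Q (?I ?h)) = ?I (hcomp X ?k ?h)"
    by (simp add: S T dbl_simps ts ccomp_assoc)
  also have "ccomp X (ccomp X (?I ?k) ?R) ?P = ?I (hcomp X ?k ?h)"
    by (simp add: S T dbl_simps ts ccomp_assoc[symmetric])
  finally have 2: "ccomp X (Cmp (cat1 X) ?S (ccomp X (?I ?k) ?R)) (Cmp (cat1 X) (ccomp X ?Q (?I ?h)) ?P)
      = ?I (hcomp X ?k ?h)"
    by (simp add: S T dbl_simps ts)
  show ?thesis
    by (simp add: is_companion_def companion_comp_def 1 2)
      (simp add: S T dbl_simps ts)
qed

lemma companion_comp_simps:
  "comp_h (companion_comp X \<sigma> \<theta>) = hcomp X (comp_h \<sigma>) (comp_h \<theta>)"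
  "comp_v (companion_comp X \<sigma> \<theta>) = Cmp (cat0 X) (comp_v \<sigma>) (comp_v \<theta>)"
  "comp_h (companion_id X A) = omap (hid X) A"
  "comp_v (companion_id X A) = Ide (cat0 X) A"
  "comp_psi (companion_id X A) = Ide (cat1 X) (omap (hid X) A)"
  "comp_chi (companion_id X A) = Ide (cat1 X) (omap (hid X) A)"
  by (simp_all add: companion_comp_def companion_id_def)

section \<open>Cells of the companion double category as commutative squares of horizontal
  arrows\<close>

definition companion_square ::
  "'h \<Rightarrow> 'h \<Rightarrow> ('v, 'h, 'c) companion \<Rightarrow> ('v, 'h, 'c) companion \<Rightarrow> bool" where
  "companion_square f g \<theta> \<theta>' \<longleftrightarrow> is_companion X \<theta> \<and> is_companion X \<theta>'
     \<and> f \<in> Obj (cat1 X) \<and> g \<in> Obj (cat1 X)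
     \<and> omap (d0 X) f = Dom (cat0 X) (comp_v \<theta>) \<and> omap (d0 X) g = Cod (cat0 X) (comp_v \<theta>)
     \<and> omap (d1 X) f = Dom (cat0 X) (comp_v \<theta>') \<and> omap (d1 X) g = Cod (cat0 X) (comp_v \<theta>')
     \<and> hcomp X (comp_h \<theta>') f = hcomp X g (comp_h \<theta>)"

text \<open>The upper row is \<open>\<psi>\<close> of the right side after \<open>f\<close>, the
  lower row is \<open>g\<close> after \<open>\<chi>\<close> of the left side. The rows can be glued
  because the square of horizontal arrows commutes.\<close>

definition companion_cell :: "'h \<Rightarrow> 'h \<Rightarrow> ('v, 'h, 'c) companion \<Rightarrow> ('v, 'h, 'c) companion \<Rightarrow> 'c" where
  "companion_cell f g \<theta> \<theta>' = Cmp (cat1 X) (ccomp X (Ide (cat1 X) g) (comp_chi \<theta>))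
     (ccomp X (comp_psi \<theta>') (Ide (cat1 X) f))"

lemma companion_squareD:
  assumes "companion_square f g \<theta> \<theta>'"
  shows "is_companion X \<theta>" "is_companion X \<theta>'" "f \<in> Obj (cat1 X)" "g \<in> Obj (cat1 X)"
    "omap (d0 X) f = Dom (cat0 X) (comp_v \<theta>)" "omap (d0 X) g = Cod (cat0 X) (comp_v \<theta>)"
    "omap (d1 X) f = Dom (cat0 X) (comp_v \<theta>')" "omap (d1 X) g = Cod (cat0 X) (comp_v \<theta>')"
    "hcomp X (comp_h \<theta>') f = hcomp X g (comp_h \<theta>)"
  using assms by (auto simp: companion_square_def)

lemma companion_cell_sides:
  assumes "companion_square f g \<theta> \<theta>'"
  shows "companion_cell f g \<theta> \<theta>' \<in> Arr (cat1 X)"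
    "Dom (cat1 X) (companion_cell f g \<theta> \<theta>') = f"
    "Cod (cat1 X) (companion_cell f g \<theta> \<theta>') = g"
    "amap (d0 X) (companion_cell f g \<theta> \<theta>') = comp_v \<theta>"
    "amap (d1 X) (companion_cell f g \<theta> \<theta>') = comp_v \<theta>'"
proof -
  note S = companion_squareD[OF assms]
  note S = S companionD[OF S(1)] companionD[OF S(2)]
  show "companion_cell f g \<theta> \<theta>' \<in> Arr (cat1 X)"
    "Dom (cat1 X) (companion_cell f g \<theta> \<theta>') = f"
    "Cod (cat1 X) (companion_cell f g \<theta> \<theta>') = g"
    "amap (d0 X) (companion_cell f g \<theta> \<theta>') = comp_v \<theta>"
    "amap (d1 X) (companion_cell f g \<theta> \<theta>') = comp_v \<theta>'"
    by (simp_all add: companion_cell_def S dbl_simps)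
qed

lemma companion_cell_psi:
  assumes "companion_square f g \<theta> \<theta>'"
  shows "ccomp X (companion_cell f g \<theta> \<theta>') (comp_psi \<theta>) = ccomp X (comp_psi \<theta>') (Ide (cat1 X) f)"
proof -
  note S = companion_squareD[OF assms]
  note S = S companionD[OF S(1)] companionD[OF S(2)]
  let ?i = "Ide (cat1 X) (omap (hid X) (Dom (cat0 X) (comp_v \<theta>)))"
  \<comment> \<open>Padding \<open>\<psi>\<close> with a vertical identity exhibits both factors as
    vertical composites. Interchange then brings \<open>\<chi>\<close> and \<open>\<psi>\<close> of
    the left side together, where they cancel.\<close>
  have "ccomp X (companion_cell f g \<theta> \<theta>') (comp_psi \<theta>)
      = ccomp X (companion_cell f g \<theta> \<theta>') (Cmp (cat1 X) (comp_psi \<theta>) ?i)"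
    by (simp add: S dbl_simps)
  also have "\<dots> = Cmp (cat1 X) (ccomp X (ccomp X (Ide (cat1 X) g) (comp_chi \<theta>)) (comp_psi \<theta>))
      (ccomp X (ccomp X (comp_psi \<theta>') (Ide (cat1 X) f)) ?i)"
    unfolding companion_cell_def by (rule interchange) (simp_all add: S dbl_simps)
  also have "ccomp X (ccomp X (Ide (cat1 X) g) (comp_chi \<theta>)) (comp_psi \<theta>) = Ide (cat1 X) (hcomp X g (comp_h \<theta>))"
    by (simp add: S dbl_simps ccomp_assoc[symmetric])
  finally show ?thesis by (simp add: S dbl_simps)
qed

lemma companion_cell_chi:
  assumes "companion_square f g \<theta> \<theta>'"
  shows "ccomp X (comp_chi \<theta>') (companion_cell f g \<theta> \<theta>') = ccomp X (Ide (cat1 X) g) (comp_chi \<theta>)"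
proof -
  note S = companion_squareD[OF assms]
  note S = S companionD[OF S(1)] companionD[OF S(2)]
  let ?i = "Ide (cat1 X) (omap (hid X) (Cod (cat0 X) (comp_v \<theta>')))"
  have "ccomp X (comp_chi \<theta>') (companion_cell f g \<theta> \<theta>')
      = ccomp X (Cmp (cat1 X) ?i (comp_chi \<theta>')) (companion_cell f g \<theta> \<theta>')"
    by (simp add: S dbl_simps)
  also have "\<dots> = Cmp (cat1 X) (ccomp X ?i (ccomp X (Ide (cat1 X) g) (comp_chi \<theta>)))
      (ccomp X (comp_chi \<theta>') (ccomp X (comp_psi \<theta>') (Ide (cat1 X) f)))"
    unfolding companion_cell_def by (rule interchange) (simp_all add: S dbl_simps)
  also have "ccomp X (comp_chi \<theta>') (ccomp X (comp_psi \<theta>') (Ide (cat1 X) f)) = Ide (cat1 X) (hcomp X (comp_h \<theta>') f)"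
    by (simp add: S dbl_simps ccomp_assoc)
  finally show ?thesis by (simp add: S dbl_simps)
qed

text \<open>A cell is determined by its composite with the binding cell of its left side, because that
  binding cell is split by the other one in both directions.\<close>

lemma companion_cell_unique:
  assumes "companion_square f g \<theta> \<theta>'" and T: "\<Theta> \<in> Arr (cat1 X)" "Dom (cat1 X) \<Theta> = f" "Cod (cat1 X) \<Theta> = g"
    "amap (d0 X) \<Theta> = comp_v \<theta>" "amap (d1 X) \<Theta> = comp_v \<theta>'"
    and psi: "ccomp X \<Theta> (comp_psi \<theta>) = ccomp X (comp_psi \<theta>') (Ide (cat1 X) f)"
  shows "\<Theta> = companion_cell f g \<theta> \<theta>'"
proof -
  note S = companion_squareD[OF assms(1)]
  note S = S companionD[OF S(1)] companionD[OF S(2)]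
  have "companion_cell f g \<theta> \<theta>' = Cmp (cat1 X) (ccomp X (Ide (cat1 X) g) (comp_chi \<theta>)) (ccomp X \<Theta> (comp_psi \<theta>))"
    by (simp add: companion_cell_def psi)
  also have "\<dots> = ccomp X (Cmp (cat1 X) (Ide (cat1 X) g) \<Theta>) (Cmp (cat1 X) (comp_chi \<theta>) (comp_psi \<theta>))"
    by (rule interchange[symmetric]) (simp_all add: S T dbl_simps)
  also have "\<dots> = \<Theta>" by (simp add: S T dbl_simps)
  finally show ?thesis ..
qed

text \<open>The binding equations leave no freedom: uniqueness identifies the cell with the pasted
  one. Statements about cells of \<open>Companions X\<close> thus become statements about squares of
  horizontal arrows.\<close>

lemma is_companion_cell_iff:
  "is_companion_cell X (\<theta>, \<Theta>, \<theta>') \<longleftrightarrow>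
    (\<exists>f g. companion_square f g \<theta> \<theta>' \<and> \<Theta> = companion_cell f g \<theta> \<theta>')" (is "?l \<longleftrightarrow> ?r")
proof
  assume ?l
  then have l: "is_companion X \<theta>" "is_companion X \<theta>'" "\<Theta> \<in> Arr (cat1 X)" "amap (d0 X) \<Theta> = comp_v \<theta>"
    "amap (d1 X) \<Theta> = comp_v \<theta>'"
    "hcomp X (comp_h \<theta>') (Dom (cat1 X) \<Theta>) = hcomp X (Cod (cat1 X) \<Theta>) (comp_h \<theta>)"
    "ccomp X \<Theta> (comp_psi \<theta>) = ccomp X (comp_psi \<theta>') (Ide (cat1 X) (Dom (cat1 X) \<Theta>))"
    by (auto simp: is_companion_cell_def Let_def)
  then have "companion_square (Dom (cat1 X) \<Theta>) (Cod (cat1 X) \<Theta>) \<theta> \<theta>'"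
    by (simp add: companion_square_def D0.A.cat_simps flip: D0.Dom_amap D0.Cod_amap D1.Dom_amap D1.Cod_amap)
  with l companion_cell_unique[OF this] show ?r by auto
next
  assume ?r
  then obtain f g where "companion_square f g \<theta> \<theta>'" "\<Theta> = companion_cell f g \<theta> \<theta>'" by blast
  then show ?l
    using companion_squareD companion_cell_sides companion_cell_psi companion_cell_chi
    by (simp add: is_companion_cell_def)
qed

lemma is_companion_cell_iff':
  "is_companion_cell X (\<theta>, \<Theta>, \<theta>') \<longleftrightarrow>
    companion_square (Dom (cat1 X) \<Theta>) (Cod (cat1 X) \<Theta>) \<theta> \<theta>'
    \<and> \<Theta> = companion_cell (Dom (cat1 X) \<Theta>) (Cod (cat1 X) \<Theta>) \<theta> \<theta>'"
  unfolding is_companion_cell_iff using companion_cell_sides by metis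

lemma companion_square_hcomp:
  assumes "companion_square f g \<theta> \<theta>'" "companion_square f' g' \<theta>' \<theta>''"
  shows "companion_square (hcomp X f' f) (hcomp X g' g) \<theta> \<theta>''"
proof -
  note S = companion_squareD[OF assms(1)] companion_squareD[OF assms(2)]
  note S = S companionD[OF S(1)] companionD[OF S(2)] companionD[OF S(11)]
  have "hcomp X (comp_h \<theta>'') (hcomp X f' f) = hcomp X (hcomp X (comp_h \<theta>'') f') f"
    by (simp add: S dbl_simps hcomp_assoc)
  also have "\<dots> = hcomp X g' (hcomp X (comp_h \<theta>') f)" 
    unfolding S(18) by (simp add: S(1-8,10-17,19-) dbl_simps hcomp_assoc)
  also have "\<dots> = hcomp X (hcomp X g' g) (comp_h \<theta>)" by (simp add: S dbl_simps hcomp_assoc)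
  finally show ?thesis by (simp add: companion_square_def S(1-8,10-17,19-) dbl_simps)
qed

text \<open>The composite absorbs \<open>\<psi>\<close> one factor at a time, so uniqueness
  identifies it and no pasting has to be expanded.\<close>

lemma companion_cell_hcomp:
  assumes "companion_square f g \<theta> \<theta>'" "companion_square f' g' \<theta>' \<theta>''"
  shows "ccomp X (companion_cell f' g' \<theta>' \<theta>'') (companion_cell f g \<theta> \<theta>')
    = companion_cell (hcomp X f' f) (hcomp X g' g) \<theta> \<theta>''"
proof (rule companion_cell_unique[OF companion_square_hcomp[OF assms]])
  note S = companion_squareD[OF assms(1)] companion_squareD[OF assms(2)]
  note S = S companionD[OF S(1)] companionD[OF S(2)] companionD[OF S(11)]
  note C = companion_cell_sides[OF assms(1)] companion_cell_sides[OF assms(2)]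
  have "ccomp X (ccomp X (companion_cell f' g' \<theta>' \<theta>'') (companion_cell f g \<theta> \<theta>')) (comp_psi \<theta>)
    = ccomp X (companion_cell f' g' \<theta>' \<theta>'') (ccomp X (comp_psi \<theta>') (Ide (cat1 X) f))"
    by (simp add: S C ccomp_assoc[symmetric] companion_cell_psi[OF assms(1)])
  also have "\<dots> = ccomp X (comp_psi \<theta>'') (Ide (cat1 X) (hcomp X f' f))"
    by (simp add: S C ccomp_assoc companion_cell_psi[OF assms(2)] dbl_simps)
      (simp add: S C ccomp_assoc[symmetric] dbl_simps)
  finally show "ccomp X (ccomp X (companion_cell f' g' \<theta>' \<theta>'') (companion_cell f g \<theta> \<theta>')) (comp_psi \<theta>)
    = ccomp X (comp_psi \<theta>'') (Ide (cat1 X) (hcomp X f' f))" .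
  show "ccomp X (companion_cell f' g' \<theta>' \<theta>'') (companion_cell f g \<theta> \<theta>') \<in> Arr (cat1 X)"
    "Dom (cat1 X) (ccomp X (companion_cell f' g' \<theta>' \<theta>'') (companion_cell f g \<theta> \<theta>')) = hcomp X f' f"
    "Cod (cat1 X) (ccomp X (companion_cell f' g' \<theta>' \<theta>'') (companion_cell f g \<theta> \<theta>')) = hcomp X g' g"
    "amap (d0 X) (ccomp X (companion_cell f' g' \<theta>' \<theta>'') (companion_cell f g \<theta> \<theta>')) = comp_v \<theta>"
    "amap (d1 X) (ccomp X (companion_cell f' g' \<theta>' \<theta>'') (companion_cell f g \<theta> \<theta>')) = comp_v \<theta>''"
    by (simp_all add: C dbl_simps)
qed

lemma companion_square_vcomp:
  assumes "companion_square f g \<theta> \<theta>'" "companion_square g k \<rho> \<rho>'"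
    and c: "Cod (cat0 X) (comp_v \<theta>) = Dom (cat0 X) (comp_v \<rho>)" "Cod (cat0 X) (comp_v \<theta>') = Dom (cat0 X) (comp_v \<rho>')"
  shows "companion_square f k (companion_comp X \<rho> \<theta>) (companion_comp X \<rho>' \<theta>')"
proof -
  note S = companion_squareD[OF assms(1)] companion_squareD[OF assms(2)]
  have R: "is_companion X (companion_comp X \<rho> \<theta>)" "is_companion X (companion_comp X \<rho>' \<theta>')"
    using S c by (simp_all add: companion_comp)
  note S = S companionD[OF S(1)] companionD[OF S(2)] companionD[OF S(10)] companionD[OF S(11)]
  have "hcomp X (hcomp X (comp_h \<rho>') (comp_h \<theta>')) f = hcomp X (comp_h \<rho>') (hcomp X (comp_h \<theta>') f)"
    by (simp add: S(1-8,10-17,19-) c dbl_simps hcomp_assoc)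
  also have "\<dots> = hcomp X (hcomp X (comp_h \<rho>') g) (comp_h \<theta>)"
    unfolding S(9) by (simp add: S(1-8,10-17,19-) c dbl_simps hcomp_assoc)
  also have "\<dots> = hcomp X k (hcomp X (comp_h \<rho>) (comp_h \<theta>))"
    unfolding S(18) by (simp add: S(1-8,10-17,19-) c dbl_simps hcomp_assoc)
  finally show ?thesis
    by (simp add: companion_square_def companion_comp_simps S(1-8,10-17,19-) R c dbl_simps)
qed

text \<open>The test cell \<open>\<psi>\<close> of a composite companion is itself a vertical
  composite. Interchange distributes the test over the two given cells, and uniqueness applies to
  the result.\<close>

lemma companion_cell_vcomp:
  assumes "companion_square f g \<theta> \<theta>'" "companion_square g k \<rho> \<rho>'"
    and c: "Cod (cat0 X) (comp_v \<theta>) = Dom (cat0 X) (comp_v \<rho>)" "Cod (cat0 X) (comp_v \<theta>') = Dom (cat0 X) (comp_v \<rho>')"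
  shows "Cmp (cat1 X) (companion_cell g k \<rho> \<rho>') (companion_cell f g \<theta> \<theta>')
    = companion_cell f k (companion_comp X \<rho> \<theta>) (companion_comp X \<rho>' \<theta>')"
proof (rule companion_cell_unique[OF companion_square_vcomp[OF assms]])
  note S = companion_squareD[OF assms(1)] companion_squareD[OF assms(2)]
  note S = S companionD[OF S(1)] companionD[OF S(2)] companionD[OF S(10)] companionD[OF S(11)]
  note C = companion_cell_sides[OF assms(1)] companion_cell_sides[OF assms(2)]
  let ?I = "Ide (cat1 X)"
  have "ccomp X (Cmp (cat1 X) (companion_cell g k \<rho> \<rho>') (companion_cell f g \<theta> \<theta>')) (comp_psi (companion_comp X \<rho> \<theta>))
    = Cmp (cat1 X) (ccomp X (companion_cell g k \<rho> \<rho>') (ccomp X (comp_psi \<rho>) (?I (comp_h \<theta>))))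
       (ccomp X (companion_cell f g \<theta> \<theta>') (comp_psi \<theta>))"
    unfolding companion_comp_def companion.sel
    by (rule interchange) (simp_all add: S C c dbl_simps)
  also have "ccomp X (companion_cell g k \<rho> \<rho>') (ccomp X (comp_psi \<rho>) (?I (comp_h \<theta>)))
    = ccomp X (ccomp X (comp_psi \<rho>') (?I g)) (?I (comp_h \<theta>))"
    by (subst ccomp_assoc) (simp_all add: S C c dbl_simps companion_cell_psi[OF assms(2)])
  \<comment> \<open>Commutativity of the upper square enters here: \<open>g\<close> after
    \<open>comp_h \<theta>\<close> is \<open>comp_h \<theta>'\<close> after \<open>f\<close>. It is
    kept out of the rewriting in the step that follows, which only changes brackets.\<close>
  also have "\<dots> = ccomp X (comp_psi \<rho>') (?I (hcomp X (comp_h \<theta>') f))"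
    by (subst ccomp_assoc[symmetric]) (simp_all add: S(1-17,19-) C c dbl_simps)
  also have "\<dots> = ccomp X (ccomp X (comp_psi \<rho>') (?I (comp_h \<theta>'))) (?I f)"
    by (subst ccomp_assoc[symmetric]) (simp_all add: S(1-8,10-17,19-) C c dbl_simps)
  also have "ccomp X (companion_cell f g \<theta> \<theta>') (comp_psi \<theta>) = ccomp X (comp_psi \<theta>') (?I f)"
    by (rule companion_cell_psi[OF assms(1)])
  also have "Cmp (cat1 X) (ccomp X (ccomp X (comp_psi \<rho>') (?I (comp_h \<theta>'))) (?I f)) (ccomp X (comp_psi \<theta>') (?I f))
    = ccomp X (Cmp (cat1 X) (ccomp X (comp_psi \<rho>') (?I (comp_h \<theta>'))) (comp_psi \<theta>')) (Cmp (cat1 X) (?I f) (?I f))"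
    by (rule interchange[symmetric]) (simp_all add: S(1-8,10-17,19-) C c dbl_simps)
  finally show "ccomp X (Cmp (cat1 X) (companion_cell g k \<rho> \<rho>') (companion_cell f g \<theta> \<theta>')) (comp_psi (companion_comp X \<rho> \<theta>))
    = ccomp X (comp_psi (companion_comp X \<rho>' \<theta>')) (?I f)"
    by (simp add: companion_comp_def S dbl_simps)
qed (use companion_cell_sides[OF assms(1)] companion_cell_sides[OF assms(2)] c
    in \<open>simp_all add: dbl_simps companion_comp_simps\<close>)

lemma companion_square_Ide: "f \<in> Obj (cat1 X) \<Longrightarrow>
    companion_square f f (companion_id X (omap (d0 X) f)) (companion_id X (omap (d1 X) f))"
  by (simp add: companion_square_def companion_id companion_comp_simps dbl_simps)

lemma companion_cell_Ide: "f \<in> Obj (cat1 X) \<Longrightarrow>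
    companion_cell f f (companion_id X (omap (d0 X) f)) (companion_id X (omap (d1 X) f)) = Ide (cat1 X) f"
  by (rule companion_cell_unique[symmetric, OF companion_square_Ide])
    (simp_all add: companion_comp_simps dbl_simps)

lemma companion_square_hid:
  assumes "is_companion X \<theta>" shows
    "companion_square (omap (hid X) (Dom (cat0 X) (comp_v \<theta>))) (omap (hid X) (Cod (cat0 X) (comp_v \<theta>))) \<theta> \<theta>"
  using companionD[OF assms] by (simp add: companion_square_def assms dbl_simps)

lemma companion_cell_hid:
  assumes "is_companion X \<theta>" shows
    "companion_cell (omap (hid X) (Dom (cat0 X) (comp_v \<theta>))) (omap (hid X) (Cod (cat0 X) (comp_v \<theta>))) \<theta> \<theta>
      = amap (hid X) (comp_v \<theta>)"
  by (rule companion_cell_unique[symmetric, OF companion_square_hid[OF assms]])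
    (use companionD[OF assms] in \<open>simp_all add: dbl_simps\<close>)

lemma companion_comp_assoc:
  assumes t: "is_companion X \<theta>" and s: "is_companion X \<sigma>" and r: "is_companion X \<rho>"
    and ts: "Cod (cat0 X) (comp_v \<theta>) = Dom (cat0 X) (comp_v \<sigma>)"
    and sr: "Cod (cat0 X) (comp_v \<sigma>) = Dom (cat0 X) (comp_v \<rho>)"
  shows "companion_comp X \<rho> (companion_comp X \<sigma> \<theta>) = companion_comp X (companion_comp X \<rho> \<sigma>) \<theta>"
proof -
  note S = companionD[OF t] companionD[OF s] companionD[OF r] ts sr
  let ?I = "Ide (cat1 X)"
  have psi: "Cmp (cat1 X) (ccomp X (comp_psi \<rho>) (?I (hcomp X (comp_h \<sigma>) (comp_h \<theta>)))) (Cmp (cat1 X) (ccomp X (comp_psi \<sigma>) (?I (comp_h \<theta>))) (comp_psi \<theta>))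
     = Cmp (cat1 X) (ccomp X (Cmp (cat1 X) (ccomp X (comp_psi \<rho>) (?I (comp_h \<sigma>))) (comp_psi \<sigma>)) (?I (comp_h \<theta>))) (comp_psi \<theta>)"
  proof -
    \<comment> \<open>The identity cell on \<open>comp_h \<theta>\<close> is written as a vertical
      composite with itself, so that interchange can distribute it over the other composite.\<close>
    have "ccomp X (Cmp (cat1 X) (ccomp X (comp_psi \<rho>) (?I (comp_h \<sigma>))) (comp_psi \<sigma>)) (Cmp (cat1 X) (?I (comp_h \<theta>)) (?I (comp_h \<theta>)))
      = Cmp (cat1 X) (ccomp X (ccomp X (comp_psi \<rho>) (?I (comp_h \<sigma>))) (?I (comp_h \<theta>))) (ccomp X (comp_psi \<sigma>) (?I (comp_h \<theta>)))"
      by (rule interchange) (simp_all add: S dbl_simps)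
    also have "ccomp X (ccomp X (comp_psi \<rho>) (?I (comp_h \<sigma>))) (?I (comp_h \<theta>)) = ccomp X (comp_psi \<rho>) (?I (hcomp X (comp_h \<sigma>) (comp_h \<theta>)))"
      by (subst ccomp_assoc[symmetric]) (simp_all add: S dbl_simps)
    finally show ?thesis by (simp add: S dbl_simps D0.A.Cmp_assoc)
  qed
  have chi: "Cmp (cat1 X) (comp_chi \<rho>) (ccomp X (?I (comp_h \<rho>)) (Cmp (cat1 X) (comp_chi \<sigma>) (ccomp X (?I (comp_h \<sigma>)) (comp_chi \<theta>))))
     = Cmp (cat1 X) (Cmp (cat1 X) (comp_chi \<rho>) (ccomp X (?I (comp_h \<rho>)) (comp_chi \<sigma>))) (ccomp X (?I (hcomp X (comp_h \<rho>) (comp_h \<sigma>))) (comp_chi \<theta>))"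
  proof -
    have "ccomp X (Cmp (cat1 X) (?I (comp_h \<rho>)) (?I (comp_h \<rho>))) (Cmp (cat1 X) (comp_chi \<sigma>) (ccomp X (?I (comp_h \<sigma>)) (comp_chi \<theta>)))
      = Cmp (cat1 X) (ccomp X (?I (comp_h \<rho>)) (comp_chi \<sigma>)) (ccomp X (?I (comp_h \<rho>)) (ccomp X (?I (comp_h \<sigma>)) (comp_chi \<theta>)))"
      by (rule interchange) (simp_all add: S dbl_simps)
    also have "ccomp X (?I (comp_h \<rho>)) (ccomp X (?I (comp_h \<sigma>)) (comp_chi \<theta>)) = ccomp X (?I (hcomp X (comp_h \<rho>) (comp_h \<sigma>))) (comp_chi \<theta>)"
      by (subst ccomp_assoc) (simp_all add: S dbl_simps)
    finally show ?thesis by (simp add: S dbl_simps D0.A.Cmp_assoc)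
  qed
  show ?thesis
    by (simp add: companion_comp_def psi chi) (simp add: S dbl_simps hcomp_assoc D0.B.Cmp_assoc)
qed

lemma companion_comp_id_right:
  "is_companion X \<theta> \<Longrightarrow> companion_comp X \<theta> (companion_id X (Dom (cat0 X) (comp_v \<theta>))) = \<theta>"
  using companionD[of \<theta>]
  by (cases \<theta>) (simp add: companion_comp_def companion_id_def dbl_simps)

lemma companion_comp_id_left:
  "is_companion X \<theta> \<Longrightarrow> companion_comp X (companion_id X (Cod (cat0 X) (comp_v \<theta>))) \<theta> = \<theta>"
  using companionD[of \<theta>]
  by (cases \<theta>) (simp add: companion_comp_def companion_id_def dbl_simps)

end

section \<open>Companions form a double category\<close>

context double_category
begin

lemma Arr_CompanionsE:
  assumes "f \<in> Arr (cat1 (Companions X))"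
  obtains p q \<theta> \<theta>' where "f = (\<theta>, companion_cell p q \<theta> \<theta>', \<theta>')" "companion_square p q \<theta> \<theta>'"
  using assms by (cases f) (auto simp: Companions_def is_companion_cell_iff)

text \<open>Closure of the cells under both compositions is the part that \<open>X\<close> does not
  hand over directly; it comes from the composition rules for pasted cells. Equations between
  underlying cells are those of \<open>X\<close>, and equations between sides are the unit and
  associativity laws of companions.\<close>

lemma Companions_double_category: "double_category (Companions X)"
proof -
  let ?K = "Companions X"
  have cat0: "category (cat0 ?K)"
    by unfold_locales
      (simp_all add: Companions_def companion_id companion_comp companion_comp_simps dbl_simps
        companionD companion_comp_id_right companion_comp_id_left companion_comp_assoc)
  have cat1: "category (cat1 ?K)"
  proof
    fix f assume "f \<in> Arr (cat1 ?K)"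
    then obtain p q \<theta> \<theta>' where f: "f = (\<theta>, companion_cell p q \<theta> \<theta>', \<theta>')" and sq: "companion_square p q \<theta> \<theta>'"
      by (rule Arr_CompanionsE)
    note S = companion_cell_sides[OF sq] companion_squareD[OF sq]
    show "Dom (cat1 ?K) f \<in> Obj (cat1 ?K)" "Cod (cat1 ?K) f \<in> Obj (cat1 ?K)"
      "Cmp (cat1 ?K) f (Ide (cat1 ?K) (Dom (cat1 ?K) f)) = f"
      "Cmp (cat1 ?K) (Ide (cat1 ?K) (Cod (cat1 ?K) f)) f = f"
      by (simp_all add: f Companions_def S dbl_simps companion_comp_id_right companion_comp_id_left)
  next
    fix f assume "f \<in> Obj (cat1 ?K)"
    then show "Ide (cat1 ?K) f \<in> Arr (cat1 ?K)" "Dom (cat1 ?K) (Ide (cat1 ?K) f) = f"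
      "Cod (cat1 ?K) (Ide (cat1 ?K) f) = f"
      by (simp_all add: Companions_def companion_cell_Ide companion_square_Ide dbl_simps is_companion_cell_iff')
  next
    fix f g assume fg: "f \<in> Arr (cat1 ?K)" "g \<in> Arr (cat1 ?K)" "Cod (cat1 ?K) f = Dom (cat1 ?K) g"
    obtain p q \<theta> \<theta>' where f: "f = (\<theta>, companion_cell p q \<theta> \<theta>', \<theta>')" and sq: "companion_square p q \<theta> \<theta>'"
      using fg(1) by (rule Arr_CompanionsE)
    obtain p' q' \<rho> \<rho>' where g: "g = (\<rho>, companion_cell p' q' \<rho> \<rho>', \<rho>')" and sq': "companion_square p' q' \<rho> \<rho>'"
      using fg(2) by (rule Arr_CompanionsE)
    note S = companion_cell_sides[OF sq] companion_cell_sides[OF sq']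
    have [simp]: "p' = q" using fg(3) by (simp add: f g Companions_def S)
    have c: "Cod (cat0 X) (comp_v \<theta>) = Dom (cat0 X) (comp_v \<rho>)" "Cod (cat0 X) (comp_v \<theta>') = Dom (cat0 X) (comp_v \<rho>')"
      using companion_squareD[OF sq] companion_squareD[OF sq'] by simp_all
    note sq' = sq'[simplified]
    show "Cmp (cat1 ?K) g f \<in> Arr (cat1 ?K)"
      "Dom (cat1 ?K) (Cmp (cat1 ?K) g f) = Dom (cat1 ?K) f"
      "Cod (cat1 ?K) (Cmp (cat1 ?K) g f) = Cod (cat1 ?K) g"
      using companion_square_vcomp[OF sq sq' c] companion_cell_vcomp[OF sq sq' c]
        companion_cell_sides[OF sq] companion_cell_sides[OF sq']
      by (auto simp: f g Companions_def is_companion_cell_iff companion_cell_sides)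
  next
    fix f g h assume fgh: "f \<in> Arr (cat1 ?K)" "g \<in> Arr (cat1 ?K)" "h \<in> Arr (cat1 ?K)"
      "Cod (cat1 ?K) f = Dom (cat1 ?K) g" "Cod (cat1 ?K) g = Dom (cat1 ?K) h"
    obtain p q \<theta> \<theta>' where f: "f = (\<theta>, companion_cell p q \<theta> \<theta>', \<theta>')" and sq: "companion_square p q \<theta> \<theta>'"
      using fgh(1) by (rule Arr_CompanionsE)
    obtain p' q' \<rho> \<rho>' where g: "g = (\<rho>, companion_cell p' q' \<rho> \<rho>', \<rho>')" and sq': "companion_square p' q' \<rho> \<rho>'"
      using fgh(2) by (rule Arr_CompanionsE)
    obtain p'' q'' \<sigma> \<sigma>' where h: "h = (\<sigma>, companion_cell p'' q'' \<sigma> \<sigma>', \<sigma>')" and sq'': "companion_square p'' q'' \<sigma> \<sigma>'"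
      using fgh(3) by (rule Arr_CompanionsE)
    note S = companion_cell_sides[OF sq] companion_cell_sides[OF sq'] companion_cell_sides[OF sq'']
    have [simp]: "p' = q" "p'' = q'" using fgh(4,5) by (simp_all add: f g h Companions_def S)
    have "companion_comp X \<sigma> (companion_comp X \<rho> \<theta>) = companion_comp X (companion_comp X \<sigma> \<rho>) \<theta>"
      "companion_comp X \<sigma>' (companion_comp X \<rho>' \<theta>') = companion_comp X (companion_comp X \<sigma>' \<rho>') \<theta>'"
      using companion_squareD[OF sq] companion_squareD[OF sq'] companion_squareD[OF sq'']
      by (auto intro!: companion_comp_assoc)
    then show "Cmp (cat1 ?K) h (Cmp (cat1 ?K) g f) = Cmp (cat1 ?K) (Cmp (cat1 ?K) h g) f"
      using S by (simp add: f g h Companions_def D0.A.Cmp_assoc)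
  qed
  interpret c0: category "cat0 ?K" by (rule cat0)
  interpret c1: category "cat1 ?K" by (rule cat1)
  let ?P = "pullback (cat1 ?K) (cat1 ?K) (d0 ?K) (d1 ?K)"
  have d0: "cat_functor (cat1 ?K) (cat0 ?K) (d0 ?K)"
    by unfold_locales (auto simp: Companions_def is_companion_cell_iff companion_squareD companion_cell_sides dbl_simps)
  have d1: "cat_functor (cat1 ?K) (cat0 ?K) (d1 ?K)"
    by unfold_locales (auto simp: Companions_def is_companion_cell_iff companion_squareD companion_cell_sides dbl_simps)
  interpret d0: cat_functor "cat1 ?K" "cat0 ?K" "d0 ?K" by (rule d0)
  interpret d1: cat_functor "cat1 ?K" "cat0 ?K" "d1 ?K" by (rule d1)
  have pb: "category ?P"
    by (rule pullback_category[OF d0 d1])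
  have hid: "cat_functor (cat0 ?K) (cat1 ?K) (hid ?K)"
    by (unfold_locales; simp add: Companions_def is_companion_cell_iff companionD dbl_simps companion_comp_simps
        HI.amap_Cmp companion_id_def[symmetric])
      (metis companion_cell_hid companion_square_hid)
  have hcmp: "cat_functor ?P (cat1 ?K) (hcmp ?K)"
  proof (intro cat_functor.intro pb cat1 cat_functor_axioms.intro)
    fix f assume "f \<in> Arr ?P"
    then show "amap (hcmp ?K) f \<in> Arr (cat1 ?K)"
      "Dom (cat1 ?K) (amap (hcmp ?K) f) = omap (hcmp ?K) (Dom ?P f)"
      "Cod (cat1 ?K) (amap (hcmp ?K) f) = omap (hcmp ?K) (Cod ?P f)"
      apply (auto simp: pullback_def Companions_def is_companion_cell_iff companion_cell_sides dbl_simps)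
      by (metis companion_cell_hcomp companion_square_hcomp)
  qed (auto simp: pullback_def Companions_def is_companion_cell_iff companion_cell_sides dbl_simps interchange)
  show ?thesis
    by (intro double_category.intro d0 d1 hid hcmp)
      (auto simp: Companions_def is_companion_cell_iff companionD companion_cell_sides dbl_simps hcomp_assoc ccomp_assoc)
qed

end

section \<open>Strict functors and horizontal transformations\<close>

context strict_double_functor
begin

sublocale F0: cat_functor "cat0 X" "cat0 Y" "ftr0 F" by (rule ftr0_functor)
sublocale F1: cat_functor "cat1 X" "cat1 Y" "ftr1 F" by (rule ftr1_functor)

lemmas sdf_simps = F0.ftr_simps F1.ftr_simps preserves_d0 preserves_d1 preserves_d0_cell preserves_d1_cell
  preserves_hid preserves_hid_cell preserves_hcomp preserves_ccomp F0.amap_Cmp F1.amap_Cmp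

lemma map_companion_sel:
  "comp_h (map_companion_ftr F \<theta>) = omap (ftr1 F) (comp_h \<theta>)"
  "comp_v (map_companion_ftr F \<theta>) = amap (ftr0 F) (comp_v \<theta>)"
  "comp_psi (map_companion_ftr F \<theta>) = amap (ftr1 F) (comp_psi \<theta>)"
  "comp_chi (map_companion_ftr F \<theta>) = amap (ftr1 F) (comp_chi \<theta>)"
  by (simp_all add: map_companion_ftr_def companion.map_sel)

lemma map_companion: 
  assumes "is_companion X \<theta>" shows "is_companion Y (map_companion_ftr F \<theta>)"
proof -
  note T = X.companionD[OF assms]
  show ?thesis
    by (simp add: is_companion_def map_companion_sel)
      (simp add: T X.dbl_simps sdf_simps flip: preserves_ccomp F1.amap_Cmp)
qed

lemma map_companion_id: "A \<in> Obj (cat0 X) \<Longrightarrow> map_companion_ftr F (companion_id X A) = companion_id Y (omap (ftr0 F) A)"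
  by (simp add: map_companion_ftr_def companion_id_def X.dbl_simps sdf_simps)

lemma map_companion_comp:
  assumes t: "is_companion X \<theta>" and s: "is_companion X \<sigma>"
    and ts: "Cod (cat0 X) (comp_v \<theta>) = Dom (cat0 X) (comp_v \<sigma>)"
  shows "map_companion_ftr F (companion_comp X \<sigma> \<theta>) = companion_comp Y (map_companion_ftr F \<sigma>) (map_companion_ftr F \<theta>)"
  by (simp add: companion_comp_def map_companion_sel)
    (simp add: map_companion_ftr_def X.companionD[OF t] X.companionD[OF s] ts X.dbl_simps sdf_simps)

lemma map_companion_square:
  assumes "X.companion_square f g \<theta> \<theta>'"
  shows "Y.companion_square (omap (ftr1 F) f) (omap (ftr1 F) g) (map_companion_ftr F \<theta>) (map_companion_ftr F \<theta>')"
proof -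
  note S = X.companion_squareD[OF assms]
  note S = S X.companionD[OF S(1)] X.companionD[OF S(2)]
  show ?thesis
    by (simp add: Y.companion_square_def map_companion map_companion_sel S sdf_simps flip: preserves_hcomp)
qed

lemma map_companion_cell:
  assumes "X.companion_square f g \<theta> \<theta>'"
  shows "amap (ftr1 F) (X.companion_cell f g \<theta> \<theta>')
    = Y.companion_cell (omap (ftr1 F) f) (omap (ftr1 F) g) (map_companion_ftr F \<theta>) (map_companion_ftr F \<theta>')"
proof -
  note S = X.companion_squareD[OF assms]
  note S = S X.companionD[OF S(1)] X.companionD[OF S(2)]
  show ?thesis
    by (simp add: X.companion_cell_def Y.companion_cell_def map_companion_sel S sdf_simps X.dbl_simps)
qed

lemma map_is_companion_cell:
  assumes "is_companion_cell X (\<theta>, \<Theta>, \<theta>')"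
  shows "is_companion_cell Y (map_companion_ftr F \<theta>, amap (ftr1 F) \<Theta>, map_companion_ftr F \<theta>')"
  using assms unfolding X.is_companion_cell_iff Y.is_companion_cell_iff
  using map_companion_square map_companion_cell by blast

lemma Companions_ftr_strict: "strict_double_functor (Companions X) (Companions Y) (Companions_ftr F)"
proof -
  interpret CX: double_category "Companions X" by (rule X.Companions_double_category)
  interpret CY: double_category "Companions Y" by (rule Y.Companions_double_category)
  have f0: "cat_functor (cat0 (Companions X)) (cat0 (Companions Y)) (ftr0 (Companions_ftr F))"
    by unfold_locales
      (auto simp: Companions_def Companions_ftr_def map_companion map_companion_sel map_companion_id
        map_companion_comp X.companionD sdf_simps)
  have f1: "cat_functor (cat1 (Companions X)) (cat1 (Companions Y)) (ftr1 (Companions_ftr F))"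
    apply unfold_locales
         apply (auto simp: Companions_def Companions_ftr_def map_is_companion_cell map_companion_id
        X.dbl_simps sdf_simps)
       apply (auto simp: X.is_companion_cell_iff X.companion_cell_sides sdf_simps X.companion_squareD)
    by (metis X.companion_squareD map_companion_comp)+
  show ?thesis
    by (intro strict_double_functor.intro strict_double_functor_axioms.intro f0 f1
        X.Companions_double_category Y.Companions_double_category)
      (auto simp: Companions_def Companions_ftr_def X.is_companion_cell_iff X.companion_cell_sides
        X.companionD sdf_simps map_companion_sel)
qed

end

section \<open>Extensional functors and transformations, and the categories they form\<close>

lemma dbl_functorsI: 
  "\<lbrakk>strict_double_functor X Y F; ftr_extensional (cat0 X) (ftr0 F); ftr_extensional (cat1 X) (ftr1 F)\<rbrakk>
    \<Longrightarrow> F \<in> dbl_functors X Y"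
  by (simp add: dbl_functors_def)

lemma dbl_functorsD: "F \<in> dbl_functors X Y \<Longrightarrow> strict_double_functor X Y F"
  by (simp add: dbl_functors_def)

lemma ftr_eqI:
  assumes "ftr_extensional A F" "ftr_extensional A G" "\<And>x. x \<in> Obj A \<Longrightarrow> omap F x = omap G x"
    "\<And>f. f \<in> Arr A \<Longrightarrow> amap F f = amap G f"
  shows "F = (G :: ('o, 'a, 'p, 'b) ftr)"
  using assms by (auto simp: ftr_extensional_def intro!: ftr.equality extensionalityI)

lemma ftr_extensional_restrict [simp]: "ftr_extensional A (ftr_restrict A F)"
  by (simp add: ftr_extensional_def ftr_restrict_def)

lemma ftr_restrict_apply [simp]:
  "x \<in> Obj A \<Longrightarrow> omap (ftr_restrict A F) x = omap F x"
  "f \<in> Arr A \<Longrightarrow> amap (ftr_restrict A F) f = amap F f"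
  by (simp_all add: ftr_restrict_def)

lemma dblftr_restrict_strict:
  assumes "strict_double_functor X Y F"
  shows "strict_double_functor X Y (dblftr_restrict X F)"
proof -
  interpret strict_double_functor X Y F by fact
  show ?thesis
    by (intro strict_double_functor.intro strict_double_functor_axioms.intro
        X.double_category_axioms Y.double_category_axioms)
      (simp_all add: dblftr_restrict_def ftr_restrict_functor F0.cat_functor_axioms F1.cat_functor_axioms
        X.dbl_simps sdf_simps)
qed

lemma dblftr_comp_functors:
  assumes "strict_double_functor X Y F" "strict_double_functor Y Z G"
  shows "dblftr_comp X G F \<in> dbl_functors X Z"
proof (rule dbl_functorsI)
  interpret F: strict_double_functor X Y F by fact
  interpret G: strict_double_functor Y Z G by fact
  show "strict_double_functor X Z (dblftr_comp X G F)"
    unfolding dblftr_comp_def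
    by (intro dblftr_restrict_strict strict_double_functor.intro strict_double_functor_axioms.intro
        F.X.double_category_axioms G.Y.double_category_axioms)
      (simp_all add: ftr_comp_functor[OF F.ftr0_functor G.ftr0_functor]
        ftr_comp_functor[OF F.ftr1_functor G.ftr1_functor], simp_all add: ftr_comp_def F.sdf_simps G.sdf_simps)
qed (simp_all add: dblftr_comp_def dblftr_restrict_def)

context horizontal_transformation
begin

lemmas htrans_simps = component component_d0 component_d1 cell cell_top cell_bottom cell_left cell_right cell_Ide cell_Cmp

text \<open>Cell naturality is applied to the vertical identity on \<open>f\<close>; the tops of the
  two sides give an equation between horizontal arrows.\<close>

lemma hor_naturality:
  assumes "f \<in> Obj (cat1 X)"
  shows "hcomp Y (omap a (omap (d1 X) f)) (omap (ftr1 G) f) = hcomp Y (omap (ftr1 K) f) (omap a (omap (d0 X) f))"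
proof -
  have "Dom (cat1 Y) (ccomp Y (amap a (amap (d1 X) (Ide (cat1 X) f))) (amap (ftr1 G) (Ide (cat1 X) f)))
        = Dom (cat1 Y) (ccomp Y (amap (ftr1 K) (Ide (cat1 X) f)) (amap a (amap (d0 X) (Ide (cat1 X) f))))"
    by (rule arg_cong[OF cell_naturality]) (simp add: assms G.X.dbl_simps)
  then show ?thesis using assms
    by (simp add: G.X.dbl_simps G.sdf_simps K.sdf_simps htrans_simps G.Y.dbl_simps)
qed

end

lemma htransD: "a \<in> htrans X Y G K \<Longrightarrow> horizontal_transformation X Y G K a"
  by (simp add: htrans_def)

lemma htrans_ext: "a \<in> htrans X Y G K \<Longrightarrow> ftr_extensional (cat0 X) a"
  by (simp add: htrans_def)

text \<open>Only values on the carriers enter the axioms of a transformation, so it can be made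
  extensional at no cost.\<close>

lemma htrans_restrict:
  assumes "horizontal_transformation X Y G K a"
  shows "ftr_restrict (cat0 X) a \<in> htrans X Y G K"
proof -
  interpret horizontal_transformation X Y G K a by fact
  show ?thesis unfolding htrans_def
    by (simp, intro horizontal_transformation.intro horizontal_transformation_axioms.intro
        G.strict_double_functor_axioms K.strict_double_functor_axioms)
      (simp_all add: G.X.dbl_simps htrans_simps cell_naturality)
qed

lemma htrans_id_in:
  assumes "strict_double_functor X Y G"
  shows "htrans_id X Y G \<in> htrans X Y G G"
proof -
  interpret strict_double_functor X Y G by fact
  show ?thesis unfolding htrans_id_def
    by (intro htrans_restrict horizontal_transformation.intro assms horizontal_transformation_axioms.intro)
      (simp_all add: ftr_comp_def sdf_simps Y.dbl_simps X.dbl_simps Y.HI.amap_Cmp)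
qed

lemma htrans_comp_in:
  assumes "horizontal_transformation X Y G K a" "horizontal_transformation X Y K L b"
  shows "htrans_comp X Y b a \<in> htrans X Y G L"
proof -
  interpret a: horizontal_transformation X Y G K a by fact
  interpret b: horizontal_transformation X Y K L b by fact
  note simps = a.htrans_simps b.htrans_simps a.G.X.dbl_simps a.G.Y.dbl_simps a.G.sdf_simps a.K.sdf_simps b.K.sdf_simps
  have nat: "ccomp Y (ccomp Y (amap b (amap (d1 X) \<zeta>)) (amap a (amap (d1 X) \<zeta>))) (amap (ftr1 G) \<zeta>)
     = ccomp Y (amap (ftr1 L) \<zeta>) (ccomp Y (amap b (amap (d0 X) \<zeta>)) (amap a (amap (d0 X) \<zeta>)))"
    if z: "\<zeta> \<in> Arr (cat1 X)" for \<zeta>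
  proof -
    have "ccomp Y (ccomp Y (amap b (amap (d1 X) \<zeta>)) (amap a (amap (d1 X) \<zeta>))) (amap (ftr1 G) \<zeta>)
        = ccomp Y (amap b (amap (d1 X) \<zeta>)) (ccomp Y (amap (ftr1 K) \<zeta>) (amap a (amap (d0 X) \<zeta>)))"
      by (subst a.G.Y.ccomp_assoc[symmetric]) (simp_all add: z a.cell_naturality simps)
    also have "\<dots> = ccomp Y (ccomp Y (amap (ftr1 L) \<zeta>) (amap b (amap (d0 X) \<zeta>))) (amap a (amap (d0 X) \<zeta>))"
      by (subst a.G.Y.ccomp_assoc) (simp_all add: z b.cell_naturality simps)
    also have "\<dots> = ccomp Y (amap (ftr1 L) \<zeta>) (ccomp Y (amap b (amap (d0 X) \<zeta>)) (amap a (amap (d0 X) \<zeta>)))"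
      by (subst a.G.Y.ccomp_assoc) (simp_all add: z simps)
    finally show ?thesis .
  qed
  show ?thesis unfolding htrans_comp_def
    by (intro htrans_restrict horizontal_transformation.intro horizontal_transformation_axioms.intro
        a.G.strict_double_functor_axioms b.K.strict_double_functor_axioms)
      (simp_all add: nat, simp_all add: simps a.G.Y.interchange)
qed

lemma htrans_comp_apply:
  "A \<in> Obj (cat0 X) \<Longrightarrow> omap (htrans_comp X Y b a) A = hcomp Y (omap b A) (omap a A)"
  "v \<in> Arr (cat0 X) \<Longrightarrow> amap (htrans_comp X Y b a) v = ccomp Y (amap b v) (amap a v)"
  by (simp_all add: htrans_comp_def)

lemma htrans_id_apply:
  "A \<in> Obj (cat0 X) \<Longrightarrow> omap (htrans_id X Y G) A = omap (hid Y) (omap (ftr0 G) A)"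
  "v \<in> Arr (cat0 X) \<Longrightarrow> amap (htrans_id X Y G) v = amap (hid Y) (amap (ftr0 G) v)"
  by (simp_all add: htrans_id_def ftr_comp_def)

lemma htrans_whisker_apply:
  "A \<in> Obj (cat0 X) \<Longrightarrow> omap (htrans_whisker X b F) A = omap b (omap (ftr0 F) A)"
  "v \<in> Arr (cat0 X) \<Longrightarrow> amap (htrans_whisker X b F) v = amap b (amap (ftr0 F) v)"
  by (simp_all add: htrans_whisker_def ftr_comp_def)

lemma htrans_comp_ext [simp]: "ftr_extensional (cat0 X) (htrans_comp X Y b a)"
  and htrans_id_ext [simp]: "ftr_extensional (cat0 X) (htrans_id X Y G)"
  by (simp_all add: htrans_comp_def htrans_id_def)

lemma htrans_whisker_ext [simp]: "ftr_extensional (cat0 X) (htrans_whisker X b F)"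
  by (simp add: htrans_whisker_def)

lemma dblftr_comp_apply:
  "A \<in> Obj (cat0 X) \<Longrightarrow> omap (ftr0 (dblftr_comp X G F)) A = omap (ftr0 G) (omap (ftr0 F) A)"
  "v \<in> Arr (cat0 X) \<Longrightarrow> amap (ftr0 (dblftr_comp X G F)) v = amap (ftr0 G) (amap (ftr0 F) v)"
  "f \<in> Obj (cat1 X) \<Longrightarrow> omap (ftr1 (dblftr_comp X G F)) f = omap (ftr1 G) (omap (ftr1 F) f)"
  "\<zeta> \<in> Arr (cat1 X) \<Longrightarrow> amap (ftr1 (dblftr_comp X G F)) \<zeta> = amap (ftr1 G) (amap (ftr1 F) \<zeta>)"
  by (simp_all add: dblftr_comp_def dblftr_restrict_def ftr_comp_def)

lemma htrans_comp_id_right: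
  assumes "a \<in> htrans X Y G K" shows "htrans_comp X Y a (htrans_id X Y G) = a"
proof -
  interpret a: horizontal_transformation X Y G K a using assms by (rule htransD)
  show ?thesis
    by (rule ftr_eqI[OF htrans_comp_ext htrans_ext[OF assms]])
      (simp_all add: htrans_comp_apply htrans_id_apply a.htrans_simps a.G.Y.dbl_simps)
qed

lemma htrans_comp_id_left:
  assumes "a \<in> htrans X Y G K" shows "htrans_comp X Y (htrans_id X Y K) a = a"
proof -
  interpret a: horizontal_transformation X Y G K a using assms by (rule htransD)
  show ?thesis
    by (rule ftr_eqI[OF htrans_comp_ext htrans_ext[OF assms]])
      (simp_all add: htrans_comp_apply htrans_id_apply a.htrans_simps a.G.Y.dbl_simps)
qed

lemma htrans_comp_assoc:
  assumes "a \<in> htrans X Y G K" "b \<in> htrans X Y K L" "c \<in> htrans X Y L M"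
  shows "htrans_comp X Y c (htrans_comp X Y b a) = htrans_comp X Y (htrans_comp X Y c b) a"
proof -
  interpret a: horizontal_transformation X Y G K a using assms(1) by (rule htransD)
  interpret b: horizontal_transformation X Y K L b using assms(2) by (rule htransD)
  interpret c: horizontal_transformation X Y L M c using assms(3) by (rule htransD)
  show ?thesis
    by (rule ftr_eqI[OF htrans_comp_ext htrans_comp_ext])
      (simp_all add: htrans_comp_apply a.htrans_simps b.htrans_simps c.htrans_simps
        a.G.Y.hcomp_assoc a.G.Y.ccomp_assoc)
qed

lemma Hom_h_category: "category (Hom_h X Y)"
  by unfold_locales
    (auto simp: Hom_h_def htrans_id_in dbl_functorsD htrans_comp_id_left htrans_comp_id_right htrans_comp_assoc
      intro: htrans_comp_in htransD)

lemma htrans_whisker_in: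
  assumes "horizontal_transformation Y Z G K b" "strict_double_functor X Y F"
  shows "htrans_whisker X b F \<in> htrans X Z (dblftr_comp X G F) (dblftr_comp X K F)"
proof -
  interpret b: horizontal_transformation Y Z G K b by fact
  interpret F: strict_double_functor X Y F by fact
  have nat: "ccomp Z (amap b (amap (ftr0 F) (amap (d1 X) \<zeta>))) (amap (ftr1 G) (amap (ftr1 F) \<zeta>))
      = ccomp Z (amap (ftr1 K) (amap (ftr1 F) \<zeta>)) (amap b (amap (ftr0 F) (amap (d0 X) \<zeta>)))"
    if "\<zeta> \<in> Arr (cat1 X)" for \<zeta>
    using b.cell_naturality[OF F.F1.amap_closed[OF that]] that by (simp add: F.preserves_d0_cell F.preserves_d1_cell)
  show ?thesis unfolding htrans_whisker_def
    by (intro htrans_restrict horizontal_transformation.intro horizontal_transformation_axioms.intro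
        dbl_functorsD[OF dblftr_comp_functors[OF F.strict_double_functor_axioms b.G.strict_double_functor_axioms]]
        dbl_functorsD[OF dblftr_comp_functors[OF F.strict_double_functor_axioms b.K.strict_double_functor_axioms]])
      (simp_all add: ftr_comp_def dblftr_comp_apply F.X.dbl_simps b.G.X.dbl_simps F.sdf_simps b.htrans_simps
        nat)
qed

lemma htrans_whisker_id:
  assumes "strict_double_functor X Y F"
  shows "htrans_whisker X (htrans_id Y Z G) F = htrans_id X Z (dblftr_comp X G F)"
proof -
  interpret F: strict_double_functor X Y F by fact
  show ?thesis
    by (rule ftr_eqI[OF htrans_whisker_ext htrans_id_ext])
      (simp_all add: htrans_whisker_apply htrans_id_apply F.sdf_simps dblftr_comp_apply)
qed

lemma htrans_whisker_comp:
  assumes "strict_double_functor X Y F"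
  shows "htrans_whisker X (htrans_comp Y Z b a) F = htrans_comp X Z (htrans_whisker X b F) (htrans_whisker X a F)"
proof -
  interpret F: strict_double_functor X Y F by fact
  show ?thesis
    by (rule ftr_eqI[OF htrans_whisker_ext htrans_comp_ext])
      (simp_all add: htrans_whisker_apply htrans_comp_apply F.sdf_simps)
qed

text \<open>Naturality of \<open>a\<close> at the binding cell \<open>\<psi>\<close>, whose left
  side is an identity, is exactly the equation that characterises the pasted cell. Hence the
  component of \<open>a\<close> at the vertical arrow of a companion is automatically a companion
  cell.\<close>

lemma (in horizontal_transformation) Companions_htrans:
  "horizontal_transformation (Companions X) (Companions Y) (Companions_ftr G) (Companions_ftr K) (Companions_htrans G a K)"
proof (intro horizontal_transformation.intro horizontal_transformation_axioms.intro
    G.Companions_ftr_strict K.Companions_ftr_strict)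
  have cell: "is_companion_cell Y (map_companion_ftr G \<theta>, amap a (comp_v \<theta>), map_companion_ftr K \<theta>)"
    if t: "is_companion X \<theta>" for \<theta>
  proof -
    note T = G.X.companionD[OF t]
    have "ccomp Y (amap a (comp_v \<theta>)) (amap (ftr1 G) (comp_psi \<theta>))
        = ccomp Y (amap (ftr1 K) (comp_psi \<theta>)) (Ide (cat1 Y) (omap a (Dom (cat0 X) (comp_v \<theta>))))"
      using cell_naturality[OF T(5)] by (simp add: T G.X.dbl_simps htrans_simps)
    moreover have "hcomp Y (omap a (Cod (cat0 X) (comp_v \<theta>))) (omap (ftr1 G) (comp_h \<theta>))
        = hcomp Y (omap (ftr1 K) (comp_h \<theta>)) (omap a (Dom (cat0 X) (comp_v \<theta>)))"
      using hor_naturality[OF T(1)] by (simp add: T)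
    ultimately have
      sq: "G.Y.companion_square (omap a (Dom (cat0 X) (comp_v \<theta>))) (omap a (Cod (cat0 X) (comp_v \<theta>)))
        (map_companion_ftr G \<theta>) (map_companion_ftr K \<theta>)"
      and psi: "ccomp Y (amap a (comp_v \<theta>)) (comp_psi (map_companion_ftr G \<theta>))
        = ccomp Y (comp_psi (map_companion_ftr K \<theta>)) (Ide (cat1 Y) (omap a (Dom (cat0 X) (comp_v \<theta>))))"
      by (simp_all add: G.Y.companion_square_def G.map_companion[OF t] K.map_companion[OF t]
          G.map_companion_sel K.map_companion_sel T htrans_simps G.X.dbl_simps G.sdf_simps K.sdf_simps)
    have "amap a (comp_v \<theta>) = G.Y.companion_cell (omap a (Dom (cat0 X) (comp_v \<theta>))) (omap a (Cod (cat0 X) (comp_v \<theta>)))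
        (map_companion_ftr G \<theta>) (map_companion_ftr K \<theta>)"
      by (rule G.Y.companion_cell_unique[OF sq _ _ _ _ _ psi])
        (simp_all add: G.map_companion_sel K.map_companion_sel T htrans_simps)
    with sq show ?thesis unfolding G.Y.is_companion_cell_iff by blast
  qed
  fix \<theta> assume "\<theta> \<in> Arr (cat0 (Companions X))"
  then show "amap (Companions_htrans G a K) \<theta> \<in> Arr (cat1 (Companions Y))"
    using cell by (simp add: Companions_def Companions_htrans_def)
next
  fix \<zeta> assume "\<zeta> \<in> Arr (cat1 (Companions X))"
  then obtain p q \<theta> \<theta>' where z: "\<zeta> = (\<theta>, G.X.companion_cell p q \<theta> \<theta>', \<theta>')"
    and sq: "G.X.companion_square p q \<theta> \<theta>'"
    by (rule G.X.Arr_CompanionsE)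
  show "ccomp (Companions Y) (amap (Companions_htrans G a K) (amap (d1 (Companions X)) \<zeta>)) (amap (ftr1 (Companions_ftr G)) \<zeta>)
    = ccomp (Companions Y) (amap (ftr1 (Companions_ftr K)) \<zeta>) (amap (Companions_htrans G a K) (amap (d0 (Companions X)) \<zeta>))"
    using cell_naturality[of "G.X.companion_cell p q \<theta> \<theta>'"] G.X.companion_cell_sides[OF sq]
    by (simp add: z Companions_def Companions_htrans_def Companions_ftr_def)
qed (simp_all add: Companions_def Companions_htrans_def Companions_ftr_def htrans_simps
      G.X.companionD G.map_companion_id K.map_companion_id G.X.companion_comp_simps G.map_companion_comp
      K.map_companion_comp)

section \<open>Horizontal and vertical embeddings of categories\<close>

context category
begin

lemma H_dbl_double_category: "double_category (H_dbl C)"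
proof -
  interpret A: category "discrete_cat (Obj C)" by (rule discrete_category)
  interpret B: category "discrete_cat (Arr C)" by (rule discrete_category)
  have d: "cat_functor (discrete_cat (Arr C)) (discrete_cat (Obj C)) \<lparr>omap = Dom C, amap = Dom C\<rparr>"
    "cat_functor (discrete_cat (Arr C)) (discrete_cat (Obj C)) \<lparr>omap = Cod C, amap = Cod C\<rparr>"
    by (unfold_locales; simp add: discrete_cat_def cat_simps)+
  interpret P: category "pullback (discrete_cat (Arr C)) (discrete_cat (Arr C))
    \<lparr>omap = Dom C, amap = Dom C\<rparr> \<lparr>omap = Cod C, amap = Cod C\<rparr>"
    by (rule pullback_category[OF d])
  show ?thesis
    by (unfold_locales; auto simp: H_dbl_def discrete_cat_def pullback_def cat_simps Cmp_assoc)
qed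

lemma V_dbl_double_category: "double_category (V_dbl C)"
proof -
  have i: "cat_functor C C ftr_id" by unfold_locales (simp_all add: ftr_id_def cat_simps)
  interpret P: category "pullback C C ftr_id ftr_id"
    by (rule pullback_category[OF i i])
  show ?thesis
    by (unfold_locales; auto simp: V_dbl_def ftr_id_def pullback_def cat_simps Cmp_assoc)
qed

end

lemma H_dbl_simps:
  "Obj (cat0 (H_dbl C)) = Obj C" "Arr (cat0 (H_dbl C)) = Obj C" "Obj (cat1 (H_dbl C)) = Arr C"
  "Arr (cat1 (H_dbl C)) = Arr C" "Dom (cat0 (H_dbl C)) x = x" "Cod (cat0 (H_dbl C)) x = x"
  "Ide (cat0 (H_dbl C)) x = x" "Cmp (cat0 (H_dbl C)) y x = x"
  "Dom (cat1 (H_dbl C)) f = f" "Cod (cat1 (H_dbl C)) f = f"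
  "Ide (cat1 (H_dbl C)) f = f" "Cmp (cat1 (H_dbl C)) g f = f"
  "omap (d0 (H_dbl C)) = Dom C" "amap (d0 (H_dbl C)) = Dom C"
  "omap (d1 (H_dbl C)) = Cod C" "amap (d1 (H_dbl C)) = Cod C"
  "omap (hid (H_dbl C)) = Ide C" "amap (hid (H_dbl C)) = Ide C"
  "hcomp (H_dbl C) g f = Cmp C g f" "ccomp (H_dbl C) g f = Cmp C g f"
  by (simp_all add: H_dbl_def discrete_cat_def)

lemma V_dbl_simps:
  "cat0 (V_dbl C) = C" "cat1 (V_dbl C) = C" "omap (d0 (V_dbl C)) x = x" "amap (d0 (V_dbl C)) f = f"
  "omap (d1 (V_dbl C)) x = x" "amap (d1 (V_dbl C)) f = f"
  "omap (hid (V_dbl C)) x = x" "amap (hid (V_dbl C)) f = f"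
  "hcomp (V_dbl C) y x = y" "ccomp (V_dbl C) g f = g"
  by (simp_all add: V_dbl_def ftr_id_def)

text \<open>Every cell of \<open>H_dbl C\<close> is a vertical identity, which leaves no choice for
  its image.\<close>

lemma H_functor_cell:
  assumes "strict_double_functor (H_dbl C) D G" "f \<in> Arr C"
  shows "amap (ftr1 G) f = Ide (cat1 D) (omap (ftr1 G) f)"
proof -
  interpret strict_double_functor "H_dbl C" D G by fact
  show ?thesis using F1.amap_Ide[of f] assms(2) by (simp add: H_dbl_simps)
qed

lemma H_functor_vert:
  assumes "strict_double_functor (H_dbl C) D G" "x \<in> Obj C"
  shows "amap (ftr0 G) x = Ide (cat0 D) (omap (ftr0 G) x)"
proof -
  interpret strict_double_functor "H_dbl C" D G by fact
  show ?thesis using F0.amap_Ide[of x] assms(2) by (simp add: H_dbl_simps)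
qed

lemma hor_ftr_functor:
  assumes "category C" "strict_double_functor (H_dbl C) D G"
  shows "cat_functor C (hor_cat D) (hor_ftr G)"
proof -
  interpret category C by fact
  interpret G: strict_double_functor "H_dbl C" D G by fact
  interpret H: category "hor_cat D" by (rule G.Y.hor_category)
  show ?thesis
    by unfold_locales
      (use G.F0.omap_closed G.F1.omap_closed G.preserves_d0 G.preserves_d1 G.preserves_hid G.preserves_hcomp
        in \<open>simp_all add: hor_ftr_def hor_cat_def H_dbl_simps\<close>)
qed

text \<open>The vertical arrows of \<open>H_dbl C\<close> are identities, so the cell components
  have to be vertical identities. The only remaining condition is naturality in the horizontal
  arrows.\<close>

lemma H_htransI:
  assumes "category C" "strict_double_functor (H_dbl C) D G" "strict_double_functor (H_dbl C) D K"
    and a: "\<And>x. x \<in> Obj C \<Longrightarrow> a x \<in> Obj (cat1 D)"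
      "\<And>x. x \<in> Obj C \<Longrightarrow> omap (d0 D) (a x) = omap (ftr0 G) x"
      "\<And>x. x \<in> Obj C \<Longrightarrow> omap (d1 D) (a x) = omap (ftr0 K) x"
    and nat: "\<And>f. f \<in> Arr C \<Longrightarrow> hcomp D (a (Cod C f)) (omap (ftr1 G) f) = hcomp D (omap (ftr1 K) f) (a (Dom C f))"
  shows "ftr_restrict (cat0 (H_dbl C)) \<lparr>omap = a, amap = \<lambda>x. Ide (cat1 D) (a x)\<rparr> \<in> htrans (H_dbl C) D G K"
proof -
  interpret category C by fact
  interpret G: strict_double_functor "H_dbl C" D G by fact
  interpret K: strict_double_functor "H_dbl C" D K by fact
  have "omap (d0 D) (omap (ftr1 G) f) = omap (ftr0 G) (Dom C f)" "omap (d1 D) (omap (ftr1 G) f) = omap (ftr0 G) (Cod C f)"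
    "omap (d0 D) (omap (ftr1 K) f) = omap (ftr0 K) (Dom C f)" "omap (d1 D) (omap (ftr1 K) f) = omap (ftr0 K) (Cod C f)"
    "omap (ftr1 G) f \<in> Obj (cat1 D)" "omap (ftr1 K) f \<in> Obj (cat1 D)" if "f \<in> Arr C" for f
    using that G.preserves_d0[of f] G.preserves_d1[of f] K.preserves_d0[of f] K.preserves_d1[of f]
      G.F1.omap_closed K.F1.omap_closed by (simp_all add: H_dbl_simps)
  then show ?thesis
    by (intro htrans_restrict horizontal_transformation.intro horizontal_transformation_axioms.intro assms(2,3))
      (simp_all add: H_dbl_simps a G.Y.dbl_simps cat_simps H_functor_cell[OF assms(2)] H_functor_cell[OF assms(3)]
        H_functor_vert[OF assms(2)] H_functor_vert[OF assms(3)] nat)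
qed

lemma H_htrans_eqI:
  assumes "a \<in> htrans (H_dbl C) D G K" "b \<in> htrans (H_dbl C) D G K" "\<And>x. x \<in> Obj C \<Longrightarrow> omap a x = omap b x"
  shows "a = b"
proof (rule ftr_eqI[OF htrans_ext[OF assms(1)] htrans_ext[OF assms(2)]])
  fix v assume "v \<in> Arr (cat0 (H_dbl C))"
  then show "amap a v = amap b v"
    using horizontal_transformation.cell_Ide[OF htransD[OF assms(1)], of v]
      horizontal_transformation.cell_Ide[OF htransD[OF assms(2)], of v] assms(3)
    by (simp add: H_dbl_simps)
qed (simp add: H_dbl_simps assms(3))

text \<open>The horizontal arrows and the cells of \<open>V_dbl N\<close> are horizontal identities.
  Strictness forces their images, so a functor from \<open>N\<close> to \<open>cat0 K\<close> is all
  the data there is.\<close>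

lemma V_functorI:
  assumes "cat_functor N (cat0 K) F" "double_category K"
  shows "strict_double_functor (V_dbl N) K \<lparr>ftr0 = F, ftr1 = ftr_comp (hid K) F\<rparr>"
proof -
  interpret F: cat_functor N "cat0 K" F by fact
  interpret K: double_category K by fact
  show ?thesis
    by (intro strict_double_functor.intro strict_double_functor_axioms.intro F.A.V_dbl_double_category assms(2))
      (simp_all add: V_dbl_simps assms(1) ftr_comp_functor[OF assms(1) K.hid_functor],
        simp_all add: V_dbl_simps ftr_comp_def K.dbl_simps F.ftr_simps)
qed

lemma V_functor_cell:
  assumes "strict_double_functor (V_dbl N) K F"
  shows "x \<in> Obj N \<Longrightarrow> omap (ftr1 F) x = omap (hid K) (omap (ftr0 F) x)"
    "f \<in> Arr N \<Longrightarrow> amap (ftr1 F) f = amap (hid K) (amap (ftr0 F) f)"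
  using strict_double_functor.preserves_hid[OF assms] strict_double_functor.preserves_hid_cell[OF assms]
  by (simp_all add: V_dbl_simps)

lemma V_functor_eqI:
  assumes "F \<in> dbl_functors (V_dbl N) K" "G \<in> dbl_functors (V_dbl N) K"
    "\<And>x. x \<in> Obj N \<Longrightarrow> omap (ftr0 F) x = omap (ftr0 G) x" "\<And>f. f \<in> Arr N \<Longrightarrow> amap (ftr0 F) f = amap (ftr0 G) f"
  shows "F = G"
proof -
  have e: "ftr_extensional N (ftr0 F)" "ftr_extensional N (ftr1 F)" "ftr_extensional N (ftr0 G)" "ftr_extensional N (ftr1 G)"
    using assms(1,2) by (simp_all add: dbl_functors_def V_dbl_simps)
  have "ftr0 F = ftr0 G" by (rule ftr_eqI[OF e(1,3)]) (simp_all add: assms)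
  moreover have "ftr1 F = ftr1 G"
    by (rule ftr_eqI[OF e(2,4)])
      (simp_all add: assms V_functor_cell[OF dbl_functorsD[OF assms(1)]] V_functor_cell[OF dbl_functorsD[OF assms(2)]])
  ultimately show ?thesis by simp
qed

section \<open>The double category of fractions\<close>

locale fractions = calculus_of_fractions C W for C :: "('o, 'a) cat" and W :: "'a set" +
  assumes two_of_three: "two_out_of_three C W"
begin

abbreviation comp :: "'a \<Rightarrow> 'a \<Rightarrow> 'a" (infixl "\<cdot>" 70) where "g \<cdot> f \<equiv> Cmp C g f"

section \<open>Spans with legs in \<open>W\<close> and their refinements\<close>

lemma W_Arr: "w \<in> W \<Longrightarrow> w \<in> Arr C" using W_arrows by blast

lemma Ide_W: "x \<in> Obj C \<Longrightarrow> Ide C x \<in> W" by (rule CF1_iso[OF iso_Ide])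

lemma W_cancel_left: "\<lbrakk>g \<in> W; g \<cdot> f \<in> W; f \<in> Arr C; Cod C f = Dom C g\<rbrakk> \<Longrightarrow> f \<in> W"
  using two_of_three W_Arr unfolding two_out_of_three_def by blast

lemmas C_simps = cat_simps Cmp_Ide_right' Cmp_Ide_left' W_Arr CF1_comp Ide_W

text \<open>The definition only asks that the common composite lie in \<open>W\<close>; the
  2-out-of-3 property passes this on to both legs. From here on spans can be refined inside
  \<open>W\<close>.\<close>

lemma spans_iff:
  assumes "w1 \<in> W" "w2 \<in> W"
  shows "(u1, u2) \<in> spans C W w1 w2 \<longleftrightarrow> u1 \<in> W \<and> u2 \<in> W \<and> Dom C u1 = Dom C u2
    \<and> Cod C u1 = Dom C w1 \<and> Cod C u2 = Dom C w2 \<and> w1 \<cdot> u1 = w2 \<cdot> u2"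
proof
  assume "(u1, u2) \<in> spans C W w1 w2"
  then have u: "u1 \<in> Arr C" "u2 \<in> Arr C" "Dom C u1 = Dom C u2" "Cod C u1 = Dom C w1" "Cod C u2 = Dom C w2"
    "w1 \<cdot> u1 = w2 \<cdot> u2" "w1 \<cdot> u1 \<in> W" unfolding spans_def by blast+
  then have "u1 \<in> W" "u2 \<in> W" using W_cancel_left[of w1 u1] W_cancel_left[of w2 u2] assms by simp_all
  with u show "u1 \<in> W \<and> u2 \<in> W \<and> Dom C u1 = Dom C u2
    \<and> Cod C u1 = Dom C w1 \<and> Cod C u2 = Dom C w2 \<and> w1 \<cdot> u1 = w2 \<cdot> u2" by simp
next
  assume u: "u1 \<in> W \<and> u2 \<in> W \<and> Dom C u1 = Dom C u2
    \<and> Cod C u1 = Dom C w1 \<and> Cod C u2 = Dom C w2 \<and> w1 \<cdot> u1 = w2 \<cdot> u2"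
  then have "w1 \<cdot> u1 \<in> W" by (intro CF1_comp) (use assms in simp_all)
  with u show "(u1, u2) \<in> spans C W w1 w2" by (simp add: spans_def W_Arr)
qed

lemma spans_Cod:
  assumes "w1 \<in> W" "w2 \<in> W" "u \<in> spans C W w1 w2" shows "Cod C w1 = Cod C w2"
proof -
  obtain u1 u2 where u: "u = (u1, u2)" by fastforce
  note U = assms(3)[unfolded u spans_iff[OF assms(1,2)]]
  have "Cod C (w1 \<cdot> u1) = Cod C w1" "Cod C (w2 \<cdot> u2) = Cod C w2"
    using U Cod_Cmp[of u1 w1] Cod_Cmp[of u2 w2] assms(1,2) W_Arr by metis+
  with U show ?thesis by simp
qed

lemma spans_refine:
  assumes "w1 \<in> W" "w2 \<in> W" "(u1, u2) \<in> spans C W w1 w2" "r \<in> W" "Cod C r = Dom C u1"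
  shows "(u1 \<cdot> r, u2 \<cdot> r) \<in> spans C W w1 w2"
  using assms by (simp add: spans_iff C_simps Cmp_assoc)

text \<open>CF2 completes the two objects to a square whose diagonal is a composite of arrows of
  \<open>W\<close>. Thus any two objects over the same codomain are joined by a vertical
  arrow.\<close>

lemma span_exists:
  assumes "w1 \<in> W" "w2 \<in> W" "Cod C w1 = Cod C w2"
  obtains u1 u2 where "(u1, u2) \<in> spans C W w1 w2"
proof -
  obtain f' w' where "f' \<in> Arr C" "w' \<in> W" "Dom C f' = Dom C w'" "Cod C f' = Dom C w2" "Cod C w' = Dom C w1"
    "w2 \<cdot> f' = w1 \<cdot> w'"
    using CF2[of w1 w2] assms W_Arr by auto
  then have "(w', f') \<in> spans C W w1 w2"
    using assms by (simp add: spans_def C_simps)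
  then show ?thesis by (rule that)
qed

lemma CF2_W:
  assumes "f \<in> Arr C" "w \<in> W" "Cod C f = Cod C w"
  obtains f' w' where "f' \<in> Arr C" "w' \<in> W" "Dom C f' = Dom C w'" "Cod C f' = Dom C w"
    "Cod C w' = Dom C f" "w \<cdot> f' = f \<cdot> w'"
  using CF2[OF assms] by blast

text \<open>CF2 makes the left legs agree after refinement. The right legs then agree after
  \<open>w2\<close>, because both composites equal the one through \<open>w1\<close>, and CF3
  removes \<open>w2\<close> at the price of one more refinement.\<close>

lemma spans_common_refinement:
  assumes w: "w1 \<in> W" "w2 \<in> W" and u: "(u1, u2) \<in> spans C W w1 w2" and v: "(v1, v2) \<in> spans C W w1 w2"
  obtains r s where "r \<in> W" "s \<in> W" "Dom C r = Dom C s" "Cod C r = Dom C u1" "Cod C s = Dom C v1"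
    "u1 \<cdot> r = v1 \<cdot> s" "u2 \<cdot> r = v2 \<cdot> s"
proof -
  note U = u[unfolded spans_iff[OF w]] and V = v[unfolded spans_iff[OF w]]
  obtain a b where ab: "a \<in> W" "b \<in> W" "Dom C a = Dom C b" "Cod C a = Dom C u1" "Cod C b = Dom C v1"
    "u1 \<cdot> a = v1 \<cdot> b"
    using span_exists[of u1 v1] U V spans_iff[of u1 v1] by (metis W_Arr)
  have "w2 \<cdot> (u2 \<cdot> a) = w1 \<cdot> (u1 \<cdot> a)" "w2 \<cdot> (v2 \<cdot> b) = w1 \<cdot> (v1 \<cdot> b)"
    using U V ab(1-5) w by (simp_all add: C_simps Cmp_assoc)
  then have "w2 \<cdot> (u2 \<cdot> a) = w2 \<cdot> (v2 \<cdot> b)" by (simp add: ab)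
  then obtain t where t: "t \<in> W" "Cod C t = Dom C (u2 \<cdot> a)" "(u2 \<cdot> a) \<cdot> t = (v2 \<cdot> b) \<cdot> t"
    using CF3[of w2 "u2 \<cdot> a" "v2 \<cdot> b"] U V ab w by (auto simp: C_simps)
  show ?thesis
    by (rule that[of "a \<cdot> t" "b \<cdot> t"])
      (use U V ab w t in \<open>simp_all add: C_simps Cmp_assoc\<close>)
qed

text \<open>Common refinements always exist, so the relation is the full relation on spans and an
  equivalence class is either everything or empty.\<close>

lemma span_rel_image:
  assumes w: "w1 \<in> W" "w2 \<in> W"
  shows "span_rel C W w1 w2 `` {u} = (if u \<in> spans C W w1 w2 then spans C W w1 w2 else {})"
proof -
  have "(u, v) \<in> span_rel C W w1 w2" if in_spans: "u \<in> spans C W w1 w2" "v \<in> spans C W w1 w2" for v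
  proof -
    obtain u1 u2 v1 v2 where uv: "u = (u1, u2)" "v = (v1, v2)" by fastforce
    obtain r s where rs: "r \<in> W" "s \<in> W" "Dom C r = Dom C s" "Cod C r = Dom C u1" "Cod C s = Dom C v1"
      "u1 \<cdot> r = v1 \<cdot> s" "u2 \<cdot> r = v2 \<cdot> s"
      by (rule spans_common_refinement[OF w in_spans[unfolded uv]])
    have "w1 \<cdot> (u1 \<cdot> r) \<in> W"
      using in_spans(1) unfolding uv spans_iff[OF w] by (simp add: C_simps rs(1,4) w)
    then show ?thesis
      using in_spans rs W_Arr unfolding uv span_rel_def by blast
  qed
  then show ?thesis by (auto simp: span_rel_def)
qed

section \<open>Vertical arrows and cells in normal form\<close>

definition vert :: "'a \<Rightarrow> 'a \<Rightarrow> 'a frac_vert" where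
  "vert w1 w2 = Vert w1 w2 (spans C W w1 w2)"

lemma vert_sel [simp]: "v_from (vert w1 w2) = w1" "v_to (vert w1 w2) = w2"
  "v_class (vert w1 w2) = spans C W w1 w2"
  by (simp_all add: vert_def)

lemma frac_vert_eq:
  "\<lbrakk>w1 \<in> W; w2 \<in> W; u \<in> spans C W w1 w2\<rbrakk> \<Longrightarrow> frac_vert C W w1 w2 u = vert w1 w2"
  by (simp add: frac_vert_def vert_def span_rel_image)

lemma frac_verts_iff: "S \<in> frac_verts C W \<longleftrightarrow> (\<exists>w1\<in>W. \<exists>w2\<in>W. Cod C w1 = Cod C w2 \<and> S = vert w1 w2)"
proof
  show "S \<in> frac_verts C W \<Longrightarrow> \<exists>w1\<in>W. \<exists>w2\<in>W. Cod C w1 = Cod C w2 \<and> S = vert w1 w2"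
    unfolding frac_verts_def using frac_vert_eq by blast
  assume "\<exists>w1\<in>W. \<exists>w2\<in>W. Cod C w1 = Cod C w2 \<and> S = vert w1 w2"
  then obtain w1 w2 where w: "w1 \<in> W" "w2 \<in> W" "Cod C w1 = Cod C w2" "S = vert w1 w2" by blast
  obtain u1 u2 where "(u1, u2) \<in> spans C W w1 w2" using span_exists w by blast
  then show "S \<in> frac_verts C W" 
    unfolding frac_verts_def
    by (intro CollectI exI[of _ w1] exI[of _ w2] exI[of _ "(u1, u2)"]) (simp add: w frac_vert_eq)
qed

definition reps :: "'a frac_hor \<Rightarrow> 'a frac_hor \<Rightarrow> 'a cell_rep set" where
  "reps f1 f2 = cell_reps C f1 f2 (vert (h_from f1) (h_from f2)) (vert (h_to f1) (h_to f2))"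

text \<open>The normal form of a cell carries all representatives at once, so that equality of cells
  is equality of their top and bottom. It denotes a cell of \<open>Frac C W\<close> only when
  \<open>reps f1 f2\<close> is nonempty.\<close>

definition cell :: "'a frac_hor \<Rightarrow> 'a frac_hor \<Rightarrow> 'a frac_cell" where
  "cell f1 f2 = Cell f1 f2 (vert (h_from f1) (h_from f2)) (vert (h_to f1) (h_to f2)) (reps f1 f2)"

lemma cell_sel [simp]: "c_top (cell f1 f2) = f1" "c_bot (cell f1 f2) = f2"
  "c_left (cell f1 f2) = vert (h_from f1) (h_from f2)" "c_right (cell f1 f2) = vert (h_to f1) (h_to f2)"
  "c_class (cell f1 f2) = reps f1 f2"
  by (simp_all add: cell_def)

lemma frac_horsD:
  "f \<in> frac_hors C W \<Longrightarrow> h_from f \<in> W" "f \<in> frac_hors C W \<Longrightarrow> h_to f \<in> W" "f \<in> frac_hors C W \<Longrightarrow> h_arr f \<in> Arr C"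
  "f \<in> frac_hors C W \<Longrightarrow> Dom C (h_arr f) = Dom C (h_from f)"
  "f \<in> frac_hors C W \<Longrightarrow> Cod C (h_arr f) = Dom C (h_to f)"
  by (auto simp: frac_hors_def)

lemma frac_hors_iff: "f \<in> frac_hors C W \<longleftrightarrow> h_from f \<in> W \<and> h_to f \<in> W \<and> h_arr f \<in> Arr C
   \<and> Dom C (h_arr f) = Dom C (h_from f) \<and> Cod C (h_arr f) = Dom C (h_to f)"
  by (cases f) (auto simp: frac_hors_def)

lemma reps_iff:
  assumes "f1 \<in> frac_hors C W" "f2 \<in> frac_hors C W"
  shows "((u1, u2), \<phi>, (u1', u2')) \<in> reps f1 f2 \<longleftrightarrow>
    u1 \<in> W \<and> u2 \<in> W \<and> Dom C u1 = Dom C u2 \<and> Cod C u1 = Dom C (h_from f1) \<and> Cod C u2 = Dom C (h_from f2)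
    \<and> h_from f1 \<cdot> u1 = h_from f2 \<cdot> u2
    \<and> u1' \<in> W \<and> u2' \<in> W \<and> Dom C u1' = Dom C u2' \<and> Cod C u1' = Dom C (h_to f1) \<and> Cod C u2' = Dom C (h_to f2)
    \<and> h_to f1 \<cdot> u1' = h_to f2 \<cdot> u2'
    \<and> \<phi> \<in> Arr C \<and> Dom C \<phi> = Dom C u1 \<and> Cod C \<phi> = Dom C u1'
    \<and> h_arr f1 \<cdot> u1 = u1' \<cdot> \<phi> \<and> h_arr f2 \<cdot> u2 = u2' \<cdot> \<phi>"
  using assms by (auto simp: reps_def cell_reps_def spans_iff frac_horsD)

lemma reps_refine_left:
  assumes f: "f1 \<in> frac_hors C W" "f2 \<in> frac_hors C W" and x: "((u1, u2), \<phi>, (u1', u2')) \<in> reps f1 f2"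
    and r: "r \<in> W" "Cod C r = Dom C u1"
  shows "((u1 \<cdot> r, u2 \<cdot> r), \<phi> \<cdot> r, (u1', u2')) \<in> reps f1 f2"
  using x r f unfolding reps_iff[OF f] by (simp add: C_simps Cmp_assoc frac_horsD)

lemma reps_refine_right:
  assumes f: "f1 \<in> frac_hors C W" "f2 \<in> frac_hors C W" and x: "((u1, u2), r \<cdot> \<xi>, (u1', u2')) \<in> reps f1 f2"
    and r: "r \<in> W" "Cod C r = Dom C u1'" "\<xi> \<in> Arr C" "Cod C \<xi> = Dom C r"
  shows "((u1, u2), \<xi>, (u1' \<cdot> r, u2' \<cdot> r)) \<in> reps f1 f2"
  using x r f unfolding reps_iff[OF f] by (simp add: C_simps Cmp_assoc frac_horsD)

text \<open>By CF3, two representatives become equal after refining their spans, so the boundary of a cell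
  determines the cell.\<close>

lemma cell_rel_image:
  assumes f: "f1 \<in> frac_hors C W" "f2 \<in> frac_hors C W"
  defines "S \<equiv> vert (h_from f1) (h_from f2)" and "S' \<equiv> vert (h_to f1) (h_to f2)"
  shows "cell_rel C W f1 f2 S S' `` {x} = (if x \<in> reps f1 f2 then reps f1 f2 else {})"
proof -
  have "(x, y) \<in> cell_rel C W f1 f2 S S'" if xy: "x \<in> reps f1 f2" "y \<in> reps f1 f2" for y
  proof -
    obtain u1 u2 \<phi> u1' u2' v1 v2 \<psi> v1' v2' where x: "x = ((u1, u2), \<phi>, (u1', u2'))"
      and y: "y = ((v1, v2), \<psi>, (v1', v2'))" by (metis surj_pair)
    note U = xy(1)[unfolded x reps_iff[OF f]] and V = xy(2)[unfolded y reps_iff[OF f]]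
    note F = frac_horsD[OF f(1)] frac_horsD[OF f(2)]
    obtain r s where rs: "r \<in> W" "s \<in> W" "Dom C r = Dom C s" "Cod C r = Dom C u1" "Cod C s = Dom C v1"
      "u1 \<cdot> r = v1 \<cdot> s" "u2 \<cdot> r = v2 \<cdot> s"
      by (rule spans_common_refinement[of "h_from f1" "h_from f2" u1 u2 v1 v2]) (use U V F in \<open>simp_all add: spans_iff\<close>)
    obtain r' s' where rs': "r' \<in> W" "s' \<in> W" "Dom C r' = Dom C s'" "Cod C r' = Dom C u1'" "Cod C s' = Dom C v1'"
      "u1' \<cdot> r' = v1' \<cdot> s'" "u2' \<cdot> r' = v2' \<cdot> s'"
      by (rule spans_common_refinement[of "h_to f1" "h_to f2" u1' u2' v1' v2']) (use U V F in \<open>simp_all add: spans_iff\<close>)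
    \<comment> \<open>CF2 carries \<open>\<phi>\<close>, and below also \<open>\<psi>\<close>, over
      to the common refinement of the right spans. The results \<open>c1\<close> and
      \<open>c2\<close> are two candidates for the connecting arrow \<open>\<chi>\<close>.\<close>
    obtain x1 c1 where 1: "c1 \<in> Arr C" "x1 \<in> W" "Dom C c1 = Dom C x1" "Cod C c1 = Dom C r'" "Cod C x1 = Dom C r"
      "r' \<cdot> c1 = \<phi> \<cdot> r \<cdot> x1"
      by (rule CF2_W[of "\<phi> \<cdot> r" r']) (use U rs rs' in \<open>simp_all add: C_simps\<close>)
    obtain x2 c2 where 2: "c2 \<in> Arr C" "x2 \<in> W" "Dom C c2 = Dom C x2" "Cod C c2 = Dom C s'" "Cod C x2 = Dom C x1"
      "s' \<cdot> c2 = \<psi> \<cdot> s \<cdot> x1 \<cdot> x2"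
      by (rule CF2_W[of "\<psi> \<cdot> s \<cdot> x1" s']) (use U V rs rs' 1 in \<open>simp_all add: C_simps\<close>)
    \<comment> \<open>Both candidates compute \<open>h_arr f1\<close> on the common refinement of
      the left spans, so they agree after \<open>u1' \<cdot> r'\<close>. That arrow lies in
      \<open>W\<close>, and CF3 makes the candidates equal after one more refinement
      \<open>t\<close>.\<close>
    have "(u1' \<cdot> r') \<cdot> (c1 \<cdot> x2) = u1' \<cdot> (r' \<cdot> c1) \<cdot> x2"
      using U rs'(1-5) 1(1-5) 2(1-5) by (simp add: C_simps Cmp_assoc)
    also have "\<dots> = (u1' \<cdot> \<phi>) \<cdot> r \<cdot> x1 \<cdot> x2"
      unfolding 1(6) using U rs(1-5) rs'(1-5) 1(1-5) 2(1-5) by (simp add: C_simps Cmp_assoc)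
    also have "\<dots> = h_arr f1 \<cdot> (u1 \<cdot> r) \<cdot> x1 \<cdot> x2"
      using U F rs(1-5) rs'(1-5) 1(1-5) 2(1-5) by (simp add: C_simps Cmp_assoc)
    also have "\<dots> = (h_arr f1 \<cdot> v1) \<cdot> s \<cdot> x1 \<cdot> x2"
      unfolding rs(6) using V F rs(1-5) rs'(1-5) 1(1-5) 2(1-5) by (simp add: C_simps Cmp_assoc)
    also have "\<dots> = v1' \<cdot> (\<psi> \<cdot> s \<cdot> x1 \<cdot> x2)"
      using V F rs(1-5) rs'(1-5) 1(1-5) 2(1-5) by (simp add: C_simps Cmp_assoc)
    also have "\<dots> = (u1' \<cdot> r') \<cdot> c2"
      unfolding 2(6)[symmetric] rs'(6) using V F rs(1-5) rs'(1-5) 1(1-5) 2(1-5) by (simp add: C_simps Cmp_assoc)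
    finally have "(u1' \<cdot> r') \<cdot> (c1 \<cdot> x2) = (u1' \<cdot> r') \<cdot> c2" .
    then obtain t where t: "t \<in> W" "Cod C t = Dom C x2" "c1 \<cdot> x2 \<cdot> t = c2 \<cdot> t"
      using CF3[of "u1' \<cdot> r'" "c1 \<cdot> x2" c2] U rs'(1-5) 1(1-5) 2(1-5) by (auto simp: C_simps)
    define R where "R = x1 \<cdot> x2 \<cdot> t"
    have R: "R \<in> W" "Dom C R = Dom C t" "Cod C R = Dom C r" using 1 2 t by (simp_all add: R_def C_simps)
    have e1: "\<phi> \<cdot> (r \<cdot> R) = r' \<cdot> (c2 \<cdot> t)"
    proof -
      have "\<phi> \<cdot> (r \<cdot> R) = (\<phi> \<cdot> r \<cdot> x1) \<cdot> x2 \<cdot> t"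
        using U rs(1-5) 1(1-5) 2(1-5) t by (simp add: C_simps R_def Cmp_assoc)
      also have "\<dots> = r' \<cdot> (c1 \<cdot> x2 \<cdot> t)"
        unfolding 1(6)[symmetric] using rs'(1-5) 1(1-5) 2(1-5) t(1-2) by (simp add: C_simps Cmp_assoc)
      finally show ?thesis by (simp add: t)
    qed
    have e2: "\<psi> \<cdot> (s \<cdot> R) = s' \<cdot> (c2 \<cdot> t)"
    proof -
      have "\<psi> \<cdot> (s \<cdot> R) = (\<psi> \<cdot> s \<cdot> x1 \<cdot> x2) \<cdot> t"
        using U V rs(1-5) 1(1-5) 2(1-5) t by (simp add: C_simps R_def Cmp_assoc)
      then show ?thesis
        unfolding 2(6)[symmetric] using rs'(1-5) 1(1-5) 2(1-5) t(1-2) by (simp add: C_simps Cmp_assoc)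
    qed
    have e3: "u1 \<cdot> (r \<cdot> R) = v1 \<cdot> (s \<cdot> R)" "u2 \<cdot> (r \<cdot> R) = v2 \<cdot> (s \<cdot> R)"
      using U V rs R by (simp_all add: C_simps Cmp_assoc)
    have "x \<in> cell_reps C f1 f2 S S'" "y \<in> cell_reps C f1 f2 S S'"
      using xy by (simp_all add: reps_def S_def S'_def)
    moreover have "r \<cdot> R \<in> Arr C" "s \<cdot> R \<in> Arr C" "r' \<in> Arr C" "s' \<in> Arr C" "c2 \<cdot> t \<in> Arr C"
      "Dom C (s \<cdot> R) = Dom C (r \<cdot> R)" "Cod C (r \<cdot> R) = Dom C u1" "Cod C (s \<cdot> R) = Dom C v1"
      "Dom C (c2 \<cdot> t) = Dom C (r \<cdot> R)" "Cod C (c2 \<cdot> t) = Dom C r'"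
      "v_from S \<cdot> (u1 \<cdot> (r \<cdot> R)) \<in> W" "v_from S' \<cdot> (u1' \<cdot> r') \<in> W"
      using U rs(1-5) rs'(1-5) 1(1-5) 2(1-5) t(1,2) R F by (simp_all add: C_simps S_def S'_def)
    ultimately show ?thesis
      unfolding cell_rel_def x y mem_Collect_eq case_prod_conv
      using rs'(3)[symmetric] rs'(4-7) e1 e2 e3 by blast
  qed
  then show ?thesis by (auto simp: cell_rel_def reps_def S_def S'_def)
qed

lemma frac_cell_eq:
  assumes "f1 \<in> frac_hors C W" "f2 \<in> frac_hors C W" "x \<in> reps f1 f2"
  shows "frac_cell C W f1 f2 (vert (h_from f1) (h_from f2)) (vert (h_to f1) (h_to f2)) x = cell f1 f2"
  by (simp add: frac_cell_def cell_def cell_rel_image assms)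

text \<open>The legs of each span have equal composites into the two objects, and a composite keeps
  the codomain of its last factor.\<close>

lemma reps_Cod:
  assumes "f1 \<in> frac_hors C W" "f2 \<in> frac_hors C W" "x \<in> reps f1 f2"
  shows "Cod C (h_from f1) = Cod C (h_from f2)" "Cod C (h_to f1) = Cod C (h_to f2)"
proof -
  obtain u1 u2 \<phi> u1' u2' where x: "x = ((u1, u2), \<phi>, (u1', u2'))" by (metis surj_pair)
  show "Cod C (h_from f1) = Cod C (h_from f2)" "Cod C (h_to f1) = Cod C (h_to f2)"
    using assms(3) unfolding x reps_iff[OF assms(1,2)] using frac_horsD[OF assms(1)] frac_horsD[OF assms(2)]
    by (metis Cod_Cmp W_Arr)+
qed

lemma frac_cells_iff: "\<zeta> \<in> frac_cells C W \<longleftrightarrow>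
   (\<exists>f1\<in>frac_hors C W. \<exists>f2\<in>frac_hors C W. reps f1 f2 \<noteq> {} \<and> \<zeta> = cell f1 f2)" (is "?l \<longleftrightarrow> ?r")
proof
  assume ?l
  then obtain f1 f2 S S' x where z: "\<zeta> = frac_cell C W f1 f2 S S' x" and f: "f1 \<in> frac_hors C W" "f2 \<in> frac_hors C W"
    and S: "S \<in> frac_verts C W" "S' \<in> frac_verts C W" "v_from S = h_from f1" "v_to S = h_from f2"
     "v_from S' = h_to f1" "v_to S' = h_to f2" and x: "x \<in> cell_reps C f1 f2 S S'"
    unfolding frac_cells_def by blast
  have "S = vert (h_from f1) (h_from f2)" "S' = vert (h_to f1) (h_to f2)"
    using S unfolding frac_verts_iff by auto
  then show ?r using z f x frac_cell_eq[OF f] unfolding reps_def by blast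
next
  assume ?r
  then obtain f1 f2 x where z: "\<zeta> = cell f1 f2" and f: "f1 \<in> frac_hors C W" "f2 \<in> frac_hors C W" and x: "x \<in> reps f1 f2"
    by blast
  have "vert (h_from f1) (h_from f2) \<in> frac_verts C W" "vert (h_to f1) (h_to f2) \<in> frac_verts C W"
    using reps_Cod[OF f x] frac_horsD[OF f(1)] frac_horsD[OF f(2)] unfolding frac_verts_iff by blast+
  moreover have "x \<in> cell_reps C f1 f2 (vert (h_from f1) (h_from f2)) (vert (h_to f1) (h_to f2))"
    using x by (simp add: reps_def)
  ultimately show ?l unfolding frac_cells_def z frac_cell_eq[OF f x, symmetric] using f by fastforce
qed

text \<open>CF2 aligns the middle legs on both sides, a further use of CF2 lifts the two arrows, and
  CF3 equalises the lifts. Once both cells are represented by the same arrow \<open>\<xi>\<close>,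
  composing them vertically just drops the middle legs.\<close>

lemma reps_vcomp:
  assumes f: "f1 \<in> frac_hors C W" "f2 \<in> frac_hors C W" "f3 \<in> frac_hors C W"
    and xy: "x \<in> reps f1 f2" "y \<in> reps f2 f3"
  obtains p1 p2 p3 \<xi> q1 q2 q3 where "((p1, p2), \<xi>, (q1, q2)) \<in> reps f1 f2" "((p2, p3), \<xi>, (q2, q3)) \<in> reps f2 f3"
    "((p1, p3), \<xi>, (q1, q3)) \<in> reps f1 f3"
proof -
  obtain u1 u2 \<phi> u1' u2' v1 v2 \<psi> v1' v2' where x: "x = ((u1, u2), \<phi>, (u1', u2'))"
    and y: "y = ((v1, v2), \<psi>, (v1', v2'))" by (metis surj_pair)
  note U = xy(1)[unfolded x reps_iff[OF f(1,2)]] and V = xy(2)[unfolded y reps_iff[OF f(2,3)]]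
  note F = frac_horsD[OF f(1)] frac_horsD[OF f(2)] frac_horsD[OF f(3)]
  obtain a b where ab: "a \<in> W" "b \<in> W" "Dom C a = Dom C b" "Cod C a = Dom C u2" "Cod C b = Dom C v1" "u2 \<cdot> a = v1 \<cdot> b"
    using span_exists[of u2 v1] U V spans_iff[of u2 v1] by metis
  obtain a' b' where ab': "a' \<in> W" "b' \<in> W" "Dom C a' = Dom C b'" "Cod C a' = Dom C u2'" "Cod C b' = Dom C v1'"
    "u2' \<cdot> a' = v1' \<cdot> b'"
    using span_exists[of u2' v1'] U V spans_iff[of u2' v1'] by metis
  obtain \<xi>1 r1 where 1: "\<xi>1 \<in> Arr C" "r1 \<in> W" "Dom C \<xi>1 = Dom C r1" "Cod C \<xi>1 = Dom C a'" "Cod C r1 = Dom C a"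
    "a' \<cdot> \<xi>1 = \<phi> \<cdot> a \<cdot> r1"
    by (rule CF2_W[of "\<phi> \<cdot> a" a']) (use U ab ab' in \<open>simp_all add: C_simps\<close>)
  obtain \<xi>2 r2 where 2: "\<xi>2 \<in> Arr C" "r2 \<in> W" "Dom C \<xi>2 = Dom C r2" "Cod C \<xi>2 = Dom C b'" "Cod C r2 = Dom C r1"
    "b' \<cdot> \<xi>2 = \<psi> \<cdot> b \<cdot> r1 \<cdot> r2"
    by (rule CF2_W[of "\<psi> \<cdot> b \<cdot> r1" b']) (use V ab ab' 1 in \<open>simp_all add: C_simps\<close>)
  \<comment> \<open>The two lifts are compared after \<open>u2' \<cdot> a'\<close>, an arrow of
    \<open>W\<close>: both sides compute the middle horizontal arrow \<open>f2\<close> on the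
    aligned leg.\<close>
  have "(u2' \<cdot> a') \<cdot> (\<xi>1 \<cdot> r2) = u2' \<cdot> (a' \<cdot> \<xi>1) \<cdot> r2"
    using U ab'(1-5) 1(1-5) 2(1-5) by (simp add: C_simps Cmp_assoc)
  also have "\<dots> = (u2' \<cdot> \<phi>) \<cdot> a \<cdot> r1 \<cdot> r2"
    unfolding 1(6) using U ab(1-5) 1(1-5) 2(1-5) by (simp add: C_simps Cmp_assoc)
  also have "\<dots> = h_arr f2 \<cdot> (u2 \<cdot> a) \<cdot> r1 \<cdot> r2"
    using U F ab(1-5) 1(1-5) 2(1-5) by (simp add: C_simps Cmp_assoc)
  also have "\<dots> = (h_arr f2 \<cdot> v1) \<cdot> b \<cdot> r1 \<cdot> r2"
    unfolding ab(6) using V F ab(1-5) 1(1-5) 2(1-5) by (simp add: C_simps Cmp_assoc)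
  also have "\<dots> = v1' \<cdot> (\<psi> \<cdot> b \<cdot> r1 \<cdot> r2)"
    using V F ab(1-5) 1(1-5) 2(1-5) by (simp add: C_simps Cmp_assoc)
  also have "\<dots> = (u2' \<cdot> a') \<cdot> \<xi>2"
    unfolding 2(6)[symmetric] ab'(6) using V ab'(1-5) 1(1-5) 2(1-5) by (simp add: C_simps Cmp_assoc)
  finally have "(u2' \<cdot> a') \<cdot> (\<xi>1 \<cdot> r2) = (u2' \<cdot> a') \<cdot> \<xi>2" .
  then obtain t where t: "t \<in> W" "Cod C t = Dom C r2" "\<xi>1 \<cdot> r2 \<cdot> t = \<xi>2 \<cdot> t"
    using CF3[of "u2' \<cdot> a'" "\<xi>1 \<cdot> r2" \<xi>2] U ab'(1-5) 1(1-5) 2(1-5) by (auto simp: C_simps)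
  define R where "R = r1 \<cdot> r2 \<cdot> t"
  have R: "R \<in> W" "Dom C R = Dom C t" "Cod C R = Dom C a" using 1 2 t by (simp_all add: R_def C_simps)
  have e1: "\<phi> \<cdot> (a \<cdot> R) = a' \<cdot> (\<xi>2 \<cdot> t)"
  proof -
    have "\<phi> \<cdot> (a \<cdot> R) = (\<phi> \<cdot> a \<cdot> r1) \<cdot> r2 \<cdot> t"
      using U ab(1-5) 1(1-5) 2(1-5) t by (simp add: C_simps R_def Cmp_assoc)
    also have "\<dots> = a' \<cdot> (\<xi>1 \<cdot> r2 \<cdot> t)"
      unfolding 1(6)[symmetric] using ab'(1-5) 1(1-5) 2(1-5) t(1-2) by (simp add: C_simps Cmp_assoc)
    finally show ?thesis by (simp add: t)
  qed
  have e2: "\<psi> \<cdot> (b \<cdot> R) = b' \<cdot> (\<xi>2 \<cdot> t)"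
  proof -
    have "\<psi> \<cdot> (b \<cdot> R) = (\<psi> \<cdot> b \<cdot> r1 \<cdot> r2) \<cdot> t"
      using V ab(1-5) 1(1-5) 2(1-5) t by (simp add: C_simps R_def Cmp_assoc)
    then show ?thesis
      unfolding 2(6)[symmetric] using ab'(1-5) 1(1-5) 2(1-5) t(1-2) by (simp add: C_simps Cmp_assoc)
  qed
  \<comment> \<open>The equation \<open>e1\<close> shows that the refined arrow factors through
    \<open>a'\<close>, so this factor from \<open>W\<close> can be moved into the right
    span.\<close>
  have "((u1 \<cdot> (a \<cdot> R), u2 \<cdot> (a \<cdot> R)), \<xi>2 \<cdot> t, (u1' \<cdot> a', u2' \<cdot> a')) \<in> reps f1 f2"
    by (rule reps_refine_right[OF f(1,2)], fold e1, rule reps_refine_left[OF f(1,2) xy(1)[unfolded x]])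
      (use U ab ab' R t 2 in \<open>simp_all add: C_simps\<close>)
  moreover have "((v1 \<cdot> (b \<cdot> R), v2 \<cdot> (b \<cdot> R)), \<xi>2 \<cdot> t, (v1' \<cdot> b', v2' \<cdot> b')) \<in> reps f2 f3"
    by (rule reps_refine_right[OF f(2,3)], fold e2, rule reps_refine_left[OF f(2,3) xy(2)[unfolded y]])
      (use V ab ab' R t 2 in \<open>simp_all add: C_simps\<close>)
  moreover have "v1 \<cdot> (b \<cdot> R) = u2 \<cdot> (a \<cdot> R)"
    using U V ab R by (simp add: C_simps Cmp_assoc)
  ultimately have "((u1 \<cdot> (a \<cdot> R), u2 \<cdot> (a \<cdot> R)), \<xi>2 \<cdot> t, (u1' \<cdot> a', u2' \<cdot> a')) \<in> reps f1 f2"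
    "((u2 \<cdot> (a \<cdot> R), v2 \<cdot> (b \<cdot> R)), \<xi>2 \<cdot> t, (u2' \<cdot> a', v2' \<cdot> b')) \<in> reps f2 f3"
    by (simp_all add: ab'(6))
  then show ?thesis
    by (rule that) (use \<open>((u1 \<cdot> (a \<cdot> R), u2 \<cdot> (a \<cdot> R)), \<xi>2 \<cdot> t, (u1' \<cdot> a', u2' \<cdot> a')) \<in> reps f1 f2\<close>
      \<open>((u2 \<cdot> (a \<cdot> R), v2 \<cdot> (b \<cdot> R)), \<xi>2 \<cdot> t, (u2' \<cdot> a', v2' \<cdot> b')) \<in> reps f2 f3\<close> f in \<open>simp add: reps_iff\<close>)
qed

lemma hor_comp: 
  "\<lbrakk>f \<in> frac_hors C W; g \<in> frac_hors C W; h_from g = h_to f\<rbrakk> \<Longrightarrow> frac_hor_comp C g f \<in> frac_hors C W"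
  by (simp add: frac_hors_iff frac_hor_comp_def C_simps)

lemma hor_comp_sel [simp]: "h_from (frac_hor_comp C g f) = h_from f" "h_to (frac_hor_comp C g f) = h_to g"
   "h_arr (frac_hor_comp C g f) = h_arr g \<cdot> h_arr f"
  by (simp_all add: frac_hor_comp_def)

lemma reps_hcomp_composite:
  assumes f: "f1 \<in> frac_hors C W" "f2 \<in> frac_hors C W" and g: "g1 \<in> frac_hors C W" "g2 \<in> frac_hors C W"
    and fg: "h_from g1 = h_to f1" "h_from g2 = h_to f2"
    and xy: "(u, \<phi>, p) \<in> reps f1 f2" "(p, \<psi>, v) \<in> reps g1 g2"
  shows "(u, \<psi> \<cdot> \<phi>, v) \<in> reps (frac_hor_comp C g1 f1) (frac_hor_comp C g2 f2)"
proof -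
  obtain u1 u2 p1 p2 v1 v2 where p: "u = (u1, u2)" "p = (p1, p2)" "v = (v1, v2)" by fastforce
  note F = frac_horsD[OF f(1)] frac_horsD[OF f(2)] frac_horsD[OF g(1)] frac_horsD[OF g(2)] fg
  note U = xy(1)[unfolded p reps_iff[OF f]] and V = xy(2)[unfolded p reps_iff[OF g]]
  have e: "k \<cdot> h \<cdot> a = d \<cdot> (\<psi> \<cdot> \<phi>)"
    if "h \<cdot> a = b \<cdot> \<phi>" "k \<cdot> b = d \<cdot> \<psi>" "h \<in> Arr C" "k \<in> Arr C" "a \<in> Arr C" "b \<in> Arr C" "d \<in> Arr C"
      "Cod C h = Dom C k" "Cod C a = Dom C h" "Cod C \<phi> = Dom C b" "Cod C b = Dom C k" "Dom C \<psi> = Dom C b" "Cod C \<psi> = Dom C d"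
    for h k a b d
  proof -
    have "k \<cdot> h \<cdot> a = k \<cdot> (b \<cdot> \<phi>)" using that(1,3-) by (simp add: Cmp_assoc[symmetric])
    also have "\<dots> = d \<cdot> \<psi> \<cdot> \<phi>" using that(2-) U by (simp add: Cmp_assoc)
    finally show ?thesis using that U V by (simp add: Cmp_assoc)
  qed
  have "h_arr g1 \<cdot> h_arr f1 \<cdot> u1 = v1 \<cdot> (\<psi> \<cdot> \<phi>)" "h_arr g2 \<cdot> h_arr f2 \<cdot> u2 = v2 \<cdot> (\<psi> \<cdot> \<phi>)"
    by (rule e[of _ _ p1] e[of _ _ p2]; use U V F in \<open>simp add: C_simps\<close>)+
  then show ?thesis
    unfolding p using U V F hor_comp[OF f(1) g(1)] hor_comp[OF f(2) g(2)] by (simp add: reps_iff C_simps)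
qed

text \<open>A common refinement of the two middle spans, along which CF2 pulls back
  \<open>\<phi>\<close>, lets both representatives meet in the same span. Horizontal composition is
  then composition of arrows in \<open>C\<close>.\<close>

lemma reps_hcomp:
  assumes f: "f1 \<in> frac_hors C W" "f2 \<in> frac_hors C W" and g: "g1 \<in> frac_hors C W" "g2 \<in> frac_hors C W"
    and fg: "h_from g1 = h_to f1" "h_from g2 = h_to f2"
    and xy: "x \<in> reps f1 f2" "y \<in> reps g1 g2"
  obtains u \<phi> p \<psi> v where "(u, \<phi>, p) \<in> reps f1 f2" "(p, \<psi>, v) \<in> reps g1 g2"
    "(u, \<psi> \<cdot> \<phi>, v) \<in> reps (frac_hor_comp C g1 f1) (frac_hor_comp C g2 f2)"
proof -
  obtain u1 u2 \<phi> u1' u2' v1 v2 \<psi> v1' v2' where x: "x = ((u1, u2), \<phi>, (u1', u2'))"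
    and y: "y = ((v1, v2), \<psi>, (v1', v2'))" by (metis surj_pair)
  note U = xy(1)[unfolded x reps_iff[OF f]] and V = xy(2)[unfolded y reps_iff[OF g]]
  note F = frac_horsD[OF f(1)] frac_horsD[OF f(2)] frac_horsD[OF g(1)] frac_horsD[OF g(2)] fg
  obtain r s where rs: "r \<in> W" "s \<in> W" "Dom C r = Dom C s" "Cod C r = Dom C u1'" "Cod C s = Dom C v1"
    "u1' \<cdot> r = v1 \<cdot> s" "u2' \<cdot> r = v2 \<cdot> s"
    by (rule spans_common_refinement[of "h_to f1" "h_to f2" u1' u2' v1 v2]) (use U V F in \<open>simp_all add: spans_iff\<close>)
  obtain \<phi>' q where q: "\<phi>' \<in> Arr C" "q \<in> W" "Dom C \<phi>' = Dom C q" "Cod C \<phi>' = Dom C r" "Cod C q = Dom C \<phi>"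
      "r \<cdot> \<phi>' = \<phi> \<cdot> q"
    by (rule CF2_W[of \<phi> r]) (use U rs in \<open>simp_all add: C_simps\<close>)
  have 1: "((u1 \<cdot> q, u2 \<cdot> q), \<phi>', (u1' \<cdot> r, u2' \<cdot> r)) \<in> reps f1 f2"
    by (rule reps_refine_right[OF f], unfold q(6), rule reps_refine_left[OF f xy(1)[unfolded x]])
      (use U rs q in \<open>simp_all add: C_simps\<close>)
  have 2: "((u1' \<cdot> r, u2' \<cdot> r), \<psi> \<cdot> s, (v1', v2')) \<in> reps g1 g2"
    unfolding rs(6,7) by (rule reps_refine_left[OF g xy(2)[unfolded y]]) (use V rs q in \<open>simp_all add: C_simps\<close>)
  show ?thesis by (rule that[OF 1 2 reps_hcomp_composite[OF f g fg 1 2]])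
qed

end

section \<open>The operations of the double category of fractions as operations on
  boundaries\<close>

context fractions
begin

lemma vert_inject [simp]: "vert w1 w2 = vert v1 v2 \<longleftrightarrow> w1 = v1 \<and> w2 = v2"
  using vert_sel by metis

lemma cell_inject [simp]: "cell f1 f2 = cell g1 g2 \<longleftrightarrow> f1 = g1 \<and> f2 = g2"
  using cell_sel by metis

lemma frac_vert_id: "w \<in> W \<Longrightarrow> frac_vert_id C W w = vert w w"
  unfolding frac_vert_id_def by (rule frac_vert_eq) (simp_all add: spans_iff C_simps)

text \<open>Every choice of spans and completing square contributes all spans or nothing to the
  union, so exhibiting one good choice determines the composite.\<close>

lemma frac_vert_comp:
  assumes w: "w1 \<in> W" "w2 \<in> W" "w3 \<in> W" and c: "Cod C w1 = Cod C w2" "Cod C w2 = Cod C w3"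
  shows "frac_vert_comp C W (vert w2 w3) (vert w1 w2) = vert w1 w3"
proof -
  obtain u1 u2 where u: "(u1, u2) \<in> spans C W w1 w2" using span_exists w c by blast
  obtain v1 v2 where v: "(v1, v2) \<in> spans C W w2 w3" using span_exists w c by blast
  note U = u[unfolded spans_iff[OF w(1,2)]] and V = v[unfolded spans_iff[OF w(2,3)]]
  obtain a b where ab: "a \<in> W" "b \<in> W" "Dom C a = Dom C b" "Cod C a = Dom C u2" "Cod C b = Dom C v1" "u2 \<cdot> a = v1 \<cdot> b"
    using span_exists[of u2 v1] U V spans_iff[of u2 v1] by metis
  have sq: "(a, b) \<in> vert_squares C W w2 u2 v1"
    using U V ab(1-5) w by (simp add: vert_squares_def C_simps ab(6)[symmetric])
  have "w1 \<cdot> (u1 \<cdot> a) = w2 \<cdot> (u2 \<cdot> a)" using U ab(1-5) w by (simp add: Cmp_assoc C_simps)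
  also have "\<dots> = w3 \<cdot> (v2 \<cdot> b)" unfolding ab(6) using V ab(1-5) w by (simp add: Cmp_assoc C_simps)
  finally have "(u1 \<cdot> a, v2 \<cdot> b) \<in> spans C W w1 w3"
    using U V ab(1-5) w by (simp add: spans_iff C_simps)
  then have "span_rel C W w1 w3 `` {(u1 \<cdot> a, v2 \<cdot> b)} = spans C W w1 w3"
    by (simp add: span_rel_image w)
  moreover have "\<And>x. span_rel C W w1 w3 `` {x} \<subseteq> spans C W w1 w3"
    by (simp add: span_rel_image w)
  ultimately have "\<Union> {span_rel C W w1 w3 `` {(u1 \<cdot> v1', v2 \<cdot> u2')} | u1 u2 v1 v2 v1' u2'.
        (u1, u2) \<in> spans C W w1 w2 \<and> (v1, v2) \<in> spans C W w2 w3 \<and> (v1', u2') \<in> vert_squares C W w2 u2 v1}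
      = spans C W w1 w3"
    using u v sq by (intro equalityI) blast+
  then show ?thesis by (simp add: frac_vert_comp_def) (simp add: vert_def)
qed

text \<open>Existence of a representative is the only information that a cell adds to its boundary.
  Composition of cells is expressed by closure properties of this relation.\<close>

definition linked :: "'a frac_hor \<Rightarrow> 'a frac_hor \<Rightarrow> bool" where
  "linked f1 f2 \<longleftrightarrow> f1 \<in> frac_hors C W \<and> f2 \<in> frac_hors C W \<and> reps f1 f2 \<noteq> {}"

lemma linkedD: assumes "linked f1 f2" shows "f1 \<in> frac_hors C W" "f2 \<in> frac_hors C W"
    "Cod C (h_from f1) = Cod C (h_from f2)" "Cod C (h_to f1) = Cod C (h_to f2)"
  using assms reps_Cod[of f1 f2] unfolding linked_def by blast+

lemma frac_cells_linked: "\<zeta> \<in> frac_cells C W \<longleftrightarrow> (\<exists>f1 f2. linked f1 f2 \<and> \<zeta> = cell f1 f2)"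
  unfolding frac_cells_iff linked_def by blast

lemma linked_trans: "\<lbrakk>linked f1 f2; linked f2 f3\<rbrakk> \<Longrightarrow> linked f1 f3"
  unfolding linked_def using reps_vcomp[of f1 f2 f3] by (metis empty_iff ex_in_conv)

lemma linked_hcomp: "\<lbrakk>linked f1 f2; linked g1 g2; h_from g1 = h_to f1; h_from g2 = h_to f2\<rbrakk>
    \<Longrightarrow> linked (frac_hor_comp C g1 f1) (frac_hor_comp C g2 f2)"
  unfolding linked_def using reps_hcomp[of f1 f2 g1 g2] hor_comp by (metis empty_iff ex_in_conv)

lemma reps_vid: "f \<in> frac_hors C W \<Longrightarrow> ((Ide C (Dom C (h_from f)), Ide C (Dom C (h_from f))), h_arr f,
    (Ide C (Dom C (h_to f)), Ide C (Dom C (h_to f)))) \<in> reps f f"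
  using frac_horsD[of f] by (simp add: reps_iff C_simps)

lemma linked_refl: "f \<in> frac_hors C W \<Longrightarrow> linked f f"
  unfolding linked_def using reps_vid by blast

lemma frac_hor_id: "w \<in> W \<Longrightarrow> frac_hor_id C w \<in> frac_hors C W"
  by (simp add: frac_hor_id_def frac_hors_iff C_simps)

lemma frac_hor_id_sel [simp]: "h_from (frac_hor_id C w) = w" "h_to (frac_hor_id C w) = w"
  "h_arr (frac_hor_id C w) = Ide C (Dom C w)"
  by (simp_all add: frac_hor_id_def)

lemma reps_hid:
  assumes "w1 \<in> W" "w2 \<in> W" "u \<in> spans C W w1 w2"
  shows "(u, Ide C (Dom C (fst u)), u) \<in> reps (frac_hor_id C w1) (frac_hor_id C w2)"
  using assms by (cases u) (simp add: reps_iff frac_hor_id spans_iff C_simps)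

lemma linked_hid: assumes "w1 \<in> W" "w2 \<in> W" "Cod C w1 = Cod C w2"
  shows "linked (frac_hor_id C w1) (frac_hor_id C w2)"
proof -
  obtain u1 u2 where "(u1, u2) \<in> spans C W w1 w2" using span_exists assms by blast
  then show ?thesis unfolding linked_def using reps_hid[OF assms(1,2)] frac_hor_id assms(1,2) by blast
qed

lemma frac_cell_vid: "f \<in> frac_hors C W \<Longrightarrow> frac_cell_vid C W f = cell f f"
  using frac_cell_eq[OF _ _ reps_vid, of f] frac_horsD[of f] by (simp add: frac_cell_vid_def Let_def frac_vert_id)

lemma frac_cell_hid:
  assumes w: "w1 \<in> W" "w2 \<in> W" "Cod C w1 = Cod C w2"
  shows "frac_cell_hid C W (vert w1 w2) = cell (frac_hor_id C w1) (frac_hor_id C w2)"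
proof -
  have F: "frac_hor_id C w1 \<in> frac_hors C W" "frac_hor_id C w2 \<in> frac_hors C W" using w by (simp_all add: frac_hor_id)
  let ?R = "\<lambda>u. cell_rel C W (frac_hor_id C w1) (frac_hor_id C w2) (vert w1 w2) (vert w1 w2) `` {(u, Ide C (Dom C (fst u)), u)}"
  have R: "?R u = reps (frac_hor_id C w1) (frac_hor_id C w2)" if "u \<in> spans C W w1 w2" for u
    using cell_rel_image[OF F, unfolded frac_hor_id_sel] reps_hid[OF w(1,2) that] by simp
  obtain u1 u2 where "(u1, u2) \<in> spans C W w1 w2" using span_exists w by blast
  then have "spans C W w1 w2 \<noteq> {}" by blast
  then have "(\<Union>u\<in>spans C W w1 w2. ?R u) = reps (frac_hor_id C w1) (frac_hor_id C w2)"
    by (simp add: R cong: SUP_cong_simp)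
  then show ?thesis by (simp add: frac_cell_hid_def Let_def cell_def)
qed

text \<open>No choice contributes anything outside the normal form. One choice fills it: for
  representatives with the same arrow and the same middle legs, identities complete both squares and
  serve as \<open>r\<close>.\<close>

lemma frac_cell_vcomp:
  assumes l: "linked f1 f2" "linked f2 f3"
  shows "frac_cell_vcomp C W (cell f2 f3) (cell f1 f2) = cell f1 f3"
proof -
  note f = linkedD(1,2)[OF l(1)] linkedD(2)[OF l(2)]
  note F = frac_horsD[OF f(1)] frac_horsD[OF f(2)] frac_horsD[OF f(3)] linkedD(3,4)[OF l(1)] linkedD(3,4)[OF l(2)]
  obtain x y where xy: "x \<in> reps f1 f2" "y \<in> reps f2 f3" using l unfolding linked_def by blast
  obtain p1 p2 p3 \<xi> q1 q2 q3 where r: "((p1, p2), \<xi>, (q1, q2)) \<in> reps f1 f2" "((p2, p3), \<xi>, (q2, q3)) \<in> reps f2 f3"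
    "((p1, p3), \<xi>, (q1, q3)) \<in> reps f1 f3"
    by (rule reps_vcomp[OF f xy])
  note R = r(1)[unfolded reps_iff[OF f(1,2)]] r(2)[unfolded reps_iff[OF f(2,3)]]
  let ?R = "cell_rel C W f1 f3 (vert (h_from f1) (h_from f3)) (vert (h_to f1) (h_to f3))"
  let ?i = "Ide C (Dom C p1)" and ?j = "Ide C (Dom C q1)"
  have R': "p1 \<in> W" "p2 \<in> W" "p3 \<in> W" "q1 \<in> W" "q2 \<in> W" "q3 \<in> W" "\<xi> \<in> Arr C"
    "Dom C p2 = Dom C p1" "Dom C p3 = Dom C p1" "Dom C q2 = Dom C q1" "Dom C q3 = Dom C q1"
    "Dom C \<xi> = Dom C p1" "Cod C \<xi> = Dom C q1" "Cod C p2 = Dom C (h_from f2)" "Cod C q2 = Dom C (h_to f2)"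
    using R by metis+
  have sq: "(?i, ?i) \<in> vert_squares C W (h_from f2) p2 p2" "(?j, ?j) \<in> vert_squares C W (h_to f2) q2 q2"
    using R' F(6,7) by (simp_all add: vert_squares_def C_simps)
  have e: "((p1 \<cdot> ?i \<cdot> ?i, p3 \<cdot> ?i \<cdot> ?i), \<xi>, (q1 \<cdot> ?j, q3 \<cdot> ?j)) = ((p1, p3), \<xi>, (q1, q3))"
    using R' by (simp add: C_simps)
  have sub: "?R `` {x} \<subseteq> reps f1 f3" for x by (simp add: cell_rel_image[OF f(1,3)])
  have full: "?R `` {((p1 \<cdot> ?i \<cdot> ?i, p3 \<cdot> ?i \<cdot> ?i), \<xi>, (q1 \<cdot> ?j, q3 \<cdot> ?j))} = reps f1 f3"
    unfolding e using r(3) by (simp add: cell_rel_image[OF f(1,3)])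
  have "(\<Union> {?R `` {((u1 \<cdot> a \<cdot> r, v2 \<cdot> b \<cdot> r), \<xi>, (u1' \<cdot> a', v2' \<cdot> b'))} |
            u1 u2 \<phi> u1' u2' v1 v2 \<psi> v1' v2' a b a' b' r \<xi>.
          ((u1, u2), \<phi>, (u1', u2')) \<in> reps f1 f2 \<and> ((v1, v2), \<psi>, (v1', v2')) \<in> reps f2 f3
          \<and> (a, b) \<in> vert_squares C W (h_from f2) u2 v1
          \<and> (a', b') \<in> vert_squares C W (h_to f2) u2' v1'
          \<and> r \<in> W \<and> Cod C r = Dom C a
          \<and> \<xi> \<in> Arr C \<and> Dom C \<xi> = Dom C r \<and> Cod C \<xi> = Dom C a'
          \<and> a' \<cdot> \<xi> = \<phi> \<cdot> a \<cdot> r \<and> b' \<cdot> \<xi> = \<psi> \<cdot> b \<cdot> r}) = reps f1 f3" (is "\<Union> ?U = _")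
  proof (rule equalityI)
    show "\<Union> ?U \<subseteq> reps f1 f3" using sub by blast
    have "reps f1 f3 \<in> ?U"
      apply (rule CollectI)
      \<comment> \<open>The witnesses follow the quantifiers of the definition: the two aligned
        representatives, identities for the completing squares and for \<open>r\<close>, and the
        shared arrow \<open>\<xi>\<close>.\<close>
      apply (rule exI[of _ p1], rule exI[of _ p2], rule exI[of _ \<xi>], rule exI[of _ q1], rule exI[of _ q2],
          rule exI[of _ p2], rule exI[of _ p3], rule exI[of _ \<xi>], rule exI[of _ q2], rule exI[of _ q3],
          rule exI[of _ ?i], rule exI[of _ ?i], rule exI[of _ ?j], rule exI[of _ ?j], rule exI[of _ ?i], rule exI[of _ \<xi>])
      by (intro conjI full[symmetric] r sq) (use R' in \<open>simp_all add: C_simps\<close>)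
    then show "reps f1 f3 \<subseteq> \<Union> ?U" by blast
  qed
  then show ?thesis
    using F by (simp add: frac_cell_vcomp_def Let_def frac_vert_comp) (simp add: cell_def)
qed

text \<open>For representatives that share their middle span the choices \<open>r\<close>,
  \<open>s\<close> and \<open>q\<close> can be identities and the lifted arrow is
  \<open>\<phi>\<close> itself. This single admissible choice already exhausts the normal
  form.\<close>

lemma frac_cell_hcomp:
  assumes l: "linked f1 f2" "linked g1 g2" and fg: "h_from g1 = h_to f1" "h_from g2 = h_to f2"
  shows "frac_cell_hcomp C W (cell g1 g2) (cell f1 f2) = cell (frac_hor_comp C g1 f1) (frac_hor_comp C g2 f2)"
proof -
  note f = linkedD(1,2)[OF l(1)] and g = linkedD(1,2)[OF l(2)]
  note F = frac_horsD[OF f(1)] frac_horsD[OF f(2)] frac_horsD[OF g(1)] frac_horsD[OF g(2)] fg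
  let ?k1 = "frac_hor_comp C g1 f1" and ?k2 = "frac_hor_comp C g2 f2"
  have k: "?k1 \<in> frac_hors C W" "?k2 \<in> frac_hors C W" using f g fg by (simp_all add: hor_comp)
  obtain x y where xy: "x \<in> reps f1 f2" "y \<in> reps g1 g2" using l unfolding linked_def by blast
  obtain u \<phi> p \<psi> v where r: "(u, \<phi>, p) \<in> reps f1 f2" "(p, \<psi>, v) \<in> reps g1 g2" "(u, \<psi> \<cdot> \<phi>, v) \<in> reps ?k1 ?k2"
    by (rule reps_hcomp[OF f g fg xy])
  obtain u1 u2 p1 p2 v1 v2 where p: "u = (u1, u2)" "p = (p1, p2)" "v = (v1, v2)" by fastforce
  note r = r[unfolded p]
  note R = r(1)[unfolded reps_iff[OF f]] r(2)[unfolded reps_iff[OF g]]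
  let ?R = "cell_rel C W ?k1 ?k2 (vert (h_from f1) (h_from f2)) (vert (h_to g1) (h_to g2))"
  note im = cell_rel_image[OF k, unfolded hor_comp_sel]
  let ?i = "Ide C (Dom C u1)" and ?j = "Ide C (Dom C p1)"
  have R': "u1 \<in> W" "u2 \<in> W" "p1 \<in> W" "p2 \<in> W" "\<phi> \<in> Arr C" "\<psi> \<in> Arr C"
    "Dom C u2 = Dom C u1" "Dom C p2 = Dom C p1" "Cod C p1 = Dom C (h_to f1)"
    "Dom C \<phi> = Dom C u1" "Cod C \<phi> = Dom C p1" "Dom C \<psi> = Dom C p1"
    using R by metis+
  have e: "((u1 \<cdot> ?i, u2 \<cdot> ?i), \<psi> \<cdot> (?j \<cdot> \<phi>), (v1, v2)) = ((u1, u2), \<psi> \<cdot> \<phi>, (v1, v2))"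
    using R' by (simp add: C_simps)
  have sub: "?R `` {x} \<subseteq> reps ?k1 ?k2" for x by (simp add: im)
  have full: "?R `` {((u1 \<cdot> ?i, u2 \<cdot> ?i), \<psi> \<cdot> (?j \<cdot> \<phi>), (v1, v2))} = reps ?k1 ?k2"
    unfolding e using r(3) by (simp add: im)
  have "\<Union> {?R `` {((u1 \<cdot> q, u2 \<cdot> q), \<psi> \<cdot> (s \<cdot> \<phi>'), (v1', v2'))} |
            u1 u2 \<phi> u1' u2' v1 v2 \<psi> v1' v2' r s q \<phi>'.
          ((u1, u2), \<phi>, (u1', u2')) \<in> reps f1 f2 \<and> ((v1, v2), \<psi>, (v1', v2')) \<in> reps g1 g2
          \<and> r \<in> Arr C \<and> s \<in> Arr C \<and> Dom C r = Dom C s \<and> Cod C r = Dom C u1' \<and> Cod C s = Dom C v1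
          \<and> u1' \<cdot> r = v1 \<cdot> s \<and> u2' \<cdot> r = v2 \<cdot> s
          \<and> h_to f1 \<cdot> (u1' \<cdot> r) \<in> W
          \<and> q \<in> W \<and> \<phi>' \<in> Arr C \<and> Dom C q = Dom C \<phi>' \<and> Cod C q = Dom C \<phi> \<and> Cod C \<phi>' = Dom C r
          \<and> \<phi> \<cdot> q = r \<cdot> \<phi>'} = reps ?k1 ?k2" (is "\<Union> ?U = _")
  proof (rule equalityI)
    show "\<Union> ?U \<subseteq> reps ?k1 ?k2" using sub by blast
    have W: "h_to f1 \<cdot> p1 \<in> W" using R' F(2) by (intro CF1_comp) auto
    have "reps ?k1 ?k2 \<in> ?U"
      apply (rule CollectI)
      apply (rule exI[of _ u1], rule exI[of _ u2], rule exI[of _ \<phi>], rule exI[of _ p1], rule exI[of _ p2],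
          rule exI[of _ p1], rule exI[of _ p2], rule exI[of _ \<psi>], rule exI[of _ v1], rule exI[of _ v2],
          rule exI[of _ ?j], rule exI[of _ ?j], rule exI[of _ ?i], rule exI[of _ \<phi>])
      by (intro conjI full[symmetric] r) (use R' W in \<open>simp_all add: C_simps\<close>)
    then show "reps ?k1 ?k2 \<subseteq> \<Union> ?U" by blast
  qed
  then show ?thesis
    using F by (simp add: frac_cell_hcomp_def Let_def) (simp add: cell_def)
qed

lemma Frac_simps:
  "Obj (cat0 (Frac C W)) = W" "Arr (cat0 (Frac C W)) = frac_verts C W" "Dom (cat0 (Frac C W)) = v_from"
  "Cod (cat0 (Frac C W)) = v_to" "Ide (cat0 (Frac C W)) = frac_vert_id C W" "Cmp (cat0 (Frac C W)) = frac_vert_comp C W"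
  "Obj (cat1 (Frac C W)) = frac_hors C W" "Arr (cat1 (Frac C W)) = frac_cells C W" "Dom (cat1 (Frac C W)) = c_top"
  "Cod (cat1 (Frac C W)) = c_bot" "Ide (cat1 (Frac C W)) = frac_cell_vid C W" "Cmp (cat1 (Frac C W)) = frac_cell_vcomp C W"
  "omap (d0 (Frac C W)) = h_from" "amap (d0 (Frac C W)) = c_left"
  "omap (d1 (Frac C W)) = h_to" "amap (d1 (Frac C W)) = c_right"
  "omap (hid (Frac C W)) = frac_hor_id C" "amap (hid (Frac C W)) = frac_cell_hid C W"
  "hcomp (Frac C W) g f = frac_hor_comp C g f" "ccomp (Frac C W) \<beta> \<alpha> = frac_cell_hcomp C W \<beta> \<alpha>"
  by (simp_all add: Frac_def)

lemma frac_hor_eqI: "\<lbrakk>h_from f = h_from g; h_to f = h_to g; h_arr f = h_arr g\<rbrakk> \<Longrightarrow> f = g"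
  by (cases f; cases g) simp

lemma frac_hor_id_comp:
  "f \<in> frac_hors C W \<Longrightarrow> frac_hor_comp C f (frac_hor_id C (h_from f)) = f"
  "f \<in> frac_hors C W \<Longrightarrow> frac_hor_comp C (frac_hor_id C (h_to f)) f = f"
  by (rule frac_hor_eqI; simp add: frac_horsD C_simps)+

text \<open>Beyond equality of boundaries one has to know that the composites and identities are
  cells at all; this is what transitivity, reflexivity and horizontal closure of
  \<open>linked\<close> provide.\<close>

lemma Frac_double_category: "double_category (Frac C W)"
proof -
  let ?F = "Frac C W"
  have cat0: "category (cat0 ?F)"
    by unfold_locales (auto simp: Frac_simps frac_verts_iff frac_vert_id frac_vert_comp)
  have cat1: "category (cat1 ?F)"
  proof
    fix f g h assume "f \<in> Arr (cat1 ?F)" "g \<in> Arr (cat1 ?F)" "h \<in> Arr (cat1 ?F)"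
      "Cod (cat1 ?F) f = Dom (cat1 ?F) g" "Cod (cat1 ?F) g = Dom (cat1 ?F) h"
    then obtain f1 f2 f3 f4 where "f = cell f1 f2" "g = cell f2 f3" "h = cell f3 f4"
      and l: "linked f1 f2" "linked f2 f3" "linked f3 f4"
      by (auto simp: Frac_simps frac_cells_linked)
    then show "Cmp (cat1 ?F) h (Cmp (cat1 ?F) g f) = Cmp (cat1 ?F) (Cmp (cat1 ?F) h g) f"
      using linked_trans[OF l(1,2)] linked_trans[OF l(2,3)] by (simp add: Frac_simps frac_cell_vcomp)
  next
    fix f assume "f \<in> Arr (cat1 ?F)"
    then obtain f1 f2 where f: "f = cell f1 f2" and l: "linked f1 f2" by (auto simp: Frac_simps frac_cells_linked)
    then show "Cmp (cat1 ?F) f (Ide (cat1 ?F) (Dom (cat1 ?F) f)) = f" "Cmp (cat1 ?F) (Ide (cat1 ?F) (Cod (cat1 ?F) f)) f = f"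
      using linkedD[OF l] by (simp_all add: Frac_simps frac_cell_vcomp frac_cell_vid linked_refl)
  qed (auto simp: Frac_simps frac_cells_linked frac_cell_vid frac_cell_vcomp linked_refl
       dest: linkedD intro: linked_trans)
  have d: "cat_functor (cat1 ?F) (cat0 ?F) (d0 ?F)" "cat_functor (cat1 ?F) (cat0 ?F) (d1 ?F)"
    by (intro cat_functor.intro cat0 cat1 cat_functor_axioms.intro;
        auto simp: Frac_simps frac_cells_linked linkedD linked_refl frac_horsD frac_verts_iff frac_cell_vid frac_vert_id
          frac_cell_vcomp frac_vert_comp)+
  have hid: "cat_functor (cat0 ?F) (cat1 ?F) (hid ?F)"
    by (intro cat_functor.intro cat0 cat1 cat_functor_axioms.intro)
      (auto simp: Frac_simps frac_cells_linked frac_hor_id frac_verts_iff frac_cell_vid frac_vert_id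
          frac_cell_vcomp frac_vert_comp frac_cell_hid linked_hid)
  have hcmp: "cat_functor (pullback (cat1 ?F) (cat1 ?F) (d0 ?F) (d1 ?F)) (cat1 ?F) (hcmp ?F)"
  proof (intro cat_functor.intro pullback_category[OF d] cat1 cat_functor_axioms.intro)
    let ?P = "pullback (cat1 ?F) (cat1 ?F) (d0 ?F) (d1 ?F)"
    fix a b assume "a \<in> Arr ?P" "b \<in> Arr ?P" "Cod ?P a = Dom ?P b"
    then obtain f1 f2 f3 g1 g2 g3 where "a = (cell g1 g2, cell f1 f2)" "b = (cell g2 g3, cell f2 f3)"
      and l: "linked f1 f2" "linked f2 f3" "linked g1 g2" "linked g2 g3"
      and e: "h_from g1 = h_to f1" "h_from g2 = h_to f2" "h_from g3 = h_to f3"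
      by (auto simp: pullback_def Frac_simps frac_cells_linked)
    then show "amap (hcmp ?F) (Cmp ?P b a) = Cmp (cat1 ?F) (amap (hcmp ?F) b) (amap (hcmp ?F) a)"
      using linked_trans[OF l(1,2)] linked_trans[OF l(3,4)]
      by (simp add: pullback_def Frac_simps frac_cell_vcomp frac_cell_hcomp linked_hcomp)
  qed (auto simp: pullback_def Frac_simps frac_cells_linked frac_cell_hcomp linkedD hor_comp frac_cell_vid
        linked_hcomp linked_refl intro: linked_hcomp)
  show ?thesis
    by (intro double_category.intro d hid hcmp)
      (auto simp: Frac_simps frac_cells_linked frac_verts_iff frac_cell_hid frac_cell_hcomp hor_comp linkedD linked_hid
        linked_hcomp frac_horsD frac_hor_id_comp Cmp_assoc intro!: frac_hor_eqI)
qed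

lemma Frac_cell_eqI:
  assumes "\<alpha> \<in> Arr (cat1 (Frac C W))" "\<beta> \<in> Arr (cat1 (Frac C W))"
    "Dom (cat1 (Frac C W)) \<alpha> = Dom (cat1 (Frac C W)) \<beta>" "Cod (cat1 (Frac C W)) \<alpha> = Cod (cat1 (Frac C W)) \<beta>"
  shows "\<alpha> = \<beta>"
  using assms by (auto simp: Frac_simps frac_cells_linked)

section \<open>The strict functors J and Phi into the double categories built from the
  fractions\<close>

lemma J_ftr_strict: "strict_double_functor (H_dbl C) (Frac C W) (J_ftr C W)"
proof -
  interpret F: double_category "Frac C W" by (rule Frac_double_category)
  interpret H: double_category "H_dbl C" by (rule H_dbl_double_category)
  have h: "Hor (Ide C x) (Ide C y) f \<in> frac_hors C W" if "f \<in> Arr C" "Dom C f = x" "Cod C f = y" for f x y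
    using that by (auto simp: frac_hors_iff C_simps)
  have i: "frac_hor_id C (Ide C x) = Hor (Ide C x) (Ide C x) (Ide C x)" if "x \<in> Obj C" for x
    using that by (simp add: frac_hor_id_def C_simps)
  have c: "frac_hor_comp C (Hor y z g) (Hor x y f) = Hor x z (g \<cdot> f)" for x y z f g
    by (simp add: frac_hor_comp_def)
  show ?thesis
    by (intro strict_double_functor.intro strict_double_functor_axioms.intro cat_functor.intro cat_functor_axioms.intro
        F.double_category_axioms H.double_category_axioms H.D0.A.category_axioms H.D0.B.category_axioms
        F.D0.A.category_axioms F.D0.B.category_axioms)
     (auto simp: J_ftr_def Let_def H_dbl_simps Frac_simps C_simps h i c frac_vert_id frac_vert_comp frac_verts_iff
       frac_cell_vid frac_cells_linked linked_refl frac_cell_vcomp frac_cell_hid frac_cell_hcomp intro!: frac_hor_eqI)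
qed

lemma Nabla_simps:
  "Obj (Nabla C W) = W" "(u, w) \<in> Arr (Nabla C W) \<longleftrightarrow> u \<in> W \<and> w \<in> W \<and> Cod C u = Dom C w"
  "Dom (Nabla C W) (u, w) = w \<cdot> u" "Cod (Nabla C W) (u, w) = w"
  "Ide (Nabla C W) w = (Ide C (Dom C w), w)" "Cmp (Nabla C W) (u', w') (u, w) = (u' \<cdot> u, w')"
  using W_cancel_left[of w u] by (auto simp: Nabla_def W_Arr CF1_comp)

lemma Nabla_category: "category (Nabla C W)"
  by unfold_locales (auto simp: Nabla_simps C_simps Cmp_assoc)

text \<open>It is enough to check that the representatives used in the definition are
  representatives; afterwards the vertical arrow and the binding cells can be replaced by their
  normal forms.\<close>

lemma Phi_companion:
  assumes "u \<in> W" "w \<in> W" "Cod C u = Dom C w"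
  defines "h \<equiv> Hor (w \<cdot> u) w u"
  shows "Phi_companion C W (u, w) = Companion h (vert (w \<cdot> u) w) (cell (frac_hor_id C (w \<cdot> u)) h) (cell h (frac_hor_id C w))"
    "h \<in> frac_hors C W" "linked (frac_hor_id C (w \<cdot> u)) h" "linked h (frac_hor_id C w)"
proof -
  show h: "h \<in> frac_hors C W" using assms(1-3) by (simp add: h_def frac_hors_iff C_simps)
  note k = frac_hor_id[OF assms(2)] frac_hor_id[OF CF1_comp[OF assms(1-3)]]
  have p: "((Ide C (Dom C u), Ide C (Dom C u)), Ide C (Dom C u), (Ide C (Dom C u), u)) \<in> reps (frac_hor_id C (w \<cdot> u)) h"
    "((Ide C (Dom C u), u), u, (Ide C (Dom C w), Ide C (Dom C w))) \<in> reps h (frac_hor_id C w)"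
    using assms(1-3) by (simp_all add: reps_iff[OF k(2) h] reps_iff[OF h k(1)]) (simp_all add: h_def C_simps)
  then show "linked (frac_hor_id C (w \<cdot> u)) h" "linked h (frac_hor_id C w)"
    using k h unfolding linked_def by blast+
  have v: "frac_vert C W (w \<cdot> u) w (Ide C (Dom C u), u) = vert (w \<cdot> u) w"
    by (rule frac_vert_eq) (use assms(1-3) in \<open>simp_all add: spans_iff C_simps\<close>)
  show "Phi_companion C W (u, w) = Companion h (vert (w \<cdot> u) w) (cell (frac_hor_id C (w \<cdot> u)) h) (cell h (frac_hor_id C w))"
    using frac_cell_eq[OF k(2) h p(1)] frac_cell_eq[OF h k(1) p(2)] v assms(1-3)
    by (simp add: Phi_companion_def Let_def h_def frac_vert_id C_simps)
qed

abbreviation Phi0_ftr :: "('a, 'a \<times> 'a, 'a, ('a frac_vert, 'a frac_hor, 'a frac_cell) companion) ftr" where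
  "Phi0_ftr \<equiv> \<lparr>omap = \<lambda>w. w, amap = Phi_companion C W\<rparr>"

lemma Phi_functor: "cat_functor (Nabla C W) (cat0 (Companions (Frac C W))) Phi0_ftr"
proof -
  interpret F: double_category "Frac C W" by (rule Frac_double_category)
  interpret K: double_category "Companions (Frac C W)" by (rule F.Companions_double_category)
  have c: "is_companion (Frac C W) (Phi_companion C W (u, w))" if "u \<in> W" "w \<in> W" "Cod C u = Dom C w" for u w
    using Phi_companion[OF that] that CF1_comp[OF that]
    by (auto simp: is_companion_def Let_def Frac_simps frac_verts_iff frac_cells_linked C_simps frac_vert_id
        frac_cell_hcomp frac_cell_vcomp frac_cell_vid frac_cell_hid intro!: frac_hor_eqI)
  \<comment> \<open>The binding cells are determined by their boundaries, so a companion in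
    \<open>Frac C W\<close> is known from its horizontal and its vertical arrow.\<close>
  have eq: "comp_h \<theta> = comp_h \<sigma> \<Longrightarrow> comp_v \<theta> = comp_v \<sigma> \<Longrightarrow> \<theta> = \<sigma>"
    if "is_companion (Frac C W) \<theta>" "is_companion (Frac C W) \<sigma>" for \<theta> \<sigma>
    using F.companionD[OF that(1)] F.companionD[OF that(2)]
    by (intro companion.expand) (auto intro: Frac_cell_eqI)
  show ?thesis
  proof (intro cat_functor.intro cat_functor_axioms.intro Nabla_category K.D0.B.category_axioms)
    fix w assume "w \<in> Obj (Nabla C W)"
    then have w: "w \<in> W" by (simp add: Nabla_simps)
    then show "amap Phi0_ftr (Ide (Nabla C W) w)
       = Ide (cat0 (Companions (Frac C W))) (omap Phi0_ftr w)"
      using Phi_companion[of "Ide C (Dom C w)" w] F.companion_id[of w] c[of "Ide C (Dom C w)" w]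
      by (auto simp: Nabla_simps Companions_def C_simps F.companion_comp_simps Frac_simps frac_vert_id intro!: eq frac_hor_eqI)
  next
    fix f g assume fg: "f \<in> Arr (Nabla C W)" "g \<in> Arr (Nabla C W)" "Cod (Nabla C W) f = Dom (Nabla C W) g"
    obtain u w u' w' where "f = (u, w)" "g = (u', w')" by fastforce
    \<comment> \<open>An arrow of \<open>Nabla C W\<close> stores only its target, so composability
      says that the target of \<open>f\<close> is the composite
      \<open>w' \<cdot> u'\<close>.\<close>
    with fg have f: "f = (u, w' \<cdot> u')" "g = (u', w')" and u: "u \<in> W" "u' \<in> W" "w' \<in> W" "w' \<cdot> u' \<in> W"
      "Cod C u' = Dom C w'" "Cod C u = Dom C (w' \<cdot> u')" "Cod C u = Dom C u'"
      by (auto simp: Nabla_simps C_simps)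
    have v: "u' \<cdot> u \<in> W" "Cod C (u' \<cdot> u) = Dom C w'" "w' \<cdot> (u' \<cdot> u) = w' \<cdot> u' \<cdot> u" "w' \<cdot> u' \<cdot> u \<in> W"
      using u by (simp_all add: C_simps Cmp_assoc)
    note P = Phi_companion[OF u(1,4,6)] Phi_companion[OF u(2,3,5)] Phi_companion[OF v(1) u(3) v(2)]
    have "Phi_companion C W (u' \<cdot> u, w') = companion_comp (Frac C W) (Phi_companion C W (u', w')) (Phi_companion C W (u, w' \<cdot> u'))"
    proof (rule eq)
      show "is_companion (Frac C W) (companion_comp (Frac C W) (Phi_companion C W (u', w')) (Phi_companion C W (u, w' \<cdot> u')))"
        by (rule F.companion_comp[OF c[OF u(1,4,6)] c[OF u(2,3,5)]]) (use P in \<open>simp add: Frac_simps\<close>)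
      show "is_companion (Frac C W) (Phi_companion C W (u' \<cdot> u, w'))"
        by (rule c[OF v(1) u(3) v(2)])
    qed (use P u v in \<open>simp_all add: F.companion_comp_simps Frac_simps frac_vert_comp frac_hor_comp_def C_simps\<close>)
    then show "amap Phi0_ftr (Cmp (Nabla C W) g f)
       = Cmp (cat0 (Companions (Frac C W))) (amap Phi0_ftr g) (amap Phi0_ftr f)"
      by (simp add: f Nabla_simps Companions_def)
  next
    fix f assume "f \<in> Arr (Nabla C W)"
    then show "amap Phi0_ftr f \<in> Arr (cat0 (Companions (Frac C W)))"
      by (cases f) (simp add: Nabla_simps Companions_def c)
  qed (auto simp: Nabla_simps Companions_def Frac_simps Phi_companion)
qed

lemma Phi_ftr_strict: "strict_double_functor (V_dbl (Nabla C W)) (Companions (Frac C W)) (Phi_ftr C W)"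
  unfolding Phi_ftr_def Let_def
  by (rule V_functorI[OF Phi_functor double_category.Companions_double_category[OF Frac_double_category]])

end

section \<open>The comparison functor\<close>

lemma (in double_category) h_minus_functor: "cat_functor (cat0 (Companions X)) (hor_cat X) h_minus"
proof -
  interpret K: double_category "Companions X" by (rule Companions_double_category)
  show ?thesis
    by (intro cat_functor.intro cat_functor_axioms.intro K.D0.B.category_axioms hor_category)
      (auto simp: Companions_def hor_cat_def h_minus_def companionD companion_comp_simps dbl_simps)
qed

lemma (in strict_double_functor) hor_functor: "cat_functor (hor_cat X) (hor_cat Y) (hor_ftr F)"
  by (intro cat_functor.intro cat_functor_axioms.intro X.hor_category Y.hor_category)
    (auto simp: hor_cat_def hor_ftr_def sdf_simps)

lemma hor_cat_simps:
  "Obj (hor_cat X) = Obj (cat0 X)" "Arr (hor_cat X) = Obj (cat1 X)" "Dom (hor_cat X) = omap (d0 X)"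
  "Cod (hor_cat X) = omap (d1 X)" "Ide (hor_cat X) = omap (hid X)" "Cmp (hor_cat X) g f = hcomp X g f"
  by (simp_all add: hor_cat_def)

lemma Companions_simps:
  "omap (hid (Companions X)) x = omap (hid X) x" "hcomp (Companions X) g f = hcomp X g f"
  "omap (d0 (Companions X)) f = omap (d0 X) f" "omap (d1 (Companions X)) f = omap (d1 X) f"
  "Obj (cat0 (Companions X)) = Obj (cat0 X)" "Obj (cat1 (Companions X)) = Obj (cat1 X)"
  "amap (hid (Companions X)) \<theta> = (\<theta>, amap (hid X) (comp_v \<theta>), \<theta>)"
  "ccomp (Companions X) (\<rho>, P, \<rho>') (\<theta>, \<Theta>, \<theta>') = (\<theta>, ccomp X P \<Theta>, \<rho>')"
  "\<theta> \<in> Arr (cat0 (Companions X)) \<longleftrightarrow> is_companion X \<theta>"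
  "Cmp (cat0 (Companions X)) = companion_comp X" "Ide (cat0 (Companions X)) = companion_id X"
  "Dom (cat0 (Companions X)) \<theta> = Dom (cat0 X) (comp_v \<theta>)" "Cod (cat0 (Companions X)) \<theta> = Cod (cat0 X) (comp_v \<theta>)"
  by (simp_all add: Companions_def)

context fractions
begin

sublocale F: double_category "Frac C W" by (rule Frac_double_category)
sublocale N: category "Nabla C W" by (rule Nabla_category)

end

section \<open>The category of friendly functors and friendly transformations\<close>

locale fractions_target = fractions C W + D: double_category D
  for C :: "('o, 'a) cat" and W :: "'a set" and D :: "('p, 'v, 'h, 'c) dblcat"
begin

sublocale KD: double_category "Companions D" by (rule D.Companions_double_category)
sublocale HD: category "hor_cat D" by (rule D.hor_category)

lemma D0_functor: "cat_functor (Nabla C W) C (D0_ftr C)"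
  by (intro cat_functor.intro cat_functor_axioms.intro N.category_axioms category_axioms)
    (auto simp: Nabla_simps D0_ftr_def C_simps)

text \<open>Functoriality of both sides of \<open>\<gamma>\<close> follows from strictness of
  \<open>G\<close> and \<open>\<Gamma>\<close>. What is left of the natural isomorphism is its
  components and one square for each arrow \<open>(u, w)\<close>.\<close>

lemma friendly_functors_iff: "(G, \<Gamma>, \<gamma>) \<in> friendly_functors C W D \<longleftrightarrow>
     G \<in> dbl_functors (H_dbl C) D \<and> \<Gamma> \<in> dbl_functors (V_dbl (Nabla C W)) (Companions D) \<and> \<gamma> \<in> extensional W
     \<and> (\<forall>w\<in>W. iso_arr (hor_cat D) (\<gamma> w) \<and> omap (d0 D) (\<gamma> w) = omap (ftr0 \<Gamma>) w \<and> omap (d1 D) (\<gamma> w) = omap (ftr0 G) (Dom C w))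
     \<and> (\<forall>u\<in>W. \<forall>w\<in>W. Cod C u = Dom C w \<longrightarrow>
          hcomp D (\<gamma> w) (comp_h (amap (ftr0 \<Gamma>) (u, w))) = hcomp D (omap (ftr1 G) u) (\<gamma> (w \<cdot> u)))"
    (is "_ \<longleftrightarrow> ?G \<and> ?\<Gamma> \<and> ?e \<and> ?i \<and> ?n")
proof -
  have "nat_iso (Nabla C W) (hor_cat D) (ftr_comp h_minus (ftr0 \<Gamma>)) (ftr_comp (hor_ftr G) (D0_ftr C)) \<gamma> \<longleftrightarrow> ?i \<and> ?n"
    if G: ?G and \<Gamma>: ?\<Gamma>
  proof -
    interpret \<Gamma>: strict_double_functor "V_dbl (Nabla C W)" "Companions D" \<Gamma> using \<Gamma> by (rule dbl_functorsD)
    have 1: "cat_functor (Nabla C W) (hor_cat D) (ftr_comp h_minus (ftr0 \<Gamma>))"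
      using \<Gamma>.ftr0_functor D.h_minus_functor by (intro ftr_comp_functor) (simp_all add: V_dbl_simps)
    have 2: "cat_functor (Nabla C W) (hor_cat D) (ftr_comp (hor_ftr G) (D0_ftr C))"
      by (rule ftr_comp_functor[OF D0_functor hor_ftr_functor[OF category_axioms dbl_functorsD[OF G]]])
    show ?thesis unfolding nat_iso_def
      by (simp only: 1 2 simp_thms) (auto simp: nat_iso_axioms_def Nabla_simps hor_cat_simps ftr_comp_def h_minus_def hor_ftr_def D0_ftr_def)
  qed
  then show ?thesis unfolding friendly_functors_def by blast
qed

lemma friendly_functorsD:
  assumes "(G, \<Gamma>, \<gamma>) \<in> friendly_functors C W D"
  shows "strict_double_functor (H_dbl C) D G" "strict_double_functor (V_dbl (Nabla C W)) (Companions D) \<Gamma>"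
    "w \<in> W \<Longrightarrow> iso_arr (hor_cat D) (\<gamma> w)" "w \<in> W \<Longrightarrow> \<gamma> w \<in> Obj (cat1 D)"
    "w \<in> W \<Longrightarrow> omap (d0 D) (\<gamma> w) = omap (ftr0 \<Gamma>) w" "w \<in> W \<Longrightarrow> omap (d1 D) (\<gamma> w) = omap (ftr0 G) (Dom C w)"
    "\<lbrakk>u \<in> W; w \<in> W; Cod C u = Dom C w\<rbrakk> \<Longrightarrow>
          hcomp D (\<gamma> w) (comp_h (amap (ftr0 \<Gamma>) (u, w))) = hcomp D (omap (ftr1 G) u) (\<gamma> (w \<cdot> u))"
proof -
  note f = assms[unfolded friendly_functors_iff]
  show "strict_double_functor (H_dbl C) D G" "strict_double_functor (V_dbl (Nabla C W)) (Companions D) \<Gamma>"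
    using f by (blast intro: dbl_functorsD)+
  show i: "iso_arr (hor_cat D) (\<gamma> w)" if "w \<in> W" for w using f that by blast
  show "\<gamma> w \<in> Obj (cat1 D)" if "w \<in> W" for w using HD.inv_arr(1)[OF i[OF that]] by (simp add: hor_cat_simps)
qed (use assms[unfolded friendly_functors_iff] in blast)+

lemma friendly_htrans_iff: "(a, \<alpha>) \<in> friendly_htrans C W D (G, \<Gamma>, \<gamma>) (L, \<Lambda>, \<mu>) \<longleftrightarrow>
     a \<in> htrans (H_dbl C) D G L \<and> \<alpha> \<in> htrans (V_dbl (Nabla C W)) (Companions D) \<Gamma> \<Lambda>
     \<and> (\<forall>w\<in>W. hcomp D (\<mu> w) (omap \<alpha> w) = hcomp D (omap a (Dom C w)) (\<gamma> w))"
  by (simp add: friendly_htrans_def)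

lemma htrans_H_sides:
  assumes "a \<in> htrans (H_dbl C) D G L" "x \<in> Obj C"
  shows "omap a x \<in> Obj (cat1 D)" "omap (d0 D) (omap a x) = omap (ftr0 G) x" "omap (d1 D) (omap a x) = omap (ftr0 L) x"
  using horizontal_transformation.component[OF htransD[OF assms(1)], of x]
    horizontal_transformation.component_d0[OF htransD[OF assms(1)], of x]
    horizontal_transformation.component_d1[OF htransD[OF assms(1)], of x] assms(2)
  by (simp_all add: H_dbl_simps)

lemma htrans_V_sides:
  assumes "\<alpha> \<in> htrans (V_dbl (Nabla C W)) (Companions D) \<Gamma> \<Lambda>" "w \<in> W"
  shows "omap \<alpha> w \<in> Obj (cat1 D)" "omap (d0 D) (omap \<alpha> w) = omap (ftr0 \<Gamma>) w" "omap (d1 D) (omap \<alpha> w) = omap (ftr0 \<Lambda>) w"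
  using horizontal_transformation.component[OF htransD[OF assms(1)], of w]
    horizontal_transformation.component_d0[OF htransD[OF assms(1)], of w]
    horizontal_transformation.component_d1[OF htransD[OF assms(1)], of w] assms(2)
  by (simp_all add: V_dbl_simps Nabla_simps Companions_def)

lemma friendly_htrans_id:
  assumes P: "(G, \<Gamma>, \<gamma>) \<in> friendly_functors C W D"
  shows "(htrans_id (H_dbl C) D G, htrans_id (V_dbl (Nabla C W)) (Companions D) \<Gamma>)
    \<in> friendly_htrans C W D (G, \<Gamma>, \<gamma>) (G, \<Gamma>, \<gamma>)"
  using friendly_functorsD[OF P]
  by (simp add: friendly_htrans_iff htrans_id_in htrans_id_apply H_dbl_simps V_dbl_simps Nabla_simps C_simps
      Companions_simps D.dbl_simps)

text \<open>The two compatibility squares are pasted along the structure isomorphism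
  \<open>\<theta>\<close> of the middle functor.\<close>

lemma friendly_htrans_comp:
  assumes P: "(G, \<Gamma>, \<gamma>) \<in> friendly_functors C W D" and Q: "(K, \<Theta>, \<theta>) \<in> friendly_functors C W D"
    and R: "(L, \<Lambda>, \<mu>) \<in> friendly_functors C W D"
    and a: "(a, \<alpha>) \<in> friendly_htrans C W D (G, \<Gamma>, \<gamma>) (K, \<Theta>, \<theta>)"
    and b: "(b, \<beta>) \<in> friendly_htrans C W D (K, \<Theta>, \<theta>) (L, \<Lambda>, \<mu>)"
  shows "(htrans_comp (H_dbl C) D b a, htrans_comp (V_dbl (Nabla C W)) (Companions D) \<beta> \<alpha>)
    \<in> friendly_htrans C W D (G, \<Gamma>, \<gamma>) (L, \<Lambda>, \<mu>)"
proof -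
  note a = a[unfolded friendly_htrans_iff] and b = b[unfolded friendly_htrans_iff]
  have "hcomp D (\<mu> w) (hcomp D (omap \<beta> w) (omap \<alpha> w)) = hcomp D (hcomp D (omap b (Dom C w)) (omap a (Dom C w))) (\<gamma> w)"
    if w: "w \<in> W" for w
  proof -
    have x: "Dom C w \<in> Obj C" using w by (simp add: C_simps)
    note s = friendly_functorsD(4-6)[OF P w] friendly_functorsD(4-6)[OF Q w] friendly_functorsD(4-6)[OF R w]
      htrans_H_sides[OF conjunct1[OF a] x] htrans_H_sides[OF conjunct1[OF b] x]
      htrans_V_sides[OF conjunct1[OF conjunct2[OF a]] w] htrans_V_sides[OF conjunct1[OF conjunct2[OF b]] w]
    have "hcomp D (\<mu> w) (hcomp D (omap \<beta> w) (omap \<alpha> w)) = hcomp D (hcomp D (\<mu> w) (omap \<beta> w)) (omap \<alpha> w)"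
      by (simp add: s D.hcomp_assoc)
    also have "\<dots> = hcomp D (omap b (Dom C w)) (hcomp D (\<theta> w) (omap \<alpha> w))"
      using b w by (simp add: s D.hcomp_assoc)
    also have "\<dots> = hcomp D (hcomp D (omap b (Dom C w)) (omap a (Dom C w))) (\<gamma> w)"
      using a w by (simp add: s D.hcomp_assoc)
    finally show ?thesis .
  qed
  then show ?thesis
    using a b
    by (auto simp: friendly_htrans_iff htrans_comp_apply H_dbl_simps V_dbl_simps Nabla_simps C_simps
        Companions_simps intro: htrans_comp_in[OF htransD htransD])
qed

lemma Hom_hW_category: "category (Hom_hW C W D)"
proof
  fix f assume "f \<in> Arr (Hom_hW C W D)"
  then show "Cmp (Hom_hW C W D) f (Ide (Hom_hW C W D) (Dom (Hom_hW C W D) f)) = f"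
    "Cmp (Hom_hW C W D) (Ide (Hom_hW C W D) (Cod (Hom_hW C W D) f)) f = f"
    by (auto simp: Hom_hW_def friendly_htrans_iff htrans_comp_id_left htrans_comp_id_right)
next
  fix f g h assume "f \<in> Arr (Hom_hW C W D)" "g \<in> Arr (Hom_hW C W D)" "h \<in> Arr (Hom_hW C W D)"
    "Cod (Hom_hW C W D) f = Dom (Hom_hW C W D) g" "Cod (Hom_hW C W D) g = Dom (Hom_hW C W D) h"
  then show "Cmp (Hom_hW C W D) h (Cmp (Hom_hW C W D) g f) = Cmp (Hom_hW C W D) (Cmp (Hom_hW C W D) h g) f"
    by (auto simp: Hom_hW_def friendly_htrans_iff htrans_comp_assoc)
next
  fix f g assume "f \<in> Arr (Hom_hW C W D)" "g \<in> Arr (Hom_hW C W D)" "Cod (Hom_hW C W D) f = Dom (Hom_hW C W D) g"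
  then show "Cmp (Hom_hW C W D) g f \<in> Arr (Hom_hW C W D)"
    by (auto simp: Hom_hW_def intro: friendly_htrans_comp)
qed (auto simp: Hom_hW_def friendly_htrans_id)

section \<open>Composition with J as a functor between the two categories\<close>

lemma varphi_hor: "w \<in> W \<Longrightarrow> varphi C w \<in> frac_hors C W"
  by (simp add: varphi_def frac_hors_iff C_simps)

text \<open>The inverse is the same identity arrow of \<open>C\<close>, read as a horizontal arrow
  in the opposite direction.\<close>

lemma varphi_iso:
  assumes "w \<in> W" shows "iso_arr (hor_cat (Frac C W)) (varphi C w)"
proof -
  interpret H: category "hor_cat (Frac C W)" by (rule F.hor_category)
  show ?thesis
    by (rule H.iso_arrI[where g = "Hor (Ide C (Dom C w)) w (Ide C (Dom C w))"])
      (use assms in \<open>simp_all add: hor_cat_simps Frac_simps varphi_def frac_hors_iff C_simps frac_hor_comp_def frac_hor_id_def\<close>)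
qed

lemma friendly_of_functor:
  assumes L: "strict_double_functor (Frac C W) D L"
  shows "friendly_of C W L \<in> friendly_functors C W D"
proof -
  interpret L: strict_double_functor "Frac C W" D L by fact
  interpret h: cat_functor "hor_cat (Frac C W)" "hor_cat D" "hor_ftr L" by (rule L.hor_functor)
  have "omap (d0 D) (omap (ftr1 L) (varphi C w)) = omap (ftr0 L) w"
    "omap (d1 D) (omap (ftr1 L) (varphi C w)) = omap (ftr0 L) (Ide C (Dom C w))" if "w \<in> W" for w
    using that L.preserves_d0[of "varphi C w"] L.preserves_d1[of "varphi C w"] varphi_hor[OF that]
    by (simp_all add: Frac_simps) (simp_all add: varphi_def)
  moreover have "iso_arr (hor_cat D) (omap (ftr1 L) (varphi C w))" if "w \<in> W" for w
    using h.amap_iso[OF varphi_iso[OF that]] by (simp add: hor_ftr_def)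
  \<comment> \<open>Both sides are the image under \<open>L\<close> of one horizontal arrow, namely
    \<open>u\<close> regarded as an arrow from \<open>w \<cdot> u\<close> to the identity object on
    \<open>Dom C w\<close>.\<close>
  moreover have "hcomp D (omap (ftr1 L) (varphi C w)) (omap (ftr1 L) (Hor (w \<cdot> u) w u))
      = hcomp D (omap (ftr1 L) (Hor (Ide C (Dom C u)) (Ide C (Cod C u)) u)) (omap (ftr1 L) (varphi C (w \<cdot> u)))"
    if "u \<in> W" "w \<in> W" "Cod C u = Dom C w" for u w
  proof -
    have "Hor (w \<cdot> u) w u \<in> frac_hors C W" "Hor (Ide C (Dom C u)) (Ide C (Cod C u)) u \<in> frac_hors C W"
      using that by (simp_all add: frac_hors_iff C_simps)
    then show ?thesis
      using that varphi_hor[OF that(2)] varphi_hor[OF CF1_comp[OF that]]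
        L.preserves_hcomp[of "Hor (w \<cdot> u) w u" "varphi C w", symmetric]
        L.preserves_hcomp[of "varphi C (w \<cdot> u)" "Hor (Ide C (Dom C u)) (Ide C (Cod C u)) u", symmetric]
      by (simp add: Frac_simps) (simp add: varphi_def C_simps frac_hor_comp_def)
  qed
  ultimately show ?thesis
    unfolding friendly_of_def friendly_functors_iff
    by (simp add: dblftr_comp_functors[OF J_ftr_strict L] dblftr_comp_functors[OF Phi_ftr_strict L.Companions_ftr_strict]
        dblftr_comp_apply H_dbl_simps V_dbl_simps Nabla_simps C_simps)
      (simp add: J_ftr_def Phi_ftr_def Let_def Companions_ftr_def L.map_companion_sel Phi_companion)
qed

text \<open>Compatibility with the structure isomorphisms is horizontal naturality of
  \<open>b\<close> at \<open>varphi C w\<close>.\<close>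

lemma friendly_htrans_of_in:
  assumes b: "b \<in> htrans (Frac C W) D L L'"
  shows "friendly_htrans_of C W L b L' \<in> friendly_htrans C W D (friendly_of C W L) (friendly_of C W L')"
proof -
  interpret b: horizontal_transformation "Frac C W" D L L' b using b by (rule htransD)
  have "hcomp D (omap (ftr1 L') (varphi C w)) (omap b w) = hcomp D (omap b (Ide C (Dom C w))) (omap (ftr1 L) (varphi C w))"
    if "w \<in> W" for w
    using b.hor_naturality[of "varphi C w"] varphi_hor[OF that] by (simp add: Frac_simps) (simp add: varphi_def)
  then show ?thesis
    unfolding friendly_htrans_of_def friendly_of_def friendly_htrans_iff
    by (simp add: htrans_whisker_in[OF b.horizontal_transformation_axioms J_ftr_strict]
        htrans_whisker_in[OF b.Companions_htrans Phi_ftr_strict] htrans_whisker_apply H_dbl_simps V_dbl_simps Nabla_simps C_simps)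
      (simp add: J_ftr_def Phi_ftr_def Let_def Companions_htrans_def)
qed

text \<open>Whiskering, identities and composites are all restricted to the carriers, so
  preservation of identities and composition is an equality of extensional maps and is checked on
  the objects and arrows of \<open>Nabla C W\<close>.\<close>

lemma comparison_functor: "cat_functor (Hom_h (Frac C W) D) (Hom_hW C W D) (comparison C W)"
proof (intro cat_functor.intro cat_functor_axioms.intro Hom_h_category Hom_hW_category)
  fix L assume "L \<in> Obj (Hom_h (Frac C W) D)"
  then have L: "strict_double_functor (Frac C W) D L" by (simp add: Hom_h_def dbl_functorsD)
  then show "omap (comparison C W) L \<in> Obj (Hom_hW C W D)"
    by (simp add: Hom_hW_def comparison_def friendly_of_functor)
  interpret L: strict_double_functor "Frac C W" D L by (rule L)
  have "htrans_whisker (V_dbl (Nabla C W)) (Companions_htrans L (htrans_id (Frac C W) D L) L) (Phi_ftr C W)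
    = htrans_id (V_dbl (Nabla C W)) (Companions D) (dblftr_comp (V_dbl (Nabla C W)) (Companions_ftr L) (Phi_ftr C W))"
  proof (rule ftr_eqI[OF htrans_whisker_ext htrans_id_ext])
    interpret P: strict_double_functor "V_dbl (Nabla C W)" "Companions (Frac C W)" "Phi_ftr C W" by (rule Phi_ftr_strict)
    show "omap (htrans_whisker (V_dbl (Nabla C W)) (Companions_htrans L (htrans_id (Frac C W) D L) L) (Phi_ftr C W)) w
      = omap (htrans_id (V_dbl (Nabla C W)) (Companions D) (dblftr_comp (V_dbl (Nabla C W)) (Companions_ftr L) (Phi_ftr C W))) w"
      if "w \<in> Obj (cat0 (V_dbl (Nabla C W)))" for w
      using that P.F0.omap_closed[OF that]
      by (simp add: htrans_whisker_apply htrans_id_apply dblftr_comp_apply)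
        (simp add: Companions_def Companions_htrans_def Companions_ftr_def htrans_id_apply)
    show "amap (htrans_whisker (V_dbl (Nabla C W)) (Companions_htrans L (htrans_id (Frac C W) D L) L) (Phi_ftr C W)) v
      = amap (htrans_id (V_dbl (Nabla C W)) (Companions D) (dblftr_comp (V_dbl (Nabla C W)) (Companions_ftr L) (Phi_ftr C W))) v"
      if "v \<in> Arr (cat0 (V_dbl (Nabla C W)))" for v
      using that P.F0.amap_closed[OF that]
      by (simp add: htrans_whisker_apply htrans_id_apply dblftr_comp_apply)
        (simp add: Companions_def Companions_htrans_def Companions_ftr_def htrans_id_apply F.companionD L.map_companion_sel)
  qed
  then show "amap (comparison C W) (Ide (Hom_h (Frac C W) D) L) = Ide (Hom_hW C W D) (omap (comparison C W) L)"
    by (simp add: comparison_def Hom_h_def Hom_hW_def friendly_of_def friendly_htrans_of_def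
        htrans_whisker_id[OF J_ftr_strict])
next
  fix f g assume "f \<in> Arr (Hom_h (Frac C W) D)" "g \<in> Arr (Hom_h (Frac C W) D)" "Cod (Hom_h (Frac C W) D) f = Dom (Hom_h (Frac C W) D) g"
  then obtain L a K b M where f: "f = (L, a, K)" and g: "g = (K, b, M)"
    and a: "a \<in> htrans (Frac C W) D L K" and b: "b \<in> htrans (Frac C W) D K M"
    by (auto simp: Hom_h_def)
  interpret a: horizontal_transformation "Frac C W" D L K a using a by (rule htransD)
  interpret b: horizontal_transformation "Frac C W" D K M b using b by (rule htransD)
  have "htrans_whisker (V_dbl (Nabla C W)) (Companions_htrans L (htrans_comp (Frac C W) D b a) M) (Phi_ftr C W)
    = htrans_comp (V_dbl (Nabla C W)) (Companions D) (htrans_whisker (V_dbl (Nabla C W)) (Companions_htrans K b M) (Phi_ftr C W))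
      (htrans_whisker (V_dbl (Nabla C W)) (Companions_htrans L a K) (Phi_ftr C W))"
  proof (rule ftr_eqI[OF htrans_whisker_ext htrans_comp_ext])
    interpret P: strict_double_functor "V_dbl (Nabla C W)" "Companions (Frac C W)" "Phi_ftr C W" by (rule Phi_ftr_strict)
    show "omap (htrans_whisker (V_dbl (Nabla C W)) (Companions_htrans L (htrans_comp (Frac C W) D b a) M) (Phi_ftr C W)) w
      = omap (htrans_comp (V_dbl (Nabla C W)) (Companions D) (htrans_whisker (V_dbl (Nabla C W)) (Companions_htrans K b M) (Phi_ftr C W))
      (htrans_whisker (V_dbl (Nabla C W)) (Companions_htrans L a K) (Phi_ftr C W))) w"
      if "w \<in> Obj (cat0 (V_dbl (Nabla C W)))" for w
      using that P.F0.omap_closed[OF that]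
      by (simp add: htrans_whisker_apply htrans_comp_apply)
        (simp add: Companions_def Companions_htrans_def htrans_comp_apply)
    show "amap (htrans_whisker (V_dbl (Nabla C W)) (Companions_htrans L (htrans_comp (Frac C W) D b a) M) (Phi_ftr C W)) v
      = amap (htrans_comp (V_dbl (Nabla C W)) (Companions D) (htrans_whisker (V_dbl (Nabla C W)) (Companions_htrans K b M) (Phi_ftr C W))
      (htrans_whisker (V_dbl (Nabla C W)) (Companions_htrans L a K) (Phi_ftr C W))) v"
      if "v \<in> Arr (cat0 (V_dbl (Nabla C W)))" for v
      using that P.F0.amap_closed[OF that]
      by (simp add: htrans_whisker_apply htrans_comp_apply)
        (simp add: Companions_def Companions_htrans_def htrans_comp_apply F.companionD)
  qed
  then show "amap (comparison C W) (Cmp (Hom_h (Frac C W) D) g f)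
      = Cmp (Hom_hW C W D) (amap (comparison C W) g) (amap (comparison C W) f)"
    by (simp add: f g comparison_def Hom_h_def Hom_hW_def friendly_of_def friendly_htrans_of_def
        htrans_whisker_comp[OF J_ftr_strict])
qed (auto simp: Hom_h_def Hom_hW_def comparison_def friendly_of_functor dbl_functorsD friendly_htrans_of_in)

end

section \<open>Invertible vertical arrows\<close>

context double_category
begin

text \<open>The side functors \<open>d0\<close> and \<open>d1\<close> preserve inverses, so the
  inverse cells are again horizontally composable. Interchange shows that their composite is the
  inverse.\<close>

lemma ccomp_iso:
  assumes a: "iso_arr (cat1 X) \<alpha>" and b: "iso_arr (cat1 X) \<beta>" and ab: "amap (d0 X) \<beta> = amap (d1 X) \<alpha>"
  shows "iso_arr (cat1 X) (ccomp X \<beta> \<alpha>)"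
    "inv_arr (cat1 X) (ccomp X \<beta> \<alpha>) = ccomp X (inv_arr (cat1 X) \<beta>) (inv_arr (cat1 X) \<alpha>)"
proof -
  note A = D0.A.inv_arr[OF a] and B = D0.A.inv_arr[OF b]
  have i: "amap (d0 X) (inv_arr (cat1 X) \<beta>) = amap (d1 X) (inv_arr (cat1 X) \<alpha>)"
    by (simp add: D0.amap_inv[OF b] D1.amap_inv[OF a] ab)
  have h: "omap (d0 X) (Dom (cat1 X) \<beta>) = omap (d1 X) (Dom (cat1 X) \<alpha>)"
    "omap (d0 X) (Cod (cat1 X) \<beta>) = omap (d1 X) (Cod (cat1 X) \<alpha>)"
    using D0.Dom_amap[OF B(1)] D1.Dom_amap[OF A(1)] D0.Cod_amap[OF B(1)] D1.Cod_amap[OF A(1)] ab by simp_all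
  note s = A B i ab h ccomp_closed Dom_ccomp Cod_ccomp ccomp_Ide D0.A.cat_simps
  have "Cmp (cat1 X) (ccomp X (inv_arr (cat1 X) \<beta>) (inv_arr (cat1 X) \<alpha>)) (ccomp X \<beta> \<alpha>)
      = Ide (cat1 X) (Dom (cat1 X) (ccomp X \<beta> \<alpha>))"
    by (subst interchange[symmetric]) (simp_all add: s)
  moreover have "Cmp (cat1 X) (ccomp X \<beta> \<alpha>) (ccomp X (inv_arr (cat1 X) \<beta>) (inv_arr (cat1 X) \<alpha>))
      = Ide (cat1 X) (Cod (cat1 X) (ccomp X \<beta> \<alpha>))"
    by (subst interchange[symmetric]) (simp_all add: s)
  ultimately show "iso_arr (cat1 X) (ccomp X \<beta> \<alpha>)"
    by (intro D0.A.iso_arrI[where g = "ccomp X (inv_arr (cat1 X) \<beta>) (inv_arr (cat1 X) \<alpha>)"]) (simp_all add: s)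
  then show "inv_arr (cat1 X) (ccomp X \<beta> \<alpha>) = ccomp X (inv_arr (cat1 X) \<beta>) (inv_arr (cat1 X) \<alpha>)"
    using \<open>Cmp (cat1 X) (ccomp X (inv_arr (cat1 X) \<beta>) (inv_arr (cat1 X) \<alpha>)) (ccomp X \<beta> \<alpha>)
      = Ide (cat1 X) (Dom (cat1 X) (ccomp X \<beta> \<alpha>))\<close>
    by (intro D0.A.inv_arr_eqI) (simp_all add: s)
qed

text \<open>If \<open>v\<close> is invertible, then the inverse of the binding cell \<open>\<psi>\<close> is \<open>\<chi>\<close> followed by the
  identity cell of the inverse of \<open>v\<close>.\<close>

lemma companion_iso:
  assumes t: "is_companion X \<theta>" and v: "iso_arr (cat0 X) (comp_v \<theta>)"
  shows "iso_arr (cat1 X) (comp_psi \<theta>)" "iso_arr (cat1 X) (comp_chi \<theta>)"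
proof -
  note T = companionD[OF t] and V = D0.B.inv_arr[OF v]
  let ?v = "comp_v \<theta>" and ?P = "comp_psi \<theta>" and ?R = "comp_chi \<theta>"
  let ?w = "inv_arr (cat0 X) ?v" and ?A = "Dom (cat0 X) (comp_v \<theta>)"
  let ?k = "Cmp (cat1 X) (amap (hid X) ?w) ?R"
  have k: "?k \<in> Arr (cat1 X)" "Dom (cat1 X) ?k = comp_h \<theta>" "Cod (cat1 X) ?k = omap (hid X) ?A"
    "amap (d0 X) ?k = Ide (cat0 X) ?A" "amap (d1 X) ?k = ?w"
    using T V by (simp_all add: dbl_simps)
  have kp: "Cmp (cat1 X) ?k ?P = Ide (cat1 X) (omap (hid X) ?A)"
    using T(1-15) V by (simp add: dbl_simps D0.A.Cmp_assoc[symmetric] T(16) HI.amap_Cmp[symmetric])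
  have R: "Cmp (cat1 X) (amap (hid X) ?v) ?k = ?R"
    using T(1-15) V by (simp add: dbl_simps D0.A.Cmp_assoc HI.amap_Cmp[symmetric])
  \<comment> \<open>The composite in the other order is a horizontal pasting in disguise: after
    padding with identity cells, interchange turns it into \<open>\<chi>\<close> after
    \<open>\<psi>\<close>.\<close>
  have "Cmp (cat1 X) ?P ?k = Cmp (cat1 X) (ccomp X (amap (hid X) ?v) ?P) (ccomp X ?k (Ide (cat1 X) (omap (hid X) ?A)))"
    using T(1-15) k V by (simp add: dbl_simps)
  also have "\<dots> = ccomp X (Cmp (cat1 X) (amap (hid X) ?v) ?k) (Cmp (cat1 X) ?P (Ide (cat1 X) (omap (hid X) ?A)))"
    by (rule interchange[symmetric]) (use T(1-15) k V in \<open>simp_all add: dbl_simps\<close>)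
  also have "\<dots> = Ide (cat1 X) (comp_h \<theta>)"
    unfolding R using T by (simp add: dbl_simps)
  finally have pk: "Cmp (cat1 X) ?P ?k = Ide (cat1 X) (comp_h \<theta>)" .
  show "iso_arr (cat1 X) ?P"
    by (rule D0.A.iso_arrI[where g = ?k]) (use T k kp pk in simp_all)
  have "iso_arr (cat1 X) ?k"
    by (rule D0.A.iso_arrI[where g = ?P]) (use T k kp pk in simp_all)
  then have "iso_arr (cat1 X) (Cmp (cat1 X) (amap (hid X) ?v) ?k)"
    by (rule D0.A.iso_Cmp) (use HI.amap_iso[OF v] k T in \<open>simp_all add: HI.ftr_simps\<close>)
  then show "iso_arr (cat1 X) ?R" by (simp add: R)
qed

text \<open>The pasted cell is built from binding cells and identities, all of which are invertible
  once the vertical sides are.\<close>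

lemma companion_cell_iso:
  assumes sq: "companion_square f g \<theta> \<theta>'" and v: "iso_arr (cat0 X) (comp_v \<theta>)" "iso_arr (cat0 X) (comp_v \<theta>')"
  shows "iso_arr (cat1 X) (companion_cell f g \<theta> \<theta>')"
proof -
  note S = companion_squareD[OF sq]
  note S = S companionD[OF S(1)] companionD[OF S(2)]
  show ?thesis unfolding companion_cell_def
    by (intro D0.A.iso_Cmp ccomp_iso(1) D0.A.iso_Ide companion_iso v S(1,2)) (simp_all add: S dbl_simps)
qed

text \<open>This presents the binding cell \<open>\<psi>\<close> as a pasted cell with an identity
  companion on its left, so that a construction given on pasted cells can be evaluated on binding
  cells.\<close>

lemma companion_cell_id_left:
  assumes "is_companion X \<theta>"
  defines "A \<equiv> Dom (cat0 X) (comp_v \<theta>)"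
  shows "companion_cell (omap (hid X) A) (comp_h \<theta>) (companion_id X A) \<theta> = comp_psi \<theta>"
    and "companion_square (omap (hid X) A) (comp_h \<theta>) (companion_id X A) \<theta>"
  using companionD[OF assms(1)] assms(1)
  by (simp_all add: A_def companion_cell_def companion_square_def companion_comp_simps companion_id dbl_simps)

lemma companion_cell_id_right:
  assumes "is_companion X \<theta>"
  defines "B \<equiv> Cod (cat0 X) (comp_v \<theta>)"
  shows "companion_cell (comp_h \<theta>) (omap (hid X) B) \<theta> (companion_id X B) = comp_chi \<theta>"
    and "companion_square (comp_h \<theta>) (omap (hid X) B) \<theta> (companion_id X B)"
  using companionD[OF assms(1)] assms(1)
  by (simp_all add: B_def companion_cell_def companion_square_def companion_comp_simps companion_id dbl_simps)

end

text \<open>This invariance is the source of all later independence of representatives: refining a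
  span or a cell multiplies the numerator and the denominator of a quotient by the same
  isomorphism.\<close>

lemma (in category) Cmp_inv_refine:
  assumes "f \<in> Arr C" "iso_arr C g" "iso_arr C e" "Dom C f = Cod C e" "Dom C g = Cod C e"
  shows "Cmp C (Cmp C f e) (inv_arr C (Cmp C g e)) = Cmp C f (inv_arr C g)"
proof (rule iso_cancel_right[OF iso_Cmp[OF assms(3,2)]])
  note ge = iso_Cmp[OF assms(3,2) assms(5)[symmetric]]
  show "Cmp C (Cmp C (Cmp C f e) (inv_arr C (Cmp C g e))) (Cmp C g e) = Cmp C (Cmp C f (inv_arr C g)) (Cmp C g e)"
    using assms inv_arr[OF assms(2)] inv_arr[OF assms(3)]
    by (subst Cmp_inv_cancel'[OF ge]) (simp_all add: cat_simps Cmp_assoc Cmp_inv_cancel')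
qed (use assms inv_arr[OF assms(2)] inv_arr[OF assms(3)] inv_arr[OF iso_Cmp[OF assms(3,2) assms(5)[symmetric]]]
    in \<open>simp_all add: cat_simps\<close>)

section \<open>Extension of functors from Nabla W to all vertical arrows of the double category of
  fractions\<close>

context fractions
begin

lemma span_composite:
  assumes "w1 \<in> W" "w2 \<in> W" "(u1, u2) \<in> spans C W w1 w2"
  shows "(u1, w1) \<in> Arr (Nabla C W)" "(u2, w2) \<in> Arr (Nabla C W)" "w1 \<cdot> u1 \<in> W" "w2 \<cdot> u2 = w1 \<cdot> u1"
    "Cod C (w1 \<cdot> u1) = Cod C w1" "Cod C (w1 \<cdot> u1) = Cod C w2"
  using assms spans_Cod[OF assms] by (auto simp: spans_iff Nabla_simps CF1_comp Cod_Cmp W_Arr)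

text \<open>Every vertical arrow is the composite of an arrow coming from \<open>\<nabla>W\<close> with the inverse of another one.\<close>

lemma vert_functor_eqI:
  assumes "cat_functor (cat0 (Frac C W)) K A" "cat_functor (cat0 (Frac C W)) K B"
    and 0: "\<And>w. w \<in> W \<Longrightarrow> omap A w = omap B w"
    and 1: "\<And>u w. \<lbrakk>u \<in> W; w \<in> W; Cod C u = Dom C w\<rbrakk> \<Longrightarrow> amap A (vert (w \<cdot> u) w) = amap B (vert (w \<cdot> u) w)"
    and S: "S \<in> frac_verts C W"
  shows "amap A S = amap B S"
proof -
  interpret A: cat_functor "cat0 (Frac C W)" K A by fact
  interpret B: cat_functor "cat0 (Frac C W)" K B by fact
  obtain w1 w2 where w: "w1 \<in> W" "w2 \<in> W" "Cod C w1 = Cod C w2" and S: "S = vert w1 w2"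
    using S unfolding frac_verts_iff by blast
  obtain u1 u2 where u: "(u1, u2) \<in> spans C W w1 w2" using span_exists w by blast
  note x = span_composite[OF w(1,2) u]
  let ?x = "w1 \<cdot> u1"
  have v: "vert w1 w2 \<in> Arr (cat0 (Frac C W))" "vert ?x w1 \<in> Arr (cat0 (Frac C W))" "vert w1 ?x \<in> Arr (cat0 (Frac C W))"
    using w x unfolding Frac_simps frac_verts_iff by force+
  \<comment> \<open>Vertical composites are fixed by their ends, so the opposite arrow
    \<open>vert w1 ?x\<close> is an inverse. The functors agree on both legs, and the left leg can
    be cancelled.\<close>
  have iso: "iso_arr (cat0 (Frac C W)) (vert ?x w1)"
    by (rule F.D0.B.iso_arrI[OF v(2,3)]) (use w x in \<open>simp_all add: Frac_simps frac_vert_comp frac_vert_id\<close>)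
  have c: "Cmp (cat0 (Frac C W)) (vert w1 w2) (vert ?x w1) = vert ?x w2"
    using w x by (simp add: Frac_simps frac_vert_comp)
  have eq: "Cmp K (amap A S) (amap A (vert ?x w1)) = Cmp K (amap B S) (amap A (vert ?x w1))"
    using A.amap_Cmp[OF v(2,1)] B.amap_Cmp[OF v(2,1)] 1[of u1 w1] 1[of u2 w2] x w unfolding c S
    by (simp add: Frac_simps Nabla_simps)
  have "amap A S \<in> Arr K" "Dom K (amap A S) = omap A w1" "amap B S \<in> Arr K" "Dom K (amap B S) = omap B w1"
    "Cod K (amap A (vert ?x w1)) = omap A w1"
    using A.amap_closed[OF v(1)] A.Dom_amap[OF v(1)] B.amap_closed[OF v(1)] B.Dom_amap[OF v(1)] A.Cod_amap[OF v(2)]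
    by (simp_all add: S Frac_simps)
  then show ?thesis
    using 0[OF w(1)] by (intro A.B.iso_cancel_right[OF A.amap_iso[OF iso] _ _ _ _ eq]) simp_all
qed

text \<open>The leg towards the target gives the numerator and the leg towards the source the
  denominator. The target category is left open because the construction serves twice: with vertical
  arrows of \<open>D\<close> as values and with cells of \<open>D\<close> as values.\<close>

definition vert_extension :: "('q, 'b) cat \<Rightarrow> ('a, 'a \<times> 'a, 'q, 'b) ftr \<Rightarrow> ('a, 'a frac_vert, 'q, 'b) ftr" where
  "vert_extension K A = \<lparr>omap = omap A, amap = (\<lambda>S. let u = (SOME u. u \<in> v_class S) in
     Cmp K (amap A (snd u, v_to S)) (inv_arr K (amap A (fst u, v_from S))))\<rparr>"

context
  fixes K :: "('q, 'b) cat" and A :: "('a, 'a \<times> 'a, 'q, 'b) ftr"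
  assumes A: "cat_functor (Nabla C W) K A" and iso: "\<And>f. f \<in> Arr (Nabla C W) \<Longrightarrow> iso_arr K (amap A f)"
begin

interpretation A: cat_functor "Nabla C W" K A by (rule A)

lemma amap_Nabla:
  assumes "u \<in> W" "w \<in> W" "Cod C u = Dom C w"
  shows "amap A (u, w) \<in> Arr K" "Dom K (amap A (u, w)) = omap A (w \<cdot> u)" "Cod K (amap A (u, w)) = omap A w"
    "iso_arr K (amap A (u, w))"
  using A.amap_closed[of "(u, w)"] A.Dom_amap[of "(u, w)"] A.Cod_amap[of "(u, w)"] iso[of "(u, w)"] assms
  by (simp_all add: Nabla_simps)

lemma amap_Nabla_comp:
  assumes "u \<in> W" "w \<in> W" "Cod C u = Dom C w" "r \<in> W" "Cod C r = Dom C u"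
  shows "amap A (u \<cdot> r, w) = Cmp K (amap A (u, w)) (amap A (r, w \<cdot> u))"
  using A.amap_Cmp[of "(r, w \<cdot> u)" "(u, w)"] assms by (simp add: Nabla_simps C_simps)

text \<open>As \<open>w1 \<cdot> u1\<close> and \<open>w2 \<cdot> u2\<close> coincide, a refinement
  by \<open>r\<close> precomposes both legs with the same arrow \<open>(r, w1 \<cdot> u1)\<close> of
  \<open>Nabla C W\<close>, whose image cancels. Two spans are compared through a common
  refinement.\<close>

lemma vert_extension_well_defined:
  assumes w: "w1 \<in> W" "w2 \<in> W" and u: "(u1, u2) \<in> spans C W w1 w2" and v: "(v1, v2) \<in> spans C W w1 w2"
  shows "Cmp K (amap A (u2, w2)) (inv_arr K (amap A (u1, w1))) = Cmp K (amap A (v2, w2)) (inv_arr K (amap A (v1, w1)))"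
proof -
  have refine: "Cmp K (amap A (u2 \<cdot> r, w2)) (inv_arr K (amap A (u1 \<cdot> r, w1))) = Cmp K (amap A (u2, w2)) (inv_arr K (amap A (u1, w1)))"
    if u: "(u1, u2) \<in> spans C W w1 w2" and r: "r \<in> W" "Cod C r = Dom C u1" for u1 u2 r
  proof -
    have U: "u1 \<in> W" "u2 \<in> W" "Cod C u1 = Dom C w1" "Cod C u2 = Dom C w2" "Dom C u1 = Dom C u2" "w1 \<cdot> u1 = w2 \<cdot> u2"
      using u unfolding spans_iff[OF w] by blast+
    have "amap A (u1 \<cdot> r, w1) = Cmp K (amap A (u1, w1)) (amap A (r, w1 \<cdot> u1))"
      "amap A (u2 \<cdot> r, w2) = Cmp K (amap A (u2, w2)) (amap A (r, w1 \<cdot> u1))"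
      using amap_Nabla_comp[of u1 w1 r] amap_Nabla_comp[of u2 w2 r] U r w by simp_all
    moreover have "w1 \<cdot> u1 \<in> W" "Dom C (w1 \<cdot> u1) = Dom C u1" using U w by (simp_all add: C_simps del: U(6))
    ultimately show ?thesis
      using A.B.Cmp_inv_refine[of "amap A (u2, w2)" "amap A (u1, w1)" "amap A (r, w1 \<cdot> u1)"]
        amap_Nabla[of u1 w1] amap_Nabla[of u2 w2] amap_Nabla[of r "w1 \<cdot> u1"] U r w by simp
  qed
  obtain r s where rs: "r \<in> W" "s \<in> W" "Dom C r = Dom C s" "Cod C r = Dom C u1" "Cod C s = Dom C v1"
    "u1 \<cdot> r = v1 \<cdot> s" "u2 \<cdot> r = v2 \<cdot> s"
    by (rule spans_common_refinement[OF w u v])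
  show ?thesis using refine[OF u rs(1,4)] refine[OF v rs(2,5)] rs(6,7) by simp
qed

lemma vert_extension_eq:
  assumes w: "w1 \<in> W" "w2 \<in> W" and u: "(u1, u2) \<in> spans C W w1 w2"
  shows "amap (vert_extension K A) (vert w1 w2) = Cmp K (amap A (u2, w2)) (inv_arr K (amap A (u1, w1)))"
proof -
  define v where "v = (SOME u. u \<in> spans C W w1 w2)"
  have "v \<in> spans C W w1 w2" unfolding v_def by (rule someI[of _ "(u1, u2)"]) (rule u)
  then have "(fst v, snd v) \<in> spans C W w1 w2" by simp
  from vert_extension_well_defined[OF w this u]
  show ?thesis by (simp add: vert_extension_def Let_def v_def)
qed

text \<open>The span with legs \<open>1\<close> and \<open>u\<close> represents this vertical arrow,
  and its denominator is an identity.\<close>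

lemma vert_extension_Nabla:
  assumes "u \<in> W" "w \<in> W" "Cod C u = Dom C w"
  shows "amap (vert_extension K A) (vert (w \<cdot> u) w) = amap A (u, w)"
proof -
  have wu: "w \<cdot> u \<in> W" "Dom C (w \<cdot> u) = Dom C u" using assms by (simp_all add: C_simps)
  have "(Ide C (Dom C u), u) \<in> spans C W (w \<cdot> u) w" using assms wu by (simp add: spans_iff C_simps)
  moreover have "amap A (Ide C (Dom C u), w \<cdot> u) = Ide K (omap A (w \<cdot> u))"
    using A.amap_Ide[of "w \<cdot> u"] wu by (simp add: Nabla_simps)
  ultimately show ?thesis
    using vert_extension_eq[OF wu(1) assms(2), of "Ide C (Dom C u)" u] amap_Nabla[OF assms] wu
      A.omap_closed[of "w \<cdot> u"]
    by (simp add: A.B.inv_arr_Ide A.B.Cmp_Ide_right' Nabla_simps)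
qed

lemma vert_extension_functor: "cat_functor (cat0 (Frac C W)) K (vert_extension K A)"
proof (intro cat_functor.intro cat_functor_axioms.intro F.D0.B.category_axioms A.B.category_axioms)
  have o: "omap (vert_extension K A) = omap A" by (simp add: vert_extension_def)
  show "omap (vert_extension K A) w \<in> Obj K" if "w \<in> Obj (cat0 (Frac C W))" for w
    using that A.omap_closed[of w] by (simp add: o Frac_simps Nabla_simps)
  show "amap (vert_extension K A) (Ide (cat0 (Frac C W)) w) = Ide K (omap (vert_extension K A) w)"
    if "w \<in> Obj (cat0 (Frac C W))" for w
  proof -
    have w: "w \<in> W" using that by (simp add: Frac_simps)
    then show ?thesis
      using vert_extension_Nabla[of "Ide C (Dom C w)" w] A.amap_Ide[of w]
      by (simp add: o Frac_simps frac_vert_id C_simps Nabla_simps)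
  qed
  fix S assume "S \<in> Arr (cat0 (Frac C W))"
  then obtain w1 w2 where w: "w1 \<in> W" "w2 \<in> W" "Cod C w1 = Cod C w2" and S: "S = vert w1 w2"
    by (auto simp: Frac_simps frac_verts_iff)
  obtain u1 u2 where u: "(u1, u2) \<in> spans C W w1 w2" using span_exists w by blast
  have U: "u1 \<in> W" "u2 \<in> W" "Cod C u1 = Dom C w1" "Cod C u2 = Dom C w2" "Dom C u1 = Dom C u2" "w1 \<cdot> u1 = w2 \<cdot> u2"
    using u unfolding spans_iff[OF w(1,2)] by blast+
  note a = amap_Nabla[OF U(1) w(1) U(3)] amap_Nabla[OF U(2) w(2) U(4)]
  note i = A.B.inv_arr[OF a(4)]
  show "amap (vert_extension K A) S \<in> Arr K" "Dom K (amap (vert_extension K A) S) = omap (vert_extension K A) (Dom (cat0 (Frac C W)) S)"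
    "Cod K (amap (vert_extension K A) S) = omap (vert_extension K A) (Cod (cat0 (Frac C W)) S)"
    using a i U(6) by (simp_all add: S vert_extension_eq[OF w(1,2) u] o Frac_simps A.B.cat_simps)
  fix T assume TS: "T \<in> Arr (cat0 (Frac C W))" "Cod (cat0 (Frac C W)) S = Dom (cat0 (Frac C W)) T"
  then have "T \<in> frac_verts C W" "v_from T = w2" by (simp_all add: S Frac_simps)
  then obtain w3 where w3: "w3 \<in> W" "Cod C w2 = Cod C w3" and T: "T = vert w2 w3"
    unfolding frac_verts_iff by fastforce
  obtain v2 v3 where v: "(v2, v3) \<in> spans C W w2 w3" using span_exists w w3 by blast
  have V: "v2 \<in> W" "v3 \<in> W" "Cod C v2 = Dom C w2" "Cod C v3 = Dom C w3" "Dom C v2 = Dom C v3" "w2 \<cdot> v2 = w3 \<cdot> v3"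
    using v unfolding spans_iff[OF w(2) w3(1)] by blast+
  \<comment> \<open>Refining both spans over the shared object gives them one middle leg. Its image
    occurs once as numerator and once as denominator, so the product of the quotients
    telescopes.\<close>
  obtain r s where rs: "r \<in> W" "s \<in> W" "Dom C r = Dom C s" "Cod C r = Dom C u2" "Cod C s = Dom C v2" "u2 \<cdot> r = v2 \<cdot> s"
    using span_exists[of u2 v2] U V spans_iff[of u2 v2] by metis
  have p: "(u1 \<cdot> r, u2 \<cdot> r) \<in> spans C W w1 w2" using spans_refine[OF w(1,2) u rs(1)] rs U by simp
  have q: "(u2 \<cdot> r, v3 \<cdot> s) \<in> spans C W w2 w3" using spans_refine[OF w(2) w3(1) v rs(2)] rs V by simp
  have P: "u1 \<cdot> r \<in> W" "u2 \<cdot> r \<in> W" "Cod C (u1 \<cdot> r) = Dom C w1" "Cod C (u2 \<cdot> r) = Dom C w2" "Dom C (u1 \<cdot> r) = Dom C (u2 \<cdot> r)"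
     "w1 \<cdot> (u1 \<cdot> r) = w2 \<cdot> (u2 \<cdot> r)"
    using p unfolding spans_iff[OF w(1,2)] by blast+
  have Q: "v3 \<cdot> s \<in> W" "Cod C (v3 \<cdot> s) = Dom C w3" "Dom C (u2 \<cdot> r) = Dom C (v3 \<cdot> s)" "w2 \<cdot> (u2 \<cdot> r) = w3 \<cdot> (v3 \<cdot> s)"
    using q unfolding spans_iff[OF w(2) w3(1)] by blast+
  have pq: "(u1 \<cdot> r, v3 \<cdot> s) \<in> spans C W w1 w3"
    unfolding spans_iff[OF w(1) w3(1)] using P Q by metis
  note a = amap_Nabla[OF P(1) w(1) P(3)] amap_Nabla[OF P(2) w(2) P(4)] amap_Nabla[OF Q(1) w3(1) Q(2)]
  note i = A.B.inv_arr[OF a(4)] A.B.inv_arr[OF a(8)]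
  have "Cmp K (Cmp K (amap A (v3 \<cdot> s, w3)) (inv_arr K (amap A (u2 \<cdot> r, w2)))) (Cmp K (amap A (u2 \<cdot> r, w2)) (inv_arr K (amap A (u1 \<cdot> r, w1))))
     = Cmp K (Cmp K (Cmp K (amap A (v3 \<cdot> s, w3)) (inv_arr K (amap A (u2 \<cdot> r, w2)))) (amap A (u2 \<cdot> r, w2))) (inv_arr K (amap A (u1 \<cdot> r, w1)))"
    by (rule A.B.Cmp_assoc) (use a i P(6) Q(4) in \<open>simp_all add: A.B.cat_simps\<close>)
  also have "\<dots> = Cmp K (amap A (v3 \<cdot> s, w3)) (inv_arr K (amap A (u1 \<cdot> r, w1)))"
    by (subst A.B.Cmp_inv_cancel'[OF a(8)]) (use a Q(4) in simp_all)
  finally show "amap (vert_extension K A) (Cmp (cat0 (Frac C W)) T S) = Cmp K (amap (vert_extension K A) T) (amap (vert_extension K A) S)"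
    using w w3 vert_extension_eq[OF w(1,2) p] vert_extension_eq[OF w(2) w3(1) q] vert_extension_eq[OF w(1) w3(1) pq]
    by (simp add: S T Frac_simps frac_vert_comp)
qed

end

end

section \<open>Full faithfulness\<close>

lemma (in horizontal_transformation) vertical_functor: "cat_functor (cat0 X) (cat1 Y) a"
  by (intro cat_functor.intro cat_functor_axioms.intro G.X.D0.B.category_axioms G.Y.D0.A.category_axioms)
    (simp_all add: htrans_simps)

locale fractions_globular = fractions_target C W D
  for C :: "('o, 'a) cat" and W :: "'a set" and D :: "('p, 'v, 'h, 'c) dblcat" +
  assumes vert_iso: "v \<in> Arr (cat0 D) \<Longrightarrow> iso_arr (cat0 D) v"
begin

section \<open>Faithfulness of the comparison, and the restriction of horizontal arrows along
  spans\<close>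

lemma Phi_simps:
  assumes "u \<in> W" "w \<in> W" "Cod C u = Dom C w"
  shows "is_companion (Frac C W) (Phi_companion C W (u, w))"
    "comp_h (Phi_companion C W (u, w)) = Hor (w \<cdot> u) w u"
    "comp_v (Phi_companion C W (u, w)) = vert (w \<cdot> u) w"
proof -
  interpret P: cat_functor "Nabla C W" "cat0 (Companions (Frac C W))" Phi0_ftr
    by (rule Phi_functor)
  show "is_companion (Frac C W) (Phi_companion C W (u, w))"
    using P.amap_closed[of "(u, w)"] assms by (simp add: Nabla_simps Companions_simps)
qed (simp_all add: Phi_companion[OF assms])

lemma Phi_ftr_apply: "omap (ftr0 (Phi_ftr C W)) w = w" "amap (ftr0 (Phi_ftr C W)) f = Phi_companion C W f"
  by (simp_all add: Phi_ftr_def Let_def)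

lemma htrans_of_apply:
  "w \<in> W \<Longrightarrow> omap (htrans_whisker (V_dbl (Nabla C W)) (Companions_htrans L b L') (Phi_ftr C W)) w = omap b w"
  "\<lbrakk>u \<in> W; w \<in> W; Cod C u = Dom C w\<rbrakk> \<Longrightarrow>
    amap (htrans_whisker (V_dbl (Nabla C W)) (Companions_htrans L b L') (Phi_ftr C W)) (u, w)
    = (map_companion_ftr L (Phi_companion C W (u, w)), amap b (vert (w \<cdot> u) w), map_companion_ftr L' (Phi_companion C W (u, w)))"
  by (simp_all add: htrans_whisker_apply V_dbl_simps Nabla_simps Phi_ftr_apply Companions_htrans_def Phi_simps)

text \<open>The whiskered transformation still records \<open>b\<close> on all objects and on the
  vertical arrows coming from \<open>Nabla C W\<close>. As \<open>b\<close> is a functor from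
  vertical arrows to cells, these values determine it.\<close>

lemma comparison_faithful:
  assumes b: "b \<in> htrans (Frac C W) D L L'" and b': "b' \<in> htrans (Frac C W) D L L'"
    and eq: "friendly_htrans_of C W L b L' = friendly_htrans_of C W L b' L'"
  shows "b = b'"
proof -
  interpret b: horizontal_transformation "Frac C W" D L L' b using b by (rule htransD)
  interpret b': horizontal_transformation "Frac C W" D L L' b' using b' by (rule htransD)
  have e: "htrans_whisker (V_dbl (Nabla C W)) (Companions_htrans L b L') (Phi_ftr C W)
    = htrans_whisker (V_dbl (Nabla C W)) (Companions_htrans L b' L') (Phi_ftr C W)"
    using eq by (simp add: friendly_htrans_of_def)
  have o: "omap b w = omap b' w" if "w \<in> W" for w
    using htrans_of_apply(1)[OF that, of L b L'] htrans_of_apply(1)[OF that, of L b' L'] e by simp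
  have a: "amap b (vert (w \<cdot> u) w) = amap b' (vert (w \<cdot> u) w)" if "u \<in> W" "w \<in> W" "Cod C u = Dom C w" for u w
    using htrans_of_apply(2)[OF that, of L b L'] htrans_of_apply(2)[OF that, of L b' L'] e by simp
  show ?thesis
    by (rule ftr_eqI[OF htrans_ext[OF b] htrans_ext[OF b']])
      (simp_all add: Frac_simps o vert_functor_eqI[OF b.vertical_functor b'.vertical_functor o a])
qed

text \<open>Each cell of the double category of fractions is the quotient of two companion cells.\<close>

definition span_hor :: "'a frac_hor \<Rightarrow> 'a \<Rightarrow> 'a \<Rightarrow> 'a \<Rightarrow> 'a frac_hor" where
  "span_hor f u u' \<phi> = Hor (h_from f \<cdot> u) (h_to f \<cdot> u') \<phi>"

text \<open>One half of a cell representative: \<open>\<phi>\<close> is what \<open>f\<close>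
  becomes between the refined objects. A representative is a pair of such restrictions, of the top
  and of the bottom, with the same \<open>\<phi>\<close>.\<close>

definition restriction :: "'a frac_hor \<Rightarrow> 'a \<Rightarrow> 'a \<Rightarrow> 'a \<Rightarrow> bool" where
  "restriction f u u' \<phi> \<longleftrightarrow> f \<in> frac_hors C W \<and> u \<in> W \<and> u' \<in> W \<and> \<phi> \<in> Arr C \<and> Cod C u = Dom C (h_from f)
    \<and> Cod C u' = Dom C (h_to f) \<and> Dom C \<phi> = Dom C u \<and> Cod C \<phi> = Dom C u' \<and> h_arr f \<cdot> u = u' \<cdot> \<phi>"

lemma span_hor_in:
  assumes "restriction f u u' \<phi>"
  shows "span_hor f u u' \<phi> \<in> frac_hors C W"
proof -
  have R: "f \<in> frac_hors C W" "u \<in> W" "u' \<in> W" "\<phi> \<in> Arr C" "Cod C u = Dom C (h_from f)"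
    "Cod C u' = Dom C (h_to f)" "Dom C \<phi> = Dom C u" "Cod C \<phi> = Dom C u'"
    using assms unfolding restriction_def by blast+
  show ?thesis
    unfolding span_hor_def frac_hors_iff using R(2-8) frac_horsD(1,2)[OF R(1)] by (simp add: C_simps)
qed

text \<open>In each span the two legs have equal composites with the objects they lead to. This
  makes the restricted arrows of top and bottom coincide, so both companion cells start at the same
  horizontal arrow.\<close>

lemma reps_restriction:
  assumes "f1 \<in> frac_hors C W" "f2 \<in> frac_hors C W" "((u1, u2), \<phi>, (u1', u2')) \<in> reps f1 f2"
  shows "restriction f1 u1 u1' \<phi>" "restriction f2 u2 u2' \<phi>" "span_hor f2 u2 u2' \<phi> = span_hor f1 u1 u1' \<phi>"
    "(u1, u2) \<in> spans C W (h_from f1) (h_from f2)" "(u1', u2') \<in> spans C W (h_to f1) (h_to f2)"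
  using assms(3)[unfolded reps_iff[OF assms(1,2)]] assms(1,2) frac_horsD[OF assms(1)] frac_horsD[OF assms(2)]
  by (auto simp: restriction_def span_hor_def spans_iff)

lemma restriction_square:
  assumes r: "restriction f u u' \<phi>"
  shows "F.companion_square (span_hor f u u' \<phi>) f (Phi_companion C W (u, h_from f)) (Phi_companion C W (u', h_to f))"
    "linked (span_hor f u u' \<phi>) f"
    "F.companion_cell (span_hor f u u' \<phi>) f (Phi_companion C W (u, h_from f)) (Phi_companion C W (u', h_to f))
      = cell (span_hor f u u' \<phi>) f"
proof -
  note R = r[unfolded restriction_def]
  have f: "f \<in> frac_hors C W" using R by blast
  note F = frac_horsD[OF f]
  have u: "u \<in> W" "Cod C u = Dom C (h_from f)" "u' \<in> W" "Cod C u' = Dom C (h_to f)" using R by blast+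
  note P = Phi_simps[OF u(1) F(1) u(2)] Phi_simps[OF u(3) F(2) u(4)]
  show sq: "F.companion_square (span_hor f u u' \<phi>) f (Phi_companion C W (u, h_from f)) (Phi_companion C W (u', h_to f))"
    using P F R span_hor_in[OF r]
    by (simp add: F.companion_square_def Frac_simps) (simp add: span_hor_def frac_hor_comp_def)
  have "((Ide C (Dom C u), u), \<phi>, (Ide C (Dom C u'), u')) \<in> reps (span_hor f u u' \<phi>) f"
    unfolding reps_iff[OF span_hor_in[OF r] f] using F R by (simp add: span_hor_def C_simps)
  then show l: "linked (span_hor f u u' \<phi>) f" using f span_hor_in[OF r] unfolding linked_def by blast
  show "F.companion_cell (span_hor f u u' \<phi>) f (Phi_companion C W (u, h_from f)) (Phi_companion C W (u', h_to f))
      = cell (span_hor f u u' \<phi>) f"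
    by (rule Frac_cell_eqI) (use F.companion_cell_sides[OF sq] l in \<open>auto simp: Frac_simps frac_cells_linked\<close>)
qed

text \<open>A cell of \<open>Companions D\<close> carries its two side companions, and its middle
  part is pasted from them. The value of \<open>\<alpha>\<close> on an arrow is therefore forced by
  its values on objects.\<close>

lemma htrans_V_cell:
  assumes \<alpha>: "\<alpha> \<in> htrans (V_dbl (Nabla C W)) (Companions D) \<Gamma> \<Lambda>" and u: "u \<in> W" "w \<in> W" "Cod C u = Dom C w"
  shows "amap \<alpha> (u, w) = (amap (ftr0 \<Gamma>) (u, w), fst (snd (amap \<alpha> (u, w))), amap (ftr0 \<Lambda>) (u, w))"
    and "D.companion_square (omap \<alpha> (w \<cdot> u)) (omap \<alpha> w) (amap (ftr0 \<Gamma>) (u, w)) (amap (ftr0 \<Lambda>) (u, w))"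
    and "fst (snd (amap \<alpha> (u, w))) = D.companion_cell (omap \<alpha> (w \<cdot> u)) (omap \<alpha> w) (amap (ftr0 \<Gamma>) (u, w)) (amap (ftr0 \<Lambda>) (u, w))"
proof -
  interpret \<alpha>: horizontal_transformation "V_dbl (Nabla C W)" "Companions D" \<Gamma> \<Lambda> \<alpha> using \<alpha> by (rule htransD)
  have v: "(u, w) \<in> Arr (cat0 (V_dbl (Nabla C W)))" using u by (simp add: V_dbl_simps Nabla_simps)
  obtain p q \<theta> \<theta>' where a: "amap \<alpha> (u, w) = (\<theta>, D.companion_cell p q \<theta> \<theta>', \<theta>')" and sq: "D.companion_square p q \<theta> \<theta>'"
    using \<alpha>.cell[OF v] by (rule D.Arr_CompanionsE)
  have e: "\<theta> = amap (ftr0 \<Gamma>) (u, w)" "\<theta>' = amap (ftr0 \<Lambda>) (u, w)" "p = omap \<alpha> (w \<cdot> u)" "q = omap \<alpha> w"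
    using \<alpha>.cell_left[OF v] \<alpha>.cell_right[OF v] \<alpha>.cell_top[OF v] \<alpha>.cell_bottom[OF v] D.companion_cell_sides[OF sq]
    by (simp_all add: a Companions_def V_dbl_simps Nabla_simps)
  then show "amap \<alpha> (u, w) = (amap (ftr0 \<Gamma>) (u, w), fst (snd (amap \<alpha> (u, w))), amap (ftr0 \<Lambda>) (u, w))"
    "D.companion_square (omap \<alpha> (w \<cdot> u)) (omap \<alpha> w) (amap (ftr0 \<Gamma>) (u, w)) (amap (ftr0 \<Lambda>) (u, w))"
    "fst (snd (amap \<alpha> (u, w))) = D.companion_cell (omap \<alpha> (w \<cdot> u)) (omap \<alpha> w) (amap (ftr0 \<Gamma>) (u, w)) (amap (ftr0 \<Lambda>) (u, w))"
    using a sq by simp_all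
qed

lemma companion_cell_D_iso: "D.companion_square f g \<theta> \<theta>' \<Longrightarrow> iso_arr (cat1 D) (D.companion_cell f g \<theta> \<theta>')"
  using D.companion_cell_iso vert_iso D.companionD(2) D.companion_squareD(1,2) by metis

text \<open>Forgetting the side companions leaves a functor into \<open>cat1 D\<close>, to which the
  extension along quotients applies.\<close>

abbreviation cell_ftr :: "('a, 'a \<times> 'a, 'h, ('v, 'h, 'c) companion \<times> 'c \<times> ('v, 'h, 'c) companion) ftr
    \<Rightarrow> ('a, 'a \<times> 'a, 'h, 'c) ftr" where
  "cell_ftr \<alpha> \<equiv> \<lparr>omap = omap \<alpha>, amap = \<lambda>f. fst (snd (amap \<alpha> f))\<rparr>"

lemma htrans_V_functor:
  assumes \<alpha>: "\<alpha> \<in> htrans (V_dbl (Nabla C W)) (Companions D) \<Gamma> \<Lambda>"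
  shows "cat_functor (Nabla C W) (cat1 D) (cell_ftr \<alpha>)"
proof (intro cat_functor.intro cat_functor_axioms.intro N.category_axioms D.D0.A.category_axioms)
  interpret \<alpha>: horizontal_transformation "V_dbl (Nabla C W)" "Companions D" \<Gamma> \<Lambda> \<alpha> using \<alpha> by (rule htransD)
  show "omap (cell_ftr \<alpha>) w \<in> Obj (cat1 D)" if "w \<in> Obj (Nabla C W)" for w
    using htrans_V_sides[OF \<alpha>] that by (simp add: Nabla_simps)
  show "amap (cell_ftr \<alpha>) (Ide (Nabla C W) w)
      = Ide (cat1 D) (omap (cell_ftr \<alpha>) w)" if "w \<in> Obj (Nabla C W)" for w
    using \<alpha>.cell_Ide[of w] that by (simp add: V_dbl_simps Companions_def)
  fix f assume f: "f \<in> Arr (Nabla C W)"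
  obtain u w where u: "f = (u, w)" "u \<in> W" "w \<in> W" "Cod C u = Dom C w" using f by (cases f) (auto simp: Nabla_simps)
  note s = D.companion_cell_sides[OF htrans_V_cell(2)[OF \<alpha> u(2-4)]] htrans_V_cell(3)[OF \<alpha> u(2-4)]
  show "amap (cell_ftr \<alpha>) f \<in> Arr (cat1 D)"
    "Dom (cat1 D) (amap (cell_ftr \<alpha>) f)
      = omap (cell_ftr \<alpha>) (Dom (Nabla C W) f)"
    "Cod (cat1 D) (amap (cell_ftr \<alpha>) f)
      = omap (cell_ftr \<alpha>) (Cod (Nabla C W) f)"
    by (simp_all add: u s Nabla_simps)
  fix g assume g: "g \<in> Arr (Nabla C W)" "Cod (Nabla C W) f = Dom (Nabla C W) g"
  obtain u' w' where u': "g = (u', w')" "u' \<in> W" "w' \<in> W" "Cod C u' = Dom C w'" using g by (cases g) (auto simp: Nabla_simps)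
  show "amap (cell_ftr \<alpha>) (Cmp (Nabla C W) g f)
      = Cmp (cat1 D) (amap (cell_ftr \<alpha>) g)
        (amap (cell_ftr \<alpha>) f)"
    using \<alpha>.cell_Cmp[of f g] f g htrans_V_cell(1)[OF \<alpha> u(2-4)] htrans_V_cell(1)[OF \<alpha> u'(2-4)]
    by (simp add: V_dbl_simps u(1) u'(1)) (simp add: Companions_def split: prod.splits)
qed

text \<open>The object part of \<open>\<alpha>\<close> gives the horizontal components of
  \<open>b\<close>, and the extension of its cells along quotients gives the components at vertical
  arrows. Naturality at a general cell is reduced to companion cells, which are controlled by
  squares of horizontal arrows.\<close>

lemma comparison_full:
  assumes L: "L \<in> dbl_functors (Frac C W) D" and L': "L' \<in> dbl_functors (Frac C W) D"
    and t: "t \<in> friendly_htrans C W D (friendly_of C W L) (friendly_of C W L')"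
  shows "\<exists>b\<in>htrans (Frac C W) D L L'. friendly_htrans_of C W L b L' = t"
proof -
  interpret L: strict_double_functor "Frac C W" D L using L by (rule dbl_functorsD)
  interpret L': strict_double_functor "Frac C W" D L' using L' by (rule dbl_functorsD)
  let ?N = "V_dbl (Nabla C W)"
  let ?\<Gamma> = "dblftr_comp ?N (Companions_ftr L) (Phi_ftr C W)" and ?\<Gamma>' = "dblftr_comp ?N (Companions_ftr L') (Phi_ftr C W)"
  obtain a \<alpha> where ta: "t = (a, \<alpha>)" by fastforce
  note t = t[unfolded ta friendly_of_def friendly_htrans_iff]
  have a: "a \<in> htrans (H_dbl C) D (dblftr_comp (H_dbl C) L (J_ftr C W)) (dblftr_comp (H_dbl C) L' (J_ftr C W))"
    and \<alpha>: "\<alpha> \<in> htrans ?N (Companions D) ?\<Gamma> ?\<Gamma>'"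
    and comm: "\<And>w. w \<in> W \<Longrightarrow> hcomp D (omap (ftr1 L') (varphi C w)) (omap \<alpha> w) = hcomp D (omap a (Dom C w)) (omap (ftr1 L) (varphi C w))"
    using t by auto
  interpret a: horizontal_transformation "H_dbl C" D "dblftr_comp (H_dbl C) L (J_ftr C W)" "dblftr_comp (H_dbl C) L' (J_ftr C W)" a
    using a by (rule htransD)
  have G: "amap (ftr0 ?\<Gamma>) (u, w) = map_companion_ftr L (Phi_companion C W (u, w))"
    "amap (ftr0 ?\<Gamma>') (u, w) = map_companion_ftr L' (Phi_companion C W (u, w))"
    if "u \<in> W" "w \<in> W" "Cod C u = Dom C w" for u w
    using that by (simp_all add: dblftr_comp_apply V_dbl_simps Nabla_simps Phi_ftr_apply) (simp_all add: Companions_ftr_def)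
  have G0: "omap (ftr0 ?\<Gamma>) w = omap (ftr0 L) w" "omap (ftr0 ?\<Gamma>') w = omap (ftr0 L') w" if "w \<in> W" for w
    using that by (simp_all add: dblftr_comp_apply V_dbl_simps Nabla_simps Phi_ftr_apply) (simp_all add: Companions_ftr_def)
  have al: "omap \<alpha> w \<in> Obj (cat1 D)" "omap (d0 D) (omap \<alpha> w) = omap (ftr0 L) w" "omap (d1 D) (omap \<alpha> w) = omap (ftr0 L') w"
    if "w \<in> W" for w
    using htrans_V_sides[OF \<alpha> that] G0[OF that] by simp_all
  \<comment> \<open>The squares carried by \<open>\<alpha>\<close> concern arrows of
    \<open>W\<close>. Naturality at an arbitrary horizontal arrow is transported from
    \<open>a\<close> along the images of \<open>varphi\<close>, which are invertible and can be
    cancelled at the end.\<close>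
  have hor: "hcomp D (omap \<alpha> (h_to f)) (omap (ftr1 L) f) = hcomp D (omap (ftr1 L') f) (omap \<alpha> (h_from f))"
    if f: "f \<in> frac_hors C W" for f
  proof -
    note F = frac_horsD[OF f]
    let ?x = "Dom C (h_from f)" and ?y = "Dom C (h_to f)"
    \<comment> \<open>The image under \<open>J\<close> of the underlying arrow of \<open>f\<close>:
      naturality of \<open>a\<close> applies to \<open>j\<close>, and \<open>varphi\<close> links
      \<open>j\<close> to \<open>f\<close>.\<close>
    define j where "j = Hor (Ide C ?x) (Ide C ?y) (h_arr f)"
    have j: "j \<in> frac_hors C W" using F by (simp add: j_def frac_hors_iff C_simps)
    have Jj: "omap (ftr1 (J_ftr C W)) (h_arr f) = j" using F by (simp add: J_ftr_def Let_def j_def)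
    note v = varphi_hor[OF F(1)] varphi_hor[OF F(2)]
    have jv: "frac_hor_comp C j (varphi C (h_from f)) = frac_hor_comp C (varphi C (h_to f)) f"
      using F by (simp add: j_def varphi_def frac_hor_comp_def C_simps)
    have vs: "h_from (varphi C w) = w" "h_to (varphi C w) = Ide C (Dom C w)" for w by (simp_all add: varphi_def)
    have js: "h_from j = Ide C ?x" "h_to j = Ide C ?y" by (simp_all add: j_def)
    have Lc: "hcomp D (omap (ftr1 M) j) (omap (ftr1 M) (varphi C (h_from f))) = hcomp D (omap (ftr1 M) (varphi C (h_to f))) (omap (ftr1 M) f)"
      if "strict_double_functor (Frac C W) D M" for M
      using strict_double_functor.preserves_hcomp[OF that, of "varphi C (h_from f)" j]
        strict_double_functor.preserves_hcomp[OF that, of f "varphi C (h_to f)"] f j v jv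
      by (simp add: Frac_simps vs js)
    have sides: "omap (ftr1 M) g \<in> Obj (cat1 D)" "omap (d0 D) (omap (ftr1 M) g) = omap (ftr0 M) (h_from g)"
      "omap (d1 D) (omap (ftr1 M) g) = omap (ftr0 M) (h_to g)"
      if "strict_double_functor (Frac C W) D M" "g \<in> frac_hors C W" for M g
    proof -
      interpret M: strict_double_functor "Frac C W" D M by (rule that(1))
      show "omap (ftr1 M) g \<in> Obj (cat1 D)" "omap (d0 D) (omap (ftr1 M) g) = omap (ftr0 M) (h_from g)"
        "omap (d1 D) (omap (ftr1 M) g) = omap (ftr0 M) (h_to g)"
        using that(2) M.F1.omap_closed[of g] M.preserves_d0[of g] M.preserves_d1[of g] by (simp_all add: Frac_simps)
    qed
    note LL = L.strict_double_functor_axioms L'.strict_double_functor_axioms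
    note s = sides[OF LL(1) f] sides[OF LL(2) f] sides[OF LL(1) j] sides[OF LL(2) j]
      sides[OF LL(1) v(1)] sides[OF LL(2) v(1)] sides[OF LL(1) v(2)] sides[OF LL(2) v(2)] al[OF F(1)] al[OF F(2)]
    have xy: "?x \<in> Obj C" "?y \<in> Obj C" using F by (simp_all add: C_simps)
    have J0: "omap (ftr0 (J_ftr C W)) x = Ide C x" for x by (simp add: J_ftr_def Let_def)
    note as = htrans_H_sides[OF a xy(1)] htrans_H_sides[OF a xy(2)]
    have as': "omap (d0 D) (omap a ?x) = omap (ftr0 L) (Ide C ?x)" "omap (d1 D) (omap a ?x) = omap (ftr0 L') (Ide C ?x)"
      "omap (d0 D) (omap a ?y) = omap (ftr0 L) (Ide C ?y)" "omap (d1 D) (omap a ?y) = omap (ftr0 L') (Ide C ?y)"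
      using as xy by (simp_all add: dblftr_comp_apply H_dbl_simps J0)
    have an: "hcomp D (omap a ?y) (omap (ftr1 L) j) = hcomp D (omap (ftr1 L') j) (omap a ?x)"
      using a.hor_naturality[of "h_arr f"] F by (simp add: H_dbl_simps dblftr_comp_apply Jj)
    let ?v = "\<lambda>M w. omap (ftr1 M) (varphi C w)"
    note s = s as(1,4) as' vs js
    have "hcomp D (?v L' (h_to f)) (hcomp D (omap \<alpha> (h_to f)) (omap (ftr1 L) f))
        = hcomp D (hcomp D (omap a ?y) (?v L (h_to f))) (omap (ftr1 L) f)"
      using comm[OF F(2)] by (simp add: s D.hcomp_assoc)
    also have "\<dots> = hcomp D (omap a ?y) (hcomp D (omap (ftr1 L) j) (?v L (h_from f)))"
      unfolding Lc[OF LL(1)] by (simp add: s D.hcomp_assoc)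
    also have "\<dots> = hcomp D (hcomp D (omap (ftr1 L') j) (omap a ?x)) (?v L (h_from f))"
      unfolding an[symmetric] by (simp add: s D.hcomp_assoc)
    also have "\<dots> = hcomp D (omap (ftr1 L') j) (hcomp D (?v L' (h_from f)) (omap \<alpha> (h_from f)))"
      unfolding comm[OF F(1)] by (simp add: s D.hcomp_assoc)
    also have "\<dots> = hcomp D (hcomp D (omap (ftr1 L') j) (?v L' (h_from f))) (omap \<alpha> (h_from f))"
      by (simp add: s D.hcomp_assoc)
    also have "\<dots> = hcomp D (?v L' (h_to f)) (hcomp D (omap (ftr1 L') f) (omap \<alpha> (h_from f)))"
      unfolding Lc[OF LL(2)] by (simp add: s D.hcomp_assoc)
    finally have eq: "hcomp D (?v L' (h_to f)) (hcomp D (omap \<alpha> (h_to f)) (omap (ftr1 L) f))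
      = hcomp D (?v L' (h_to f)) (hcomp D (omap (ftr1 L') f) (omap \<alpha> (h_from f)))" .
    have iso: "iso_arr (hor_cat D) (?v L' (h_to f))"
      using cat_functor.amap_iso[OF L'.hor_functor varphi_iso[OF F(2)]] by (simp add: hor_ftr_def)
    show ?thesis
      by (rule HD.iso_cancel_left[OF iso]) (use eq in \<open>simp_all add: hor_cat_simps s D.hcomp_closed D.d1_hcomp\<close>)
  qed
  let ?A = "cell_ftr \<alpha>"
  note A = htrans_V_functor[OF \<alpha>]
  have Acell: "amap ?A (u, w) = D.companion_cell (omap \<alpha> (w \<cdot> u)) (omap \<alpha> w) (map_companion_ftr L (Phi_companion C W (u, w)))
      (map_companion_ftr L' (Phi_companion C W (u, w)))"
    "D.companion_square (omap \<alpha> (w \<cdot> u)) (omap \<alpha> w) (map_companion_ftr L (Phi_companion C W (u, w)))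
      (map_companion_ftr L' (Phi_companion C W (u, w)))"
    if "u \<in> W" "w \<in> W" "Cod C u = Dom C w" for u w
    using htrans_V_cell(2,3)[OF \<alpha> that] G[OF that] by simp_all
  have Aiso: "iso_arr (cat1 D) (amap ?A f)" if "f \<in> Arr (Nabla C W)" for f
    using that Acell companion_cell_D_iso by (cases f) (simp add: Nabla_simps)
  define b where "b = vert_extension (cat1 D) ?A"
  have bf: "cat_functor (cat0 (Frac C W)) (cat1 D) b" unfolding b_def by (rule vert_extension_functor[OF A Aiso])
  interpret b: cat_functor "cat0 (Frac C W)" "cat1 D" b by (rule bf)
  have b0: "omap b w = omap \<alpha> w" for w by (simp add: b_def vert_extension_def)
  have bN: "amap b (vert (w \<cdot> u) w) = amap ?A (u, w)" if "u \<in> W" "w \<in> W" "Cod C u = Dom C w" for u w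
    unfolding b_def using vert_extension_Nabla[OF A Aiso that] .
  \<comment> \<open>Taking a side of \<open>b\<close> is again a functor on vertical arrows, so the
    comparison with \<open>L\<close> and \<open>L'\<close> has to be made only on arrows from
    \<open>Nabla C W\<close>.\<close>
  have bside: "amap (d0 D) (amap b S) = amap (ftr0 L) S" "amap (d1 D) (amap b S) = amap (ftr0 L') S" if "S \<in> frac_verts C W" for S
  proof -
    have s: "amap (d0 D) (amap b (vert (w \<cdot> u) w)) = amap (ftr0 L) (vert (w \<cdot> u) w)"
      "amap (d1 D) (amap b (vert (w \<cdot> u) w)) = amap (ftr0 L') (vert (w \<cdot> u) w)"
      if u: "u \<in> W" "w \<in> W" "Cod C u = Dom C w" for u w
      using bN[OF u] Acell[OF u] D.companion_cell_sides[OF Acell(2)[OF u]] Phi_simps[OF u]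
      by (simp_all add: L.map_companion_sel L'.map_companion_sel)
    have "amap (ftr_comp (d0 D) b) S = amap (ftr0 L) S"
      by (rule vert_functor_eqI[OF ftr_comp_functor[OF bf D.d0_functor] L.ftr0_functor _ _ that])
        (simp_all add: ftr_comp_def s b0 al)
    moreover have "amap (ftr_comp (d1 D) b) S = amap (ftr0 L') S"
      by (rule vert_functor_eqI[OF ftr_comp_functor[OF bf D.d1_functor] L'.ftr0_functor _ _ that])
        (simp_all add: ftr_comp_def s b0 al)
    ultimately show "amap (d0 D) (amap b S) = amap (ftr0 L) S" "amap (d1 D) (amap b S) = amap (ftr0 L') S"
      by (simp_all add: ftr_comp_def)
  qed
  have nat: "ccomp D (amap b (c_right \<zeta>)) (amap (ftr1 L) \<zeta>) = ccomp D (amap (ftr1 L') \<zeta>) (amap b (c_left \<zeta>))"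
    if zeta: "\<zeta> \<in> frac_cells C W" for \<zeta>
  proof -
    obtain f1 f2 where l: "linked f1 f2" and z: "\<zeta> = cell f1 f2" using zeta unfolding frac_cells_linked by blast
    note f = linkedD(1,2)[OF l]
    note F = frac_horsD[OF f(1)] frac_horsD[OF f(2)]
    obtain x where "x \<in> reps f1 f2" using l unfolding linked_def by blast
    then obtain u1 u2 \<phi> u1' u2' where x: "((u1, u2), \<phi>, (u1', u2')) \<in> reps f1 f2" by (metis surj_pair)
    note r = reps_restriction[OF f x]
    \<comment> \<open>\<open>k\<close> is the common restriction of \<open>f1\<close> and
      \<open>f2\<close> given by the representative; stacking \<open>\<zeta>\<close> under
      \<open>cell k f1\<close> produces \<open>cell k f2\<close>.\<close>
    define k where "k = span_hor f1 u1 u1' \<phi>"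
    have kf: "span_hor f2 u2 u2' \<phi> = k" using r(3) by (simp add: k_def)
    note sq = restriction_square[OF r(1), folded k_def] restriction_square[OF r(2), unfolded kf]
    have k: "k \<in> frac_hors C W" using span_hor_in[OF r(1)] by (simp add: k_def)
    have ks: "h_from k = h_from f1 \<cdot> u1" "h_to k = h_to f1 \<cdot> u1'" "h_from f2 \<cdot> u2 = h_from f1 \<cdot> u1" "h_to f2 \<cdot> u2' = h_to f1 \<cdot> u1'"
      using kf by (auto simp: k_def span_hor_def)
    have u: "u1 \<in> W" "Cod C u1 = Dom C (h_from f1)" "u1' \<in> W" "Cod C u1' = Dom C (h_to f1)"
      "u2 \<in> W" "Cod C u2 = Dom C (h_from f2)" "u2' \<in> W" "Cod C u2' = Dom C (h_to f2)"
      using r(1,2) unfolding restriction_def by blast+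
    let ?S = "vert (h_from f1) (h_from f2)" and ?S' = "vert (h_to f1) (h_to f2)"
    \<comment> \<open>On a companion cell both sides of the naturality equation are pasted cells
      with the same companions. Horizontal naturality at \<open>k\<close> and at \<open>f\<close>
      makes their tops and bottoms equal.\<close>
    have natq: "ccomp D (amap ?A (u', h_to f)) (amap (ftr1 L) (cell k f)) = ccomp D (amap (ftr1 L') (cell k f)) (amap ?A (u, h_from f))"
      and isoq: "iso_arr (cat1 D) (ccomp D (amap ?A (u', h_to f)) (amap (ftr1 L) (cell k f)))"
      if f: "f \<in> frac_hors C W"
        and sq: "F.companion_square k f (Phi_companion C W (u, h_from f)) (Phi_companion C W (u', h_to f))"
          "F.companion_cell k f (Phi_companion C W (u, h_from f)) (Phi_companion C W (u', h_to f)) = cell k f"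
        and u: "u \<in> W" "Cod C u = Dom C (h_from f)" "u' \<in> W" "Cod C u' = Dom C (h_to f)"
        and kk: "h_from f \<cdot> u = h_from k" "h_to f \<cdot> u' = h_to k"
      for f u u'
    proof -
      note F = frac_horsD[OF f]
      note Lq = L.map_companion_square[OF sq(1)] L.map_companion_cell[OF sq(1), unfolded sq(2)]
        L'.map_companion_square[OF sq(1)] L'.map_companion_cell[OF sq(1), unfolded sq(2)]
      note Au = Acell[OF u(1) F(1) u(2), unfolded kk] Acell[OF u(3) F(2) u(4), unfolded kk]
      have 1: "ccomp D (amap ?A (u', h_to f)) (amap (ftr1 L) (cell k f))
          = D.companion_cell (hcomp D (omap \<alpha> (h_to k)) (omap (ftr1 L) k)) (hcomp D (omap \<alpha> (h_to f)) (omap (ftr1 L) f))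
            (map_companion_ftr L (Phi_companion C W (u, h_from f))) (map_companion_ftr L' (Phi_companion C W (u', h_to f)))"
        unfolding Au(3) Lq(2) by (rule D.companion_cell_hcomp[OF Lq(1) Au(4)])
      have 2: "ccomp D (amap (ftr1 L') (cell k f)) (amap ?A (u, h_from f))
          = D.companion_cell (hcomp D (omap (ftr1 L') k) (omap \<alpha> (h_from k))) (hcomp D (omap (ftr1 L') f) (omap \<alpha> (h_from f)))
            (map_companion_ftr L (Phi_companion C W (u, h_from f))) (map_companion_ftr L' (Phi_companion C W (u', h_to f)))"
        unfolding Au(1) Lq(4) by (rule D.companion_cell_hcomp[OF Au(2) Lq(3)])
      show "ccomp D (amap ?A (u', h_to f)) (amap (ftr1 L) (cell k f)) = ccomp D (amap (ftr1 L') (cell k f)) (amap ?A (u, h_from f))"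
        unfolding 1 2 hor[OF k] hor[OF f] ..
      show "iso_arr (cat1 D) (ccomp D (amap ?A (u', h_to f)) (amap (ftr1 L) (cell k f)))"
        unfolding 1 by (rule companion_cell_D_iso[OF D.companion_square_hcomp[OF Lq(1) Au(4)]])
    qed
    note n1 = natq[OF f(1) sq(1,3) u(1-4) ks(1,2)[symmetric]] and i1 = isoq[OF f(1) sq(1,3) u(1-4) ks(1,2)[symmetric]]
    note n2 = natq[OF f(2) sq(4,6) u(5-8) ks(3,4)[folded ks(1,2)]]
    have v: "vert (h_from k) (h_from f1) \<in> frac_verts C W" "vert (h_from k) (h_from f2) \<in> frac_verts C W" "?S \<in> frac_verts C W"
      "vert (h_to k) (h_to f1) \<in> frac_verts C W" "vert (h_to k) (h_to f2) \<in> frac_verts C W" "?S' \<in> frac_verts C W"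
      using linkedD(3,4)[OF sq(2)] linkedD(3,4)[OF sq(5)] linkedD(3,4)[OF l] F frac_horsD[OF k] unfolding frac_verts_iff by blast+
    have b1: "amap ?A (u1, h_from f1) = amap b (vert (h_from k) (h_from f1))" "amap ?A (u1', h_to f1) = amap b (vert (h_to k) (h_to f1))"
      "amap ?A (u2, h_from f2) = amap b (vert (h_from k) (h_from f2))" "amap ?A (u2', h_to f2) = amap b (vert (h_to k) (h_to f2))"
      using bN[OF u(1) F(1) u(2)] bN[OF u(3) F(2) u(4)] bN[OF u(5) F(6) u(6)] bN[OF u(7) F(7) u(8)] ks by simp_all
    have bc: "Cmp (cat1 D) (amap b ?S) (amap b (vert (h_from k) (h_from f1))) = amap b (vert (h_from k) (h_from f2))"
      "Cmp (cat1 D) (amap b ?S') (amap b (vert (h_to k) (h_to f1))) = amap b (vert (h_to k) (h_to f2))"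
      using b.amap_Cmp[of "vert (h_from k) (h_from f1)" ?S] b.amap_Cmp[of "vert (h_to k) (h_to f1)" ?S'] v
        linkedD(3,4)[OF sq(2)] linkedD(3,4)[OF sq(5)] linkedD(3,4)[OF l] F frac_horsD[OF k]
      by (simp_all add: Frac_simps frac_vert_comp)
    have c: "\<zeta> \<in> frac_cells C W" "cell k f1 \<in> frac_cells C W" "cell k f2 \<in> frac_cells C W"
      using l sq(2,5) z unfolding frac_cells_linked by blast+
    have zq: "frac_cell_vcomp C W \<zeta> (cell k f1) = cell k f2" unfolding z by (rule frac_cell_vcomp[OF sq(2) l])
    have Lz: "Cmp (cat1 D) (amap (ftr1 M) \<zeta>) (amap (ftr1 M) (cell k f1)) = amap (ftr1 M) (cell k f2)"
      "amap (ftr1 M) \<zeta> \<in> Arr (cat1 D)" "amap (ftr1 M) (cell k f1) \<in> Arr (cat1 D)"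
      "Dom (cat1 D) (amap (ftr1 M) \<zeta>) = omap (ftr1 M) f1" "Cod (cat1 D) (amap (ftr1 M) (cell k f1)) = omap (ftr1 M) f1"
      "amap (d0 D) (amap (ftr1 M) \<zeta>) = amap (ftr0 M) ?S" "amap (d1 D) (amap (ftr1 M) \<zeta>) = amap (ftr0 M) ?S'"
      "amap (d0 D) (amap (ftr1 M) (cell k f1)) = amap (ftr0 M) (vert (h_from k) (h_from f1))"
      "amap (d1 D) (amap (ftr1 M) (cell k f1)) = amap (ftr0 M) (vert (h_to k) (h_to f1))"
      if "strict_double_functor (Frac C W) D M" for M
    proof -
      interpret M: strict_double_functor "Frac C W" D M by (rule that)
      show "Cmp (cat1 D) (amap (ftr1 M) \<zeta>) (amap (ftr1 M) (cell k f1)) = amap (ftr1 M) (cell k f2)"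
        "amap (ftr1 M) \<zeta> \<in> Arr (cat1 D)" "amap (ftr1 M) (cell k f1) \<in> Arr (cat1 D)"
        "Dom (cat1 D) (amap (ftr1 M) \<zeta>) = omap (ftr1 M) f1" "Cod (cat1 D) (amap (ftr1 M) (cell k f1)) = omap (ftr1 M) f1"
        "amap (d0 D) (amap (ftr1 M) \<zeta>) = amap (ftr0 M) ?S" "amap (d1 D) (amap (ftr1 M) \<zeta>) = amap (ftr0 M) ?S'"
        "amap (d0 D) (amap (ftr1 M) (cell k f1)) = amap (ftr0 M) (vert (h_from k) (h_from f1))"
        "amap (d1 D) (amap (ftr1 M) (cell k f1)) = amap (ftr0 M) (vert (h_to k) (h_to f1))"
        using M.F1.amap_Cmp[of "cell k f1" \<zeta>] M.F1.ftr_simps(2-4)[of \<zeta>] M.F1.ftr_simps(2-4)[of "cell k f1"]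
          M.preserves_d0_cell[of \<zeta>] M.preserves_d1_cell[of \<zeta>] M.preserves_d0_cell[of "cell k f1"] M.preserves_d1_cell[of "cell k f1"] c zq
        by (simp_all add: Frac_simps) (simp_all add: z)
    qed
    note LZ = Lz[OF L.strict_double_functor_axioms] Lz[OF L'.strict_double_functor_axioms]
    note bs = bside[OF v(1)] bside[OF v(2)] bside[OF v(3)] bside[OF v(4)] bside[OF v(5)] bside[OF v(6)]
    have ba: "amap b S \<in> Arr (cat1 D)" "Dom (cat1 D) (amap b S) = omap b (v_from S)" "Cod (cat1 D) (amap b S) = omap b (v_to S)"
      if "S \<in> frac_verts C W" for S
      using b.amap_closed[of S] b.Dom_amap[of S] b.Cod_amap[of S] that by (simp_all add: Frac_simps)
    note ba = ba[OF v(1)] ba[OF v(2)] ba[OF v(3)] ba[OF v(4)] ba[OF v(5)] ba[OF v(6)]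
    let ?Q = "ccomp D (amap b (vert (h_to k) (h_to f1))) (amap (ftr1 L) (cell k f1))"
    have Q: "?Q = ccomp D (amap (ftr1 L') (cell k f1)) (amap b (vert (h_from k) (h_from f1)))"
      using n1 unfolding b1 .
    \<comment> \<open>Stacked under the invertible cell \<open>?Q\<close>, the naturality equation
      at \<open>\<zeta>\<close> becomes the known one at \<open>cell k f2\<close>; cancelling
      \<open>?Q\<close> gives the claim.\<close>
    have "Cmp (cat1 D) (ccomp D (amap b ?S') (amap (ftr1 L) \<zeta>)) ?Q
        = ccomp D (Cmp (cat1 D) (amap b ?S') (amap b (vert (h_to k) (h_to f1)))) (Cmp (cat1 D) (amap (ftr1 L) \<zeta>) (amap (ftr1 L) (cell k f1)))"
      by (rule D.interchange[symmetric]) (use LZ bs ba in simp_all)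
    also have "\<dots> = ccomp D (Cmp (cat1 D) (amap (ftr1 L') \<zeta>) (amap (ftr1 L') (cell k f1))) (Cmp (cat1 D) (amap b ?S) (amap b (vert (h_from k) (h_from f1))))"
      unfolding bc LZ(1) LZ(10) using n2 unfolding b1 .
    also have "\<dots> = Cmp (cat1 D) (ccomp D (amap (ftr1 L') \<zeta>) (amap b ?S)) ?Q"
      unfolding Q by (rule D.interchange) (use LZ bs ba in simp_all)
    finally have eq: "Cmp (cat1 D) (ccomp D (amap b ?S') (amap (ftr1 L) \<zeta>)) ?Q = Cmp (cat1 D) (ccomp D (amap (ftr1 L') \<zeta>) (amap b ?S)) ?Q" .
    have cQ: "Cod (cat1 D) ?Q = hcomp D (omap \<alpha> (h_to f1)) (omap (ftr1 L) f1)"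
      using LZ bs ba b0 by (simp add: D.Cod_ccomp)
    have "ccomp D (amap b ?S') (amap (ftr1 L) \<zeta>) = ccomp D (amap (ftr1 L') \<zeta>) (amap b ?S)"
      by (rule D.D0.A.iso_cancel_right[OF i1[unfolded b1] _ _ _ _ eq])
        (use LZ bs ba b0 cQ hor[OF f(1)] in \<open>simp_all add: D.Dom_ccomp D.ccomp_closed\<close>)
    then show ?thesis by (simp add: z)
  qed
  let ?b = "ftr_restrict (cat0 (Frac C W)) b"
  have bin: "?b \<in> htrans (Frac C W) D L L'"
    by (intro htrans_restrict horizontal_transformation.intro horizontal_transformation_axioms.intro
        L.strict_double_functor_axioms L'.strict_double_functor_axioms)
      (use b.ftr_simps b.amap_Cmp al nat bside in \<open>simp_all add: Frac_simps b0\<close>)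
  have 1: "htrans_whisker (H_dbl C) ?b (J_ftr C W) = a"
  proof (rule H_htrans_eqI[OF _ a])
    show "htrans_whisker (H_dbl C) ?b (J_ftr C W) \<in> htrans (H_dbl C) D (dblftr_comp (H_dbl C) L (J_ftr C W)) (dblftr_comp (H_dbl C) L' (J_ftr C W))"
      by (rule htrans_whisker_in[OF htransD[OF bin] J_ftr_strict])
    fix x assume x: "x \<in> Obj C"
    then have w: "Ide C x \<in> W" "Dom C (Ide C x) = x" by (simp_all add: C_simps)
    \<comment> \<open>At an identity object \<open>varphi\<close> is a horizontal identity, so the
      compatibility of \<open>a\<close> with \<open>\<alpha>\<close> says that their components
      there are equal.\<close>
    have v: "varphi C (Ide C x) = frac_hor_id C (Ide C x)" using x by (simp add: varphi_def frac_hor_id_def C_simps)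
    have "omap (ftr1 L) (frac_hor_id C (Ide C x)) = omap (hid D) (omap (ftr0 L) (Ide C x))"
      "omap (ftr1 L') (frac_hor_id C (Ide C x)) = omap (hid D) (omap (ftr0 L') (Ide C x))"
      using L.preserves_hid[of "Ide C x"] L'.preserves_hid[of "Ide C x"] w by (simp_all add: Frac_simps)
    then have "omap \<alpha> (Ide C x) = omap a x"
      using comm[OF w(1)] al[OF w(1)] htrans_H_sides[OF a x] x
      by (simp add: v w D.dbl_simps dblftr_comp_apply H_dbl_simps) (simp add: J_ftr_def Let_def D.dbl_simps)
    then show "omap (htrans_whisker (H_dbl C) ?b (J_ftr C W)) x = omap a x"
      using x w by (simp add: htrans_whisker_apply H_dbl_simps J_ftr_def Let_def Frac_simps b0)
  qed
  have 2: "htrans_whisker ?N (Companions_htrans L ?b L') (Phi_ftr C W) = \<alpha>"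
  proof (rule ftr_eqI[OF htrans_whisker_ext htrans_ext[OF \<alpha>]])
    fix w assume "w \<in> Obj (cat0 ?N)"
    then show "omap (htrans_whisker ?N (Companions_htrans L ?b L') (Phi_ftr C W)) w = omap \<alpha> w"
      by (simp add: V_dbl_simps Nabla_simps htrans_of_apply Frac_simps b0)
  next
    fix f assume "f \<in> Arr (cat0 ?N)"
    then obtain u w where f: "f = (u, w)" and u: "u \<in> W" "w \<in> W" "Cod C u = Dom C w"
      by (cases f) (auto simp: V_dbl_simps Nabla_simps)
    have "vert (w \<cdot> u) w \<in> frac_verts C W"
      using u CF1_comp[OF u] unfolding frac_verts_iff by (auto simp: C_simps)
    then show "amap (htrans_whisker ?N (Companions_htrans L ?b L') (Phi_ftr C W)) f = amap \<alpha> f"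
      using htrans_V_cell(1)[OF \<alpha> u] G[OF u] bN[OF u] by (simp add: f htrans_of_apply(2)[OF u] Frac_simps)
  qed
  show ?thesis using bin 1 2 by (intro bexI[of _ ?b]) (simp_all add: friendly_htrans_of_def ta)
qed

end

section \<open>Essential surjectivity\<close>

context fractions_globular
begin

lemma restriction_compose:
  assumes k: "restriction f u u' \<phi>" and r: "restriction (span_hor f u u' \<phi>) r r' \<chi>"
  shows "restriction f (u \<cdot> r) (u' \<cdot> r') \<chi>" "span_hor f (u \<cdot> r) (u' \<cdot> r') \<chi> = span_hor (span_hor f u u' \<phi>) r r' \<chi>"
proof -
  have K: "f \<in> frac_hors C W" "u \<in> W" "u' \<in> W" "\<phi> \<in> Arr C" "Cod C u = Dom C (h_from f)"
    "Cod C u' = Dom C (h_to f)" "Dom C \<phi> = Dom C u" "Cod C \<phi> = Dom C u'" "h_arr f \<cdot> u = u' \<cdot> \<phi>"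
    using k unfolding restriction_def by blast+
  note F = frac_horsD[OF K(1)]
  have R: "r \<in> W" "r' \<in> W" "\<chi> \<in> Arr C" "Cod C r = Dom C u" "Cod C r' = Dom C u'"
    "Dom C \<chi> = Dom C r" "Cod C \<chi> = Dom C r'" "\<phi> \<cdot> r = r' \<cdot> \<chi>"
    using r K F unfolding restriction_def by (auto simp: span_hor_def C_simps)
  have "h_arr f \<cdot> (u \<cdot> r) = u' \<cdot> (\<phi> \<cdot> r)" using K F R(1-7) by (simp add: Cmp_assoc C_simps)
  also have "\<dots> = u' \<cdot> r' \<cdot> \<chi>" unfolding R(8) using K(1-8) F R(1-7) by (simp add: Cmp_assoc C_simps)
  finally show "restriction f (u \<cdot> r) (u' \<cdot> r') \<chi>"
    using K(1-8) F R(1-7) by (simp add: restriction_def C_simps)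
  show "span_hor f (u \<cdot> r) (u' \<cdot> r') \<chi> = span_hor (span_hor f u u' \<phi>) r r' \<chi>"
    using K(1-8) F R(1-7) by (simp add: span_hor_def Cmp_assoc C_simps)
qed

section \<open>The lift of a friendly functor on horizontal arrows\<close>

context
  fixes G :: "('o, 'o, 'a, 'a, 'p, 'v, 'h, 'c) dblftr"
    and \<Gamma> :: "('a, 'a \<times> 'a, 'a, 'a \<times> 'a, 'p, ('v, 'h, 'c) companion, 'h,
      ('v, 'h, 'c) companion \<times> 'c \<times> ('v, 'h, 'c) companion) dblftr"
    and \<gamma> :: "'a \<Rightarrow> 'h"
  assumes P: "(G, \<Gamma>, \<gamma>) \<in> friendly_functors C W D"
begin

interpretation G: strict_double_functor "H_dbl C" D G by (rule friendly_functorsD(1)[OF P])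
interpretation \<Gamma>: strict_double_functor "V_dbl (Nabla C W)" "Companions D" \<Gamma> by (rule friendly_functorsD(2)[OF P])

abbreviation \<delta> :: "'a \<Rightarrow> 'h" where "\<delta> w \<equiv> inv_arr (hor_cat D) (\<gamma> w)"

lemma gamma:
  assumes "w \<in> W"
  shows "\<gamma> w \<in> Obj (cat1 D)" "omap (d0 D) (\<gamma> w) = omap (ftr0 \<Gamma>) w" "omap (d1 D) (\<gamma> w) = omap (ftr0 G) (Dom C w)"
    "\<delta> w \<in> Obj (cat1 D)" "omap (d0 D) (\<delta> w) = omap (ftr0 G) (Dom C w)" "omap (d1 D) (\<delta> w) = omap (ftr0 \<Gamma>) w"
    "hcomp D (\<delta> w) (\<gamma> w) = omap (hid D) (omap (ftr0 \<Gamma>) w)"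
    "hcomp D (\<gamma> w) (\<delta> w) = omap (hid D) (omap (ftr0 G) (Dom C w))"
  using friendly_functorsD(4-6)[OF P assms] HD.inv_arr[OF friendly_functorsD(3)[OF P assms]]
  by (simp_all add: hor_cat_simps)

lemma G_hor:
  "f \<in> Arr C \<Longrightarrow> omap (ftr1 G) f \<in> Obj (cat1 D)"
  "f \<in> Arr C \<Longrightarrow> omap (d0 D) (omap (ftr1 G) f) = omap (ftr0 G) (Dom C f)"
  "f \<in> Arr C \<Longrightarrow> omap (d1 D) (omap (ftr1 G) f) = omap (ftr0 G) (Cod C f)"
  "x \<in> Obj C \<Longrightarrow> omap (ftr1 G) (Ide C x) = omap (hid D) (omap (ftr0 G) x)"
  "\<lbrakk>f \<in> Arr C; g \<in> Arr C; Cod C f = Dom C g\<rbrakk> \<Longrightarrow> omap (ftr1 G) (g \<cdot> f) = hcomp D (omap (ftr1 G) g) (omap (ftr1 G) f)"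
  "x \<in> Obj C \<Longrightarrow> omap (ftr0 G) x \<in> Obj (cat0 D)"
  using G.F1.omap_closed G.preserves_d0 G.preserves_d1 G.preserves_hid G.preserves_hcomp G.F0.omap_closed
  by (simp_all add: H_dbl_simps)

lemma Gam0: "w \<in> W \<Longrightarrow> omap (ftr0 \<Gamma>) w \<in> Obj (cat0 D)"
  using \<Gamma>.F0.omap_closed[of w] by (simp add: V_dbl_simps Nabla_simps Companions_simps)

lemma Gam:
  assumes "u \<in> W" "w \<in> W" "Cod C u = Dom C w"
  shows "is_companion D (amap (ftr0 \<Gamma>) (u, w))" "Dom (cat0 D) (comp_v (amap (ftr0 \<Gamma>) (u, w))) = omap (ftr0 \<Gamma>) (w \<cdot> u)"
    "Cod (cat0 D) (comp_v (amap (ftr0 \<Gamma>) (u, w))) = omap (ftr0 \<Gamma>) w"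
  using \<Gamma>.F0.amap_closed[of "(u, w)"] \<Gamma>.F0.Dom_amap[of "(u, w)"] \<Gamma>.F0.Cod_amap[of "(u, w)"] assms
  by (simp_all add: V_dbl_simps Nabla_simps Companions_simps)

lemma Gam_comp:
  assumes "u \<in> W" "w \<in> W" "Cod C u = Dom C w" "r \<in> W" "Cod C r = Dom C u"
  shows "amap (ftr0 \<Gamma>) (u \<cdot> r, w) = companion_comp D (amap (ftr0 \<Gamma>) (u, w)) (amap (ftr0 \<Gamma>) (r, w \<cdot> u))"
  using \<Gamma>.F0.amap_Cmp[of "(r, w \<cdot> u)" "(u, w)"] assms
  by (simp add: V_dbl_simps Nabla_simps Companions_simps C_simps)

lemma Gam_Ide: "w \<in> W \<Longrightarrow> amap (ftr0 \<Gamma>) (Ide C (Dom C w), w) = companion_id D (omap (ftr0 \<Gamma>) w)"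
  using \<Gamma>.F0.amap_Ide[of w] by (simp add: V_dbl_simps Nabla_simps Companions_simps)

definition lift_hor :: "'a frac_hor \<Rightarrow> 'h" where
  "lift_hor f = hcomp D (\<delta> (h_to f)) (hcomp D (omap (ftr1 G) (h_arr f)) (\<gamma> (h_from f)))"

lemma lift_hor_sides:
  assumes "f \<in> frac_hors C W"
  shows "lift_hor f \<in> Obj (cat1 D)" "omap (d0 D) (lift_hor f) = omap (ftr0 \<Gamma>) (h_from f)"
    "omap (d1 D) (lift_hor f) = omap (ftr0 \<Gamma>) (h_to f)"
  using frac_horsD[OF assms] gamma[of "h_from f"] gamma[of "h_to f"] G_hor(1-3)[of "h_arr f"]
  by (simp_all add: lift_hor_def D.dbl_simps)

lemma lift_hor_id: "w \<in> W \<Longrightarrow> lift_hor (frac_hor_id C w) = omap (hid D) (omap (ftr0 \<Gamma>) w)"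
  using gamma[of w] by (simp add: lift_hor_def G_hor C_simps D.dbl_simps)

text \<open>The conjugation is rewritten without an inverse, as naturality of
  \<open>\<gamma>\<close> with respect to the lift. Since \<open>\<gamma>\<close> is invertible this
  characterises \<open>lift_hor\<close>, and compatibility with composition can be checked without
  expanding inverses.\<close>

lemma gamma_lift_hor:
  assumes "f \<in> frac_hors C W"
  shows "hcomp D (\<gamma> (h_to f)) (lift_hor f) = hcomp D (omap (ftr1 G) (h_arr f)) (\<gamma> (h_from f))"
proof -
  note F = frac_horsD[OF assms]
  note s = gamma[OF F(1)] gamma[OF F(2)] G_hor(1-3)[OF F(3)] F
  have "hcomp D (\<gamma> (h_to f)) (lift_hor f)
     = hcomp D (hcomp D (\<gamma> (h_to f)) (\<delta> (h_to f))) (hcomp D (omap (ftr1 G) (h_arr f)) (\<gamma> (h_from f)))"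
    unfolding lift_hor_def by (rule D.hcomp_assoc) (simp_all add: s D.dbl_simps)
  then show ?thesis by (simp add: s D.dbl_simps)
qed

lemma hor_unique:
  assumes "w \<in> W" "h \<in> Obj (cat1 D)" "k \<in> Obj (cat1 D)" "omap (d1 D) h = omap (ftr0 \<Gamma>) w" "omap (d1 D) k = omap (ftr0 \<Gamma>) w"
    "hcomp D (\<gamma> w) h = hcomp D (\<gamma> w) k"
  shows "h = k"
  by (rule HD.iso_cancel_left[OF friendly_functorsD(3)[OF P assms(1)]])
    (use assms gamma[OF assms(1)] in \<open>simp_all add: hor_cat_simps\<close>)

lemma lift_hor_comp:
  assumes f: "f \<in> frac_hors C W" and g: "g \<in> frac_hors C W" and fg: "h_from g = h_to f"
  shows "lift_hor (frac_hor_comp C g f) = hcomp D (lift_hor g) (lift_hor f)"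
proof (rule hor_unique)
  note k = hor_comp[OF f g fg]
  note F = frac_horsD[OF f] frac_horsD[OF g] fg
  note s = gamma[OF F(1)] gamma[OF F(2)] gamma[OF F(7)] G_hor(1-3)[OF F(3)] G_hor(1-3)[OF F(8)]
    lift_hor_sides[OF f] lift_hor_sides[OF g] lift_hor_sides[OF k] F
  have "hcomp D (\<gamma> (h_to g)) (hcomp D (lift_hor g) (lift_hor f)) = hcomp D (hcomp D (\<gamma> (h_to g)) (lift_hor g)) (lift_hor f)"
    by (rule D.hcomp_assoc) (simp_all add: s D.dbl_simps)
  also have "\<dots> = hcomp D (omap (ftr1 G) (h_arr g)) (hcomp D (\<gamma> (h_to f)) (lift_hor f))"
    unfolding gamma_lift_hor[OF g] unfolding fg by (rule D.hcomp_assoc[symmetric]) (simp_all add: s D.dbl_simps)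
  also have "\<dots> = hcomp D (omap (ftr1 G) (h_arr g \<cdot> h_arr f)) (\<gamma> (h_from f))"
    unfolding gamma_lift_hor[OF f] using F by (simp add: G_hor(5) s D.hcomp_assoc)
  finally show "hcomp D (\<gamma> (h_to g)) (lift_hor (frac_hor_comp C g f)) = hcomp D (\<gamma> (h_to g)) (hcomp D (lift_hor g) (lift_hor f))"
    using gamma_lift_hor[OF k] by simp
qed (use lift_hor_sides[OF f] lift_hor_sides[OF g] lift_hor_sides[OF hor_comp[OF f g fg]] frac_horsD[OF g] fg
    in \<open>simp_all add: D.dbl_simps\<close>)

text \<open>The naturality square of \<open>\<gamma>\<close> at \<open>(u, w)\<close> is the
  equation that characterises the lift of \<open>u\<close>.\<close>

lemma lift_hor_Nabla:
  assumes u: "u \<in> W" "w \<in> W" "Cod C u = Dom C w"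
  shows "lift_hor (Hor (w \<cdot> u) w u) = comp_h (amap (ftr0 \<Gamma>) (u, w))"
proof -
  have f: "Hor (w \<cdot> u) w u \<in> frac_hors C W" using u by (simp add: frac_hors_iff C_simps)
  show ?thesis
    by (rule hor_unique[OF u(2)])
      (use lift_hor_sides[OF f] D.companionD[OF Gam(1)[OF u]] Gam[OF u] gamma_lift_hor[OF f] friendly_functorsD(7)[OF P u]
        in simp_all)
qed

section \<open>The lift on vertical arrows\<close>

abbreviation comp_v_ftr :: "('a, 'a \<times> 'a, 'p, 'v) ftr" where
  "comp_v_ftr \<equiv> \<lparr>omap = omap (ftr0 \<Gamma>), amap = \<lambda>f. comp_v (amap (ftr0 \<Gamma>) f)\<rparr>"

definition lift_vert :: "('a, 'a frac_vert, 'p, 'v) ftr" where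
  "lift_vert = vert_extension (cat0 D) comp_v_ftr"

lemma comp_v_functor:
  "cat_functor (Nabla C W) (cat0 D) comp_v_ftr"
proof (intro cat_functor.intro cat_functor_axioms.intro N.category_axioms D.D0.B.category_axioms)
  fix f assume f: "f \<in> Arr (Nabla C W)"
  obtain u w where u: "f = (u, w)" "u \<in> W" "w \<in> W" "Cod C u = Dom C w" using f by (cases f) (auto simp: Nabla_simps)
  note g = Gam[OF u(2-4)] D.companionD(2)[OF Gam(1)[OF u(2-4)]]
  show "amap comp_v_ftr f \<in> Arr (cat0 D)"
    "Dom (cat0 D) (amap comp_v_ftr f)
      = omap comp_v_ftr (Dom (Nabla C W) f)"
    "Cod (cat0 D) (amap comp_v_ftr f)
      = omap comp_v_ftr (Cod (Nabla C W) f)"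
    by (simp_all add: u(1) g Nabla_simps)
  fix g assume "g \<in> Arr (Nabla C W)" "Cod (Nabla C W) f = Dom (Nabla C W) g"
  then show "amap comp_v_ftr (Cmp (Nabla C W) g f)
      = Cmp (cat0 D) (amap comp_v_ftr g)
         (amap comp_v_ftr f)"
    using \<Gamma>.F0.amap_Cmp[of f g] f by (simp add: V_dbl_simps Companions_simps D.companion_comp_simps)
next
  fix w assume "w \<in> Obj (Nabla C W)"
  then show "amap comp_v_ftr (Ide (Nabla C W) w)
      = Ide (cat0 D) (omap comp_v_ftr w)"
    by (simp add: Nabla_simps Gam_Ide D.companion_comp_simps)
qed (simp add: Nabla_simps Gam0)

lemma comp_v_iso: "f \<in> Arr (Nabla C W) \<Longrightarrow>
    iso_arr (cat0 D) (amap comp_v_ftr f)"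
  by (rule vert_iso) (rule cat_functor.amap_closed[OF comp_v_functor])

lemma lift_vert_functor: "cat_functor (cat0 (Frac C W)) (cat0 D) lift_vert"
  unfolding lift_vert_def by (rule vert_extension_functor[OF comp_v_functor comp_v_iso])

lemma lift_vert_omap: "omap lift_vert w = omap (ftr0 \<Gamma>) w"
  by (simp add: lift_vert_def vert_extension_def)

lemma lift_vert_eq:
  "\<lbrakk>w1 \<in> W; w2 \<in> W; (u1, u2) \<in> spans C W w1 w2\<rbrakk> \<Longrightarrow> amap lift_vert (vert w1 w2)
    = Cmp (cat0 D) (comp_v (amap (ftr0 \<Gamma>) (u2, w2))) (inv_arr (cat0 D) (comp_v (amap (ftr0 \<Gamma>) (u1, w1))))"
  using vert_extension_eq[OF comp_v_functor comp_v_iso] by (simp add: lift_vert_def)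

lemma lift_vert_Nabla:
  "\<lbrakk>u \<in> W; w \<in> W; Cod C u = Dom C w\<rbrakk> \<Longrightarrow> amap lift_vert (vert (w \<cdot> u) w) = comp_v (amap (ftr0 \<Gamma>) (u, w))"
  using vert_extension_Nabla[OF comp_v_functor comp_v_iso] by (simp add: lift_vert_def)

section \<open>The lift on cells, as a quotient of prescribed companion cells\<close>

definition quad :: "'a frac_hor \<Rightarrow> 'a \<Rightarrow> 'a \<Rightarrow> 'a \<Rightarrow> 'c" where
  "quad f u u' \<phi> = D.companion_cell (lift_hor (span_hor f u u' \<phi>)) (lift_hor f)
     (amap (ftr0 \<Gamma>) (u, h_from f)) (amap (ftr0 \<Gamma>) (u', h_to f))"

text \<open>The corresponding square commutes among the horizontal arrows of
  \<open>Frac C W\<close>, and \<open>lift_hor\<close> preserves composition. The pasted cell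
  \<open>quad\<close> on it is the value that a lift extending \<open>\<Gamma>\<close> must take on
  the companion cell from the restricted arrow to \<open>f\<close>.\<close>

lemma quad_square:
  assumes r: "restriction f u u' \<phi>"
  shows "D.companion_square (lift_hor (span_hor f u u' \<phi>)) (lift_hor f)
     (amap (ftr0 \<Gamma>) (u, h_from f)) (amap (ftr0 \<Gamma>) (u', h_to f))"
proof -
  have R: "f \<in> frac_hors C W" "u \<in> W" "u' \<in> W" "\<phi> \<in> Arr C" "Cod C u = Dom C (h_from f)"
    "Cod C u' = Dom C (h_to f)" "Dom C \<phi> = Dom C u" "Cod C \<phi> = Dom C u'" "h_arr f \<cdot> u = u' \<cdot> \<phi>"
    using r unfolding restriction_def by blast+
  note F = frac_horsD[OF R(1)]
  note k = span_hor_in[OF r]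
  have h: "Hor (h_from f \<cdot> u) (h_from f) u \<in> frac_hors C W" "Hor (h_to f \<cdot> u') (h_to f) u' \<in> frac_hors C W"
    using R(1-8) F by (simp_all add: frac_hors_iff C_simps)
  have ks: "h_from (span_hor f u u' \<phi>) = h_from f \<cdot> u" "h_to (span_hor f u u' \<phi>) = h_to f \<cdot> u'" by (simp_all add: span_hor_def)
  have e: "frac_hor_comp C (Hor (h_to f \<cdot> u') (h_to f) u') (span_hor f u u' \<phi>) = frac_hor_comp C f (Hor (h_from f \<cdot> u) (h_from f) u)"
    using R(9) by (simp add: frac_hor_comp_def span_hor_def)
  have "hcomp D (comp_h (amap (ftr0 \<Gamma>) (u', h_to f))) (lift_hor (span_hor f u u' \<phi>))
     = hcomp D (lift_hor f) (comp_h (amap (ftr0 \<Gamma>) (u, h_from f)))"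
    using lift_hor_comp[OF k h(2)] lift_hor_comp[OF h(1) R(1)] e
    by (simp add: ks lift_hor_Nabla[OF R(2) F(1) R(5)] lift_hor_Nabla[OF R(3) F(2) R(6)])
  then show ?thesis
    using Gam[OF R(2) F(1) R(5)] Gam[OF R(3) F(2) R(6)] lift_hor_sides[OF k] lift_hor_sides[OF R(1)]
    by (simp add: D.companion_square_def ks)
qed

lemma quad:
  assumes "restriction f u u' \<phi>"
  shows "quad f u u' \<phi> \<in> Arr (cat1 D)" "Dom (cat1 D) (quad f u u' \<phi>) = lift_hor (span_hor f u u' \<phi>)"
    "Cod (cat1 D) (quad f u u' \<phi>) = lift_hor f" "amap (d0 D) (quad f u u' \<phi>) = comp_v (amap (ftr0 \<Gamma>) (u, h_from f))"
    "amap (d1 D) (quad f u u' \<phi>) = comp_v (amap (ftr0 \<Gamma>) (u', h_to f))" "iso_arr (cat1 D) (quad f u u' \<phi>)"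
  using D.companion_cell_sides[OF quad_square[OF assms]] companion_cell_D_iso[OF quad_square[OF assms]]
  by (simp_all add: quad_def)

text \<open>\<open>\<Gamma>\<close> turns composition of legs into composition of companions, so
  restricting in two steps stacks the two pasted cells vertically.\<close>

lemma quad_refine:
  assumes k: "restriction f u u' \<phi>" and r: "restriction (span_hor f u u' \<phi>) r r' \<chi>"
  shows "quad f (u \<cdot> r) (u' \<cdot> r') \<chi> = Cmp (cat1 D) (quad f u u' \<phi>) (quad (span_hor f u u' \<phi>) r r' \<chi>)"
proof -
  have K: "f \<in> frac_hors C W" "u \<in> W" "u' \<in> W" "Cod C u = Dom C (h_from f)" "Cod C u' = Dom C (h_to f)"
    using k unfolding restriction_def by blast+
  note F = frac_horsD[OF K(1)]
  have ks: "h_from (span_hor f u u' \<phi>) = h_from f \<cdot> u" "h_to (span_hor f u u' \<phi>) = h_to f \<cdot> u'" by (simp_all add: span_hor_def)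
  have x: "h_from f \<cdot> u \<in> W" "h_to f \<cdot> u' \<in> W" "Dom C (h_from f \<cdot> u) = Dom C u" "Dom C (h_to f \<cdot> u') = Dom C u'"
    using K F by (simp_all add: C_simps)
  have R: "r \<in> W" "r' \<in> W" "Cod C r = Dom C u" "Cod C r' = Dom C u'"
    using r x unfolding restriction_def ks by simp_all
  note g = Gam[OF K(2) F(1) K(4)] Gam[OF K(3) F(2) K(5)] Gam[OF R(1) x(1)] Gam[OF R(2) x(2)]
  show ?thesis
    unfolding quad_def restriction_compose(2)[OF k r] Gam_comp[OF K(2) F(1) K(4) R(1,3)] Gam_comp[OF K(3) F(2) K(5) R(2,4)]
    using D.companion_cell_vcomp[OF quad_square[OF r] quad_square[OF k]] g R x by (simp add: ks)
qed

definition quotient :: "'a frac_hor \<Rightarrow> 'a frac_hor \<Rightarrow> 'a cell_rep \<Rightarrow> 'c" where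
  "quotient f1 f2 = (\<lambda>((u1, u2), \<phi>, (u1', u2')). Cmp (cat1 D) (quad f2 u2 u2' \<phi>) (inv_arr (cat1 D) (quad f1 u1 u1' \<phi>)))"

text \<open>The numerator and the denominator acquire the same right factor, the companion cell of
  the further restriction, and this factor is invertible.\<close>

lemma quotient_refine:
  assumes f: "f1 \<in> frac_hors C W" "f2 \<in> frac_hors C W" and x: "((u1, u2), \<phi>, (u1', u2')) \<in> reps f1 f2"
    and r: "r \<in> Arr C" "r' \<in> Arr C" "\<chi> \<in> Arr C" "Cod C r = Dom C u1" "Cod C r' = Dom C u1'" "Dom C \<chi> = Dom C r" "Cod C \<chi> = Dom C r'"
      "\<phi> \<cdot> r = r' \<cdot> \<chi>" "h_from f1 \<cdot> (u1 \<cdot> r) \<in> W" "h_to f1 \<cdot> (u1' \<cdot> r') \<in> W"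
  shows "quotient f1 f2 ((u1 \<cdot> r, u2 \<cdot> r), \<chi>, (u1' \<cdot> r', u2' \<cdot> r')) = quotient f1 f2 ((u1, u2), \<phi>, (u1', u2'))"
proof -
  note k = reps_restriction[OF f x]
  let ?k = "span_hor f1 u1 u1' \<phi>"
  note F = frac_horsD[OF f(1)] frac_horsD[OF f(2)]
  have R: "u1 \<in> W" "u1' \<in> W" "\<phi> \<in> Arr C" "Cod C u1 = Dom C (h_from f1)"
    "Cod C u1' = Dom C (h_to f1)" "Dom C \<phi> = Dom C u1" "Cod C \<phi> = Dom C u1'"
    using k(1) unfolding restriction_def by blast+
  \<comment> \<open>The arrows that witness equivalence of representatives are only known to have
    composites in \<open>W\<close>; the 2-out-of-3 property puts them into \<open>W\<close>
    themselves.\<close>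
  have W: "r \<in> W" "r' \<in> W"
    using W_cancel_left[of "h_from f1 \<cdot> u1" r] W_cancel_left[of "h_to f1 \<cdot> u1'" r'] R F r
    by (simp_all add: C_simps Cmp_assoc)
  have rr: "restriction ?k r r' \<chi>"
    using r W span_hor_in[OF k(1)] R F by (simp add: restriction_def) (simp add: span_hor_def C_simps)
  have q: "quad f1 (u1 \<cdot> r) (u1' \<cdot> r') \<chi> = Cmp (cat1 D) (quad f1 u1 u1' \<phi>) (quad ?k r r' \<chi>)"
    "quad f2 (u2 \<cdot> r) (u2' \<cdot> r') \<chi> = Cmp (cat1 D) (quad f2 u2 u2' \<phi>) (quad ?k r r' \<chi>)"
    using quad_refine[OF k(1) rr] quad_refine[OF k(2), unfolded k(3), OF rr] by simp_all
  show ?thesis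
    unfolding quotient_def prod.case q
    by (rule D.D0.A.Cmp_inv_refine) (use quad[OF k(1)] quad[OF k(2)] quad[OF rr] k(3) in simp_all)
qed

text \<open>The equivalence of two representatives supplies a refinement common to both, with the
  connecting arrow \<open>\<chi>\<close> as its representative, and neither quotient changes under
  refinement.\<close>

lemma quotient_well_defined:
  assumes f: "f1 \<in> frac_hors C W" "f2 \<in> frac_hors C W" and x: "x \<in> reps f1 f2" and y: "y \<in> reps f1 f2"
  shows "quotient f1 f2 x = quotient f1 f2 y"
proof -
  obtain u1 u2 \<phi> u1' u2' where xe: "x = ((u1, u2), \<phi>, (u1', u2'))" by (metis surj_pair)
  obtain v1 v2 \<psi> v1' v2' where ye: "y = ((v1, v2), \<psi>, (v1', v2'))" by (metis surj_pair)
  have "(x, y) \<in> cell_rel C W f1 f2 (vert (h_from f1) (h_from f2)) (vert (h_to f1) (h_to f2))"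
    using cell_rel_image[OF f, of x] x y by auto
  then obtain r s r' s' \<chi> where
    a: "r \<in> Arr C" "s \<in> Arr C" "r' \<in> Arr C" "s' \<in> Arr C" "\<chi> \<in> Arr C" and
    e: "Dom C s = Dom C r" "Cod C r = Dom C u1" "Cod C s = Dom C v1" "Dom C s' = Dom C r'" "Cod C r' = Dom C u1'"
      "Cod C s' = Dom C v1'" "Dom C \<chi> = Dom C r" "Cod C \<chi> = Dom C r'" "\<phi> \<cdot> r = r' \<cdot> \<chi>" "\<psi> \<cdot> s = s' \<cdot> \<chi>"
      "u1 \<cdot> r = v1 \<cdot> s" "u2 \<cdot> r = v2 \<cdot> s" "u1' \<cdot> r' = v1' \<cdot> s'" "u2' \<cdot> r' = v2' \<cdot> s'"
      "h_from f1 \<cdot> (u1 \<cdot> r) \<in> W" "h_to f1 \<cdot> (u1' \<cdot> r') \<in> W"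
    unfolding cell_rel_def xe ye mem_Collect_eq case_prod_conv vert_sel by blast
  have "quotient f1 f2 ((u1 \<cdot> r, u2 \<cdot> r), \<chi>, (u1' \<cdot> r', u2' \<cdot> r')) = quotient f1 f2 x"
    unfolding xe using quotient_refine[OF f x[unfolded xe] a(1,3,5) e(2,5,7,8,9,15,16)] .
  moreover have "quotient f1 f2 ((v1 \<cdot> s, v2 \<cdot> s), \<chi>, (v1' \<cdot> s', v2' \<cdot> s')) = quotient f1 f2 y"
    unfolding ye using quotient_refine[OF f y[unfolded ye] a(2,4,5) e(3,6)] e a by simp
  ultimately show ?thesis using e(11-14) by simp
qed

lemma quotient_sides:
  assumes f: "f1 \<in> frac_hors C W" "f2 \<in> frac_hors C W" and x: "x \<in> reps f1 f2"
  shows "quotient f1 f2 x \<in> Arr (cat1 D)" "Dom (cat1 D) (quotient f1 f2 x) = lift_hor f1"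
    "Cod (cat1 D) (quotient f1 f2 x) = lift_hor f2"
    "amap (d0 D) (quotient f1 f2 x) = amap lift_vert (vert (h_from f1) (h_from f2))"
    "amap (d1 D) (quotient f1 f2 x) = amap lift_vert (vert (h_to f1) (h_to f2))"
proof -
  obtain u1 u2 \<phi> u1' u2' where xe: "x = ((u1, u2), \<phi>, (u1', u2'))" by (metis surj_pair)
  note k = reps_restriction[OF f x[unfolded xe]]
  note q = quad[OF k(1)] quad[OF k(2)] k(3)
  note i = D.D0.A.inv_arr[OF q(6)]
  show "quotient f1 f2 x \<in> Arr (cat1 D)" "Dom (cat1 D) (quotient f1 f2 x) = lift_hor f1"
    "Cod (cat1 D) (quotient f1 f2 x) = lift_hor f2"
    using q i by (simp_all add: xe quotient_def D.D0.A.cat_simps)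
  note F = frac_horsD[OF f(1)] frac_horsD[OF f(2)]
  show "amap (d0 D) (quotient f1 f2 x) = amap lift_vert (vert (h_from f1) (h_from f2))"
    "amap (d1 D) (quotient f1 f2 x) = amap lift_vert (vert (h_to f1) (h_to f2))"
    using q i by (simp_all add: xe quotient_def D.D0.amap_Cmp D.D1.amap_Cmp D.D0.amap_inv D.D1.amap_inv
        lift_vert_eq[OF F(1,6) k(4)] lift_vert_eq[OF F(2,7) k(5)])
qed

definition lift_cell :: "'a frac_cell \<Rightarrow> 'c" where
  "lift_cell \<zeta> = quotient (c_top \<zeta>) (c_bot \<zeta>) (SOME x. x \<in> c_class \<zeta>)"

lemma lift_cell_eq:
  assumes "f1 \<in> frac_hors C W" "f2 \<in> frac_hors C W" "x \<in> reps f1 f2"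
  shows "lift_cell (cell f1 f2) = quotient f1 f2 x"
  unfolding lift_cell_def cell_sel by (rule quotient_well_defined[OF assms(1,2) someI assms(3)]) (rule assms(3))

lemma lift_cell_sides:
  assumes "linked f1 f2"
  shows "lift_cell (cell f1 f2) \<in> Arr (cat1 D)" "Dom (cat1 D) (lift_cell (cell f1 f2)) = lift_hor f1"
    "Cod (cat1 D) (lift_cell (cell f1 f2)) = lift_hor f2"
    "amap (d0 D) (lift_cell (cell f1 f2)) = amap lift_vert (vert (h_from f1) (h_from f2))"
    "amap (d1 D) (lift_cell (cell f1 f2)) = amap lift_vert (vert (h_to f1) (h_to f2))"
proof -
  obtain x where x: "x \<in> reps f1 f2" using assms unfolding linked_def by blast
  show "lift_cell (cell f1 f2) \<in> Arr (cat1 D)" "Dom (cat1 D) (lift_cell (cell f1 f2)) = lift_hor f1"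
    "Cod (cat1 D) (lift_cell (cell f1 f2)) = lift_hor f2"
    "amap (d0 D) (lift_cell (cell f1 f2)) = amap lift_vert (vert (h_from f1) (h_from f2))"
    "amap (d1 D) (lift_cell (cell f1 f2)) = amap lift_vert (vert (h_to f1) (h_to f2))"
    unfolding lift_cell_eq[OF linkedD(1,2)[OF assms] x] by (rule quotient_sides[OF linkedD(1,2)[OF assms] x])+
qed

text \<open>For aligned representatives the companion cell of the middle arrow is the denominator of
  one quotient and the numerator of the other, so it cancels.\<close>

lemma lift_cell_vcomp:
  assumes l: "linked f1 f2" "linked f2 f3"
  shows "lift_cell (cell f1 f3) = Cmp (cat1 D) (lift_cell (cell f2 f3)) (lift_cell (cell f1 f2))"
proof -
  note f = linkedD(1,2)[OF l(1)] linkedD(2)[OF l(2)]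
  obtain x y where xy: "x \<in> reps f1 f2" "y \<in> reps f2 f3" using l unfolding linked_def by blast
  obtain p1 p2 p3 \<xi> q1 q2 q3 where r: "((p1, p2), \<xi>, (q1, q2)) \<in> reps f1 f2" "((p2, p3), \<xi>, (q2, q3)) \<in> reps f2 f3"
    "((p1, p3), \<xi>, (q1, q3)) \<in> reps f1 f3"
    by (rule reps_vcomp[OF f xy])
  note k = reps_restriction[OF f(1,2) r(1)] reps_restriction[OF f(2,3) r(2)]
  note q = quad[OF k(1)] quad[OF k(2)] quad[OF k(7)] k(3,8)
  note i = D.D0.A.inv_arr[OF q(6)] D.D0.A.inv_arr[OF q(12)]
  let ?C = "Cmp (cat1 D)" and ?i = "inv_arr (cat1 D)"
  have "?C (?C (quad f3 p3 q3 \<xi>) (?i (quad f2 p2 q2 \<xi>))) (?C (quad f2 p2 q2 \<xi>) (?i (quad f1 p1 q1 \<xi>)))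
    = ?C (?C (?C (quad f3 p3 q3 \<xi>) (?i (quad f2 p2 q2 \<xi>))) (quad f2 p2 q2 \<xi>)) (?i (quad f1 p1 q1 \<xi>))"
    by (rule D.D0.A.Cmp_assoc) (use q i in \<open>simp_all add: D.D0.A.cat_simps\<close>)
  also have "\<dots> = ?C (quad f3 p3 q3 \<xi>) (?i (quad f1 p1 q1 \<xi>))"
    by (subst D.D0.A.Cmp_inv_cancel'[OF q(12)]) (use q in simp_all)
  finally show ?thesis
    unfolding lift_cell_eq[OF f(1,2) r(1)] lift_cell_eq[OF f(2,3) r(2)] lift_cell_eq[OF f(1,3) r(3)] quotient_def prod.case ..
qed

text \<open>Over a common middle span the companion cells compose horizontally, and so do their
  inverses. Interchange then separates the product into the two quotients.\<close>

lemma lift_cell_hcomp: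
  assumes l: "linked f1 f2" "linked g1 g2" and fg: "h_from g1 = h_to f1" "h_from g2 = h_to f2"
  shows "lift_cell (cell (frac_hor_comp C g1 f1) (frac_hor_comp C g2 f2)) = ccomp D (lift_cell (cell g1 g2)) (lift_cell (cell f1 f2))"
proof -
  note f = linkedD(1,2)[OF l(1)] and g = linkedD(1,2)[OF l(2)]
  have h: "frac_hor_comp C g1 f1 \<in> frac_hors C W" "frac_hor_comp C g2 f2 \<in> frac_hors C W"
    using f g fg by (simp_all add: hor_comp)
  obtain x y where xy: "x \<in> reps f1 f2" "y \<in> reps g1 g2" using l unfolding linked_def by blast
  obtain u \<phi> p \<psi> v where r: "(u, \<phi>, p) \<in> reps f1 f2" "(p, \<psi>, v) \<in> reps g1 g2"
    "(u, \<psi> \<cdot> \<phi>, v) \<in> reps (frac_hor_comp C g1 f1) (frac_hor_comp C g2 f2)"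
    by (rule reps_hcomp[OF f g fg xy])
  obtain u1 u2 p1 p2 v1 v2 where p: "u = (u1, u2)" "p = (p1, p2)" "v = (v1, v2)" by fastforce
  note r = r[unfolded p]
  note k = reps_restriction[OF f r(1)] and m = reps_restriction[OF g r(2)] and n = reps_restriction[OF h r(3)]
  have qq: "quad (frac_hor_comp C g f) u v (\<psi> \<cdot> \<phi>) = ccomp D (quad g p v \<psi>) (quad f u p \<phi>)"
    if f: "restriction f u p \<phi>" and g: "restriction g p v \<psi>" and fg: "h_from g = h_to f" for f g u p v
  proof -
    note S = quad_square[OF f] quad_square[OF g, unfolded fg]
    have fg': "f \<in> frac_hors C W" "g \<in> frac_hors C W" using f g unfolding restriction_def by blast+
    have "span_hor (frac_hor_comp C g f) u v (\<psi> \<cdot> \<phi>) = frac_hor_comp C (span_hor g p v \<psi>) (span_hor f u p \<phi>)"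
      by (simp add: span_hor_def frac_hor_comp_def)
    then have "lift_hor (span_hor (frac_hor_comp C g f) u v (\<psi> \<cdot> \<phi>)) = hcomp D (lift_hor (span_hor g p v \<psi>)) (lift_hor (span_hor f u p \<phi>))"
      using lift_hor_comp[OF span_hor_in[OF f] span_hor_in[OF g]] fg by (simp add: span_hor_def)
    then show ?thesis
      using D.companion_cell_hcomp[OF S] lift_hor_comp[OF fg' fg] by (simp add: quad_def fg)
  qed
  note q = quad[OF k(1)] quad[OF k(2)] quad[OF m(1)] quad[OF m(2)] k(3) m(3) fg
  note i = D.D0.A.inv_arr[OF q(6)] D.D0.A.inv_arr[OF q(18)]
  let ?C = "Cmp (cat1 D)" and ?i = "inv_arr (cat1 D)"
  have "?C (ccomp D (quad g2 p2 v2 \<psi>) (quad f2 u2 p2 \<phi>)) (?i (ccomp D (quad g1 p1 v1 \<psi>) (quad f1 u1 p1 \<phi>)))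
    = ?C (ccomp D (quad g2 p2 v2 \<psi>) (quad f2 u2 p2 \<phi>)) (ccomp D (?i (quad g1 p1 v1 \<psi>)) (?i (quad f1 u1 p1 \<phi>)))"
    by (subst D.ccomp_iso(2)) (use q in simp_all)
  also have "\<dots> = ccomp D (?C (quad g2 p2 v2 \<psi>) (?i (quad g1 p1 v1 \<psi>))) (?C (quad f2 u2 p2 \<phi>) (?i (quad f1 u1 p1 \<phi>)))"
    by (rule D.interchange[symmetric]) (use q i in \<open>simp_all add: D.D0.amap_inv D.D1.amap_inv\<close>)
  finally show ?thesis
    unfolding lift_cell_eq[OF f r(1)] lift_cell_eq[OF g r(2)] lift_cell_eq[OF h r(3)] quotient_def prod.case
      qq[OF k(1) m(1) fg(1)] qq[OF k(2) m(2) fg(2)] .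
qed

lemma lift_cell_vid:
  assumes f: "f \<in> frac_hors C W"
  shows "lift_cell (cell f f) = Ide (cat1 D) (lift_hor f)"
proof -
  note k = reps_restriction[OF f f reps_vid[OF f]]
  show ?thesis
    using D.D0.A.inv_arr[OF quad(6)[OF k(1)]] quad[OF k(1)]
    by (simp add: lift_cell_eq[OF f f reps_vid[OF f]] quotient_def)
qed

lemma quad_hid:
  assumes "w \<in> W" "u \<in> W" "Cod C u = Dom C w"
  shows "quad (frac_hor_id C w) u u (Ide C (Dom C u)) = amap (hid D) (comp_v (amap (ftr0 \<Gamma>) (u, w)))"
proof -
  have "span_hor (frac_hor_id C w) u u (Ide C (Dom C u)) = frac_hor_id C (w \<cdot> u)"
    using assms by (simp add: span_hor_def frac_hor_id_def C_simps)
  then show ?thesis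
    using D.companion_cell_hid[OF Gam(1)] Gam assms CF1_comp by (simp add: quad_def lift_hor_id)
qed

text \<open>For the representative by an identity arrow both companion cells are horizontal
  identities. As \<open>hid\<close> is a functor, it carries the quotient of vertical arrows to the
  quotient of these cells.\<close>

lemma lift_cell_hid:
  assumes w: "w1 \<in> W" "w2 \<in> W" "Cod C w1 = Cod C w2"
  shows "lift_cell (cell (frac_hor_id C w1) (frac_hor_id C w2)) = amap (hid D) (amap lift_vert (vert w1 w2))"
proof -
  obtain u1 u2 where u: "(u1, u2) \<in> spans C W w1 w2" using span_exists w by blast
  have U: "u1 \<in> W" "u2 \<in> W" "Cod C u1 = Dom C w1" "Cod C u2 = Dom C w2" "Dom C u2 = Dom C u1" "w2 \<cdot> u2 = w1 \<cdot> u1"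
    using u unfolding spans_iff[OF w(1,2)] by metis+
  note g = Gam[OF U(1) w(1) U(3)] Gam[OF U(2) w(2) U(4)]
  note v = D.companionD(2)[OF g(1)] D.companionD(2)[OF g(4)]
  note i = vert_iso[OF v(1)]
  have q: "quad (frac_hor_id C w1) u1 u1 (Ide C (Dom C u1)) = amap (hid D) (comp_v (amap (ftr0 \<Gamma>) (u1, w1)))"
    "quad (frac_hor_id C w2) u2 u2 (Ide C (Dom C u1)) = amap (hid D) (comp_v (amap (ftr0 \<Gamma>) (u2, w2)))"
    using quad_hid[OF w(1) U(1,3)] quad_hid[OF w(2) U(2,4)] U(5) by simp_all
  have "lift_cell (cell (frac_hor_id C w1) (frac_hor_id C w2))
    = Cmp (cat1 D) (amap (hid D) (comp_v (amap (ftr0 \<Gamma>) (u2, w2)))) (inv_arr (cat1 D) (amap (hid D) (comp_v (amap (ftr0 \<Gamma>) (u1, w1)))))"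
    using lift_cell_eq[OF frac_hor_id[OF w(1)] frac_hor_id[OF w(2)] reps_hid[OF w(1,2) u]] by (simp add: quotient_def q)
  also have "\<dots> = amap (hid D) (amap lift_vert (vert w1 w2))"
    using D.D0.B.inv_arr[OF i] g v U(6) by (simp add: lift_vert_eq[OF w(1,2) u] D.HI.amap_Cmp D.HI.amap_inv[OF i])
  finally show ?thesis .
qed

section \<open>The lifted double functor and its comparison with the given friendly functor\<close>

definition lift_ftr :: "('a, 'a frac_vert, 'a frac_hor, 'a frac_cell, 'p, 'v, 'h, 'c) dblftr" where
  "lift_ftr = \<lparr>ftr0 = lift_vert, ftr1 = \<lparr>omap = lift_hor, amap = lift_cell\<rparr>\<rparr>"

lemma lift_ftr_strict: "strict_double_functor (Frac C W) D lift_ftr"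
proof -
  have 1: "cat_functor (cat1 (Frac C W)) (cat1 D) \<lparr>omap = lift_hor, amap = lift_cell\<rparr>"
    by (intro cat_functor.intro cat_functor_axioms.intro F.D0.A.category_axioms D.D0.A.category_axioms)
      (auto simp: Frac_simps frac_cells_linked lift_hor_sides lift_cell_sides frac_cell_vid lift_cell_vid
        frac_cell_vcomp lift_cell_vcomp)
  show ?thesis
    by (intro strict_double_functor.intro strict_double_functor_axioms.intro F.double_category_axioms D.double_category_axioms)
      (auto simp: lift_ftr_def 1 lift_vert_functor Frac_simps frac_cells_linked lift_hor_sides lift_cell_sides lift_vert_omap
        frac_verts_iff frac_cell_hid lift_cell_hid frac_cell_hcomp lift_cell_hcomp lift_hor_id lift_hor_comp)
qed

text \<open>The agreement with \<open>\<Gamma>\<close> has to be strict, binding cells included,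
  because the identity transformation is to serve as the second component of the isomorphism of
  friendly functors.\<close>

lemma lift_map_companion:
  assumes u: "u \<in> W" "w \<in> W" "Cod C u = Dom C w"
  shows "map_companion_ftr lift_ftr (Phi_companion C W (u, w)) = amap (ftr0 \<Gamma>) (u, w)"
proof (rule companion.expand, intro conjI)
  interpret L: strict_double_functor "Frac C W" D lift_ftr by (rule lift_ftr_strict)
  note Ph = Phi_companion[OF u]
  let ?h = "Hor (w \<cdot> u) w u"
  note g = Gam[OF u] D.companionD[OF Gam(1)[OF u]]
  have wu: "w \<cdot> u \<in> W" "Dom C (w \<cdot> u) = Dom C u" using u by (simp_all add: C_simps)
  note k = frac_hor_id[OF wu(1)] frac_hor_id[OF u(2)]
  let ?i = "Ide C (Dom C u)" and ?j = "Ide C (Dom C w)"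
  have i: "?i \<in> W" "Cod C ?i = Dom C u" "Dom C ?i = Dom C u" "?i \<in> Arr C" "?j \<in> W" "Cod C ?j = Dom C w" "Dom C ?j = Dom C w"
    using u by (simp_all add: C_simps)
  have p: "((?i, ?i), ?i, (?i, u)) \<in> reps (frac_hor_id C (w \<cdot> u)) ?h" "((?i, u), u, (?j, ?j)) \<in> reps ?h (frac_hor_id C w)"
    using u by (simp_all add: reps_iff[OF k(1) Ph(2)] reps_iff[OF Ph(2) k(2)]) (simp_all add: C_simps)
  note r = reps_restriction[OF k(1) Ph(2) p(1)] and t = reps_restriction[OF Ph(2) k(2) p(2)]
  \<comment> \<open>The denominator of the quotient for \<open>\<psi>\<close> is an identity cell;
    its numerator will be \<open>\<psi>\<close> itself, presented as a pasted cell with an identity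
    companion on the left.\<close>
  have q: "quad (frac_hor_id C (w \<cdot> u)) ?i ?i ?i = Ide (cat1 D) (omap (hid D) (omap (ftr0 \<Gamma>) (w \<cdot> u)))"
    using quad_hid[OF wu(1) i(1)] i wu Gam_Ide[OF wu(1)] Gam0[OF wu(1)]
    by (simp add: D.companion_comp_simps D.HI.amap_Ide)
  have "span_hor ?h ?i u ?i = frac_hor_id C (w \<cdot> u)"
    using u i wu by (simp add: span_hor_def frac_hor_id_def C_simps)
  then have q2: "quad ?h ?i u ?i = comp_psi (amap (ftr0 \<Gamma>) (u, w))"
    using D.companion_cell_id_left(1)[OF g(1)] Gam_Ide[OF wu(1)] wu g
    by (simp add: quad_def lift_hor_id lift_hor_Nabla[OF u])
  have "lift_cell (cell (frac_hor_id C (w \<cdot> u)) ?h) = comp_psi (amap (ftr0 \<Gamma>) (u, w))"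
    using g Gam0[OF wu(1)] by (simp add: lift_cell_eq[OF k(1) Ph(2) p(1)] quotient_def q q2 D.D0.A.inv_arr_Ide D.dbl_simps)
  then show "comp_psi (map_companion_ftr lift_ftr (Phi_companion C W (u, w))) = comp_psi (amap (ftr0 \<Gamma>) (u, w))"
    by (simp add: L.map_companion_sel Ph(1)) (simp add: lift_ftr_def)
  have "lift_cell (cell ?h (frac_hor_id C w)) = comp_chi (amap (ftr0 \<Gamma>) (u, w))"
  proof -
    have vs: "((?i, ?i), u, (?j, ?j)) \<in> reps ?h ?h"
      using reps_vid[OF Ph(2)] wu by simp
    note z = reps_restriction[OF Ph(2) Ph(2) vs]
    have "span_hor ?h ?i ?j u = ?h" using u wu by (simp add: span_hor_def C_simps)
    \<comment> \<open>The denominator for \<open>\<chi>\<close> restricts \<open>?h\<close> along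
      identity legs, so its companion cell is an identity and only the numerator remains.\<close>
    then have one: "quad ?h ?i ?j u = Ide (cat1 D) (comp_h (amap (ftr0 \<Gamma>) (u, w)))"
      using D.companion_cell_Ide[OF g(4)] Gam_Ide[OF wu(1)] Gam_Ide[OF u(2)] wu g
      by (simp add: quad_def lift_hor_Nabla[OF u])
    have "span_hor (frac_hor_id C w) u ?j u = ?h" using u wu by (simp add: span_hor_def C_simps)
    then have "quad (frac_hor_id C w) u ?j u = comp_chi (amap (ftr0 \<Gamma>) (u, w))"
      using D.companion_cell_id_right(1)[OF g(1)] Gam_Ide[OF u(2)] g
      by (simp add: quad_def lift_hor_id[OF u(2)] lift_hor_Nabla[OF u])
    then show ?thesis
      using g by (simp add: lift_cell_eq[OF Ph(2) k(2) p(2)] quotient_def one D.D0.A.inv_arr_Ide D.dbl_simps)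
  qed
  then show "comp_chi (map_companion_ftr lift_ftr (Phi_companion C W (u, w))) = comp_chi (amap (ftr0 \<Gamma>) (u, w))"
    by (simp add: L.map_companion_sel Ph(1)) (simp add: lift_ftr_def)
  show "comp_h (map_companion_ftr lift_ftr (Phi_companion C W (u, w))) = comp_h (amap (ftr0 \<Gamma>) (u, w))"
    "comp_v (map_companion_ftr lift_ftr (Phi_companion C W (u, w))) = comp_v (amap (ftr0 \<Gamma>) (u, w))"
    by (simp_all add: L.map_companion_sel Ph(1)) (simp_all add: lift_ftr_def lift_hor_Nabla u lift_vert_Nabla)
qed

text \<open>The friendly functor obtained from the lift has the same \<open>\<Gamma>\<close> as the
  given one. Only the functors on \<open>H_dbl C\<close> have to be compared, by the components of
  \<open>\<gamma>\<close> at identity arrows.\<close>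

lemma comparison_surjective:
  obtains L e where "L \<in> dbl_functors (Frac C W) D" "iso_arr (Hom_hW C W D) e"
    "Dom (Hom_hW C W D) e = friendly_of C W L" "Cod (Hom_hW C W D) e = (G, \<Gamma>, \<gamma>)"
proof -
  let ?N = "V_dbl (Nabla C W)" and ?H = "H_dbl C"
  \<comment> \<open>Restriction makes the lift extensional, as membership in
    \<open>dbl_functors\<close> demands, and keeps its values on the carriers.\<close>
  define L where "L = dblftr_restrict (Frac C W) lift_ftr"
  have L: "L \<in> dbl_functors (Frac C W) D"
    unfolding L_def by (intro dbl_functorsI dblftr_restrict_strict lift_ftr_strict) (simp_all add: dblftr_restrict_def)
  interpret L: strict_double_functor "Frac C W" D L using L by (rule dbl_functorsD)
  have L_apply: "\<And>w. w \<in> W \<Longrightarrow> omap (ftr0 L) w = omap (ftr0 \<Gamma>) w"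
    "\<And>f. f \<in> frac_hors C W \<Longrightarrow> omap (ftr1 L) f = lift_hor f"
    by (simp_all add: L_def dblftr_restrict_def Frac_simps lift_ftr_def lift_vert_omap)
  have Lm: "map_companion_ftr L \<theta> = map_companion_ftr lift_ftr \<theta>" if "is_companion (Frac C W) \<theta>" for \<theta>
    using F.companionD[OF that] by (cases \<theta>) (simp add: map_companion_ftr_def L_def dblftr_restrict_def)
  obtain GJ \<Delta> \<mu> where Q: "friendly_of C W L = (GJ, \<Delta>, \<mu>)" by (metis surj_pair)
  have QF: "(GJ, \<Delta>, \<mu>) \<in> friendly_functors C W D"
    using friendly_of_functor[OF L.strict_double_functor_axioms] by (simp add: Q)
  have GJ: "GJ = dblftr_comp ?H L (J_ftr C W)" and \<Delta>: "\<Delta> = dblftr_comp ?N (Companions_ftr L) (Phi_ftr C W)"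
    and \<mu>: "\<mu> = (\<lambda>w\<in>W. omap (ftr1 L) (varphi C w))"
    using Q by (simp_all add: friendly_of_def)
  have GJs: "strict_double_functor ?H D GJ" by (rule friendly_functorsD(1)[OF QF])
  \<comment> \<open>Equality holds, and not merely isomorphism, because the lift sends each
    companion in the image of \<open>Phi_ftr\<close> to the one prescribed by
    \<open>\<Gamma>\<close>.\<close>
  have "\<Delta> = \<Gamma>"
  proof (rule V_functor_eqI)
    show "\<Delta> \<in> dbl_functors ?N (Companions D)" "\<Gamma> \<in> dbl_functors ?N (Companions D)"
      using QF P by (simp_all add: friendly_functors_iff)
    show "omap (ftr0 \<Delta>) w = omap (ftr0 \<Gamma>) w" if "w \<in> Obj (Nabla C W)" for w
      using that by (simp add: \<Delta> dblftr_comp_apply V_dbl_simps Nabla_simps Phi_ftr_apply)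
        (simp add: Companions_ftr_def L_apply)
    show "amap (ftr0 \<Delta>) f = amap (ftr0 \<Gamma>) f" if f: "f \<in> Arr (Nabla C W)" for f
    proof -
      obtain u w where u: "f = (u, w)" "u \<in> W" "w \<in> W" "Cod C u = Dom C w" using f by (cases f) (auto simp: Nabla_simps)
      then show ?thesis
        using lift_map_companion[OF u(2-4)] Lm[OF Phi_simps(1)[OF u(2-4)]]
        by (simp add: \<Delta> dblftr_comp_apply V_dbl_simps Nabla_simps Phi_ftr_apply) (simp add: Companions_ftr_def)
    qed
  qed
  note Q = Q[unfolded this] and QF = QF[unfolded this]
  define j where "j f = Hor (Ide C (Dom C f)) (Ide C (Cod C f)) f" for f
  have j: "j f \<in> frac_hors C W" "h_from (j f) = Ide C (Dom C f)" "h_to (j f) = Ide C (Cod C f)" "h_arr (j f) = f"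
    if "f \<in> Arr C" for f
    using that by (simp_all add: j_def frac_hors_iff C_simps)
  have GJ0: "omap (ftr0 GJ) x = omap (ftr0 \<Gamma>) (Ide C x)" if "x \<in> Obj C" for x
    using that by (simp add: GJ dblftr_comp_apply H_dbl_simps) (simp add: J_ftr_def Let_def L_apply C_simps)
  have GJ1: "omap (ftr1 GJ) f = lift_hor (j f)" if "f \<in> Arr C" for f
    using that j[OF that] by (simp add: GJ dblftr_comp_apply H_dbl_simps) (simp add: J_ftr_def Let_def L_apply j_def)
  have W: "Ide C x \<in> W" "Dom C (Ide C x) = x" if "x \<in> Obj C" for x using that by (simp_all add: C_simps)
  note gI = gamma[OF W(1)]
  \<comment> \<open>\<open>J\<close> sends \<open>x\<close> to the object \<open>Ide C x\<close>,
    where \<open>\<gamma>\<close> leads from the value of \<open>\<Gamma>\<close> to the value of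
    \<open>G\<close> at \<open>x\<close>. These isomorphisms are the components of the comparison,
    with the inverses as components of \<open>a'\<close>.\<close>
  define a where "a = ftr_restrict (cat0 ?H) \<lparr>omap = \<lambda>x. \<gamma> (Ide C x), amap = \<lambda>x. Ide (cat1 D) (\<gamma> (Ide C x))\<rparr>"
  define a' where "a' = ftr_restrict (cat0 ?H) \<lparr>omap = \<lambda>x. \<delta> (Ide C x), amap = \<lambda>x. Ide (cat1 D) (\<delta> (Ide C x))\<rparr>"
  have a0: "omap a x = \<gamma> (Ide C x)" "omap a' x = \<delta> (Ide C x)" if "x \<in> Obj C" for x
    using that by (simp_all add: a_def a'_def H_dbl_simps)
  have a: "a \<in> htrans ?H D GJ G"
    unfolding a_def
  proof (rule H_htransI[OF category_axioms GJs G.strict_double_functor_axioms])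
    fix f assume f: "f \<in> Arr C"
    show "hcomp D (\<gamma> (Ide C (Cod C f))) (omap (ftr1 GJ) f) = hcomp D (omap (ftr1 G) f) (\<gamma> (Ide C (Dom C f)))"
      using gamma_lift_hor[OF j(1)[OF f]] j[OF f] GJ1[OF f] by simp
  qed (simp_all add: gI GJ0 W)
  have a': "a' \<in> htrans ?H D G GJ"
    unfolding a'_def
  proof (rule H_htransI[OF category_axioms G.strict_double_functor_axioms GJs])
    fix f assume f: "f \<in> Arr C"
    note x = Dom_closed[OF f] Cod_closed[OF f]
    note s = gI[OF x(1)] gI[OF x(2)] G_hor(1-3)[OF f] W(2)[OF x(1)] W(2)[OF x(2)]
    have "hcomp D (omap (ftr1 GJ) f) (\<delta> (Ide C (Dom C f)))
        = hcomp D (hcomp D (\<delta> (Ide C (Cod C f))) (omap (ftr1 G) f)) (hcomp D (\<gamma> (Ide C (Dom C f))) (\<delta> (Ide C (Dom C f))))"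
      using j[OF f] s(1-6,9-14,17-) by (simp add: GJ1[OF f] lift_hor_def D.hcomp_assoc D.dbl_simps)
    then show "hcomp D (\<delta> (Ide C (Cod C f))) (omap (ftr1 G) f) = hcomp D (omap (ftr1 GJ) f) (\<delta> (Ide C (Dom C f)))"
      by (simp add: s D.dbl_simps)
  qed (simp_all add: gI GJ0 W)
  have \<mu>1: "\<mu> w = lift_hor (varphi C w)" if "w \<in> W" for w
    using that varphi_hor[OF that] by (simp add: \<mu> L_apply)
  have vs: "h_from (varphi C w) = w" "h_to (varphi C w) = Ide C (Dom C w)" "h_arr (varphi C w) = Ide C (Dom C w)" for w
    by (simp_all add: varphi_def)
  let ?I = "htrans_id ?N (Companions D) \<Gamma>"
  have I: "?I \<in> htrans ?N (Companions D) \<Gamma> \<Gamma>" by (rule htrans_id_in[OF \<Gamma>.strict_double_functor_axioms])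
  have I0: "omap ?I w = omap (hid D) (omap (ftr0 \<Gamma>) w)" if "w \<in> W" for w
    using that by (simp add: htrans_id_apply V_dbl_simps Nabla_simps Companions_simps)
  have ta: "(a, ?I) \<in> friendly_htrans C W D (GJ, \<Gamma>, \<mu>) (G, \<Gamma>, \<gamma>)"
    unfolding friendly_htrans_iff
  proof (intro conjI ballI a I)
    fix w assume w: "w \<in> W"
    have x: "Dom C w \<in> Obj C" using w by (simp add: C_simps)
    \<comment> \<open>The arrow underlying \<open>varphi C w\<close> is an identity, so the
      characterising equation of the lift at \<open>varphi C w\<close> is the required
      compatibility.\<close>
    show "hcomp D (\<gamma> w) (omap ?I w) = hcomp D (omap a (Dom C w)) (\<mu> w)"
      using gamma_lift_hor[OF varphi_hor[OF w]] gamma[OF w] by (simp add: vs \<mu>1[OF w] I0[OF w] a0[OF x] G_hor(4)[OF x] D.dbl_simps)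
  qed
  have ta': "(a', ?I) \<in> friendly_htrans C W D (G, \<Gamma>, \<gamma>) (GJ, \<Gamma>, \<mu>)"
    unfolding friendly_htrans_iff
  proof (intro conjI ballI a' I)
    fix w assume w: "w \<in> W"
    have x: "Dom C w \<in> Obj C" using w by (simp add: C_simps)
    show "hcomp D (\<mu> w) (omap ?I w) = hcomp D (omap a' (Dom C w)) (\<gamma> w)"
      using gamma[OF w] lift_hor_sides[OF varphi_hor[OF w]]
      by (simp add: vs \<mu>1[OF w] I0[OF w] a0[OF x] D.dbl_simps) (simp add: lift_hor_def vs G_hor(4)[OF x] D.dbl_simps)
  qed
  interpret Hom: category "Hom_hW C W D" by (rule Hom_hW_category)
  have aa: "htrans_comp ?H D a' a = htrans_id ?H D GJ"
    by (rule H_htrans_eqI[OF htrans_comp_in[OF htransD[OF a] htransD[OF a']] htrans_id_in[OF GJs]])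
      (simp add: htrans_comp_apply htrans_id_apply H_dbl_simps a0 gI GJ0)
  have aa': "htrans_comp ?H D a a' = htrans_id ?H D G"
    by (rule H_htrans_eqI[OF htrans_comp_in[OF htransD[OF a'] htransD[OF a]] htrans_id_in[OF G.strict_double_functor_axioms]])
      (simp add: htrans_comp_apply htrans_id_apply H_dbl_simps a0 gI W)
  have II: "htrans_comp ?N (Companions D) ?I ?I = ?I" by (rule htrans_comp_id_left[OF I])
  let ?e = "((GJ, \<Gamma>, \<mu>), (a, ?I), (G, \<Gamma>, \<gamma>))" and ?e' = "((G, \<Gamma>, \<gamma>), (a', ?I), (GJ, \<Gamma>, \<mu>))"
  have "iso_arr (Hom_hW C W D) ?e"
    by (rule Hom.iso_arrI[where g = ?e']) (use P QF ta ta' aa aa' II in \<open>simp_all add: Hom_hW_def\<close>)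
  then show ?thesis
    by (rule that[OF L]) (simp_all add: Hom_hW_def Q)
qed

end

theorem comparison_equivalence: "cat_equivalence (Hom_h (Frac C W) D) (Hom_hW C W D) (comparison C W)"
proof (rule cat_functor.equivalenceI[OF comparison_functor])
  fix f g assume fg: "f \<in> Arr (Hom_h (Frac C W) D)" "g \<in> Arr (Hom_h (Frac C W) D)"
    "Dom (Hom_h (Frac C W) D) f = Dom (Hom_h (Frac C W) D) g" "Cod (Hom_h (Frac C W) D) f = Cod (Hom_h (Frac C W) D) g"
    "amap (comparison C W) f = amap (comparison C W) g"
  then obtain L b b' L' where "f = (L, b, L')" "g = (L, b', L')" "b \<in> htrans (Frac C W) D L L'" "b' \<in> htrans (Frac C W) D L L'"
    by (auto simp: Hom_h_def)
  with fg(5) comparison_faithful show "f = g" by (simp add: comparison_def)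
next
  fix L L' g assume g: "L \<in> Obj (Hom_h (Frac C W) D)" "L' \<in> Obj (Hom_h (Frac C W) D)" "g \<in> Arr (Hom_hW C W D)"
    "Dom (Hom_hW C W D) g = omap (comparison C W) L" "Cod (Hom_hW C W D) g = omap (comparison C W) L'"
  then obtain t where t: "g = (friendly_of C W L, t, friendly_of C W L')"
    and ft: "t \<in> friendly_htrans C W D (friendly_of C W L) (friendly_of C W L')"
    by (auto simp: Hom_hW_def comparison_def)
  have L: "L \<in> dbl_functors (Frac C W) D" "L' \<in> dbl_functors (Frac C W) D" using g by (simp_all add: Hom_h_def)
  obtain b where b: "b \<in> htrans (Frac C W) D L L'" "friendly_htrans_of C W L b L' = t"
    using comparison_full[OF L ft] by blast
  show "\<exists>f\<in>Arr (Hom_h (Frac C W) D). Dom (Hom_h (Frac C W) D) f = L \<and> Cod (Hom_h (Frac C W) D) f = L'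
      \<and> amap (comparison C W) f = g"
    by (rule bexI[of _ "(L, b, L')"]) (use b L t in \<open>simp_all add: Hom_h_def comparison_def\<close>)
next
  fix P assume P: "P \<in> Obj (Hom_hW C W D)"
  obtain G \<Gamma> \<gamma> where e: "P = (G, \<Gamma>, \<gamma>)" by (metis surj_pair)
  have "(G, \<Gamma>, \<gamma>) \<in> friendly_functors C W D" using P by (simp add: Hom_hW_def e)
  then obtain L e' where "L \<in> dbl_functors (Frac C W) D" and e': "iso_arr (Hom_hW C W D) e'"
    "Dom (Hom_hW C W D) e' = friendly_of C W L" "Cod (Hom_hW C W D) e' = (G, \<Gamma>, \<gamma>)"
    by (rule comparison_surjective)
  then have "L \<in> Obj (Hom_h (Frac C W) D)" "Dom (Hom_hW C W D) e' = omap (comparison C W) L"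
    by (simp_all add: Hom_h_def comparison_def)
  with e' show "\<exists>L\<in>Obj (Hom_h (Frac C W) D). \<exists>e. iso_arr (Hom_hW C W D) e
      \<and> Dom (Hom_hW C W D) e = omap (comparison C W) L \<and> Cod (Hom_hW C W D) e = P"
    unfolding e by blast
qed

end

theorem theoremC:
  fixes C :: "('o, 'a) cat" and W :: "'a set" and D :: "('p, 'v, 'h, 'c) dblcat"
  assumes "calculus_of_fractions C W"
    and "two_out_of_three C W"
    and "weakly_globular D"
  shows "cat_equivalence (Hom_h (Frac C W) D) (Hom_hW C W D) (comparison C W)"
proof -
  \<comment> \<open>Invertibility of the vertical arrows is extracted from the equivalence of
    \<open>cat0 D\<close> with the discrete category of its path components.\<close>
  have "iso_arr (cat0 D) v" if "v \<in> Arr (cat0 D)" for v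
  proof (rule equivalence_discrete_iso[OF _ that])
    show "cat_equivalence (cat0 D) (discrete_cat (path_component (cat0 D) ` Obj (cat0 D))) (components_quotient (cat0 D))"
      using assms(3) by (simp add: weakly_globular_def components_cat_def)
  qed
  then interpret fractions_globular C W D
    using assms by (simp add: fractions_globular_def fractions_target_def fractions_def fractions_axioms_def
        fractions_globular_axioms_def weakly_globular_def)
  show ?thesis by (rule comparison_equivalence)
qed

end
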